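(* Let $\Omega\subset\subset\mathbb{C}^{n}$ be a smoothly bounded domain with Bergman projection $B$, and let $T$ be a smooth vector field on $\overline{\Omega}$ that is tangential and complex transversal at the boundary $b\Omega$. Assume that Condition R holds for $\Omega$, i.e. $B(C^\infty(\overline\Omega))\subseteq C^\infty(\overline\Omega)$. Then $B$ maps $H^\infty_T(\Omega):=\bigcap_{k=0}^\infty H^k_T(\Omega)$ continuously to $C^\infty(\overline\Omega)$.
   Context: $\mathbb{N}=\{1,2,\dots\}$. $\Omega\subset\subset\mathbb{C}^n$ is a bounded domain with smooth boundary $b\Omega$. $\|\cdot\|$ is the $L^2(\Omega)$ norm with respect to Lebesgue measure. The Bergman projection $B$ is the orthogonal projection of $L^2(\Omega)$ onto its closed subspace $A^0(\Omega)$ of square-integrable holomorphic functions. $C^\infty(\overline\Omega)$ is the Fréchet space of functions smooth up to the boundary. A smooth vector field $T$ on $\overline\Omega$ has complex-valued coefficients in $C^\infty(\overline\Omega)$. It is tangential if at every point of $b\Omega$ it lies in the complexified tangent space $T(b\Omega)\otimes\mathbb{C}$. A tangential $T$ is complex transversal if at every point of $b\Omega$ it does not lie in $T^{1,0}(b\Omega)\oplus T^{0,1}(b\Omega)$. For $k\in\mathbb{N}$, $H^k_T(\Omega)=\{f\in L^2(\Omega): T^jf\in L^2(\Omega),\ j=1,\dots,k\}$, where $T^jf$ ($T$ applied $j$ times) is taken in the sense of distributions, with norm $\|f\|_{k,T}^2=\sum_{j=0}^k\|T^jf\|^2$; $H^0_T(\Omega)=L^2(\Omega)$. $H_T^\infty(\Omega)$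 carries the Fréchet topology induced by the family of norms $\|\cdot\|_{k,T}$, $k\in\mathbb{N}$. *)

theory Defs
  imports "HOL-Analysis.Analysis"
begin

section \<open>Smooth functions\<close>

primrec iter_partial :: "'a::euclidean_space list \<Rightarrow> ('a \<Rightarrow> 'b::real_normed_vector) \<Rightarrow> 'a \<Rightarrow> 'b" where
  "iter_partial [] f = f"
| "iter_partial (b # bs) f = (\<lambda>x. frechet_derivative (iter_partial bs f) (at x) b)"

text \<open>Since all iterated partial derivatives are required to be differentiable, they are
  all continuous.\<close>

definition smooth_on :: "'a::euclidean_space set \<Rightarrow> ('a \<Rightarrow> 'b::real_normed_vector) \<Rightarrow> bool" where
  "smooth_on S f \<longleftrightarrow> open S \<and>
     (\<forall>bs\<in>lists Basis. \<forall>x\<in>S. iter_partial bs f differentiable (at x))"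

text \<open>\<open>C\<^sup>\<infinity>\<close> up to the boundary: all derivatives on \<open>\<Omega>\<close> extend continuously to the closure.
  Membership depends only on the values on \<open>\<Omega>\<close>; the values at boundary points are
  those of the continuous extension.\<close>

definition smooth_closure :: "'a::euclidean_space set \<Rightarrow> ('a \<Rightarrow> complex) set" where
  "smooth_closure \<Omega> = {f. smooth_on \<Omega> f \<and>
     (\<forall>bs\<in>lists Basis. \<exists>g. continuous_on (closure \<Omega>) g \<and> (\<forall>x\<in>\<Omega>. g x = iter_partial bs f x))}"

definition test_functions :: "'a::euclidean_space set \<Rightarrow> ('a \<Rightarrow> complex) set" where
  "test_functions \<Omega> = {\<phi>. smooth_on UNIV \<phi> \<and>
     compact (closure {x. \<phi> x \<noteq> 0}) \<and> closure {x. \<phi> x \<noteq> 0} \<subseteq> \<Omega>}"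

section \<open>Topologies given by families of seminorms\<close>

text \<open>Functions at distance 0 for all seminorms (equal on \<open>\<Omega>\<close>, or equal almost everywhere) are
  not identified, so these topologies need not be Hausdorff; the open sets are exactly the
  preimages of the open sets of the quotient.\<close>

definition seminorm_topology ::
    "('a \<Rightarrow> complex) set \<Rightarrow> (('a \<Rightarrow> complex) \<Rightarrow> real) set \<Rightarrow> ('a \<Rightarrow> complex) topology" where
  "seminorm_topology V P = topology_generated_by
     {{g \<in> V. p (\<lambda>x. g x - f x) < e} | p f e. p \<in> P \<and> f \<in> V \<and> e > 0}"

definition smooth_closure_topology :: "'a::euclidean_space set \<Rightarrow> ('a \<Rightarrow> complex) topology" where
  "smooth_closure_topology \<Omega> = seminorm_topology (smooth_closure \<Omega>)
     {(\<lambda>f. SUP x\<in>\<Omega>. norm (iter_partial bs f x)) | bs. bs \<in> lists Basis}"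

section \<open>Square-integrable functions and the Bergman projection\<close>

definition L2 :: "'a::euclidean_space set \<Rightarrow> ('a \<Rightarrow> complex) set" where
  "L2 \<Omega> = {f. f \<in> borel_measurable (lebesgue_on \<Omega>) \<and>
     integrable (lebesgue_on \<Omega>) (\<lambda>x. (norm (f x))\<^sup>2)}"

definition L2_inner :: "'a::euclidean_space set \<Rightarrow> ('a \<Rightarrow> complex) \<Rightarrow> ('a \<Rightarrow> complex) \<Rightarrow> complex" where
  "L2_inner \<Omega> f g = (LINT x|lebesgue_on \<Omega>. f x * cnj (g x))"

definition L2_norm :: "'a::euclidean_space set \<Rightarrow> ('a \<Rightarrow> complex) \<Rightarrow> real" where
  "L2_norm \<Omega> f = sqrt (LINT x|lebesgue_on \<Omega>. (norm (f x))\<^sup>2)"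

definition holomorphic_several :: "(complex^'n) set \<Rightarrow> (complex^'n \<Rightarrow> complex) \<Rightarrow> bool" where
  "holomorphic_several \<Omega> f \<longleftrightarrow>
     (\<forall>z\<in>\<Omega>. \<exists>D. (f has_derivative D) (at z) \<and> (\<forall>c v. D (c *s v) = c * D v))"

definition bergman_space :: "(complex^'n) set \<Rightarrow> (complex^'n \<Rightarrow> complex) set" where
  "bergman_space \<Omega> = {f \<in> L2 \<Omega>. holomorphic_several \<Omega> f}"

text \<open>The projection is taken to be the holomorphic representative of its class in \<open>L\<^sup>2(\<Omega>)\<close>,
  continued by 0 outside \<open>\<Omega>\<close>; this determines it as a function.\<close>

definition bergman_projection ::
    "(complex^'n) set \<Rightarrow> (complex^'n \<Rightarrow> complex) \<Rightarrow> complex^'n \<Rightarrow> complex" where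
  "bergman_projection \<Omega> f = (THE g. g \<in> bergman_space \<Omega> \<and> (\<forall>z. z \<notin> \<Omega> \<longrightarrow> g z = 0) \<and>
     (\<forall>h\<in>bergman_space \<Omega>. L2_inner \<Omega> (\<lambda>z. f z - g z) h = 0))"

definition condition_R :: "(complex^'n) set \<Rightarrow> bool" where
  "condition_R \<Omega> \<longleftrightarrow> bergman_projection \<Omega> ` smooth_closure \<Omega> \<subseteq> smooth_closure \<Omega>"

section \<open>Smoothly bounded domains and tangent spaces of the boundary\<close>

definition defining_function :: "'a::euclidean_space set \<Rightarrow> ('a \<Rightarrow> real) \<Rightarrow> bool" where
  "defining_function \<Omega> \<rho> \<longleftrightarrow> (\<exists>U. open U \<and> frontier \<Omega> \<subseteq> U \<and> smooth_on U \<rho> \<and>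
     \<Omega> \<inter> U = {x \<in> U. \<rho> x < 0} \<and>
     (\<forall>x\<in>frontier \<Omega>. frechet_derivative \<rho> (at x) \<noteq> (\<lambda>v. 0)))"

definition smoothly_bounded_domain :: "'a::euclidean_space set \<Rightarrow> bool" where
  "smoothly_bounded_domain \<Omega> \<longleftrightarrow> open \<Omega> \<and> connected \<Omega> \<and> \<Omega> \<noteq> {} \<and> bounded \<Omega> \<and>
     (\<exists>\<rho>. defining_function \<Omega> \<rho>)"

text \<open>All defining functions have the same kernel at a boundary point.\<close>

definition boundary_tangent :: "'a::euclidean_space set \<Rightarrow> 'a \<Rightarrow> 'a set" where
  "boundary_tangent \<Omega> p = {v. \<forall>\<rho>. defining_function \<Omega> \<rho> \<longrightarrow> frechet_derivative \<rho> (at p) v = 0}"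

text \<open>An element \<open>X + \<i>Y\<close> of a complexified tangent space is encoded as the pair \<open>(X, Y)\<close> of real
  tangent vectors. Vectors of type \<open>(1,0)\<close> and \<open>(0,1)\<close> are those on which the complex structure
  \<open>J v = \<i> *s v\<close>, extended complex linearly, acts as multiplication by \<open>\<i>\<close> and \<open>-\<i>\<close>.\<close>

definition complex_tangent :: "'a::euclidean_space set \<Rightarrow> 'a \<Rightarrow> ('a \<times> 'a) set" where
  "complex_tangent \<Omega> p = boundary_tangent \<Omega> p \<times> boundary_tangent \<Omega> p"

definition tangent10 :: "(complex^'n) set \<Rightarrow> complex^'n \<Rightarrow> ((complex^'n) \<times> (complex^'n)) set" where
  "tangent10 \<Omega> p = {(X, Y) \<in> complex_tangent \<Omega> p. \<i> *s X = - Y \<and> \<i> *s Y = X}"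

definition tangent01 :: "(complex^'n) set \<Rightarrow> complex^'n \<Rightarrow> ((complex^'n) \<times> (complex^'n)) set" where
  "tangent01 \<Omega> p = {(X, Y) \<in> complex_tangent \<Omega> p. \<i> *s X = Y \<and> \<i> *s Y = - X}"

section \<open>Vector fields\<close>

definition vf_coeff :: "('a::euclidean_space \<Rightarrow> 'a \<times> 'a) \<Rightarrow> 'a \<Rightarrow> 'a \<Rightarrow> complex" where
  "vf_coeff T b x = Complex (fst (T x) \<bullet> b) (snd (T x) \<bullet> b)"

definition smooth_vector_field :: "'a::euclidean_space set \<Rightarrow> ('a \<Rightarrow> 'a \<times> 'a) \<Rightarrow> bool" where
  "smooth_vector_field \<Omega> T \<longleftrightarrow>
     (\<forall>b\<in>Basis. vf_coeff T b \<in> smooth_closure \<Omega> \<and> continuous_on (closure \<Omega>) (vf_coeff T b))"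

definition tangential :: "'a::euclidean_space set \<Rightarrow> ('a \<Rightarrow> 'a \<times> 'a) \<Rightarrow> bool" where
  "tangential \<Omega> T \<longleftrightarrow> (\<forall>p\<in>frontier \<Omega>. T p \<in> complex_tangent \<Omega> p)"

definition complex_transversal ::
    "(complex^'n) set \<Rightarrow> (complex^'n \<Rightarrow> (complex^'n) \<times> (complex^'n)) \<Rightarrow> bool" where
  "complex_transversal \<Omega> T \<longleftrightarrow>
     (\<forall>p\<in>frontier \<Omega>. T p \<notin> {u + v | u v. u \<in> tangent10 \<Omega> p \<and> v \<in> tangent01 \<Omega> p})"

section \<open>Sobolev spaces in the direction of a vector field\<close>

text \<open>With \<open>T = \<Sum>\<^sub>b t\<^sub>b \<partial>\<^sub>b\<close>, the formal transpose is \<open>\<phi> \<mapsto> - \<Sum>\<^sub>b \<partial>\<^sub>b (t\<^sub>b \<phi>)\<close>.\<close>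

definition vf_transpose ::
    "('a::euclidean_space \<Rightarrow> 'a \<times> 'a) \<Rightarrow> ('a \<Rightarrow> complex) \<Rightarrow> 'a \<Rightarrow> complex" where
  "vf_transpose T \<phi> x =
     - (\<Sum>b\<in>Basis. frechet_derivative (\<lambda>y. vf_coeff T b y * \<phi> y) (at x) b)"

text \<open>\<open>T\<^sup>j f = g\<close> as distributions on \<open>\<Omega>\<close>.\<close>

definition dist_power ::
    "'a::euclidean_space set \<Rightarrow> ('a \<Rightarrow> 'a \<times> 'a) \<Rightarrow> nat \<Rightarrow> ('a \<Rightarrow> complex) \<Rightarrow> ('a \<Rightarrow> complex) \<Rightarrow> bool" where
  "dist_power \<Omega> T j f g \<longleftrightarrow> (\<forall>\<phi>\<in>test_functions \<Omega>.
     (LINT x|lebesgue_on \<Omega>. g x * \<phi> x) = (LINT x|lebesgue_on \<Omega>. f x * (vf_transpose T ^^ j) \<phi> x))"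

definition H_T :: "'a::euclidean_space set \<Rightarrow> ('a \<Rightarrow> 'a \<times> 'a) \<Rightarrow> nat \<Rightarrow> ('a \<Rightarrow> complex) set" where
  "H_T \<Omega> T k = {f \<in> L2 \<Omega>. \<forall>j\<in>{1..k}. \<exists>g\<in>L2 \<Omega>. dist_power \<Omega> T j f g}"

text \<open>An arbitrary \<open>L\<^sup>2\<close> representative of the distribution \<open>T\<^sup>j f\<close>; it is unique up to null sets.\<close>

definition T_power ::
    "'a::euclidean_space set \<Rightarrow> ('a \<Rightarrow> 'a \<times> 'a) \<Rightarrow> nat \<Rightarrow> ('a \<Rightarrow> complex) \<Rightarrow> 'a \<Rightarrow> complex" where
  "T_power \<Omega> T j f = (SOME g. g \<in> L2 \<Omega> \<and> dist_power \<Omega> T j f g)"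

definition H_T_norm ::
    "'a::euclidean_space set \<Rightarrow> ('a \<Rightarrow> 'a \<times> 'a) \<Rightarrow> nat \<Rightarrow> ('a \<Rightarrow> complex) \<Rightarrow> real" where
  "H_T_norm \<Omega> T k f = sqrt (\<Sum>j=0..k. (L2_norm \<Omega> (T_power \<Omega> T j f))\<^sup>2)"

definition H_T_infty :: "'a::euclidean_space set \<Rightarrow> ('a \<Rightarrow> 'a \<times> 'a) \<Rightarrow> ('a \<Rightarrow> complex) set" where
  "H_T_infty \<Omega> T = (\<Inter>k. H_T \<Omega> T k)"

definition H_T_infty_topology ::
    "'a::euclidean_space set \<Rightarrow> ('a \<Rightarrow> 'a \<times> 'a) \<Rightarrow> ('a \<Rightarrow> complex) topology" where
  "H_T_infty_topology \<Omega> T = seminorm_topology (H_T_infty \<Omega> T) {H_T_norm \<Omega> T k | k. k \<ge> 1}"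

end

theory Submission
  imports Defs "HOL-Complex_Analysis.Complex_Analysis"
begin

text \<open>Let \<open>B\<close> be the Bergman projection. The proof rests on an estimate: for every list \<open>bs\<close> of directions there are \<open>C\<close> and
  \<open>k\<close> such that the derivative of \<open>B f\<close> along \<open>bs\<close> is bounded on \<open>\<Omega>\<close> by \<open>C\<close> times the norm of \<open>f\<close> in \<open>H\<^sup>k\<^sub>T\<close>. Bounded derivatives
  extend continuously to the closure of a smoothly bounded domain, so \<open>B f\<close> is smooth up to the boundary; and since \<open>B\<close> is
  linear, the estimates are its continuity.

  A holomorphic function is its own mean with respect to radial weights. So a derivative at \<open>w\<close> is the pairing with a test
  function \<open>k\<^sub>w\<close> supported near \<open>w\<close>, and, \<open>B\<close> being self-adjoint, the derivative of \<open>B f\<close> at \<open>w\<close> is the pairing of \<open>f\<close> with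
  the holomorphic function \<open>H\<^sub>w = B k\<^sub>w\<close> (\<open>bergman_projection_evaluation\<close>). What is needed is a bound on \<open>\<integral> f cnj H\<^sub>w\<close> that is
  uniform in \<open>w\<close>. Two things are true of the \<open>H\<^sub>w\<close>.

  Firstly, Condition R implies that \<open>\<bar>H\<^sub>w(z)\<bar> \<le> A / dist(z, b\<Omega>)\<^sup>m\<close> with \<open>A\<close> and \<open>m\<close> independent of \<open>w\<close>
  (\<open>projected_kernel_growth\<close>). If the projections of bumps of radius \<open>r\<close> were not bounded, with their derivatives, by a
  power of \<open>1/r\<close>, then a suitable series of bumps would be a smooth function whose projection has an unbounded derivative.

  Secondly, pairing with the conjugate of a holomorphic function \<open>H\<close> of growth \<open>m\<close> costs only \<open>m + 1\<close> derivatives in the direction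
  \<open>T\<close> (\<open>local_pairing_estimate\<close>). Near a boundary point, complex transversality provides a constant \<open>c\<close> for which \<open>c T\<close>, on
  conjugates of holomorphic functions, is to first order differentiation in a direction pointing into \<open>\<Omega>\<close>. If \<open>c T\<close> had a flow, one
  would move \<open>cnj H\<close> along it into the domain for a time \<open>t\<close>, where it is of size \<open>t\<^sup>-\<^sup>m\<close>. Taylor polynomials of the formal
  flow serve the same purpose: there are a map \<open>V\<close> with \<open>V(t, x)\<close> in \<open>\<Omega>\<close> at distance at least \<open>\<kappa> t\<close> from the boundary, and a
  weight \<open>w\<close>, such that \<open>F = w \<cdot> cnj (H \<circ> V)\<close> starts at \<open>cnj H\<close>, times a cutoff, and solves \<open>\<partial>\<^sub>t F = -c P F\<close> up to a
  bounded error, \<open>P\<close> being the transpose of \<open>T\<close>. Tangency of \<open>T\<close> allows to integrate by parts without boundary terms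
  (\<open>tangential_integration_by_parts\<close>), so the integrals \<open>I\<^sub>j(t) = \<integral> (T\<^sup>j f) F(t, \<cdot>)\<close> satisfy \<open>I\<^sub>j' = -c I\<^sub>j\<^sub>+\<^sub>1 + O(1)\<close>.
  As \<open>I\<^sub>j = O(t\<^sup>-\<^sup>m)\<close> for \<open>j \<le> m + 1\<close>, integrating this chain of relations \<open>m + 1\<close> times bounds \<open>I\<^sub>0\<close> up to \<open>t = 0\<close>
  (\<open>chain_of_relations_bound\<close>). Bumps that cut out pieces near boundary points make the estimate global
  (\<open>pairing_bounded_one\<close>).\<close>

section \<open>Calculus of functions with finitely many derivatives\<close>

text \<open>Differentiability of order \<open>n\<close>, where \<open>B\<close> asks in addition that the derivatives of order at most \<open>n\<close> be bounded on
  \<open>S\<close>. Recursion on the order instead of quantification over lists of directions makes every closure property a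
  plain induction. The flag serves to treat smooth functions and functions smooth up to the boundary at the same time.\<close>

primrec ksmooth :: "bool \<Rightarrow> 'a::euclidean_space set \<Rightarrow> nat \<Rightarrow> ('a \<Rightarrow> 'b::real_normed_vector) \<Rightarrow> bool" where
  "ksmooth B S 0 f \<longleftrightarrow> (B \<longrightarrow> bounded (f ` S))"
| "ksmooth B S (Suc n) f \<longleftrightarrow> (B \<longrightarrow> bounded (f ` S)) \<and> (\<forall>x\<in>S. f differentiable at x) \<and>
     (\<forall>b\<in>Basis. ksmooth B S n (\<lambda>x. frechet_derivative f (at x) b))"

lemma ksmooth_bounded: "ksmooth True S n f \<Longrightarrow> bounded (f ` S)"
  by (cases n) auto

lemma ksmooth_Suc_imp: "ksmooth B S (Suc n) f \<Longrightarrow> ksmooth B S n f"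
  by (induction n arbitrary: f) auto

lemma ksmooth_unbounded: "ksmooth B S n f \<Longrightarrow> ksmooth False S n f"
  by (induction n arbitrary: f) auto

lemma ksmooth_subset: "ksmooth B S n f \<Longrightarrow> S' \<subseteq> S \<Longrightarrow> ksmooth B S' n f"
  by (induction n arbitrary: f) (auto intro: bounded_subset image_mono)

lemma frechet_derivative_eqI: "(f has_derivative D) (at x) \<Longrightarrow> frechet_derivative f (at x) = D"
  using frechet_derivative_at by metis

lemma differentiable_cong_open:
  assumes "open S" "x \<in> S" "\<And>y. y \<in> S \<Longrightarrow> f y = g y"
  shows "f differentiable at x \<longleftrightarrow> g differentiable at x"
  unfolding differentiable_def
  using has_derivative_transform_within_open[OF _ assms(1,2)] assms(3) by metis

lemma frechet_derivative_cong_open: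
  assumes "open S" "x \<in> S" "\<And>y. y \<in> S \<Longrightarrow> f y = g y"
  shows "frechet_derivative f (at x) = frechet_derivative g (at x)"
proof -
  have "(f has_derivative D) (at x) \<longleftrightarrow> (g has_derivative D) (at x)" for D
    using has_derivative_transform_within_open[OF _ assms(1,2)] assms(3) by metis
  then show ?thesis unfolding frechet_derivative_def by simp
qed

lemma ksmooth_cong:
  assumes "open S" "\<And>y. y \<in> S \<Longrightarrow> f y = g y"
  shows "ksmooth B S n f \<longleftrightarrow> ksmooth B S n g"
  using assms(2)
proof (induction n arbitrary: f g)
  case 0
  then have "f ` S = g ` S" by auto
  then show ?case by simp
next
  case (Suc n)
  have 1: "f ` S = g ` S" using Suc.prems by auto
  have 2: "ksmooth B S n (\<lambda>x. frechet_derivative f (at x) b) \<longleftrightarrow> ksmooth B S n (\<lambda>x. frechet_derivative g (at x) b)" for b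
    by (rule Suc.IH) (use frechet_derivative_cong_open[OF assms(1) _ Suc.prems] in auto)
  show ?case using 1 2 differentiable_cong_open[OF assms(1) _ Suc.prems] by auto
qed

lemma ksmooth_local:
  assumes "open S" "\<And>x. x \<in> S \<Longrightarrow> \<exists>U. open U \<and> x \<in> U \<and> ksmooth False U n f"
  shows "ksmooth False S n f"
  using assms(2)
proof (induction n arbitrary: f)
  case (Suc n)
  show ?case
  proof (simp, intro conjI ballI)
    fix x assume "x \<in> S" then show "f differentiable at x" using Suc.prems by fastforce
  next
    fix b :: 'a assume b: "b \<in> Basis"
    show "ksmooth False S n (\<lambda>x. frechet_derivative f (at x) b)"
      by (rule Suc.IH) (use Suc.prems b in fastforce)
  qed
qed simp

lemma ksmooth_const: "ksmooth B S n (\<lambda>x. c)"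
  by (induction n arbitrary: c) (auto simp: image_constant_conv)

lemma ksmooth_linear:
  assumes "bounded_linear L" "open S" "B \<longrightarrow> bounded S"
  shows "ksmooth B S n L"
proof -
  have d: "(L has_derivative L) (at x)" for x using assms(1) bounded_linear_imp_has_derivative by blast
  have b: "B \<longrightarrow> bounded (L ` S)" using assms bounded_linear_image by blast
  show ?thesis
    using b by (cases n) (auto simp: frechet_derivative_eqI[OF d] ksmooth_const intro: differentiableI[OF d])
qed

lemma ksmooth_compose_linear:
  assumes "bounded_linear L" "open S" "ksmooth B S n f"
  shows "ksmooth B S n (\<lambda>x. L (f x))"
  using assms(3)
proof (induction n arbitrary: f)
  case 0 then show ?case using bounded_linear_image[OF _ assms(1)] by (auto simp: image_image[symmetric])
next
  case (Suc n)
  have D: "((\<lambda>x. L (f x)) has_derivative (\<lambda>v. L (frechet_derivative f (at x) v))) (at x)" if "x \<in> S" for x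
    using Suc.prems that by (intro bounded_linear.has_derivative[OF assms(1)]) (auto simp: frechet_derivative_works)
  have "ksmooth B S n (\<lambda>x. frechet_derivative (\<lambda>x. L (f x)) (at x) b)" if "b \<in> Basis" for b
    using Suc.IH[of "\<lambda>x. frechet_derivative f (at x) b"] Suc.prems that
    by (subst ksmooth_cong[OF assms(2), where g="\<lambda>x. L (frechet_derivative f (at x) b)"])
       (auto simp: frechet_derivative_eqI[OF D])
  moreover have "B \<longrightarrow> bounded ((\<lambda>x. L (f x)) ` S)"
    using Suc.prems bounded_linear_image[OF _ assms(1)] by (auto simp: image_image[symmetric])
  ultimately show ?case using differentiableI[OF D] by auto
qed

lemma ksmooth_add:
  assumes "open S" "ksmooth B S n f" "ksmooth B S n g"
  shows "ksmooth B S n (\<lambda>x. f x + g x)"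
  using assms(2,3)
proof (induction n arbitrary: f g)
  case 0 then show ?case by (auto intro: bounded_plus_comp)
next
  case (Suc n)
  have D: "((\<lambda>x. f x + g x) has_derivative (\<lambda>v. frechet_derivative f (at x) v + frechet_derivative g (at x) v)) (at x)" if "x \<in> S" for x
    using Suc.prems that by (intro has_derivative_add) (auto simp: frechet_derivative_works)
  have "ksmooth B S n (\<lambda>x. frechet_derivative (\<lambda>x. f x + g x) (at x) b)" if "b \<in> Basis" for b
    using Suc.IH[of "\<lambda>x. frechet_derivative f (at x) b" "\<lambda>x. frechet_derivative g (at x) b"] Suc.prems that
    by (subst ksmooth_cong[OF assms(1), where g="\<lambda>x. frechet_derivative f (at x) b + frechet_derivative g (at x) b"])
       (auto simp: frechet_derivative_eqI[OF D])
  then show ?case using differentiableI[OF D] Suc.prems by (auto intro: bounded_plus_comp)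
qed

lemma ksmooth_sum:
  assumes "open S" "\<And>i. i \<in> I \<Longrightarrow> ksmooth B S n (f i)"
  shows "ksmooth B S n (\<lambda>x. \<Sum>i\<in>I. f i x)"
  using assms(2)
  by (induction I rule: infinite_finite_induct) (auto simp: ksmooth_const intro: ksmooth_add assms(1))

lemma ksmooth_minus:
  "open S \<Longrightarrow> ksmooth B S n f \<Longrightarrow> ksmooth B S n (\<lambda>x. - f x)"
  by (rule ksmooth_compose_linear[OF bounded_linear_minus[OF bounded_linear_ident]])

lemma ksmooth_diff:
  "open S \<Longrightarrow> ksmooth B S n f \<Longrightarrow> ksmooth B S n g \<Longrightarrow> ksmooth B S n (\<lambda>x. f x - g x)"
  using ksmooth_add[OF _ _ ksmooth_minus] by fastforce

lemma ksmooth_bilinear: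
  assumes P: "bounded_bilinear P" and "open S" "ksmooth B S n f" "ksmooth B S n g"
  shows "ksmooth B S n (\<lambda>x. P (f x) (g x))"
  using assms(3,4)
proof -
  have bd: "B \<longrightarrow> bounded ((\<lambda>x. P (f x) (g x)) ` S)"
    if f: "B \<longrightarrow> bounded (f ` S)" and g: "B \<longrightarrow> bounded (g ` S)" for f g
  proof
    assume B
    obtain K where K: "\<And>a b. norm (P a b) \<le> norm a * norm b * K" "K > 0"
      using bounded_bilinear.pos_bounded[OF P] by blast
    obtain c d where "\<And>x. x \<in> S \<Longrightarrow> norm (f x) \<le> c" "\<And>x. x \<in> S \<Longrightarrow> norm (g x) \<le> d" "c > 0" "d > 0"
      using f g \<open>B\<close> unfolding bounded_pos by auto
    then have "norm (P (f x) (g x)) \<le> c * d * K" if "x \<in> S" for x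
      using K that by (meson mult_mono mult_right_mono norm_ge_zero order_trans less_imp_le)
    then show "bounded ((\<lambda>x. P (f x) (g x)) ` S)" unfolding bounded_iff by auto
  qed
  from assms(3,4) show ?thesis
  proof (induction n arbitrary: f g)
    case 0 then show ?case using bd by auto
  next
    case (Suc n)
    let ?D = "\<lambda>f b x. frechet_derivative f (at x) b"
    have D: "((\<lambda>x. P (f x) (g x)) has_derivative (\<lambda>v. P (f x) (?D g v x) + P (?D f v x) (g x))) (at x)" if "x \<in> S" for x
      using Suc.prems that by (intro bounded_bilinear.FDERIV[OF P]) (auto simp: frechet_derivative_works)
    have "ksmooth B S n (\<lambda>x. frechet_derivative (\<lambda>x. P (f x) (g x)) (at x) b)" if b: "b \<in> Basis" for b
    proof -
      have "ksmooth B S n (\<lambda>x. P (f x) (?D g b x) + P (?D f b x) (g x))"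
        by (intro ksmooth_add assms(2) Suc.IH) (use Suc.prems b in \<open>simp_all add: ksmooth_Suc_imp\<close>)
      then show ?thesis
        by (subst ksmooth_cong[OF assms(2), where g="\<lambda>x. P (f x) (?D g b x) + P (?D f b x) (g x)"])
         (auto simp: frechet_derivative_eqI[OF D])
    qed
    then show ?case using differentiableI[OF D] Suc.prems bd[of f g] by auto
  qed
qed

lemmas ksmooth_mult = ksmooth_bilinear[OF bounded_bilinear_mult]
lemmas ksmooth_scaleR = ksmooth_bilinear[OF bounded_bilinear_scaleR]

text \<open>By the chain rule the partial derivatives of \<open>h \<circ> \<Phi>\<close> are sums of products of derivatives of \<open>\<Phi>\<close> with compositions of
  derivatives of \<open>h\<close>, to which the induction hypothesis applies.\<close>

lemma ksmooth_compose:
  fixes h :: "'c::euclidean_space \<Rightarrow> 'b::real_normed_vector" and \<Phi> :: "'a::euclidean_space \<Rightarrow> 'c"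
  assumes S: "open S" "open S'" "\<Phi> ` S \<subseteq> S'" and "ksmooth B S n \<Phi>" "ksmooth B S' n h"
  shows "ksmooth B S n (\<lambda>x. h (\<Phi> x))"
  using assms(4,5)
proof (induction n arbitrary: h)
  case 0
  have "(\<lambda>x. h (\<Phi> x)) ` S \<subseteq> h ` S'" using S(3) by auto
  then show ?case using 0 bounded_subset by auto
next
  case (Suc n)
  let ?D = "\<lambda>f b x. frechet_derivative f (at x) b"
  have D: "((\<lambda>x. h (\<Phi> x)) has_derivative (\<lambda>v. ?D h (?D \<Phi> v x) (\<Phi> x))) (at x)" if "x \<in> S" for x
  proof -
    have "(\<Phi> has_derivative (\<lambda>v. ?D \<Phi> v x)) (at x)" "(h has_derivative (\<lambda>v. ?D h v (\<Phi> x))) (at (\<Phi> x))"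
      using Suc.prems that S(3) by (auto simp: frechet_derivative_works image_subset_iff)
    then show ?thesis by (rule has_derivative_compose)
  qed
  have eq: "?D (\<lambda>x. h (\<Phi> x)) b x = (\<Sum>i\<in>Basis. (?D \<Phi> b x \<bullet> i) *\<^sub>R ?D h i (\<Phi> x))" if "x \<in> S" for x b
  proof -
    have "linear (frechet_derivative h (at (\<Phi> x)))"
      using Suc.prems that S(3) by (intro linear_frechet_derivative) (simp add: image_subset_iff)
    then have "?D h (\<Sum>i\<in>Basis. (?D \<Phi> b x \<bullet> i) *\<^sub>R i) (\<Phi> x) = (\<Sum>i\<in>Basis. (?D \<Phi> b x \<bullet> i) *\<^sub>R ?D h i (\<Phi> x))"
      by (simp add: linear_sum linear_cmul)
    then show ?thesis using frechet_derivative_eqI[OF D[OF that]] by (simp add: euclidean_representation)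
  qed
  have "ksmooth B S n (\<lambda>x. ?D (\<lambda>x. h (\<Phi> x)) b x)" if b: "b \<in> Basis" for b
  proof -
    have "ksmooth B S n (\<lambda>x. (?D \<Phi> b x \<bullet> i) *\<^sub>R ?D h i (\<Phi> x))" if i: "i \<in> Basis" for i
    proof (rule ksmooth_scaleR[OF S(1)])
      show "ksmooth B S n (\<lambda>x. ?D \<Phi> b x \<bullet> i)"
        using Suc.prems b by (intro ksmooth_compose_linear[OF bounded_linear_inner_left S(1)]) auto
      show "ksmooth B S n (\<lambda>x. ?D h i (\<Phi> x))"
        using Suc.prems i by (intro Suc.IH) (simp_all add: ksmooth_Suc_imp)
    qed
    then show ?thesis
      by (subst ksmooth_cong[OF S(1) eq]) (auto intro: ksmooth_sum S(1))
  qed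
  moreover have "B \<longrightarrow> bounded ((\<lambda>x. h (\<Phi> x)) ` S)" 
  proof -
    have "(\<lambda>x. h (\<Phi> x)) ` S \<subseteq> h ` S'" using S(3) by auto
    then show ?thesis using Suc.prems bounded_subset by auto
  qed
  ultimately show ?case using differentiableI[OF D] by auto
qed

lemma ksmooth_inverse:
  fixes f :: "'a::euclidean_space \<Rightarrow> real"
  assumes "open S" "\<And>x. x \<in> S \<Longrightarrow> f x \<noteq> 0" "ksmooth False S n f"
  shows "ksmooth False S n (\<lambda>x. inverse (f x))"
  using assms(3)
proof (induction n)
  case (Suc n)
  let ?D = "\<lambda>f b x. frechet_derivative f (at x) b"
  have D: "((\<lambda>x. inverse (f x)) has_derivative (\<lambda>v. - (inverse (f x) * ?D f v x * inverse (f x)))) (at x)" if "x \<in> S" for x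
    using Suc.prems that assms(2) by (intro Deriv.has_derivative_inverse) (auto simp: frechet_derivative_works)
  have "ksmooth False S n (?D (\<lambda>x. inverse (f x)) b)" if b: "b \<in> Basis" for b
  proof -
    have "ksmooth False S n (\<lambda>x. - (inverse (f x) * ?D f b x * inverse (f x)))"
      by (intro ksmooth_minus ksmooth_mult assms(1) Suc.IH) (use Suc.prems b in \<open>simp_all add: ksmooth_Suc_imp\<close>)
    then show ?thesis
      by (subst ksmooth_cong[OF assms(1), where g="\<lambda>x. - (inverse (f x) * ?D f b x * inverse (f x))"])
       (auto simp: frechet_derivative_eqI[OF D])
  qed
  then show ?case using differentiableI[OF D] by auto
qed simp

text \<open>The recursive definition takes off derivatives from the other end of the list than \<open>iter_partial\<close>, hence the induction
  with \<open>rev_cases\<close>.\<close>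

lemma ksmooth_iter_partial:
  "ksmooth B S n f \<longleftrightarrow> (\<forall>bs\<in>lists Basis. length bs \<le> n \<longrightarrow> (B \<longrightarrow> bounded (iter_partial bs f ` S)) \<and>
     (length bs < n \<longrightarrow> (\<forall>x\<in>S. iter_partial bs f differentiable at x)))"
proof (induction n arbitrary: f)
  case 0 then show ?case by auto
next
  case (Suc n)
  have ip: "iter_partial (bs @ [b]) f = iter_partial bs (\<lambda>x. frechet_derivative f (at x) b)" for bs b and f :: "'a \<Rightarrow> 'b"
    by (induction bs) auto
  show ?case (is "_ \<longleftrightarrow> ?R")
  proof
    assume L: "ksmooth B S (Suc n) f"
    show ?R
    proof (intro ballI impI)
      fix bs :: "'a list" assume bs: "bs \<in> lists Basis" "length bs \<le> Suc n"
      show "(B \<longrightarrow> bounded (iter_partial bs f ` S)) \<and> (length bs < Suc n \<longrightarrow> (\<forall>x\<in>S. iter_partial bs f differentiable at x))"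
      proof (cases bs rule: rev_cases)
        case Nil then show ?thesis using L by auto
      next
        case (snoc cs c)
        then have "ksmooth B S n (\<lambda>x. frechet_derivative f (at x) c)" using L bs by auto
        then show ?thesis using bs unfolding Suc.IH snoc ip by auto
      qed
    qed
  next
    assume R: ?R
    have "ksmooth B S n (\<lambda>x. frechet_derivative f (at x) c)" if "c \<in> Basis" for c
      unfolding Suc.IH
    proof (intro ballI impI)
      fix bs :: "'a list" assume bs: "bs \<in> lists Basis" "length bs \<le> n"
      show "(B \<longrightarrow> bounded (iter_partial bs (\<lambda>x. frechet_derivative f (at x) c) ` S)) \<and>
        (length bs < n \<longrightarrow> (\<forall>x\<in>S. iter_partial bs (\<lambda>x. frechet_derivative f (at x) c) differentiable at x))"
        using R[rule_format, of "bs @ [c]"] bs that unfolding ip by auto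
    qed
    then show "ksmooth B S (Suc n) f" using R[rule_format, of "[]"] by auto
  qed
qed

lemma smooth_on_iff: "smooth_on S f \<longleftrightarrow> open S \<and> (\<forall>n. ksmooth False S n f)"
proof -
  have "(\<forall>bs\<in>lists Basis. \<forall>x\<in>S. iter_partial bs f differentiable (at x)) \<longleftrightarrow> (\<forall>n. ksmooth False S n f)"
    unfolding ksmooth_iter_partial by (meson le_SucI lessI order_refl)
  then show ?thesis unfolding smooth_on_def by blast
qed

lemma ksmooth_partial: "ksmooth B S (Suc n) f \<Longrightarrow> b \<in> Basis \<Longrightarrow> ksmooth B S n (\<lambda>x. frechet_derivative f (at x) b)"
  by simp

lemma ksmooth_differentiable: "ksmooth B S (Suc n) f \<Longrightarrow> x \<in> S \<Longrightarrow> f differentiable at x"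
  by simp

lemma ksmooth_continuous: "ksmooth B S (Suc n) f \<Longrightarrow> continuous_on S f"
  by (simp add: continuous_at_imp_continuous_on differentiable_imp_continuous_within)

lemma ksmooth_bounded_of_compact:
  assumes "ksmooth False U (Suc n) f" "compact K" "K \<subseteq> U" "S \<subseteq> K"
  shows "ksmooth True S n f"
  using assms(1)
proof (induction n arbitrary: f)
  case 0
  have "compact (f ` K)"
    by (rule compact_continuous_image[OF continuous_on_subset[OF ksmooth_continuous[OF 0] assms(3)] assms(2)])
  then show ?case using assms(4) compact_imp_bounded bounded_subset image_mono by (metis ksmooth.simps(1))
next
  case (Suc n)
  have "compact (f ` K)"
    by (rule compact_continuous_image[OF continuous_on_subset[OF ksmooth_continuous[OF Suc.prems] assms(3)] assms(2)])
  then have "bounded (f ` S)" using assms(4) compact_imp_bounded bounded_subset image_mono by metis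
  moreover have "ksmooth True S n (\<lambda>x. frechet_derivative f (at x) b)" if "b \<in> Basis" for b
    by (rule Suc.IH) (use Suc.prems that in \<open>simp\<close>)
  moreover have "\<forall>x\<in>S. f differentiable at x" using Suc.prems assms(3,4) by auto
  ultimately show ?case by simp
qed

lemma smooth_on_open: "smooth_on S f \<Longrightarrow> open S"
  by (simp add: smooth_on_iff)

lemma smooth_on_subset: "smooth_on S f \<Longrightarrow> open S' \<Longrightarrow> S' \<subseteq> S \<Longrightarrow> smooth_on S' f"
  by (auto simp: smooth_on_iff intro: ksmooth_subset)

lemma smooth_on_mult: "smooth_on S f \<Longrightarrow> smooth_on S g \<Longrightarrow> smooth_on S (\<lambda>x. f x * g x :: 'b::real_normed_algebra)"
  by (simp add: smooth_on_iff ksmooth_mult)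

lemma smooth_on_partial: "smooth_on S f \<Longrightarrow> b \<in> Basis \<Longrightarrow> smooth_on S (\<lambda>x. frechet_derivative f (at x) b)"
  unfolding smooth_on_iff by (metis ksmooth_partial)

lemma smooth_on_differentiable: "smooth_on S f \<Longrightarrow> x \<in> S \<Longrightarrow> f differentiable at x"
  unfolding smooth_on_iff by (metis ksmooth_differentiable)

lemma smooth_on_continuous: "smooth_on S f \<Longrightarrow> continuous_on S f"
  unfolding smooth_on_iff by (metis ksmooth_continuous)

lemma smooth_on_cong: "(\<And>y. y \<in> S \<Longrightarrow> f y = g y) \<Longrightarrow> smooth_on S f \<longleftrightarrow> smooth_on S g"
  unfolding smooth_on_iff using ksmooth_cong by blast

lemma smooth_on_iter_partial: "smooth_on S f \<Longrightarrow> bs \<in> lists Basis \<Longrightarrow> smooth_on S (iter_partial bs f)"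
  by (induction bs) (auto intro: smooth_on_partial)

lemma iter_partial_has_derivative:
  "smooth_on S f \<Longrightarrow> bs \<in> lists Basis \<Longrightarrow> x \<in> S \<Longrightarrow>
    (iter_partial bs f has_derivative frechet_derivative (iter_partial bs f) (at x)) (at x)"
  using smooth_on_differentiable[OF smooth_on_iter_partial] by (simp add: frechet_derivative_works)

lemma iter_partial_cong_open:
  assumes "open S" "x \<in> S" "\<And>y. y \<in> S \<Longrightarrow> f y = g y"
  shows "iter_partial bs f x = iter_partial bs g x"
  using assms(2)
proof (induction bs arbitrary: x)
  case (Cons b bs)
  then show ?case using frechet_derivative_cong_open[OF assms(1) Cons.prems Cons.IH] by simp
qed (use assms in auto)

lemma iter_partial_zero: "iter_partial bs (\<lambda>x. 0) = (\<lambda>x. 0)"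
  by (induction bs) auto

lemma iter_partial_eq_0_outside:
  assumes "closed K" "x \<notin> K" "\<And>y. y \<notin> K \<Longrightarrow> f y = 0"
  shows "iter_partial bs f x = 0"
  using iter_partial_cong_open[of "- K" x f "\<lambda>_. 0" bs] assms by (simp add: iter_partial_zero open_Compl)

lemma iter_partial_add:
  assumes "smooth_on S f" "smooth_on S g" "bs \<in> lists Basis" "x \<in> S"
  shows "iter_partial bs (\<lambda>x. f x + g x) x = iter_partial bs f x + iter_partial bs g x"
  using assms(3,4)
proof (induction bs arbitrary: x)
  case (Cons b bs)
  have "frechet_derivative (iter_partial bs (\<lambda>x. f x + g x)) (at x) = frechet_derivative (\<lambda>x. iter_partial bs f x + iter_partial bs g x) (at x)"
    by (rule frechet_derivative_cong_open[of S]) (use Cons assms smooth_on_open in auto)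
  also have "\<dots> = (\<lambda>v. frechet_derivative (iter_partial bs f) (at x) v + frechet_derivative (iter_partial bs g) (at x) v)"
    by (intro frechet_derivative_eqI has_derivative_add)
       (use Cons.hyps Cons.prems assms in \<open>simp_all add: iter_partial_has_derivative\<close>)
  finally show ?case by simp
qed simp

lemma iter_partial_bounded_linear:
  assumes "bounded_linear L" "smooth_on S f" "bs \<in> lists Basis" "x \<in> S"
  shows "iter_partial bs (\<lambda>x. L (f x)) x = L (iter_partial bs f x)"
  using assms(3,4)
proof (induction bs arbitrary: x)
  case (Cons b bs)
  have "frechet_derivative (iter_partial bs (\<lambda>x. L (f x))) (at x) = frechet_derivative (\<lambda>x. L (iter_partial bs f x)) (at x)"
    by (rule frechet_derivative_cong_open[of S]) (use Cons assms smooth_on_open in auto)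
  also have "\<dots> = (\<lambda>v. L (frechet_derivative (iter_partial bs f) (at x) v))"
    by (intro frechet_derivative_eqI bounded_linear.has_derivative[OF assms(1)])
       (use Cons.hyps Cons.prems assms in \<open>simp_all add: iter_partial_has_derivative\<close>)
  finally show ?case by simp
qed simp

lemma iter_partial_affine:
  fixes f :: "'a::euclidean_space \<Rightarrow> 'b::real_normed_vector"
  assumes "smooth_on UNIV f" "bs \<in> lists Basis"
  shows "iter_partial bs (\<lambda>y. f (a *\<^sub>R (y - w))) x = a ^ length bs *\<^sub>R iter_partial bs f (a *\<^sub>R (x - w))"
  using assms(2)
proof (induction bs arbitrary: x)
  case (Cons b bs)
  let ?g = "iter_partial bs f"
  have g: "(?g has_derivative frechet_derivative ?g (at z)) (at z)" for z
    using Cons.hyps assms by (intro iter_partial_has_derivative[of UNIV]) simp_all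
  have lin: "linear (frechet_derivative ?g (at z))" for z
    using g has_derivative_linear by blast
  have "((\<lambda>y. a *\<^sub>R (y - w)) has_derivative (\<lambda>v. a *\<^sub>R v)) (at x)"
    by (auto intro!: derivative_eq_intros)
  from has_derivative_compose[OF this g]
  have "((\<lambda>y. ?g (a *\<^sub>R (y - w))) has_derivative (\<lambda>v. frechet_derivative ?g (at (a *\<^sub>R (x - w))) (a *\<^sub>R v))) (at x)" .
  then have "((\<lambda>y. a ^ length bs *\<^sub>R ?g (a *\<^sub>R (y - w))) has_derivative (\<lambda>v. a ^ length bs *\<^sub>R frechet_derivative ?g (at (a *\<^sub>R (x - w))) (a *\<^sub>R v))) (at x)"
    by (rule has_derivative_scaleR_right)
  moreover have "iter_partial bs (\<lambda>y. f (a *\<^sub>R (y - w))) = (\<lambda>y. a ^ length bs *\<^sub>R ?g (a *\<^sub>R (y - w)))"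
    using Cons by auto
  ultimately have "frechet_derivative (iter_partial bs (\<lambda>y. f (a *\<^sub>R (y - w)))) (at x) =
      (\<lambda>v. a ^ length bs *\<^sub>R frechet_derivative ?g (at (a *\<^sub>R (x - w))) (a *\<^sub>R v))"
    using frechet_derivative_eqI by metis
  then show ?case using linear_cmul[OF lin] by simp
qed simp

section \<open>Smooth cutoff functions\<close>

lemma poly_over_exp_tendsto_0:
  fixes p :: "real poly"
  shows "((\<lambda>y. poly p y * exp (- y)) \<longlongrightarrow> 0) at_top"
proof -
  have "((\<lambda>y. \<Sum>i\<le>degree p. coeff p i * (y ^ i / exp y)) \<longlongrightarrow> (\<Sum>i\<le>degree p. coeff p i * 0)) at_top"
    by (intro tendsto_sum tendsto_mult tendsto_const tendsto_power_div_exp_0)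
  moreover have "(\<Sum>i\<le>degree p. coeff p i * (y ^ i / exp y)) = poly p y * exp (- y)" for y
    by (simp add: poly_altdef sum_distrib_right exp_minus divide_inverse mult.assoc)
  ultimately show ?thesis by simp
qed

text \<open>The functions \<open>p(1/x) e\<^sup>-\<^sup>1\<^sup>/\<^sup>x\<close> form a family closed under differentiation, so their smoothness at 0 is a single
  induction in which the polynomial varies.\<close>

definition flat_exp :: "real poly \<Rightarrow> real \<Rightarrow> real" where
  "flat_exp p x = (if x > 0 then poly p (1 / x) * exp (- (1 / x)) else 0)"

lemma has_derivative_flat_exp:
  "(flat_exp p has_field_derivative flat_exp ([:0, 0, 1:] * (p - pderiv p)) x) (at x)"
proof -
  consider "x > 0" | "x < 0" | "x = 0" by linarith
  then show ?thesis
  proof cases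
    case 1
    have "((\<lambda>x. poly p (1 / x) * exp (- (1 / x))) has_field_derivative flat_exp ([:0, 0, 1:] * (p - pderiv p)) x) (at x)"
      using 1 by (auto intro!: derivative_eq_intros DERIV_chain2[OF poly_DERIV]
          simp: flat_exp_def field_simps power2_eq_square)
    then show ?thesis
      by (rule has_field_derivative_transform_within_open[of _ _ _ "{0<..}"]) (use 1 in \<open>auto simp: flat_exp_def\<close>)
  next
    case 2
    have "((\<lambda>x. 0) has_field_derivative flat_exp ([:0, 0, 1:] * (p - pderiv p)) x) (at x)"
      using 2 by (simp add: flat_exp_def)
    then show ?thesis
      by (rule has_field_derivative_transform_within_open[of _ _ _ "{..<0}"]) (use 2 in \<open>auto simp: flat_exp_def\<close>)
  next
    case 3
    have l: "((\<lambda>y. flat_exp p y / y) \<longlongrightarrow> 0) (at_left 0)"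
      by (rule tendsto_eventually) (auto simp: eventually_at_filter flat_exp_def)
    have "((\<lambda>y. poly (pCons 0 p) (inverse y) * exp (- (inverse y))) \<longlongrightarrow> 0) (at_right (0::real))"
      by (rule filterlim_compose[OF poly_over_exp_tendsto_0 filterlim_inverse_at_top_right])
    then have "((\<lambda>y. flat_exp p y / y) \<longlongrightarrow> 0) (at_right 0)"
      by (rule Lim_transform_eventually) (auto simp: eventually_at_filter flat_exp_def field_simps)
    with l have "((\<lambda>y. flat_exp p y / y) \<longlongrightarrow> 0) (at 0)"
      by (simp add: filterlim_at_split)
    then show ?thesis using 3 by (simp add: has_field_derivative_iff flat_exp_def)
  qed
qed

lemma ksmooth_flat_exp: "ksmooth False UNIV n (flat_exp p)"
proof (induction n arbitrary: p)
  case (Suc n)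
  have D: "(flat_exp p has_derivative (\<lambda>v. flat_exp ([:0, 0, 1:] * (p - pderiv p)) x * v)) (at x)" for x
    using has_derivative_flat_exp[of p x] by (simp add: has_field_derivative_def)
  have "(\<lambda>x. frechet_derivative (flat_exp p) (at x) 1) = flat_exp ([:0, 0, 1:] * (p - pderiv p))"
    using frechet_derivative_eqI[OF D] by simp
  then show ?case using Suc.IH differentiableI[OF D] by simp
qed simp

definition smooth_step :: "real \<Rightarrow> real" where
  "smooth_step x = flat_exp 1 x * inverse (flat_exp 1 x + flat_exp 1 (1 - x))"

lemma flat_exp_1: "flat_exp 1 x \<ge> 0" "x > 0 \<Longrightarrow> flat_exp 1 x > 0" "x \<le> 0 \<Longrightarrow> flat_exp 1 x = 0"
  by (auto simp: flat_exp_def)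

lemma flat_exp_sum_pos: "flat_exp 1 x + flat_exp 1 (1 - x) > 0"
  using flat_exp_1[of x] flat_exp_1[of "1 - x"] by (cases "x > 0") auto

lemma smooth_on_smooth_step: "smooth_on UNIV smooth_step"
proof -
  have "ksmooth False UNIV n (\<lambda>x. flat_exp 1 (1 - x))" for n
    by (rule ksmooth_compose[of UNIV UNIV]) (auto intro!: ksmooth_flat_exp ksmooth_diff ksmooth_const ksmooth_linear[OF bounded_linear_ident])
  then have "ksmooth False UNIV n (\<lambda>x. flat_exp 1 x * inverse (flat_exp 1 x + flat_exp 1 (1 - x)))" for n
    using flat_exp_sum_pos by (intro ksmooth_mult ksmooth_inverse ksmooth_add ksmooth_flat_exp) (auto simp: less_imp_neq[symmetric])
  then show ?thesis by (simp add: smooth_on_iff smooth_step_def[abs_def])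
qed

lemma smooth_step_bounds: "0 \<le> smooth_step x" "smooth_step x \<le> 1"
  using flat_exp_1[of x] flat_exp_1[of "1 - x"] flat_exp_sum_pos[of x]
  by (auto simp: smooth_step_def field_simps)

lemma smooth_step_0: "x \<le> 0 \<Longrightarrow> smooth_step x = 0"
  by (simp add: smooth_step_def flat_exp_1)

lemma smooth_step_1: "1 \<le> x \<Longrightarrow> smooth_step x = 1"
  using flat_exp_1(3)[of "1 - x"] flat_exp_1(2)[of x] by (simp add: smooth_step_def)

text \<open>Radial about \<open>p\<close>, equal to 1 up to distance \<open>r/2\<close> and to 0 from distance \<open>3r/4\<close> on. It depends on the square of
  the distance, which is smooth at the centre as well.\<close>

definition bump :: "'a::euclidean_space \<Rightarrow> real \<Rightarrow> 'a \<Rightarrow> complex" where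
  "bump p r x = of_real (smooth_step (2 - 4 * ((x - p) \<bullet> (x - p)) / r\<^sup>2))"

lemma smooth_on_bump: "smooth_on UNIV (bump p r)"
proof -
  have l: "ksmooth False UNIV n (\<lambda>x. x - p)" for n
    by (intro ksmooth_diff ksmooth_const ksmooth_linear[OF bounded_linear_ident]) auto
  have "ksmooth False UNIV n (\<lambda>x. 2 - (4 / r\<^sup>2) * ((x - p) \<bullet> (x - p)))" for n
    by (intro ksmooth_diff ksmooth_const ksmooth_mult ksmooth_bilinear[OF bounded_bilinear_inner] l) auto
  then have "ksmooth False UNIV n (\<lambda>x. smooth_step (2 - (4 / r\<^sup>2) * ((x - p) \<bullet> (x - p))))" for n
    by (rule ksmooth_compose[OF open_UNIV open_UNIV subset_UNIV _ smooth_on_smooth_step[unfolded smooth_on_iff, THEN conjunct2, rule_format]])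
  then have "ksmooth False UNIV n (\<lambda>x. complex_of_real (smooth_step (2 - (4 / r\<^sup>2) * ((x - p) \<bullet> (x - p)))))" for n
    by (rule ksmooth_compose_linear[OF bounded_linear_of_real open_UNIV])
  then show ?thesis unfolding smooth_on_iff bump_def[abs_def] by simp
qed

lemma norm_bump_le: "norm (bump p r x) \<le> 1"
  using smooth_step_bounds by (simp add: bump_def)

lemma bump_eq_1: "r > 0 \<Longrightarrow> norm (x - p) \<le> r / 2 \<Longrightarrow> bump p r x = 1"
proof -
  assume r: "r > 0" and "norm (x - p) \<le> r / 2"
  then have "(norm (x - p))\<^sup>2 \<le> (r / 2)\<^sup>2" by (intro power_mono) auto
  then have "4 * ((x - p) \<bullet> (x - p)) / r\<^sup>2 \<le> 1" using r by (simp add: power2_norm_eq_inner power_divide power_mult_distrib divide_simps)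
  then show ?thesis by (simp add: bump_def smooth_step_1)
qed

lemma bump_eq_0: "r > 0 \<Longrightarrow> norm (x - p) \<ge> 3 * r / 4 \<Longrightarrow> bump p r x = 0"
proof -
  assume r: "r > 0" and "norm (x - p) \<ge> 3 * r / 4"
  then have "(norm (x - p))\<^sup>2 \<ge> (3 * r / 4)\<^sup>2" by (intro power_mono) auto
  then have "9 * r\<^sup>2 \<le> ((x - p) \<bullet> (x - p)) * 16" by (simp add: power2_norm_eq_inner power_divide power_mult_distrib)
  then have "4 * ((x - p) \<bullet> (x - p)) / r\<^sup>2 \<ge> 2"
    using r by (simp add: pos_le_divide_eq) (smt (verit) zero_le_power2)
  then show ?thesis by (simp add: bump_def smooth_step_0)
qed

lemma cnj_bump: "cnj (bump p r x) = bump p r x"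
  by (simp add: bump_def)

lemma bump_affine: "r > 0 \<Longrightarrow> bump w r = (\<lambda>x. bump 0 1 ((1 / r) *\<^sub>R (x - w)))"
  by (simp add: bump_def power2_eq_square fun_eq_iff divide_simps)

section \<open>Test functions\<close>

lemma test_functionsI:
  assumes "smooth_on UNIV f" "compact K" "K \<subseteq> \<Omega>" "\<And>x. x \<notin> K \<Longrightarrow> f x = 0"
  shows "f \<in> test_functions \<Omega>"
proof -
  have "closure {x. f x \<noteq> 0} \<subseteq> K"
    using assms by (intro closure_minimal) (auto dest: compact_imp_closed)
  moreover from this have "compact (closure {x. f x \<noteq> 0})"
    using assms(2) by (metis closed_closure closed_Int_compact inf.absorb1)
  ultimately show ?thesis using assms(1,3) unfolding test_functions_def by blast
qed

lemma test_functionsE: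
  assumes "f \<in> test_functions \<Omega>"
  obtains K where "smooth_on UNIV f" "compact K" "K \<subseteq> \<Omega>" "\<And>x. x \<notin> K \<Longrightarrow> f x = 0"
proof (rule that[of "closure {x. f x \<noteq> 0}"])
  show "f x = 0" if "x \<notin> closure {x. f x \<noteq> 0}" for x
    using that closure_subset[of "{x. f x \<noteq> 0}"] by blast
qed (use assms in \<open>auto simp: test_functions_def\<close>)

lemma smooth_on_extend_zero:
  assumes "smooth_on W f" "closed K" "K \<subseteq> W" "\<And>x. x \<in> W - K \<Longrightarrow> f x = 0"
  shows "smooth_on UNIV (\<lambda>x. if x \<in> W then f x else 0)"
  unfolding smooth_on_iff
proof (intro conjI allI open_UNIV ksmooth_local)
  fix n x
  let ?f = "\<lambda>x. if x \<in> W then f x else 0"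
  have W: "open W" using assms smooth_on_open by auto
  show "\<exists>U. open U \<and> x \<in> U \<and> ksmooth False U n ?f"
  proof (cases "x \<in> W")
    case True
    have "ksmooth False W n ?f \<longleftrightarrow> ksmooth False W n f" by (rule ksmooth_cong[OF W]) auto
    then show ?thesis using True W assms(1) unfolding smooth_on_iff by blast
  next
    case False
    have "ksmooth False (- K) n ?f \<longleftrightarrow> ksmooth False (- K) n (\<lambda>x. 0::'b)" by (rule ksmooth_cong) (use assms in auto)
    then have "ksmooth False (- K) n ?f" using ksmooth_const by simp
    moreover have "x \<in> - K" "open (- K)" using False assms(2,3) by (auto simp: open_Compl)
    ultimately show ?thesis by blast
  qed
qed

lemma test_function_iter_partial:
  assumes "f \<in> test_functions \<Omega>" "bs \<in> lists Basis"
  shows "iter_partial bs f \<in> test_functions \<Omega>"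
proof -
  obtain K where K: "smooth_on UNIV f" "compact K" "K \<subseteq> \<Omega>" "\<And>x. x \<notin> K \<Longrightarrow> f x = 0"
    using test_functionsE[OF assms(1)] by metis
  show ?thesis
    by (rule test_functionsI[OF smooth_on_iter_partial[OF K(1) assms(2)] K(2,3)])
       (rule iter_partial_eq_0_outside[OF compact_imp_closed[OF K(2)] _ K(4)])
qed

lemma test_function_bounded:
  assumes "f \<in> test_functions \<Omega>"
  shows "bounded (range f)"
proof -
  obtain K where K: "smooth_on UNIV f" "compact K" "\<And>x. x \<notin> K \<Longrightarrow> f x = 0"
    using test_functionsE[OF assms] by metis
  have "compact (f ` K)"
    by (rule compact_continuous_image[OF continuous_on_subset[OF smooth_on_continuous[OF K(1)]] K(2)]) simp
  moreover have "range f \<subseteq> insert 0 (f ` K)" using K(3) by auto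
  ultimately show ?thesis using compact_imp_bounded bounded_insert bounded_subset by metis
qed

lemma bump_test_function:
  assumes "r > 0" "ball p r \<subseteq> \<Omega>"
  shows "bump p r \<in> test_functions \<Omega>"
proof (rule test_functionsI[OF smooth_on_bump compact_cball])
  show "cball p (3 * r / 4) \<subseteq> \<Omega>" using assms by (auto simp: subset_iff)
  show "bump p r x = 0" if "x \<notin> cball p (3 * r / 4)" for x
    using bump_eq_0[OF assms(1), of x p] that by (auto simp: dist_norm norm_minus_commute)
qed

lemma smooth_on_UNIV_smooth_closure:
  assumes "smooth_on UNIV f" "open \<Omega>"
  shows "f \<in> smooth_closure \<Omega>"
  unfolding smooth_closure_def
proof (intro CollectI conjI ballI)
  show "smooth_on \<Omega> f" using smooth_on_subset[OF assms] by simp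
  fix bs :: "'a list" assume "bs \<in> lists Basis"
  then have "continuous_on UNIV (iter_partial bs f)"
    by (rule smooth_on_continuous[OF smooth_on_iter_partial[OF assms(1)]])
  then have "continuous_on (closure \<Omega>) (iter_partial bs f)"
    by (rule continuous_on_subset) simp
  then show "\<exists>g. continuous_on (closure \<Omega>) g \<and> (\<forall>x\<in>\<Omega>. g x = iter_partial bs f x)" by blast
qed

lemma test_function_smooth_closure: "f \<in> test_functions \<Omega> \<Longrightarrow> open \<Omega> \<Longrightarrow> f \<in> smooth_closure \<Omega>"
  by (meson smooth_on_UNIV_smooth_closure test_functionsE)

lemma smooth_closure_ksmooth_True:
  assumes "f \<in> smooth_closure \<Omega>" "bounded \<Omega>"
  shows "ksmooth True \<Omega> n f"
proof -
  have "bounded (iter_partial bs f ` \<Omega>)" if bs: "bs \<in> lists Basis" for bs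
  proof -
    obtain g where g: "continuous_on (closure \<Omega>) g" "\<forall>x\<in>\<Omega>. g x = iter_partial bs f x"
      using assms bs unfolding smooth_closure_def by blast
    have "compact (g ` closure \<Omega>)" using g assms by (intro compact_continuous_image) auto
    then have "bounded (g ` closure \<Omega>)" by (rule compact_imp_bounded)
    moreover have "iter_partial bs f ` \<Omega> = g ` \<Omega>" using g(2) by (intro image_cong) auto
    then have "iter_partial bs f ` \<Omega> \<subseteq> g ` closure \<Omega>" using image_mono[OF closure_subset] by metis
    ultimately show ?thesis using bounded_subset by blast
  qed
  then show ?thesis
    using assms(1) unfolding ksmooth_iter_partial smooth_closure_def smooth_on_def by simp
qed

section \<open>Square-integrable functions\<close>

lemma L2_measurable: "f \<in> L2 \<Omega> \<Longrightarrow> f \<in> borel_measurable (lebesgue_on \<Omega>)"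
  by (simp add: L2_def)

lemma L2_integrable_square: "f \<in> L2 \<Omega> \<Longrightarrow> integrable (lebesgue_on \<Omega>) (\<lambda>x. (norm (f x))\<^sup>2)"
  by (simp add: L2_def)

lemma L2_integrable_norm_mult:
  assumes "f \<in> L2 \<Omega>" "g \<in> L2 \<Omega>"
  shows "integrable (lebesgue_on \<Omega>) (\<lambda>x. norm (f x) * norm (g x))"
proof (rule Bochner_Integration.integrable_bound)
  show "integrable (lebesgue_on \<Omega>) (\<lambda>x. (norm (f x))\<^sup>2 + (norm (g x))\<^sup>2)"
    using assms L2_integrable_square by (intro Bochner_Integration.integrable_add) auto
  show "(\<lambda>x. norm (f x) * norm (g x)) \<in> borel_measurable (lebesgue_on \<Omega>)"
    using assms L2_measurable by measurable
  have "a * b \<le> a\<^sup>2 + b\<^sup>2" if "a \<ge> 0" "b \<ge> 0" for a b :: real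
    using sum_squares_bound[of a b] mult_nonneg_nonneg[OF that] by linarith
  then show "AE x in lebesgue_on \<Omega>. norm (norm (f x) * norm (g x)) \<le> norm ((norm (f x))\<^sup>2 + (norm (g x))\<^sup>2)"
    by (auto simp: abs_mult)
qed

lemma L2_integrable_mult:
  assumes "f \<in> L2 \<Omega>" "g \<in> L2 \<Omega>"
  shows "integrable (lebesgue_on \<Omega>) (\<lambda>x. f x * g x)"
proof (rule Bochner_Integration.integrable_bound[OF L2_integrable_norm_mult[OF assms]])
  show "(\<lambda>x. f x * g x) \<in> borel_measurable (lebesgue_on \<Omega>)"
    using assms L2_measurable by (intro borel_measurable_times) auto
qed (simp add: norm_mult)

lemma L2_cnj: "f \<in> L2 \<Omega> \<Longrightarrow> (\<lambda>x. cnj (f x)) \<in> L2 \<Omega>"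
  unfolding L2_def
  by (auto intro: borel_measurable_continuous_on[OF continuous_on_cnj[OF continuous_on_id]])

lemma L2_integrable_inner: "f \<in> L2 \<Omega> \<Longrightarrow> g \<in> L2 \<Omega> \<Longrightarrow> integrable (lebesgue_on \<Omega>) (\<lambda>x. f x * cnj (g x))"
  by (rule L2_integrable_mult[OF _ L2_cnj])

lemma L2_add:
  assumes "f \<in> L2 \<Omega>" "g \<in> L2 \<Omega>"
  shows "(\<lambda>x. f x + g x) \<in> L2 \<Omega>"
  unfolding L2_def
proof (intro CollectI conjI)
  show m: "(\<lambda>x. f x + g x) \<in> borel_measurable (lebesgue_on \<Omega>)"
    using assms L2_measurable by (intro borel_measurable_add) auto
  show "integrable (lebesgue_on \<Omega>) (\<lambda>x. (norm (f x + g x))\<^sup>2)"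
  proof (rule Bochner_Integration.integrable_bound)
    show "integrable (lebesgue_on \<Omega>) (\<lambda>x. (norm (f x))\<^sup>2 + (norm (g x))\<^sup>2 + 2 * (norm (f x) * norm (g x)))"
      using assms L2_integrable_square L2_integrable_norm_mult
      by (intro Bochner_Integration.integrable_add integrable_mult_right) auto
    show "(\<lambda>x. (norm (f x + g x))\<^sup>2) \<in> borel_measurable (lebesgue_on \<Omega>)" using m by measurable
    have "(norm (f x + g x))\<^sup>2 \<le> (norm (f x) + norm (g x))\<^sup>2" for x
      by (intro power_mono norm_triangle_ineq) auto
    then show "AE x in lebesgue_on \<Omega>. norm ((norm (f x + g x))\<^sup>2)
        \<le> norm ((norm (f x))\<^sup>2 + (norm (g x))\<^sup>2 + 2 * (norm (f x) * norm (g x)))"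
      by (auto simp: power2_sum algebra_simps)
  qed
qed

lemma L2_cmult: "f \<in> L2 \<Omega> \<Longrightarrow> (\<lambda>x. c * f x) \<in> L2 \<Omega>"
  unfolding L2_def by (auto simp: norm_mult power_mult_distrib)

lemma L2_diff: "f \<in> L2 \<Omega> \<Longrightarrow> g \<in> L2 \<Omega> \<Longrightarrow> (\<lambda>x. f x - g x) \<in> L2 \<Omega>"
  using L2_add[OF _ L2_cmult[of g \<Omega> "-1"]] by simp

lemma L2_zero: "(\<lambda>x. 0) \<in> L2 \<Omega>"
  by (simp add: L2_def)

lemma L2_cong: "(\<And>x. x \<in> \<Omega> \<Longrightarrow> f x = g x) \<Longrightarrow> f \<in> L2 \<Omega> \<longleftrightarrow> g \<in> L2 \<Omega>"
proof -
  assume fg: "\<And>x. x \<in> \<Omega> \<Longrightarrow> f x = g x"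
  have "f \<in> borel_measurable (lebesgue_on \<Omega>) \<longleftrightarrow> g \<in> borel_measurable (lebesgue_on \<Omega>)"
    by (rule measurable_cong) (use fg in auto)
  moreover have "integrable (lebesgue_on \<Omega>) (\<lambda>x. (norm (f x))\<^sup>2) \<longleftrightarrow> integrable (lebesgue_on \<Omega>) (\<lambda>x. (norm (g x))\<^sup>2)"
    by (rule Bochner_Integration.integrable_cong) (use fg in auto)
  ultimately show ?thesis by (simp add: L2_def)
qed

lemma L2_norm_nonneg: "L2_norm \<Omega> f \<ge> 0"
  by (simp add: L2_norm_def)

lemma L2_norm_square: "(L2_norm \<Omega> f)\<^sup>2 = (LINT x|lebesgue_on \<Omega>. (norm (f x))\<^sup>2)"
  by (simp add: L2_norm_def)

lemma L2_norm_cnj: "L2_norm \<Omega> (\<lambda>x. cnj (f x)) = L2_norm \<Omega> f"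
  by (simp add: L2_norm_def)

lemma L2_Cauchy_Schwarz_norm:
  assumes f: "f \<in> L2 \<Omega>" and g: "g \<in> L2 \<Omega>"
  shows "(LINT x|lebesgue_on \<Omega>. norm (f x) * norm (g x)) \<le> L2_norm \<Omega> f * L2_norm \<Omega> g"
proof -
  let ?A = "LINT x|lebesgue_on \<Omega>. (norm (f x))\<^sup>2" and ?B = "LINT x|lebesgue_on \<Omega>. (norm (g x))\<^sup>2"
  let ?C = "LINT x|lebesgue_on \<Omega>. norm (f x) * norm (g x)"
  note i = L2_integrable_square[OF f] L2_integrable_square[OF g] L2_integrable_norm_mult[OF f g]
  have q: "0 \<le> ?A - 2 * t * ?C + t\<^sup>2 * ?B" for t
  proof -
    have "0 \<le> (LINT x|lebesgue_on \<Omega>. (norm (f x) - t * norm (g x))\<^sup>2)" by simp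
    also have "\<dots> = (LINT x|lebesgue_on \<Omega>. (norm (f x))\<^sup>2 - 2 * t * (norm (f x) * norm (g x)) + t\<^sup>2 * (norm (g x))\<^sup>2)"
      by (simp add: power2_diff power_mult_distrib algebra_simps)
    also have "\<dots> = ?A - 2 * t * ?C + t\<^sup>2 * ?B" using i by simp
    finally show ?thesis .
  qed
  have quad: "c\<^sup>2 \<le> a * b" if "\<And>t. 0 \<le> a - 2 * t * c + t\<^sup>2 * b" "b \<ge> 0" for a b c :: real
  proof (cases "b = 0")
    case True
    have "c = 0"
    proof (rule ccontr)
      assume "c \<noteq> 0"
      then have "0 \<le> a - 2 * ((a + 1) / (2 * c)) * c" using that(1)[of "(a + 1) / (2 * c)"] True by simp
      then show False using \<open>c \<noteq> 0\<close> by simp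
    qed
    then show ?thesis using True by simp
  next
    case False
    then have b: "b > 0" using that(2) by simp
    have "0 \<le> a - 2 * (c / b) * c + (c / b)\<^sup>2 * b" by (rule that(1))
    also have "\<dots> = a - c\<^sup>2 / b" using b by (simp add: field_simps power2_eq_square)
    finally show ?thesis using b by (simp add: field_simps)
  qed
  have "?C\<^sup>2 \<le> ?A * ?B" by (rule quad[OF q]) simp
  then have "?C \<le> sqrt (?A * ?B)" by (rule real_le_rsqrt)
  then show ?thesis unfolding L2_norm_def real_sqrt_mult .
qed

lemma L2_Cauchy_Schwarz_mult:
  assumes "f \<in> L2 \<Omega>" "g \<in> L2 \<Omega>"
  shows "norm (LINT x|lebesgue_on \<Omega>. f x * g x) \<le> L2_norm \<Omega> f * L2_norm \<Omega> g"
  using integral_norm_bound[of "lebesgue_on \<Omega>" "\<lambda>x. f x * g x"] L2_Cauchy_Schwarz_norm[OF assms]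
  by (simp add: norm_mult)

lemma L2_Cauchy_Schwarz:
  assumes "f \<in> L2 \<Omega>" "g \<in> L2 \<Omega>"
  shows "norm (L2_inner \<Omega> f g) \<le> L2_norm \<Omega> f * L2_norm \<Omega> g"
  using L2_Cauchy_Schwarz_mult[OF assms(1) L2_cnj[OF assms(2)]] by (simp add: L2_inner_def L2_norm_cnj)

lemma L2_inner_add_left:
  "f \<in> L2 \<Omega> \<Longrightarrow> g \<in> L2 \<Omega> \<Longrightarrow> h \<in> L2 \<Omega> \<Longrightarrow> L2_inner \<Omega> (\<lambda>x. f x + g x) h = L2_inner \<Omega> f h + L2_inner \<Omega> g h"
  by (simp add: L2_inner_def distrib_right L2_integrable_inner)

lemma L2_inner_diff_left:
  "f \<in> L2 \<Omega> \<Longrightarrow> g \<in> L2 \<Omega> \<Longrightarrow> h \<in> L2 \<Omega> \<Longrightarrow> L2_inner \<Omega> (\<lambda>x. f x - g x) h = L2_inner \<Omega> f h - L2_inner \<Omega> g h"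
  by (simp add: L2_inner_def left_diff_distrib L2_integrable_inner)

lemma L2_inner_cmult_left: "L2_inner \<Omega> (\<lambda>x. c * f x) h = c * L2_inner \<Omega> f h"
  by (simp add: L2_inner_def mult.assoc)

lemma L2_inner_commute: "L2_inner \<Omega> f g = cnj (L2_inner \<Omega> g f)"
  unfolding L2_inner_def by (simp add: Bochner_Integration.integral_cnj[symmetric] mult.commute del: Bochner_Integration.integral_cnj)

lemma L2_inner_self: "L2_inner \<Omega> f f = of_real ((L2_norm \<Omega> f)\<^sup>2)"
  unfolding L2_inner_def L2_norm_square
  by (simp flip: complex_norm_square integral_complex_of_real)

lemma L2_norm_sub_cmult:
  assumes f: "f \<in> L2 \<Omega>" and g: "g \<in> L2 \<Omega>"
  shows "(L2_norm \<Omega> (\<lambda>x. f x - t * g x))\<^sup>2 =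
    (L2_norm \<Omega> f)\<^sup>2 + (norm t)\<^sup>2 * (L2_norm \<Omega> g)\<^sup>2 - 2 * Re (cnj t * L2_inner \<Omega> f g)"
proof -
  have e: "(norm (a - t * b))\<^sup>2 = (norm a)\<^sup>2 + (norm t)\<^sup>2 * (norm b)\<^sup>2 - 2 * Re (cnj t * (a * cnj b))" for a b
    unfolding cmod_power2 by (simp add: algebra_simps power2_eq_square)
  note i = L2_integrable_square[OF f] L2_integrable_square[OF g] L2_integrable_inner[OF f g]
  have r: "(LINT x|lebesgue_on \<Omega>. Re (cnj t * (f x * cnj (g x)))) = Re (cnj t * L2_inner \<Omega> f g)"
    unfolding L2_inner_def using i(3) by (subst integral_Re) auto
  have "integrable (lebesgue_on \<Omega>) (\<lambda>x. Re (cnj t * (f x * cnj (g x))))"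
    by (intro integrable_Re integrable_mult_right i)
  then have "(LINT x|lebesgue_on \<Omega>. (norm (f x))\<^sup>2 + (norm t)\<^sup>2 * (norm (g x))\<^sup>2 - 2 * Re (cnj t * (f x * cnj (g x)))) =
     (LINT x|lebesgue_on \<Omega>. (norm (f x))\<^sup>2) + (norm t)\<^sup>2 * (LINT x|lebesgue_on \<Omega>. (norm (g x))\<^sup>2)
     - 2 * (LINT x|lebesgue_on \<Omega>. Re (cnj t * (f x * cnj (g x))))"
    by (subst Bochner_Integration.integral_diff, (intro Bochner_Integration.integrable_add integrable_mult_right i | assumption)+,
        subst Bochner_Integration.integral_add, (intro integrable_mult_right i)+, simp only: integral_mult_right_zero)
  then show ?thesis unfolding L2_norm_square e r .
qed

lemma L2_parallelogram:
  assumes "f \<in> L2 \<Omega>" "g \<in> L2 \<Omega>"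
  shows "(L2_norm \<Omega> (\<lambda>x. f x + g x))\<^sup>2 + (L2_norm \<Omega> (\<lambda>x. f x - g x))\<^sup>2 = 2 * (L2_norm \<Omega> f)\<^sup>2 + 2 * (L2_norm \<Omega> g)\<^sup>2"
  using L2_norm_sub_cmult[OF assms, of 1] L2_norm_sub_cmult[OF assms, of "-1"] by simp

lemma L2_norm_cmult: "L2_norm \<Omega> (\<lambda>x. c * f x) = norm c * L2_norm \<Omega> f"
  by (simp add: L2_norm_def norm_mult power_mult_distrib real_sqrt_mult)

text \<open>The bound is obtained at \<open>t = (u, h) / \<bar>h\<bar>\<^sup>2\<close>, which minimises the right-hand side of the hypothesis. For \<open>e = 0\<close> this is the
  orthogonality of the error of best approximation.\<close>

lemma L2_inner_small:
  assumes u: "u \<in> L2 \<Omega>" and h: "h \<in> L2 \<Omega>"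
    and min: "\<And>t. (L2_norm \<Omega> u)\<^sup>2 - e \<le> (L2_norm \<Omega> (\<lambda>x. u x - t * h x))\<^sup>2"
  shows "(norm (L2_inner \<Omega> u h))\<^sup>2 \<le> e * (L2_norm \<Omega> h)\<^sup>2"
proof (cases "L2_norm \<Omega> h = 0")
  case True
  then show ?thesis using L2_Cauchy_Schwarz[OF u h] by simp
next
  case False
  define N where "N = (L2_norm \<Omega> h)\<^sup>2"
  define i where "i = L2_inner \<Omega> u h"
  have N: "N > 0" using False by (simp add: N_def)
  have r: "Re (cnj (i / of_real N) * i) = (norm i)\<^sup>2 / N"
    unfolding cmod_power2 by (simp add: power2_eq_square add_divide_distrib)
  have "(L2_norm \<Omega> u)\<^sup>2 - e \<le> (L2_norm \<Omega> u)\<^sup>2 + (norm (i / of_real N))\<^sup>2 * N - 2 * Re (cnj (i / of_real N) * i)"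
    using min[of "i / of_real N"] unfolding L2_norm_sub_cmult[OF u h] by (simp add: N_def i_def)
  then have "- e \<le> (norm i)\<^sup>2 / N\<^sup>2 * N - 2 * ((norm i)\<^sup>2 / N)"
    unfolding r using N by (simp add: norm_divide power_divide)
  also have "\<dots> = - ((norm i)\<^sup>2 / N)" using N by (simp add: power2_eq_square)
  finally show ?thesis using N by (simp add: field_simps N_def i_def)
qed

text \<open>Orthogonal projection onto a complete subspace: a minimizing sequence is Cauchy by the
  parallelogram law, and its limit satisfies the orthogonality relations.\<close>

lemma L2_projection_exists:
  assumes V: "V \<subseteq> L2 \<Omega>" "V \<noteq> {}"
    and lin: "\<And>g h c. g \<in> V \<Longrightarrow> h \<in> V \<Longrightarrow> (\<lambda>x. g x + c * h x) \<in> V"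
    and complete: "\<And>h. (\<And>n. h n \<in> V) \<Longrightarrow>
       (\<And>e. e > 0 \<Longrightarrow> \<exists>N. \<forall>m\<ge>N. \<forall>n\<ge>N. (L2_norm \<Omega> (\<lambda>x. h m x - h n x))\<^sup>2 < e) \<Longrightarrow>
       \<exists>g\<in>V. (\<lambda>n. L2_norm \<Omega> (\<lambda>x. h n x - g x)) \<longlonglongrightarrow> 0"
    and f: "f \<in> L2 \<Omega>"
  shows "\<exists>g\<in>V. \<forall>h\<in>V. L2_inner \<Omega> (\<lambda>x. f x - g x) h = 0"
proof -
  let ?N = "\<lambda>g. (L2_norm \<Omega> g)\<^sup>2"
  define d where "d = (INF h\<in>V. ?N (\<lambda>x. f x - h x))"
  have bb: "bdd_below ((\<lambda>h. ?N (\<lambda>x. f x - h x)) ` V)" by (rule bdd_belowI2[of _ 0]) simp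
  have d: "d \<le> ?N (\<lambda>x. f x - h x)" if "h \<in> V" for h
    unfolding d_def by (rule cINF_lower[OF bb that])
  have "\<exists>h\<in>V. ?N (\<lambda>x. f x - h x) < d + inverse (real (Suc n))" for n
  proof (rule ccontr)
    assume "\<not> ?thesis"
    then have "d + inverse (real (Suc n)) \<le> (INF h\<in>V. ?N (\<lambda>x. f x - h x))"
      using V(2) by (intro cINF_greatest) (auto simp: not_less)
    moreover have "inverse (real (Suc n)) > 0" by simp
    ultimately show False unfolding d_def[symmetric] by linarith
  qed
  then obtain h where hV: "\<And>n. h n \<in> V" and h: "\<And>n. ?N (\<lambda>x. f x - h n x) < d + inverse (real (Suc n))"
    by metis
  have hL: "h n \<in> L2 \<Omega>" for n using hV V by auto
  have fh: "(\<lambda>x. f x - h n x) \<in> L2 \<Omega>" for n by (rule L2_diff[OF f hL])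
  have cauchy: "?N (\<lambda>x. h m x - h n x) \<le> 2 * inverse (real (Suc n)) + 2 * inverse (real (Suc m))" for m n
  proof -
    have mid: "(\<lambda>x. (1/2) * (h n x + h m x)) \<in> V"
    proof -
      have "(\<lambda>x. h n x + - (1/2) * h n x) \<in> V" by (rule lin[OF hV hV])
      from lin[OF this hV[of m], of "1/2"] show ?thesis by (simp add: algebra_simps)
    qed
    have "(\<lambda>x. (f x - h n x) + (f x - h m x)) = (\<lambda>x. 2 * (f x - (1/2) * (h n x + h m x)))"
      by (auto simp: algebra_simps)
    then have "?N (\<lambda>x. (f x - h n x) + (f x - h m x)) = 4 * ?N (\<lambda>x. f x - (1/2) * (h n x + h m x))"
      using L2_norm_cmult[of \<Omega> 2 "\<lambda>x. f x - (1/2) * (h n x + h m x)"] by (simp add: power_mult_distrib)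
    then have "?N (\<lambda>x. (f x - h n x) + (f x - h m x)) \<ge> 4 * d" using d[OF mid] by simp
    moreover have "?N (\<lambda>x. (f x - h n x) - (f x - h m x)) = ?N (\<lambda>x. h m x - h n x)" by simp
    ultimately show ?thesis using L2_parallelogram[OF fh[of n] fh[of m]] h[of n] h[of m] by simp
  qed
  have "\<exists>g\<in>V. (\<lambda>n. L2_norm \<Omega> (\<lambda>x. h n x - g x)) \<longlonglongrightarrow> 0"
  proof (rule complete[OF hV])
    fix e :: real assume "e > 0"
    then obtain N where N: "inverse (real (Suc N)) < e / 4" using reals_Archimedean[of "e/4"] by auto
    have "?N (\<lambda>x. h m x - h n x) < e" if "m \<ge> N" "n \<ge> N" for m n
    proof -
      have "inverse (real (Suc m)) \<le> inverse (real (Suc N))" "inverse (real (Suc n)) \<le> inverse (real (Suc N))"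
        using that by (auto intro: le_imp_inverse_le)
      then show ?thesis using cauchy[of m n] N by linarith
    qed
    then show "\<exists>N. \<forall>m\<ge>N. \<forall>n\<ge>N. ?N (\<lambda>x. h m x - h n x) < e" by blast
  qed
  then obtain g where g: "g \<in> V" "(\<lambda>n. L2_norm \<Omega> (\<lambda>x. h n x - g x)) \<longlonglongrightarrow> 0" by blast
  have gL: "g \<in> L2 \<Omega>" using g V by auto
  have "L2_inner \<Omega> (\<lambda>x. f x - g x) k = 0" if k: "k \<in> V" for k
  proof -
    have kL: "k \<in> L2 \<Omega>" using k V by auto
    have sm: "(norm (L2_inner \<Omega> (\<lambda>x. f x - h n x) k))\<^sup>2 \<le> inverse (real (Suc n)) * (L2_norm \<Omega> k)\<^sup>2" for n
    proof (rule L2_inner_small[OF fh kL])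
      fix t
      have "d \<le> ?N (\<lambda>x. f x - (h n x + t * k x))" by (rule d[OF lin[OF hV k]])
      then show "?N (\<lambda>x. f x - h n x) - inverse (real (Suc n)) \<le> ?N (\<lambda>x. f x - h n x - t * k x)"
        using h[of n] by (simp add: diff_diff_eq)
    qed
    have "(\<lambda>n. inverse (real (Suc n)) * (L2_norm \<Omega> k)\<^sup>2) \<longlonglongrightarrow> 0 * (L2_norm \<Omega> k)\<^sup>2"
      by (intro tendsto_mult tendsto_const LIMSEQ_inverse_real_of_nat)
    then have lim0: "(\<lambda>n. inverse (real (Suc n)) * (L2_norm \<Omega> k)\<^sup>2) \<longlonglongrightarrow> 0" by (simp only: mult_zero_left)
    have "(\<lambda>n. (norm (L2_inner \<Omega> (\<lambda>x. f x - h n x) k))\<^sup>2) \<longlonglongrightarrow> 0"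
      by (rule tendsto_sandwich[OF _ _ tendsto_const lim0]) (use sm in auto)
    then have "(\<lambda>n. sqrt ((norm (L2_inner \<Omega> (\<lambda>x. f x - h n x) k))\<^sup>2)) \<longlonglongrightarrow> sqrt 0"
      by (rule tendsto_real_sqrt)
    then have 1: "(\<lambda>n. L2_inner \<Omega> (\<lambda>x. f x - h n x) k) \<longlonglongrightarrow> 0"
      by (simp add: tendsto_norm_zero_iff)
    have "(\<lambda>n. L2_norm \<Omega> (\<lambda>x. h n x - g x) * L2_norm \<Omega> k) \<longlonglongrightarrow> 0"
      using g(2) tendsto_mult_left_zero by blast
    then have 2: "(\<lambda>n. L2_inner \<Omega> (\<lambda>x. h n x - g x) k) \<longlonglongrightarrow> 0"
      by (rule Lim_null_comparison[rotated]) (use L2_Cauchy_Schwarz[OF L2_diff[OF hL gL] kL] in auto)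
    have "L2_inner \<Omega> (\<lambda>x. f x - g x) k = L2_inner \<Omega> (\<lambda>x. f x - h n x) k + L2_inner \<Omega> (\<lambda>x. h n x - g x) k" for n
      using L2_inner_add_left[OF fh[of n] L2_diff[OF hL[of n] gL] kL] by simp
    with tendsto_add[OF 1 2] show ?thesis by (simp add: LIMSEQ_const_iff)
  qed
  then show ?thesis using g(1) by blast
qed

lemma bounded_measurable_L2:
  assumes "\<Omega> \<in> lmeasurable" "f \<in> borel_measurable (lebesgue_on \<Omega>)" "\<And>x. x \<in> \<Omega> \<Longrightarrow> norm (f x) \<le> C"
  shows "f \<in> L2 \<Omega>" and "L2_norm \<Omega> f \<le> C * sqrt (measure lebesgue \<Omega>)"
proof -
  have fin: "finite_measure (lebesgue_on \<Omega>)" by (rule finite_measure_lebesgue_on[OF assms(1)])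
  have sq: "(norm (f x))\<^sup>2 \<le> C\<^sup>2" if "x \<in> \<Omega>" for x using assms(3)[OF that] by (intro power_mono) auto
  have i: "integrable (lebesgue_on \<Omega>) (\<lambda>x. (norm (f x))\<^sup>2)"
    using assms(2) sq by (intro finite_measure.integrable_const_bound[OF fin, of _ "C\<^sup>2"]) (auto intro!: AE_I2)
  show "f \<in> L2 \<Omega>" using i assms(2) by (simp add: L2_def)
  have m: "measure (lebesgue_on \<Omega>) (space (lebesgue_on \<Omega>)) = measure lebesgue \<Omega>"
    using assms(1) by (simp add: measure_restrict_space fmeasurable_def)
  show "L2_norm \<Omega> f \<le> C * sqrt (measure lebesgue \<Omega>)"
  proof (cases "\<Omega> = {}")
    case True
    then show ?thesis by (simp add: L2_norm_def integral_eq_zero_null_sets)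
  next
    case False
    then have "C \<ge> 0" using assms(3) by (meson all_not_in_conv norm_ge_zero order_trans)
    have "(LINT x|lebesgue_on \<Omega>. (norm (f x))\<^sup>2) \<le> (LINT x|lebesgue_on \<Omega>. C\<^sup>2)"
      by (rule integral_mono[OF i]) (use sq finite_measure.integrable_const[OF fin] in auto)
    also have "\<dots> = C\<^sup>2 * measure lebesgue \<Omega>" using m by simp
    finally have "L2_norm \<Omega> f \<le> sqrt (C\<^sup>2 * measure lebesgue \<Omega>)" by (simp add: L2_norm_def)
    then show ?thesis using \<open>C \<ge> 0\<close> by (simp add: real_sqrt_mult)
  qed
qed

lemma continuous_measurable_lebesgue_on:
  "continuous_on \<Omega> f \<Longrightarrow> open \<Omega> \<Longrightarrow> f \<in> borel_measurable (lebesgue_on \<Omega>)"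
  by (intro continuous_imp_measurable_on_sets_lebesgue) auto

lemma bounded_open_lmeasurable: "open \<Omega> \<Longrightarrow> bounded \<Omega> \<Longrightarrow> \<Omega> \<in> lmeasurable"
  by (simp add: bounded_set_imp_lmeasurable lmeasurable_open)

lemma smooth_closure_bounded:
  assumes "f \<in> smooth_closure \<Omega>" "bounded \<Omega>"
  shows "bounded (f ` \<Omega>)"
  using ksmooth_bounded[OF smooth_closure_ksmooth_True[OF assms]] by blast

lemma smooth_closure_L2:
  assumes "f \<in> smooth_closure \<Omega>" "open \<Omega>" "bounded \<Omega>"
  shows "f \<in> L2 \<Omega>"
proof -
  obtain C where "\<And>x. x \<in> \<Omega> \<Longrightarrow> norm (f x) \<le> C"
    using smooth_closure_bounded[OF assms(1,3)] unfolding bounded_iff by auto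
  moreover have "continuous_on \<Omega> f" using assms smooth_on_continuous unfolding smooth_closure_def by blast
  ultimately show ?thesis
    by (intro bounded_measurable_L2 bounded_open_lmeasurable continuous_measurable_lebesgue_on assms) auto
qed

section \<open>Differentiation of integrals\<close>

lemma norm_linear_le_sum_Basis:
  fixes L :: "'a::euclidean_space \<Rightarrow> 'b::real_normed_vector"
  assumes "linear L"
  shows "norm (L v) \<le> (\<Sum>b\<in>Basis. norm (L b)) * norm v"
proof -
  have "L v = L (\<Sum>b\<in>Basis. (v \<bullet> b) *\<^sub>R b)" by (simp add: euclidean_representation)
  also have "\<dots> = (\<Sum>b\<in>Basis. (v \<bullet> b) *\<^sub>R L b)" using assms by (simp add: linear_sum linear_cmul)
  also have "norm \<dots> \<le> (\<Sum>b\<in>Basis. norm ((v \<bullet> b) *\<^sub>R L b))" by (rule norm_sum)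
  also have "\<dots> \<le> (\<Sum>b\<in>Basis. norm v * norm (L b))"
    by (intro sum_mono) (auto intro!: mult_right_mono Basis_le_norm)
  finally show ?thesis by (simp add: sum_distrib_left mult.commute)
qed

lemma ksmooth_derivative_bounded:
  fixes f :: "'a::euclidean_space \<Rightarrow> 'b::real_normed_vector"
  assumes "ksmooth True S (Suc 0) f"
  obtains C where "C > 0" "\<And>x v. x \<in> S \<Longrightarrow> norm (frechet_derivative f (at x) v) \<le> C * norm v"
proof -
  have "\<exists>c. \<forall>x\<in>S. norm (frechet_derivative f (at x) b) \<le> c" if "b \<in> Basis" for b :: 'a
    using assms that by (auto simp: bounded_iff)
  then obtain c where c: "\<And>b x. b \<in> Basis \<Longrightarrow> x \<in> S \<Longrightarrow> norm (frechet_derivative f (at x) b) \<le> c b" by metis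
  show thesis
  proof (rule that[of "1 + \<bar>\<Sum>b\<in>Basis. c b\<bar>"])
    fix x v assume x: "x \<in> S"
    have "norm (frechet_derivative f (at x) v) \<le> (\<Sum>b\<in>Basis. norm (frechet_derivative f (at x) b)) * norm v"
      using assms x by (intro norm_linear_le_sum_Basis linear_frechet_derivative) auto
    also have "\<dots> \<le> (\<Sum>b\<in>Basis. c b) * norm v"
      using c x by (intro mult_right_mono sum_mono) auto
    also have "\<dots> \<le> (1 + \<bar>\<Sum>b\<in>Basis. c b\<bar>) * norm v" by (intro mult_right_mono) auto
    finally show "norm (frechet_derivative f (at x) v) \<le> (1 + \<bar>\<Sum>b\<in>Basis. c b\<bar>) * norm v" .
  qed auto
qed

lemma lipschitz_of_derivative_bound:
  fixes f :: "'a::euclidean_space \<Rightarrow> 'b::real_normed_vector"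
  assumes "convex S" "\<And>z. z \<in> S \<Longrightarrow> f differentiable (at z)"
    and "\<And>z v. z \<in> S \<Longrightarrow> norm (frechet_derivative f (at z) v) \<le> C * norm v"
    and "x \<in> S" "y \<in> S"
  shows "norm (f x - f y) \<le> C * norm (x - y)"
proof (rule differentiable_bound[OF assms(1) _ _ assms(4,5)])
  show "(f has_derivative frechet_derivative f (at z)) (at z within S)" if "z \<in> S" for z
    using assms(2)[OF that] by (simp add: frechet_derivative_works has_derivative_at_withinI)
  show "onorm (frechet_derivative f (at z)) \<le> C" if "z \<in> S" for z
    using assms(3)[OF that] by (intro onorm_le) auto
qed

text \<open>The remainder is bounded uniformly in \<open>x\<close>, as needed to differentiate a convolution under the integral sign.\<close>

lemma test_function_taylor:
  fixes f :: "'a::euclidean_space \<Rightarrow> complex"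
  assumes "f \<in> test_functions UNIV"
  obtains C where "C > 0" "\<And>x v. norm (f (x + v) - f x - frechet_derivative f (at x) v) \<le> C * (norm v)\<^sup>2"
proof -
  have sm: "smooth_on UNIV f" using assms by (simp add: test_functions_def)
  have bd: "bounded (range (iter_partial bs f))" if "bs \<in> lists Basis" for bs
    by (rule test_function_bounded[OF test_function_iter_partial[OF assms that]])
  have k: "ksmooth True UNIV n f" for n
    unfolding ksmooth_iter_partial using bd sm by (auto simp: smooth_on_def)
  let ?D = "\<lambda>b x. frechet_derivative f (at x) b"
  have "\<exists>C. \<forall>x y. norm (?D b x - ?D b y) \<le> C * norm (x - y)" if b: "b \<in> Basis" for b
  proof -
    have kb: "ksmooth True UNIV (Suc 0) (?D b)" using k[of "Suc (Suc 0)"] b by simp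
    obtain C where C: "\<And>x v. x \<in> UNIV \<Longrightarrow> norm (frechet_derivative (?D b) (at x) v) \<le> C * norm v"
      using ksmooth_derivative_bounded[OF kb] by metis
    have "norm (?D b x - ?D b y) \<le> C * norm (x - y)" for x y
      by (rule lipschitz_of_derivative_bound[of UNIV]) (use C kb in auto)
    then show ?thesis by blast
  qed
  then obtain c where c: "\<And>b x y. b \<in> Basis \<Longrightarrow> norm (?D b x - ?D b y) \<le> c b * norm (x - y)" by metis
  define C where "C = 1 + (\<Sum>b\<in>Basis. \<bar>c b\<bar>)"
  have C: "C \<ge> 0" by (simp add: C_def sum_nonneg)
  have der: "(f has_derivative frechet_derivative f (at x)) (at x)" for x
    using sm smooth_on_differentiable by (auto simp: frechet_derivative_works[symmetric])
  have dif: "norm (?D v x - ?D v y) \<le> C * norm (x - y) * norm v" for x y v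
  proof -
    have lin: "linear (\<lambda>v. ?D v x - ?D v y)"
      using der has_derivative_linear by (intro linear_compose_sub) auto
    have "norm (?D v x - ?D v y) \<le> (\<Sum>b\<in>Basis. norm (?D b x - ?D b y)) * norm v"
      by (rule norm_linear_le_sum_Basis[OF lin])
    also have "\<dots> \<le> (\<Sum>b\<in>Basis. \<bar>c b\<bar> * norm (x - y)) * norm v"
      by (intro mult_right_mono sum_mono order_trans[OF c]) (auto intro: mult_right_mono)
    also have "\<dots> \<le> C * norm (x - y) * norm v"
      unfolding C_def by (simp add: sum_distrib_right[symmetric] algebra_simps)
    finally show ?thesis .
  qed
  have "norm (f (x + v) - f x - frechet_derivative f (at x) v) \<le> C * (norm v)\<^sup>2" for x v
  proof -
    have "norm (f (x + v) - f x - frechet_derivative f (at x) (x + v - x)) \<le> norm (x + v - x) * (C * norm v)"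
    proof (rule differentiable_bound_linearization[where S="cball x (norm v)"])
      show "x + t *\<^sub>R (x + v - x) \<in> cball x (norm v)" if "t \<in> {0..1}" for t
        using that by (auto simp: dist_norm intro: mult_left_le_one_le)
      show "(f has_derivative frechet_derivative f (at y)) (at y within cball x (norm v))" for y
        using der has_derivative_at_withinI by blast
      show "onorm (frechet_derivative f (at y) - frechet_derivative f (at x)) \<le> C * norm v" if "y \<in> cball x (norm v)" for y
      proof (rule onorm_le)
        fix u
        have "norm (?D u y - ?D u x) \<le> C * norm (y - x) * norm u" by (rule dif)
        also have "\<dots> \<le> C * norm v * norm u"
          using that C by (intro mult_right_mono mult_left_mono) (auto simp: dist_norm norm_minus_commute)
        finally show "norm ((frechet_derivative f (at y) - frechet_derivative f (at x)) u) \<le> C * norm v * norm u" by simp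
      qed
    qed auto
    then show ?thesis by (simp add: power2_eq_square mult.commute mult.left_commute)
  qed
  moreover have "C > 0" by (simp add: C_def add_pos_nonneg sum_nonneg)
  ultimately show thesis using that by blast
qed

lemma integrable_mult_bounded_continuous:
  fixes g \<phi> :: "'a::euclidean_space \<Rightarrow> complex"
  assumes "integrable (lebesgue_on \<Omega>) g" "continuous_on UNIV \<phi>" "bounded (range \<phi>)"
  shows "integrable (lebesgue_on \<Omega>) (\<lambda>z. g z * \<phi> z)"
proof -
  obtain C where C: "\<And>z. norm (\<phi> z) \<le> C" using assms(3) by (auto simp: bounded_iff)
  have "\<phi> \<in> borel_measurable lebesgue" using assms(2) by (intro measurable_completion) (simp add: borel_measurable_continuous_onI)
  then have m: "\<phi> \<in> borel_measurable (lebesgue_on \<Omega>)" by (rule measurable_restrict_space1)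
  show ?thesis
  proof (rule Bochner_Integration.integrable_bound)
    show "integrable (lebesgue_on \<Omega>) (\<lambda>z. C * norm (g z))" using assms(1) by auto
    show "(\<lambda>z. g z * \<phi> z) \<in> borel_measurable (lebesgue_on \<Omega>)"
      using m assms(1) by (intro borel_measurable_times) auto
    have "norm (g z * \<phi> z) \<le> norm (C * norm (g z))" for z
      using C[of z] mult_right_mono[OF C[of z] norm_ge_zero[of "g z"]] order_trans[OF norm_ge_zero C[of z]]
      by (simp add: norm_mult abs_mult mult.commute)
    then show "AE z in lebesgue_on \<Omega>. norm (g z * \<phi> z) \<le> norm (C * norm (g z))" by auto
  qed
qed

text \<open>All derivatives fall on the test function; for the first one, the uniform Taylor estimate bounds the error of the
  linear approximation for an increment \<open>v\<close> by a multiple of \<open>\<bar>v\<bar>\<^sup>2\<close> times the \<open>L\<^sup>1\<close> norm of \<open>g\<close>.\<close>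

lemma convolution_has_derivative:
  fixes g \<phi> :: "'a::euclidean_space \<Rightarrow> complex"
  assumes g: "integrable (lebesgue_on \<Omega>) g" and \<phi>: "\<phi> \<in> test_functions UNIV"
  shows "((\<lambda>w. LINT z|lebesgue_on \<Omega>. g z * \<phi> (z - w)) has_derivative
     (\<lambda>v. - (LINT z|lebesgue_on \<Omega>. g z * frechet_derivative \<phi> (at (z - w)) v))) (at w)"
proof -
  let ?M = "lebesgue_on \<Omega>"
  let ?D = "\<lambda>v x. frechet_derivative \<phi> (at x) v"
  obtain C where C: "C > 0" "\<And>x v. norm (\<phi> (x + v) - \<phi> x - ?D v x) \<le> C * (norm v)\<^sup>2"
    using test_function_taylor[OF \<phi>] by metis
  have sm: "smooth_on UNIV \<phi>" using \<phi> by (simp add: test_functions_def)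
  have der: "(\<phi> has_derivative frechet_derivative \<phi> (at x)) (at x)" for x
    using sm smooth_on_differentiable by (auto simp: frechet_derivative_works[symmetric])
  have lin: "linear (frechet_derivative \<phi> (at x))" for x using der has_derivative_linear by blast
  have cont_shift: "continuous_on UNIV (\<lambda>z. f (z - w))" and bd_shift: "bounded (range (\<lambda>z. f (z - w)))"
    if f: "f \<in> test_functions UNIV" for f :: "'a \<Rightarrow> complex" and w
  proof -
    have "continuous_on UNIV f" using f smooth_on_continuous by (auto simp: test_functions_def)
    then show "continuous_on UNIV (\<lambda>z. f (z - w))" by (rule continuous_on_compose2) (auto intro!: continuous_intros)
    show "bounded (range (\<lambda>z. f (z - w)))" by (rule bounded_subset[OF test_function_bounded[OF f]]) auto
  qed
  have int0: "integrable ?M (\<lambda>z. g z * f (z - w))" if "f \<in> test_functions UNIV" for f w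
    by (rule integrable_mult_bounded_continuous[OF g cont_shift[OF that] bd_shift[OF that]])
  have intD: "integrable ?M (\<lambda>z. g z * ?D v (z - w))" for v
  proof -
    have "?D v x = (\<Sum>b\<in>Basis. complex_of_real (v \<bullet> b) * ?D b x)" for x
      by (subst euclidean_representation[of v, symmetric])
         (simp add: linear_sum[OF lin] linear_cmul[OF lin] scaleR_conv_of_real)
    then have "(\<lambda>z. g z * ?D v (z - w)) = (\<lambda>z. \<Sum>b\<in>Basis. complex_of_real (v \<bullet> b) * (g z * ?D b (z - w)))"
      by (simp add: sum_distrib_left mult.left_commute)
    moreover have "integrable ?M (\<lambda>z. g z * ?D b (z - w))" if "b \<in> Basis" for b
      using int0[of "?D b" w] test_function_iter_partial[OF \<phi>, of "[b]"] that by simp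
    ultimately show ?thesis by simp
  qed
  let ?L = "\<lambda>v. - (LINT z|?M. g z * ?D v (z - w))"
  let ?u = "\<lambda>w. LINT z|?M. g z * \<phi> (z - w)"
  define K where "K = C * (LINT z|?M. norm (g z))"
  have K: "K \<ge> 0" using C(1) by (simp add: K_def)
  have rem: "norm (?u y - ?u w - ?L (y - w)) \<le> K * (norm (y - w))\<^sup>2" for y
  proof -
    have eq: "?u y - ?u w - ?L (y - w) = (LINT z|?M. g z * (\<phi> (z - y) - \<phi> (z - w) + ?D (y - w) (z - w)))"
      using int0[OF \<phi>, of y] int0[OF \<phi>, of w] intD[of "y - w"] by (simp add: distrib_left right_diff_distrib)
    have "norm (?u y - ?u w - ?L (y - w)) \<le> (LINT z|?M. norm (g z * (\<phi> (z - y) - \<phi> (z - w) + ?D (y - w) (z - w))))"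
      unfolding eq by (rule integral_norm_bound)
    also have "\<dots> \<le> (LINT z|?M. (C * (norm (y - w))\<^sup>2) * norm (g z))"
    proof (rule integral_mono)
      have "integrable ?M (\<lambda>z. g z * \<phi> (z - y) - g z * \<phi> (z - w) + g z * ?D (y - w) (z - w))"
        by (rule Bochner_Integration.integrable_add[OF Bochner_Integration.integrable_diff[OF int0[OF \<phi>] int0[OF \<phi>]] intD])
      then show "integrable ?M (\<lambda>z. norm (g z * (\<phi> (z - y) - \<phi> (z - w) + ?D (y - w) (z - w))))"
        by (simp add: distrib_left right_diff_distrib)
      show "integrable ?M (\<lambda>z. (C * (norm (y - w))\<^sup>2) * norm (g z))" using g by auto
      fix z
      have "norm (\<phi> ((z - w) + (w - y)) - \<phi> (z - w) - ?D (w - y) (z - w)) \<le> C * (norm (w - y))\<^sup>2" by (rule C)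
      moreover have "?D (w - y) (z - w) = - ?D (y - w) (z - w)"
        using linear_neg[OF lin, of "z - w" "y - w"] by simp
      ultimately have "norm (\<phi> (z - y) - \<phi> (z - w) + ?D (y - w) (z - w)) \<le> C * (norm (y - w))\<^sup>2"
        by (simp add: norm_minus_commute)
      then show "norm (g z * (\<phi> (z - y) - \<phi> (z - w) + ?D (y - w) (z - w))) \<le> (C * (norm (y - w))\<^sup>2) * norm (g z)"
        unfolding norm_mult by (subst mult.commute) (rule mult_right_mono, auto)
    qed
    also have "\<dots> = K * (norm (y - w))\<^sup>2" by (simp add: K_def)
    finally show ?thesis .
  qed
  have lin_L: "linear ?L"
  proof (rule linearI)
    show "?L (a + b) = ?L a + ?L b" for a b
      using intD by (simp add: linear_add[OF lin] distrib_left)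
    show "?L (r *\<^sub>R a) = r *\<^sub>R ?L a" for r a
      by (simp add: linear_cmul[OF lin])
  qed
  show ?thesis unfolding has_derivative_at_alt
  proof (intro conjI allI impI)
    show "bounded_linear ?L" using lin_L by (simp add: linear_conv_bounded_linear)
    fix e :: real assume e: "e > 0"
    show "\<exists>d>0. \<forall>y. norm (y - w) < d \<longrightarrow> norm (?u y - ?u w - ?L (y - w)) \<le> e * norm (y - w)"
    proof (intro exI[of _ "e / (K + 1)"] conjI allI impI)
      fix y assume y: "norm (y - w) < e / (K + 1)"
      then have "K * norm (y - w) \<le> e" using K e
        by (smt (verit, best) mult_right_mono norm_ge_zero pos_less_divide_eq mult.commute)
      then have "K * norm (y - w) * norm (y - w) \<le> e * norm (y - w)" by (rule mult_right_mono) simp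
      then show "norm (?u y - ?u w - ?L (y - w)) \<le> e * norm (y - w)"
        using rem[of y] by (simp add: power2_eq_square mult.assoc)
    qed (use e K in auto)
  qed
qed

lemma convolution_iter_partial:
  fixes g \<phi> :: "'a::euclidean_space \<Rightarrow> complex"
  assumes g: "integrable (lebesgue_on \<Omega>) g" and \<phi>: "\<phi> \<in> test_functions UNIV" and bs: "bs \<in> lists Basis"
  shows "iter_partial bs (\<lambda>w. LINT z|lebesgue_on \<Omega>. g z * \<phi> (z - w)) =
    (\<lambda>w. (-1) ^ length bs * (LINT z|lebesgue_on \<Omega>. g z * iter_partial bs \<phi> (z - w)))"
  using bs
proof (induction bs)
  case (Cons b bs)
  have "((\<lambda>w. (-1) ^ length bs * (LINT z|lebesgue_on \<Omega>. g z * iter_partial bs \<phi> (z - w))) has_derivative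
     (\<lambda>v. (-1) ^ length bs * (- (LINT z|lebesgue_on \<Omega>. g z * frechet_derivative (iter_partial bs \<phi>) (at (z - w)) v)))) (at w)" for w
    by (rule has_derivative_mult_right[OF convolution_has_derivative[OF g test_function_iter_partial[OF \<phi>]]])
       (use Cons.hyps in simp)
  from frechet_derivative_eqI[OF this] show ?case by (simp add: Cons.IH)
qed simp

lemma convolution_smooth:
  fixes g \<phi> :: "'a::euclidean_space \<Rightarrow> complex"
  assumes g: "integrable (lebesgue_on \<Omega>) g" and \<phi>: "\<phi> \<in> test_functions UNIV"
  shows "smooth_on UNIV (\<lambda>w. LINT z|lebesgue_on \<Omega>. g z * \<phi> (z - w))"
  unfolding smooth_on_def
proof (intro conjI ballI)
  fix bs :: "'a list" and w :: 'a assume bs: "bs \<in> lists Basis"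
  have "((\<lambda>w. (-1) ^ length bs * (LINT z|lebesgue_on \<Omega>. g z * iter_partial bs \<phi> (z - w))) has_derivative
     (\<lambda>v. (-1) ^ length bs * (- (LINT z|lebesgue_on \<Omega>. g z * frechet_derivative (iter_partial bs \<phi>) (at (z - w)) v)))) (at w)"
    by (rule has_derivative_mult_right[OF convolution_has_derivative[OF g test_function_iter_partial[OF \<phi> bs]]])
  then show "iter_partial bs (\<lambda>w. LINT z|lebesgue_on \<Omega>. g z * \<phi> (z - w)) differentiable at w"
    unfolding convolution_iter_partial[OF assms bs] by (rule differentiableI)
qed auto

lemma has_vector_derivative_iff_quotient:
  fixes f :: "real \<Rightarrow> 'b::real_normed_vector"
  shows "(f has_vector_derivative d) (at t) \<longleftrightarrow> ((\<lambda>h. (1 / h) *\<^sub>R (f (t + h) - f t)) \<longlongrightarrow> d) (at 0)"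
proof -
  have e: "norm (f (t + h) - f t - h *\<^sub>R d) / norm h = norm ((1 / h) *\<^sub>R (f (t + h) - f t) - d)" if "h \<noteq> 0" for h
  proof -
    have "(1 / h) *\<^sub>R (f (t + h) - f t) - d = (1 / h) *\<^sub>R (f (t + h) - f t - h *\<^sub>R d)"
      using that by (simp add: scaleR_diff_right)
    then show ?thesis by (simp add: divide_inverse mult.commute)
  qed
  have "(f has_vector_derivative d) (at t) \<longleftrightarrow> ((\<lambda>h. norm (f (t + h) - f t - h *\<^sub>R d) / norm h) \<longlongrightarrow> 0) (at 0)"
    unfolding has_vector_derivative_def has_derivative_at by (simp add: bounded_linear_scaleR_left)
  also have "\<dots> \<longleftrightarrow> ((\<lambda>h. norm ((1 / h) *\<^sub>R (f (t + h) - f t) - d)) \<longlongrightarrow> 0) (at 0)"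
    by (intro tendsto_cong) (use e in \<open>simp add: eventually_at_filter\<close>)
  also have "\<dots> \<longleftrightarrow> ((\<lambda>h. (1 / h) *\<^sub>R (f (t + h) - f t)) \<longlongrightarrow> d) (at 0)"
    by (simp add: tendsto_norm_zero_iff LIM_zero_iff)
  finally show ?thesis .
qed

lemma integral_has_vector_derivative:
  fixes F :: "real \<Rightarrow> 'a \<Rightarrow> complex"
  assumes e: "e > 0" and int: "\<And>t. \<bar>t - s\<bar> < e \<Longrightarrow> integrable M (F t)"
    and der: "\<And>t x. \<bar>t - s\<bar> < e \<Longrightarrow> x \<in> space M \<Longrightarrow> ((\<lambda>t. F t x) has_vector_derivative F' t x) (at t)"
    and bd: "\<And>t x. \<bar>t - s\<bar> < e \<Longrightarrow> x \<in> space M \<Longrightarrow> norm (F' t x) \<le> G x" and G: "integrable M G"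
  shows "((\<lambda>t. LINT x|M. F t x) has_vector_derivative (LINT x|M. F' s x)) (at s)"
    and "integrable M (F' s)"
proof -
  let ?q = "\<lambda>h x. (1 / h) *\<^sub>R (F (s + h) x - F s x)"
  have pt: "((\<lambda>h. ?q h x) \<longlongrightarrow> F' s x) (at 0)" if "x \<in> space M" for x
    using der[of s x] e that unfolding has_vector_derivative_iff_quotient by simp
  have lip: "norm (?q h x) \<le> G x" if h: "\<bar>h\<bar> < e" and x: "x \<in> space M" for h x
  proof (cases "h = 0")
    case True
    have "0 \<le> G x" using bd[of s x] e x by (simp add: order_trans[OF norm_ge_zero])
    then show ?thesis using True by simp
  next
    case False
    have "norm (F (s + h) x - F s x) \<le> G x * norm (s + h - s)"
    proof (rule differentiable_bound[of "ball s e" _ "\<lambda>t d. d *\<^sub>R F' t x"])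
      show "((\<lambda>t. F t x) has_derivative (\<lambda>d. d *\<^sub>R F' t x)) (at t within ball s e)" if "t \<in> ball s e" for t
        using der[of t x] that x by (auto simp: has_vector_derivative_def dist_real_def abs_minus_commute intro: has_derivative_at_withinI)
      show "onorm (\<lambda>d. d *\<^sub>R F' t x) \<le> G x" if "t \<in> ball s e" for t
        using bd[of t x] that x by (intro onorm_le) (auto simp: dist_real_def abs_minus_commute mult.commute[of "G x"] intro: mult_left_mono)
    qed (use h e in \<open>auto simp: dist_real_def\<close>)
    then have "norm (F (s + h) x - F s x) / \<bar>h\<bar> \<le> G x" using False by (simp add: pos_divide_le_eq)
    then show ?thesis by (simp add: divide_inverse mult.commute)
  qed
  have ev: "\<forall>\<^sub>F h in at (0::real). \<bar>h\<bar> < e" using e by (auto simp: eventually_at dist_real_def)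
  have meas: "F' s \<in> borel_measurable M"
  proof (rule borel_measurable_LIMSEQ_metric)
    fix n show "?q (e / real (n + 2)) \<in> borel_measurable M"
    proof -
      have "e / real (n + 2) < e / 1" using e by (intro divide_strict_left_mono) auto
      then have "integrable M (F (s + e / real (n + 2)))" "integrable M (F s)" using e by (auto intro!: int)
      then show ?thesis by (intro borel_measurable_scaleR borel_measurable_diff) auto
    qed
  next
    fix x assume x: "x \<in> space M"
    have "(\<lambda>n. e * (1 / real (n + 2))) \<longlonglongrightarrow> e * 0"
      by (intro tendsto_mult tendsto_const) (use LIMSEQ_ignore_initial_segment[OF lim_1_over_n, of 2] in simp)
    then have "filterlim (\<lambda>n. e / real (n + 2)) (at 0) sequentially"
      using e by (auto simp: filterlim_at)
    from filterlim_compose[OF pt[OF x] this] show "(\<lambda>n. ?q (e / real (n + 2)) x) \<longlonglongrightarrow> F' s x" .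
  qed
  show I: "integrable M (F' s)"
    by (rule Bochner_Integration.integrable_bound[OF G meas])
       (use bd[of s] e in \<open>auto intro!: AE_I2 order_trans[OF _ abs_ge_self]\<close>)
  have "((\<lambda>h. LINT x|M. ?q h x) \<longlongrightarrow> (LINT x|M. F' s x)) (at 0)"
  proof (rule tendsto_at_iff_sequentially[THEN iffD2], intro allI impI)
    fix X :: "nat \<Rightarrow> real" assume X: "\<forall>i. X i \<in> UNIV - {0}" "X \<longlonglongrightarrow> 0"
    have "eventually (\<lambda>i. dist (X i) 0 < e) sequentially" using X(2) e tendstoD by blast
    then obtain N where N: "\<And>i. i \<ge> N \<Longrightarrow> \<bar>X i\<bar> < e" by (auto simp: eventually_sequentially)
    have "(\<lambda>i. LINT x|M. ?q (X (i + N)) x) \<longlonglongrightarrow> (LINT x|M. F' s x)"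
    proof (rule integral_dominated_convergence[where w=G])
      show "F' s \<in> borel_measurable M" by (rule meas)
      show "?q (X (i + N)) \<in> borel_measurable M" for i
      proof -
        have "integrable M (F (s + X (i + N)))" "integrable M (F s)" using N[of "i + N"] e by (auto intro!: int)
        then show ?thesis by (intro borel_measurable_scaleR borel_measurable_diff) auto
      qed
      show "AE x in M. (\<lambda>i. ?q (X (i + N)) x) \<longlonglongrightarrow> F' s x"
      proof (rule AE_I2)
        fix x assume x: "x \<in> space M"
        have "filterlim (\<lambda>i. X (i + N)) (at 0) sequentially"
          using X LIMSEQ_ignore_initial_segment[OF X(2), of N] by (auto simp: filterlim_at)
        from filterlim_compose[OF pt[OF x] this] show "(\<lambda>i. ?q (X (i + N)) x) \<longlonglongrightarrow> F' s x" .
      qed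
      show "AE x in M. norm (?q (X (i + N)) x) \<le> G x" for i
        using lip[of "X (i + N)"] N[of "i + N"] by (intro AE_I2) auto
    qed (rule G)
    then have "(\<lambda>i. LINT x|M. ?q (X i) x) \<longlonglongrightarrow> (LINT x|M. F' s x)" by (rule LIMSEQ_offset)
    then show "((\<lambda>h. LINT x|M. ?q h x) \<circ> X) \<longlonglongrightarrow> (LINT x|M. F' s x)" by (simp add: comp_def)
  qed
  then have "((\<lambda>h. (1 / h) *\<^sub>R ((LINT x|M. F (s + h) x) - (LINT x|M. F s x))) \<longlongrightarrow> (LINT x|M. F' s x)) (at 0)"
  proof (rule Lim_transform_eventually)
    show "\<forall>\<^sub>F h in at 0. (LINT x|M. ?q h x) = (1 / h) *\<^sub>R ((LINT x|M. F (s + h) x) - (LINT x|M. F s x))"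
      using ev by eventually_elim (use int e in \<open>simp add: Bochner_Integration.integral_diff\<close>)
  qed
  then show "((\<lambda>t. LINT x|M. F t x) has_vector_derivative (LINT x|M. F' s x)) (at s)"
    unfolding has_vector_derivative_iff_quotient .
qed

lemma integrable_compact_support:
  fixes f :: "'a::euclidean_space \<Rightarrow> complex"
  assumes "continuous_on UNIV f" "\<And>x. norm x \<ge> R \<Longrightarrow> f x = 0"
  shows "integrable lborel f"
proof -
  have "continuous_on (cball 0 R) f" using assms continuous_on_subset by blast
  then have "integrable lborel (\<lambda>x. indicator (cball 0 R) x *\<^sub>R f x)"
    using borel_integrable_compact[OF compact_cball] by (simp add: set_integrable_def)
  moreover have "(\<lambda>x. indicator (cball 0 R) x *\<^sub>R f x) = f"
    using assms(2) by (fastforce simp: indicator_def fun_eq_iff)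
  ultimately show ?thesis by simp
qed

text \<open>The integral of \<open>f (x + t b)\<close> over \<open>x\<close> does not depend on \<open>t\<close>; differentiate at \<open>t = 0\<close>.\<close>

lemma integral_partial_eq_0:
  fixes f :: "'a::euclidean_space \<Rightarrow> complex"
  assumes der: "\<And>x. (f has_derivative f' x) (at x)" and supp: "\<And>x. norm x \<ge> R \<Longrightarrow> f x = 0"
    and bd: "\<And>x. norm (f' x b) \<le> C"
  shows "(LINT x|lborel. f' x b) = 0" and "integrable lborel (\<lambda>x. f' x b)"
proof -
  let ?F = "\<lambda>t x. f (x + t *\<^sub>R b)"
  have cont: "continuous_on UNIV f"
    using has_derivative_continuous[OF der] by (simp add: continuous_at_imp_continuous_on)
  have shift: "integral\<^sup>L lborel (?F t) = integral\<^sup>L lborel f" and ints: "integrable lborel (?F t)" for t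
  proof -
    have fm: "f \<in> borel_measurable borel" using cont by (rule borel_measurable_continuous_onI)
    have "integral\<^sup>L (distr lborel borel ((+) (t *\<^sub>R b))) f = integral\<^sup>L lborel (\<lambda>x. f (t *\<^sub>R b + x))"
      using fm by (intro integral_distr) auto
    then show "integral\<^sup>L lborel (?F t) = integral\<^sup>L lborel f" by (simp add: lborel_distr_plus add.commute)
    have "integrable lborel f" by (rule integrable_compact_support[OF cont supp])
    then have "integrable (distr lborel borel ((+) (t *\<^sub>R b))) f" by (simp add: lborel_distr_plus)
    then show "integrable lborel (?F t)" using fm by (subst (asm) integrable_distr_eq) (auto simp: add.commute)
  qed
  define R' where "R' = max R 0 + 1 + norm b"
  have C0: "C \<ge> 0" using bd[of 0] by (rule order_trans[OF norm_ge_zero])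
  have zero: "f' x b = 0" if "norm x > R" for x
  proof -
    have "open {x::'a. norm x > R}" by (intro open_Collect_less continuous_intros)
    then have "((\<lambda>x. 0) has_derivative f' x) (at x)"
      by (rule has_derivative_transform_within_open[OF der]) (use that supp in auto)
    then have "f' x = (\<lambda>v. 0)" by (rule has_derivative_unique) simp
    then show ?thesis by simp
  qed
  have d: "((\<lambda>t. ?F t x) has_vector_derivative f' (x + t *\<^sub>R b) b) (at t)" for t x
  proof -
    have "((\<lambda>t. x + t *\<^sub>R b) has_derivative (\<lambda>d. d *\<^sub>R b)) (at t)" by (auto intro!: derivative_eq_intros)
    from has_derivative_compose[OF this der]
    have "((\<lambda>t. ?F t x) has_derivative (\<lambda>d. f' (x + t *\<^sub>R b) (d *\<^sub>R b))) (at t)" .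
    then show "((\<lambda>t. ?F t x) has_vector_derivative f' (x + t *\<^sub>R b) b) (at t)"
      unfolding has_vector_derivative_def using linear_cmul[OF has_derivative_linear[OF der]] by simp
  qed
  have n: "norm (f' (x + t *\<^sub>R b) b) \<le> C * indicator (cball 0 R') x" if t: "\<bar>t - 0\<bar> < 1" for t x
  proof (cases "x \<in> cball 0 R'")
    case False
    have "norm x \<le> norm (x + t *\<^sub>R b) + norm (t *\<^sub>R b)" using norm_triangle_ineq4[of "x + t *\<^sub>R b" "t *\<^sub>R b"] by simp
    moreover have "norm (t *\<^sub>R b) \<le> norm b" using t by (simp add: mult_left_le_one_le)
    ultimately have "norm (x + t *\<^sub>R b) > R" using False by (auto simp: R'_def)
    then show ?thesis using zero C0 by simp
  qed (use bd in auto)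
  have i: "integrable lborel (\<lambda>x. C * indicator (cball 0 R') x)"
    using emeasure_bounded_finite[OF bounded_cball] by (intro integrable_mult_right integrable_real_indicator) auto
  note * = integral_has_vector_derivative[where e=1 and s=0 and M=lborel and F="?F" and F'="\<lambda>t x. f' (x + t *\<^sub>R b) b"
      and G="\<lambda>x. C * indicator (cball 0 R') x", OF zero_less_one ints d n i]
  have "((\<lambda>t. integral\<^sup>L lborel (?F t)) has_vector_derivative 0) (at 0)" unfolding shift by simp
  with *(1) show "(LINT x|lborel. f' x b) = 0" using vector_derivative_unique_at by fastforce
  show "integrable lborel (\<lambda>x. f' x b)" using *(2) by simp
qed

section \<open>Holomorphic functions of several variables\<close>

lemma test_function_ksmooth_True:
  assumes "f \<in> test_functions \<Omega>"
  shows "ksmooth True UNIV n f"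
proof -
  have "bounded (range (iter_partial bs f))" if "bs \<in> lists Basis" for bs
    by (rule test_function_bounded[OF test_function_iter_partial[OF assms that]])
  moreover have "smooth_on UNIV f" using assms by (simp add: test_functions_def)
  ultimately show ?thesis unfolding ksmooth_iter_partial smooth_on_def by simp
qed

lemma norm_scalar_mult: "norm (c *s v) = norm c * norm (v :: complex^'n)"
  by (simp add: norm_vec_def vector_scalar_mult_def norm_mult L2_set_right_distrib)

lemma bounded_linear_scalar_mult_left: "bounded_linear (\<lambda>c. c *s (v :: complex^'n))"
  unfolding linear_conv_bounded_linear[symmetric]
  by (rule linearI) (auto simp: vec_eq_iff distrib_right)

lemma bounded_linear_scalar_mult_right: "bounded_linear (\<lambda>v :: complex^'n. c *s v)"
  unfolding linear_conv_bounded_linear[symmetric]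
  by (rule linearI) (auto simp: vec_eq_iff distrib_left)

lemma inner_ii_scalar_mult: "(\<i> *s v) \<bullet> v = 0" for v :: "complex^'n"
  by (simp add: inner_vec_def inner_complex_def vector_scalar_mult_def)

lemma scaleR_eq_scalar_mult: "r *\<^sub>R v = complex_of_real r *s v" for v :: "complex^'n"
  by (simp add: vec_eq_iff complex_eq_iff)

lemma holomorphic_several_derivative:
  assumes "holomorphic_several \<Omega> h" "z \<in> \<Omega>"
  shows "(h has_derivative frechet_derivative h (at z)) (at z)"
    and "frechet_derivative h (at z) (c *s v) = c * frechet_derivative h (at z) v"
proof -
  obtain D where D: "(h has_derivative D) (at z)" "\<forall>c v. D (c *s v) = c * D v"
    using assms unfolding holomorphic_several_def by blast
  have "frechet_derivative h (at z) = D" by (rule frechet_derivative_eqI[OF D(1)])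
  then show "(h has_derivative frechet_derivative h (at z)) (at z)"
    and "frechet_derivative h (at z) (c *s v) = c * frechet_derivative h (at z) v"
    using D by auto
qed

lemma holomorphic_several_continuous: "holomorphic_several \<Omega> h \<Longrightarrow> continuous_on \<Omega> h"
  by (rule continuous_at_imp_continuous_on) (metis holomorphic_several_derivative(1) has_derivative_continuous)

lemma holomorphic_several_line:
  assumes "holomorphic_several \<Omega> h" "z + \<mu> *s v \<in> \<Omega>"
  shows "((\<lambda>\<mu>. h (z + \<mu> *s v)) has_field_derivative frechet_derivative h (at (z + \<mu> *s v)) v) (at \<mu>)"
proof -
  have "((\<lambda>\<mu>. z + \<mu> *s v) has_derivative (\<lambda>d. d *s v)) (at \<mu>)"
    using bounded_linear_imp_has_derivative[OF bounded_linear_scalar_mult_left] by (auto intro!: derivative_eq_intros)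
  from has_derivative_compose[OF this holomorphic_several_derivative(1)[OF assms]]
  moreover have "(\<lambda>d. frechet_derivative h (at (z + \<mu> *s v)) (d *s v)) = (*) (frechet_derivative h (at (z + \<mu> *s v)) v)"
    unfolding holomorphic_several_derivative(2)[OF assms] by (simp add: fun_eq_iff)
  ultimately show ?thesis unfolding has_field_derivative_def by metis
qed

text \<open>The one-variable Cauchy estimate on the complex line in direction \<open>v\<close>.\<close>

lemma holomorphic_derivative_bound:
  assumes h: "holomorphic_several \<Omega> h" and r: "r > 0" "ball z r \<subseteq> \<Omega>" and B: "B > 0" "\<And>w. w \<in> ball z r \<Longrightarrow> norm (h w) \<le> B"
  shows "norm (frechet_derivative h (at z) v) \<le> 4 * B * norm v / r"
proof (cases "v = 0")
  case True
  have "z \<in> \<Omega>" using r by auto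
  then show ?thesis using True linear_0[OF has_derivative_linear[OF holomorphic_several_derivative(1)[OF h]]] by simp
next
  case False
  define g where "g \<mu> = h (z + \<mu> *s v)" for \<mu>
  define \<rho> where "\<rho> = r / (2 * norm v)"
  have \<rho>: "\<rho> > 0" using False r by (simp add: \<rho>_def)
  have inb: "z + \<mu> *s v \<in> ball z r" if "norm \<mu> \<le> \<rho>" for \<mu>
  proof -
    have "norm \<mu> * norm v \<le> \<rho> * norm v" using that by (rule mult_right_mono) simp
    also have "\<dots> = r / 2" using False by (simp add: \<rho>_def)
    finally show ?thesis using r by (simp add: dist_norm norm_scalar_mult)
  qed
  have der: "(g has_field_derivative frechet_derivative h (at (z + \<mu> *s v)) v) (at \<mu>)" if "norm \<mu> \<le> \<rho>" for \<mu>
    unfolding g_def by (rule holomorphic_several_line[OF h]) (use inb[OF that] r in auto)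
  have "cmod ((deriv ^^ 1) g 0) \<le> fact 1 * (2 * B) / \<rho> ^ 1"
  proof (rule Cauchy_higher_deriv_bound[where y=0])
    show "g holomorphic_on ball 0 \<rho>"
      unfolding holomorphic_on_def field_differentiable_def
      by (metis der has_field_derivative_at_within mem_ball_0 less_imp_le)
    show "continuous_on (cball 0 \<rho>) g"
      using der by (intro continuous_at_imp_continuous_on ballI) (metis DERIV_isCont mem_cball_0)
    show "g w \<in> ball 0 (2 * B)" if "w \<in> ball 0 \<rho>" for w
      using B(2)[OF inb[of w]] that B(1) by (simp add: g_def)
  qed (use \<rho> in auto)
  moreover have "deriv g 0 = frechet_derivative h (at z) v" using DERIV_imp_deriv[OF der[of 0]] \<rho> by simp
  ultimately show ?thesis using False by (simp add: \<rho>_def field_simps)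
qed

lemma linear_sum_Basis:
  fixes L :: "'a::euclidean_space \<Rightarrow> complex"
  assumes "linear L"
  shows "(\<Sum>b\<in>Basis. L b * of_real (v \<bullet> b)) = L v"
proof -
  have "L v = L (\<Sum>b\<in>Basis. (v \<bullet> b) *\<^sub>R b)" by (simp add: euclidean_representation)
  also have "\<dots> = (\<Sum>b\<in>Basis. (v \<bullet> b) *\<^sub>R L b)" using assms by (simp add: linear_sum linear_cmul)
  finally show ?thesis by (simp add: scaleR_conv_of_real mult.commute)
qed

text \<open>The field \<open>\<i> \<zeta>\<close> is tangent to the spheres about 0, on which the bump is constant.\<close>

lemma bump_derivative_rotation: "frechet_derivative (bump 0 r) (at \<zeta>) (\<i> *s \<zeta>) = 0" for \<zeta> :: "complex^'n"
proof -
  have "(smooth_step has_derivative frechet_derivative smooth_step (at y)) (at y)" for y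
    using smooth_on_differentiable[OF smooth_on_smooth_step] by (simp add: frechet_derivative_works)
  moreover have "((\<lambda>x. 2 - k * ((x - 0) \<bullet> (x - 0))) has_derivative (\<lambda>v. - (k * (2 * (\<zeta> \<bullet> v))))) (at \<zeta>)" for k
    by (auto intro!: derivative_eq_intros simp: inner_commute)
  from this[of "4 / r\<^sup>2"] have "((\<lambda>x. 2 - 4 * ((x - 0) \<bullet> (x - 0)) / r\<^sup>2) has_derivative (\<lambda>v. - (4 * (2 * (\<zeta> \<bullet> v)) / r\<^sup>2))) (at \<zeta>)"
    by simp
  ultimately have "((\<lambda>x. smooth_step (2 - 4 * ((x - 0) \<bullet> (x - 0)) / r\<^sup>2)) has_derivative
     (\<lambda>v. frechet_derivative smooth_step (at (2 - 4 * ((\<zeta> - 0) \<bullet> (\<zeta> - 0)) / r\<^sup>2)) (- (4 * (2 * (\<zeta> \<bullet> v)) / r\<^sup>2)))) (at \<zeta>)"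
    using has_derivative_compose by blast
  from has_derivative_of_real[OF this]
  have "frechet_derivative (bump 0 r) (at \<zeta>) = (\<lambda>v. of_real (frechet_derivative smooth_step (at (2 - 4 * ((\<zeta> - 0) \<bullet> (\<zeta> - 0)) / r\<^sup>2)) (- (4 * (2 * (\<zeta> \<bullet> v)) / r\<^sup>2))))"
    unfolding bump_def[abs_def] by (rule frechet_derivative_eqI)
  moreover have "linear (frechet_derivative smooth_step (at y))" for y
    using smooth_on_differentiable[OF smooth_on_smooth_step] by (simp add: linear_frechet_derivative)
  moreover have "\<zeta> \<bullet> (\<i> *s \<zeta>) = 0" by (metis inner_commute inner_ii_scalar_mult)
  ultimately show ?thesis by (simp add: linear_0)
qed

text \<open>The mean value property for radial weights. With \<open>G s = \<integral> h (w + s \<zeta>) \<psi> \<zeta>\<close> one has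
  \<open>G' s = \<integral> h' (w + s \<zeta>) \<zeta> \<psi> \<zeta>\<close>, and by complex linearity \<open>s h' (w + s \<zeta>) \<zeta>\<close> is \<open>-\<i>\<close> times the derivative
  of \<open>\<zeta> \<mapsto> h (w + s \<zeta>)\<close> along the rotation field \<open>\<i> \<zeta>\<close>. That field is divergence free and kills \<open>\<psi>\<close>,
  so the integral of a divergence remains, which is 0; hence \<open>G 1 = G 0\<close>.\<close>

lemma radial_mean_value:
  fixes h :: "complex^'n \<Rightarrow> complex"
  assumes h: "holomorphic_several \<Omega> h" and r: "r > 0" "ball w r \<subseteq> \<Omega>" "open \<Omega>"
  shows "(LINT \<zeta>|lborel. h (w + \<zeta>) * bump 0 r \<zeta>) = h w * (LINT \<zeta>|lborel. bump 0 r (\<zeta> :: complex^'n))"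
proof -
  define \<psi> where "\<psi> = (bump 0 r :: complex^'n \<Rightarrow> complex)"
  define h' where "h' x = frechet_derivative h (at x)" for x
  define \<psi>' where "\<psi>' x = frechet_derivative \<psi> (at x)" for x
  have d\<psi>: "(\<psi> has_derivative \<psi>' x) (at x)" for x
    unfolding \<psi>_def \<psi>'_def using smooth_on_differentiable[OF smooth_on_bump] by (simp add: frechet_derivative_works)
  have \<psi>0: "\<psi> x = 0" if "norm x \<ge> 3 * r / 4" for x unfolding \<psi>_def by (rule bump_eq_0) (use r that in auto)
  have \<psi>'0: "\<psi>' x = (\<lambda>v. 0)" if "norm x > 3 * r / 4" for x
  proof -
    have "open {x::complex^'n. norm x > 3 * r / 4}" by (intro open_Collect_less continuous_intros)
    then have "((\<lambda>x. 0) has_derivative \<psi>' x) (at x)"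
      by (rule has_derivative_transform_within_open[OF d\<psi>]) (use that \<psi>0 in auto)
    then show ?thesis by (rule has_derivative_unique) simp
  qed
  have \<psi>1: "norm (\<psi> x) \<le> 1" for x unfolding \<psi>_def by (rule norm_bump_le)
  have dh: "(h has_derivative h' x) (at x)" and h'c: "h' x (c *s v) = c * h' x v" if "x \<in> \<Omega>" for x c v
    using holomorphic_several_derivative[OF h that] by (auto simp: h'_def)
  have conth: "continuous_on \<Omega> h" by (rule holomorphic_several_continuous[OF h])
  have sub: "cball w (15 * r / 16) \<subseteq> \<Omega>" using r by (auto simp: subset_iff)
  have "compact (h ` cball w (15 * r / 16))"
    by (intro compact_continuous_image continuous_on_subset[OF conth sub] compact_cball)
  then have "bounded (h ` cball w (15 * r / 16))" by (rule compact_imp_bounded)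
  then obtain B0 where B0: "\<And>x. x \<in> cball w (15 * r / 16) \<Longrightarrow> norm (h x) \<le> B0"
    unfolding bounded_iff by blast
  define B where "B = \<bar>B0\<bar> + 1"
  have B: "norm (h x) \<le> B" if "x \<in> cball w (15 * r / 16)" for x using B0[OF that] by (simp add: B_def)
  have Bpos: "B > 0" by (simp add: B_def)
  have h'b: "norm (h' x v) \<le> 4 * B * norm v / (r / 16)" if x: "norm (x - w) \<le> 7 * r / 8" for x v
  proof -
    have s: "ball x (r / 16) \<subseteq> cball w (15 * r / 16)"
    proof
      fix y assume "y \<in> ball x (r / 16)"
      then have "dist w y \<le> 7 * r / 8 + r / 16"
        using dist_triangle[of w y x] x by (simp add: dist_norm norm_minus_commute)
      then show "y \<in> cball w (15 * r / 16)" by simp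
    qed
    show ?thesis unfolding h'_def
      by (rule holomorphic_derivative_bound[OF h]) (use r s sub B Bpos in auto)
  qed
  have inb: "norm ((w + s *\<^sub>R \<zeta>) - w) \<le> 7 * r / 8" if "norm \<zeta> \<le> 3 * r / 4" "\<bar>s\<bar> < 9/8" for s \<zeta>
  proof -
    have "\<bar>s\<bar> * norm \<zeta> \<le> 9/8 * (3 * r / 4)" using that by (intro mult_mono) auto
    then show ?thesis using r by simp
  qed
  have in\<Omega>: "w + s *\<^sub>R \<zeta> \<in> \<Omega>" if "norm \<zeta> \<le> 3 * r / 4" "\<bar>s\<bar> < 9/8" for s \<zeta>
    using inb[OF that] sub r by (auto simp: dist_norm norm_minus_commute subset_iff)
  have dE: "((\<lambda>\<zeta>. h (w + s *\<^sub>R \<zeta>) * \<psi> \<zeta>) has_derivative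
      (\<lambda>v. h (w + s *\<^sub>R \<zeta>) * \<psi>' \<zeta> v + h' (w + s *\<^sub>R \<zeta>) (s *\<^sub>R v) * \<psi> \<zeta>)) (at \<zeta>)" if s: "\<bar>s\<bar> < 9/8" for s \<zeta>
  proof (cases "norm \<zeta> \<le> 3 * r / 4")
    case True
    have "((\<lambda>\<zeta>. w + s *\<^sub>R \<zeta>) has_derivative (\<lambda>v. s *\<^sub>R v)) (at \<zeta>)" by (auto intro!: derivative_eq_intros)
    from has_derivative_compose[OF this dh[OF in\<Omega>[OF True s]]]
    have "((\<lambda>\<zeta>. h (w + s *\<^sub>R \<zeta>)) has_derivative (\<lambda>v. h' (w + s *\<^sub>R \<zeta>) (s *\<^sub>R v))) (at \<zeta>)" .
    from has_derivative_mult[OF this d\<psi>] show ?thesis .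
  next
    case False
    have o: "open {x::complex^'n. norm x > 3 * r / 4}" by (intro open_Collect_less continuous_intros)
    have "((\<lambda>\<zeta>. h (w + s *\<^sub>R \<zeta>) * \<psi> \<zeta>) has_derivative (\<lambda>v. 0)) (at \<zeta>)"
      by (rule has_derivative_transform_within_open[OF has_derivative_const o]) (use False \<psi>0 in auto)
    then show ?thesis using \<psi>'0[of \<zeta>] \<psi>0[of \<zeta>] False by simp
  qed
  have contE: "continuous_on UNIV (\<lambda>\<zeta>. h (w + s *\<^sub>R \<zeta>) * \<psi> \<zeta>)" if "\<bar>s\<bar> < 9/8" for s
    using has_derivative_continuous[OF dE[OF that]] by (simp add: continuous_at_imp_continuous_on)
  have intE: "integrable lborel (\<lambda>\<zeta>. h (w + s *\<^sub>R \<zeta>) * \<psi> \<zeta>)" if "\<bar>s\<bar> < 9/8" for s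
    by (rule integrable_compact_support[OF contE[OF that], of "3 * r / 4"]) (use \<psi>0 in auto)
  \<comment> \<open>the integral of the derivative along the rotation field vanishes\<close>
  have rot: "(LINT \<zeta>|lborel. h' (w + s *\<^sub>R \<zeta>) \<zeta> * \<psi> \<zeta>) = 0" if s: "\<bar>s\<bar> < 9/8" "s \<noteq> 0" for s
  proof -
    obtain C where C: "C > 0" "\<And>x v. norm (\<psi>' x v) \<le> C * norm v"
    proof -
      have "\<psi> \<in> test_functions UNIV" unfolding \<psi>_def by (rule bump_test_function) (use r in auto)
      then have "ksmooth True UNIV (Suc 0) \<psi>" by (rule test_function_ksmooth_True)
      from ksmooth_derivative_bounded[OF this] that show thesis unfolding \<psi>'_def by (metis UNIV_I)
    qed
    define E where "E \<zeta> = h (w + s *\<^sub>R \<zeta>) * \<psi> \<zeta>" for \<zeta>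
    define E' where "E' \<zeta> v = h (w + s *\<^sub>R \<zeta>) * \<psi>' \<zeta> v + h' (w + s *\<^sub>R \<zeta>) (s *\<^sub>R v) * \<psi> \<zeta>" for \<zeta> v
    define f' where "f' b \<zeta> v = E \<zeta> * of_real ((\<i> *s v) \<bullet> b) + E' \<zeta> v * of_real ((\<i> *s \<zeta>) \<bullet> b)" for b \<zeta> v
    have Eb: "norm (E \<zeta>) \<le> B" for \<zeta>
    proof (cases "norm \<zeta> \<le> 3 * r / 4")
      case True
      have "norm (h (w + s *\<^sub>R \<zeta>)) \<le> B"
        using inb[OF True s(1)] r by (intro B) (auto simp: dist_norm)
      then have "norm (E \<zeta>) \<le> B * 1" unfolding E_def norm_mult using \<psi>1 Bpos by (intro mult_mono) auto
      then show ?thesis by simp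
    qed (use \<psi>0 Bpos in \<open>simp add: E_def\<close>)
    have E'b: "norm (E' \<zeta> v) \<le> (B * C + 4 * B * 2 / (r / 16)) * norm v" for \<zeta> v
    proof (cases "norm \<zeta> \<le> 3 * r / 4")
      case True
      have 1: "norm (h (w + s *\<^sub>R \<zeta>) * \<psi>' \<zeta> v) \<le> B * (C * norm v)"
        unfolding norm_mult using inb[OF True s(1)] r C Bpos by (intro mult_mono B) (auto simp: dist_norm)
      have 2: "norm (h' (w + s *\<^sub>R \<zeta>) (s *\<^sub>R v) * \<psi> \<zeta>) \<le> (4 * B * (2 * norm v) / (r / 16)) * 1"
        unfolding norm_mult
      proof (intro mult_mono \<psi>1)
        have "norm (s *\<^sub>R v) \<le> 2 * norm v" using s(1) by (simp add: mult_right_mono)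
        then have "4 * B * norm (s *\<^sub>R v) / (r / 16) \<le> 4 * B * (2 * norm v) / (r / 16)"
          using r Bpos by (intro divide_right_mono mult_left_mono) auto
        then show "norm (h' (w + s *\<^sub>R \<zeta>) (s *\<^sub>R v)) \<le> 4 * B * (2 * norm v) / (r / 16)"
          using h'b[OF inb[OF True s(1)], of "s *\<^sub>R v"] by linarith
      qed (use r Bpos in auto)
      have "norm (E' \<zeta> v) \<le> B * (C * norm v) + 4 * B * (2 * norm v) / (r / 16) * 1"
        unfolding E'_def by (rule norm_triangle_mono[OF 1 2])
      then show ?thesis by (simp add: algebra_simps)
    next
      case False
      have "E' \<zeta> v = 0" using False \<psi>0[of \<zeta>] \<psi>'0[of \<zeta>] by (simp add: E'_def)
      then show ?thesis using r Bpos C by simp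
    qed
    have E'0: "E' \<zeta> v = 0" if "norm \<zeta> > r" for \<zeta> v
      using that r \<psi>0[of \<zeta>] \<psi>'0[of \<zeta>] by (simp add: E'_def)
    have dE': "(E has_derivative E' \<zeta>) (at \<zeta>)" for \<zeta> unfolding E_def[abs_def] E'_def[abs_def] by (rule dE[OF s(1)])
    have df: "((\<lambda>\<zeta>. E \<zeta> * of_real ((\<i> *s \<zeta>) \<bullet> b)) has_derivative f' b \<zeta>) (at \<zeta>)" for b \<zeta>
    proof -
      have "((\<lambda>\<zeta>. complex_of_real ((\<i> *s \<zeta>) \<bullet> b)) has_derivative (\<lambda>v. of_real ((\<i> *s v) \<bullet> b))) (at \<zeta>)"
        by (intro has_derivative_of_real has_derivative_inner_left bounded_linear_imp_has_derivative bounded_linear_scalar_mult_right)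
      from has_derivative_mult[OF dE' this] show ?thesis unfolding f'_def[abs_def] .
    qed
    have zero: "(LINT \<zeta>|lborel. f' b \<zeta> b) = 0" and intf: "integrable lborel (\<lambda>\<zeta>. f' b \<zeta> b)" if b: "b \<in> Basis" for b
    proof -
      have bd: "norm (f' b \<zeta> b) \<le> B * 1 + (B * C + 4 * B * 2 / (r / 16)) * r" for \<zeta>
      proof -
        have "norm (E \<zeta> * of_real ((\<i> *s b) \<bullet> b)) \<le> B * 1"
          unfolding norm_mult using Eb b Bpos Cauchy_Schwarz_ineq2[of "\<i> *s b" b]
          by (intro mult_mono) (auto simp: norm_scalar_mult)
        moreover have "norm (E' \<zeta> b * of_real ((\<i> *s \<zeta>) \<bullet> b)) \<le> (B * C + 4 * B * 2 / (r / 16)) * r"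
        proof (cases "norm \<zeta> > r")
          case True
          then show ?thesis using E'0 Bpos C r by simp
        next
          case False
          show ?thesis unfolding norm_mult using E'b[of \<zeta> b] b Bpos C r False Cauchy_Schwarz_ineq2[of "\<i> *s \<zeta>" b]
            by (intro mult_mono) (auto simp: norm_scalar_mult)
        qed
        ultimately show ?thesis unfolding f'_def by (rule norm_triangle_mono)
      qed
      have s0: "E x * of_real ((\<i> *s x) \<bullet> b) = 0" if "norm x \<ge> r" for x
        using \<psi>0[of x] that r by (simp add: E_def)
      show "(LINT \<zeta>|lborel. f' b \<zeta> b) = 0" by (rule integral_partial_eq_0(1)[OF df s0 bd])
      show "integrable lborel (\<lambda>\<zeta>. f' b \<zeta> b)" by (rule integral_partial_eq_0(2)[OF df s0 bd])
    qed
    have sum: "(\<Sum>b\<in>Basis. f' b \<zeta> b) = (of_real s * \<i>) * (h' (w + s *\<^sub>R \<zeta>) \<zeta> * \<psi> \<zeta>)" for \<zeta>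
    proof -
      have "(\<Sum>b\<in>Basis. f' b \<zeta> b) = (\<Sum>b\<in>Basis. E' \<zeta> b * of_real ((\<i> *s \<zeta>) \<bullet> b))"
        by (simp add: f'_def inner_ii_scalar_mult)
      also have "\<dots> = E' \<zeta> (\<i> *s \<zeta>)" by (rule linear_sum_Basis[OF has_derivative_linear[OF dE']])
      also have "\<dots> = h' (w + s *\<^sub>R \<zeta>) (s *\<^sub>R (\<i> *s \<zeta>)) * \<psi> \<zeta>"
        unfolding E'_def \<psi>'_def \<psi>_def bump_derivative_rotation by simp
      also have "\<dots> = (of_real s * \<i>) * (h' (w + s *\<^sub>R \<zeta>) \<zeta> * \<psi> \<zeta>)"
      proof (cases "norm \<zeta> \<le> 3 * r / 4")
        case True
        show ?thesis unfolding scaleR_eq_scalar_mult[of s "\<i> *s \<zeta>"] h'c[OF in\<Omega>[OF True s(1)]] by simp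
      qed (use \<psi>0 in simp)
      finally show ?thesis .
    qed
    have "(of_real s * \<i>) * (LINT \<zeta>|lborel. h' (w + s *\<^sub>R \<zeta>) \<zeta> * \<psi> \<zeta>) = (LINT \<zeta>|lborel. (\<Sum>b\<in>Basis. f' b \<zeta> b))"
      unfolding sum by (rule integral_mult_right_zero[symmetric])
    also have "\<dots> = (\<Sum>b\<in>Basis. (LINT \<zeta>|lborel. f' b \<zeta> b))"
      by (rule Bochner_Integration.integral_sum[OF intf])
    also have "\<dots> = 0" using zero by simp
    finally show ?thesis using s(2) by simp
  qed
  \<comment> \<open>So the weighted mean \<open>G s\<close> over dilations does not depend on \<open>s\<close>; at \<open>s = 0\<close> it is \<open>h w\<close> times the mass.\<close>
  define G where "G s = (LINT \<zeta>|lborel. h (w + s *\<^sub>R \<zeta>) * \<psi> \<zeta>)" for s :: real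
  have dG: "(G has_vector_derivative (LINT \<zeta>|lborel. h' (w + s *\<^sub>R \<zeta>) \<zeta> * \<psi> \<zeta>)) (at s)" if s: "s \<in> {0..1}" for s
    unfolding G_def[abs_def]
  proof (rule integral_has_vector_derivative(1)[where e="1/8" and M=lborel and F="\<lambda>s \<zeta>. h (w + s *\<^sub>R \<zeta>) * \<psi> \<zeta>" and F'="\<lambda>s \<zeta>. h' (w + s *\<^sub>R \<zeta>) \<zeta> * \<psi> \<zeta>"
      and G="\<lambda>x. (4 * B * r / (r / 16)) * indicator (cball 0 r) x"])
    fix t assume "\<bar>t - s\<bar> < 1/8"
    then have t: "\<bar>t\<bar> < 9/8" using s unfolding abs_less_iff atLeastAtMost_iff by linarith
    show "integrable lborel (\<lambda>\<zeta>. h (w + t *\<^sub>R \<zeta>) * \<psi> \<zeta>)" by (rule intE[OF t])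
    fix \<zeta> :: "complex^'n"
    show "((\<lambda>t. h (w + t *\<^sub>R \<zeta>) * \<psi> \<zeta>) has_vector_derivative h' (w + t *\<^sub>R \<zeta>) \<zeta> * \<psi> \<zeta>) (at t)"
    proof (cases "norm \<zeta> \<le> 3 * r / 4")
      case True
      have "((\<lambda>t. w + t *\<^sub>R \<zeta>) has_derivative (\<lambda>d. d *\<^sub>R \<zeta>)) (at t)" by (auto intro!: derivative_eq_intros)
      from has_derivative_compose[OF this dh[OF in\<Omega>[OF True t]]]
      have "((\<lambda>t. h (w + t *\<^sub>R \<zeta>)) has_derivative (\<lambda>d. d *\<^sub>R h' (w + t *\<^sub>R \<zeta>) \<zeta>)) (at t)"
        by (simp add: linear_cmul[OF has_derivative_linear[OF dh[OF in\<Omega>[OF True t]]]])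
      from has_derivative_mult_left[OF this, of "\<psi> \<zeta>"] show ?thesis
        unfolding has_vector_derivative_def by simp
    qed (use \<psi>0 in simp)
    show "norm (h' (w + t *\<^sub>R \<zeta>) \<zeta> * \<psi> \<zeta>) \<le> (4 * B * r / (r / 16)) * indicator (cball 0 r) \<zeta>"
    proof (cases "norm \<zeta> \<le> 3 * r / 4")
      case True
      have "4 * B * norm \<zeta> / (r / 16) \<le> 4 * B * r / (r / 16)"
        using True r Bpos by (intro divide_right_mono mult_left_mono) auto
      then have "norm (h' (w + t *\<^sub>R \<zeta>) \<zeta>) \<le> 4 * B * r / (r / 16)"
        using h'b[OF inb[OF True t], of \<zeta>] by linarith
      then have "norm (h' (w + t *\<^sub>R \<zeta>) \<zeta> * \<psi> \<zeta>) \<le> (4 * B * r / (r / 16)) * 1"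
        unfolding norm_mult using \<psi>1 Bpos r by (intro mult_mono) auto
      moreover have "\<zeta> \<in> cball 0 r" using True r by simp
      ultimately show ?thesis by simp
    qed (use \<psi>0 r Bpos in simp)
  next
    show "integrable lborel (\<lambda>x. (4 * B * r / (r / 16)) * indicator (cball (0::complex^'n) r) x)"
      using emeasure_bounded_finite[OF bounded_cball] by (intro integrable_mult_right integrable_real_indicator) auto
  qed auto
  have "G 1 = G 0"
  proof (rule has_derivative_zero_unique_strong_interval[of "{0}" 0 1])
    show "continuous_on {0..1} G"
      by (intro continuous_at_imp_continuous_on ballI) (rule has_vector_derivative_continuous[OF dG])
    show "(G has_derivative (\<lambda>h. 0)) (at s within {0..1})" if "s \<in> {0..1} - {0}" for s
    proof -
      have "(LINT \<zeta>|lborel. h' (w + s *\<^sub>R \<zeta>) \<zeta> * \<psi> \<zeta>) = 0" by (rule rot) (use that in auto)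
      then have "(G has_derivative (\<lambda>d. d *\<^sub>R 0)) (at s)" using dG[of s] that unfolding has_vector_derivative_def by auto
      then show ?thesis by (simp add: has_derivative_at_withinI)
    qed
  qed auto
  then show ?thesis by (simp add: G_def \<psi>_def)
qed

section \<open>The Bergman space and its evaluation functionals\<close>

lemma bump_integrable: "r > 0 \<Longrightarrow> integrable lborel (bump 0 r :: 'a::euclidean_space \<Rightarrow> complex)"
  by (rule integrable_compact_support[OF smooth_on_continuous[OF smooth_on_bump], of "3 * r / 4"]) (simp add: bump_eq_0)

text \<open>The bump is nonnegative, and equal to 1 on a ball of volume proportional to \<open>r\<^sup>d\<close>.\<close>

lemma bump_mass_lower_bound:
  "\<exists>c>0. \<forall>r>0. c * r ^ DIM('a) \<le> norm (LINT \<zeta>|lborel. bump 0 r (\<zeta> :: 'a::euclidean_space))"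
proof (intro exI conjI allI impI)
  let ?c = "unit_ball_vol (DIM('a)) / 2 ^ DIM('a)"
  show "?c > 0" using unit_ball_vol_pos[of "DIM('a)"] by simp
  fix r :: real assume r: "r > 0"
  have "?c * r ^ DIM('a) = measure lborel (ball (0::'a) (r / 2))"
    using r by (simp add: content_ball power_divide)
  also have "\<dots> = (LINT \<zeta>|lborel. indicator (ball (0::'a) (r / 2)) \<zeta>)" by simp
  also have "\<dots> \<le> (LINT \<zeta>|lborel. Re (bump 0 r (\<zeta> :: 'a)))"
  proof (rule integral_mono)
    show "integrable lborel (indicator (ball (0::'a) (r / 2)) :: 'a \<Rightarrow> real)"
      using emeasure_bounded_finite[OF bounded_ball] by (intro integrable_real_indicator) auto
    show "integrable lborel (\<lambda>\<zeta>. Re (bump 0 r (\<zeta> :: 'a)))" using bump_integrable[OF r] by (rule integrable_Re)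
    show "indicator (ball (0::'a) (r / 2)) \<zeta> \<le> Re (bump 0 r \<zeta>)" for \<zeta>
      using bump_eq_1[OF r, of \<zeta> 0] smooth_step_bounds by (auto simp: indicator_def bump_def)
  qed
  also have "\<dots> = Re (LINT \<zeta>|lborel. bump 0 r (\<zeta> :: 'a))" by (rule integral_Re[OF bump_integrable[OF r]])
  also have "\<dots> \<le> norm (LINT \<zeta>|lborel. bump 0 r (\<zeta> :: 'a))" by (rule complex_Re_le_cmod)
  finally show "?c * r ^ DIM('a) \<le> norm (LINT \<zeta>|lborel. bump 0 r (\<zeta> :: 'a))" .
qed

lemma bump_mass_nonzero:
  assumes r: "r > 0"
  shows "(LINT \<zeta>|lborel. bump 0 r (\<zeta> :: 'a::euclidean_space)) \<noteq> 0"
proof -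
  obtain c where c: "c > 0" "\<forall>r>0. c * r ^ DIM('a) \<le> norm (LINT \<zeta>|lborel. bump 0 r (\<zeta> :: 'a))"
    using bump_mass_lower_bound by blast
  have "0 < c * r ^ DIM('a)" using c(1) r by simp
  then have "0 < norm (LINT \<zeta>|lborel. bump 0 r (\<zeta> :: 'a))" using c(2) r by (metis less_le_trans)
  then show ?thesis by simp
qed

text \<open>The test function whose pairing with a holomorphic function is the derivative along \<open>bs\<close> at \<open>w\<close>. For \<open>bs = []\<close> it is the
  normalised bump; each derivative of the convolution contributes a factor \<open>-1\<close>, since \<open>w\<close> enters through \<open>z - w\<close>.\<close>

definition eval_kernel :: "'a::euclidean_space list \<Rightarrow> 'a \<Rightarrow> real \<Rightarrow> 'a \<Rightarrow> complex" where
  "eval_kernel bs w r z =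
     (-1) ^ length bs / (LINT \<zeta>|lborel. bump 0 r (\<zeta> :: 'a)) * iter_partial bs (bump 0 r) (z - w)"

lemma test_function_shift:
  fixes f :: "'a::euclidean_space \<Rightarrow> complex"
  assumes "f \<in> test_functions (ball 0 r)"
  shows "(\<lambda>z. c * f (z - w)) \<in> test_functions (ball w r)"
proof -
  obtain K where K: "smooth_on UNIV f" "compact K" "K \<subseteq> ball 0 r" "\<And>x. x \<notin> K \<Longrightarrow> f x = 0"
    using test_functionsE[OF assms] by metis
  have "ksmooth False UNIV n (\<lambda>z. f (z - w))" for n
  proof (rule ksmooth_compose[where \<Phi>="\<lambda>z. z - w" and h=f, OF open_UNIV open_UNIV subset_UNIV])
    show "ksmooth False UNIV n (\<lambda>z. z - w)"
      by (intro ksmooth_diff ksmooth_const ksmooth_linear[OF bounded_linear_ident]) auto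
    show "ksmooth False UNIV n f" using K(1) unfolding smooth_on_iff by blast
  qed
  then have sm: "smooth_on UNIV (\<lambda>z. c * f (z - w))"
    unfolding smooth_on_iff using ksmooth_compose_linear[OF bounded_linear_mult_right open_UNIV] by blast
  show ?thesis
  proof (rule test_functionsI[OF sm])
    show "compact ((+) w ` K)" using K(2) by (rule compact_translation)
    show "(+) w ` K \<subseteq> ball w r" using K(3) by (auto simp: dist_norm)
    show "c * f (x - w) = 0" if "x \<notin> (+) w ` K" for x
    proof -
      have "x - w \<notin> K" using that by (metis add_diff_cancel_left' diff_add_cancel add.commute image_eqI)
      then show ?thesis using K(4) by simp
    qed
  qed
qed

lemma test_functions_mono: "f \<in> test_functions A \<Longrightarrow> A \<subseteq> B \<Longrightarrow> f \<in> test_functions B"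
  by (auto simp: test_functions_def)

lemma eval_kernel_test_function:
  assumes "r > 0" "ball w r \<subseteq> \<Omega>" "bs \<in> lists Basis"
  shows "eval_kernel bs w r \<in> test_functions \<Omega>"
proof -
  have "bump 0 r \<in> test_functions (ball (0::'a) r)" using assms(1) by (rule bump_test_function) simp
  then have "iter_partial bs (bump 0 r) \<in> test_functions (ball (0::'a) r)" by (rule test_function_iter_partial[OF _ assms(3)])
  from test_function_shift[OF this] show ?thesis
    unfolding eval_kernel_def[abs_def] using assms(2) by (rule test_functions_mono)
qed

lemma cnj_eval_kernel:
  assumes "bs \<in> lists Basis"
  shows "cnj (eval_kernel bs w r z) = eval_kernel bs w r z"
proof -
  have "(LINT \<zeta>|lborel. cnj (bump 0 r (\<zeta> :: 'a))) = cnj (LINT \<zeta>|lborel. bump 0 r (\<zeta> :: 'a))"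
    by simp
  moreover have "cnj (iter_partial bs (bump 0 r) x) = iter_partial bs (bump 0 r) (x :: 'a)" for x
    using iter_partial_bounded_linear[OF bounded_linear_cnj smooth_on_bump[of 0 r] assms, of x] by (simp add: cnj_bump)
  ultimately show ?thesis by (simp add: eval_kernel_def cnj_bump)
qed

lemma L2_const: "\<Omega> \<in> lmeasurable \<Longrightarrow> (\<lambda>x. c) \<in> L2 \<Omega>"
  by (rule bounded_measurable_L2(1)[where C="norm c"]) auto

lemma L2_integrable: "\<Omega> \<in> lmeasurable \<Longrightarrow> f \<in> L2 \<Omega> \<Longrightarrow> integrable (lebesgue_on \<Omega>) f"
  using L2_integrable_mult[of f \<Omega> "\<lambda>x. 1"] L2_const by auto

lemma test_function_L2: "f \<in> test_functions \<Omega> \<Longrightarrow> open \<Omega> \<Longrightarrow> bounded \<Omega> \<Longrightarrow> f \<in> L2 \<Omega>"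
  by (rule smooth_closure_L2[OF test_function_smooth_closure])

lemma L2_sum: "(\<And>i. i \<in> I \<Longrightarrow> f i \<in> L2 \<Omega>) \<Longrightarrow> (\<lambda>x. \<Sum>i\<in>I. f i x) \<in> L2 \<Omega>"
  by (induction I rule: infinite_finite_induct) (auto simp: L2_zero intro: L2_add)

lemma bergman_space_L2: "h \<in> bergman_space \<Omega> \<Longrightarrow> h \<in> L2 \<Omega>"
  by (simp add: bergman_space_def)

lemma bergman_convolution:
  fixes h :: "complex^'n \<Rightarrow> complex"
  assumes h: "holomorphic_several \<Omega> h" and \<Omega>: "open \<Omega>" and r: "r > 0" "ball w r \<subseteq> \<Omega>"
  shows "h w = (LINT z|lebesgue_on \<Omega>. h z * bump 0 r (z - w)) / (LINT \<zeta>|lborel. bump 0 r (\<zeta> :: complex^'n))"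
proof -
  let ?k = "\<lambda>z. h z * bump 0 r (z - w)"
  have k0: "?k z = 0" if "z \<notin> cball w (3 * r / 4)" for z
    using bump_eq_0[OF r(1), of "z - w" 0] that by (simp add: dist_norm norm_minus_commute)
  have cont: "continuous_on UNIV ?k"
  proof -
    have "continuous_on (ball w r) ?k"
    proof (intro continuous_on_mult)
      show "continuous_on (ball w r) h" by (rule continuous_on_subset[OF holomorphic_several_continuous[OF h] r(2)])
      show "continuous_on (ball w r) (\<lambda>z. bump 0 r (z - w))"
        by (rule continuous_on_compose2[OF smooth_on_continuous[OF smooth_on_bump]]) (auto intro!: continuous_intros)
    qed
    moreover have "continuous_on (- cball w (3 * r / 4)) ?k"
      by (subst continuous_on_cong[OF refl k0]) auto
    ultimately have "continuous_on (ball w r \<union> - cball w (3 * r / 4)) ?k"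
      by (intro continuous_on_open_Un) auto
    moreover have "ball w r \<union> - cball w (3 * r / 4) = UNIV" using r by auto
    ultimately show ?thesis by simp
  qed
  then have km: "?k \<in> borel_measurable borel" by (rule borel_measurable_continuous_onI)
  have "(LINT z|lebesgue_on \<Omega>. ?k z) = (LINT z|lebesgue. indicator \<Omega> z *\<^sub>R ?k z)"
    by (rule integral_restrict_space) (use \<Omega> in auto)
  also have "(\<lambda>z. indicator \<Omega> z *\<^sub>R ?k z) = ?k"
  proof
    fix z show "indicator \<Omega> z *\<^sub>R ?k z = ?k z"
    proof (cases "z \<in> \<Omega>")
      case False
      then have "z \<notin> cball w (3 * r / 4)" using r by (auto simp: subset_iff)
      then have "?k z = 0" by (rule k0)
      then show ?thesis by (simp only: scaleR_zero_right)
    qed simp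
  qed
  also have "(LINT z|lebesgue. ?k z) = (LINT z|lborel. ?k z)" by (rule integral_completion) (use km in simp)
  also have "\<dots> = (LINT z|distr lborel borel ((+) w). ?k z)" by (simp add: lborel_distr_plus)
  also have "\<dots> = (LINT \<zeta>|lborel. ?k (w + \<zeta>))" using km by (intro integral_distr) auto
  also have "\<dots> = (LINT \<zeta>|lborel. h (w + \<zeta>) * bump 0 r \<zeta>)" by simp
  also have "\<dots> = h w * (LINT \<zeta>|lborel. bump 0 r (\<zeta> :: complex^'n))"
    by (rule radial_mean_value[OF h r \<Omega>])
  finally show ?thesis using bump_mass_nonzero[OF r(1), where 'a="complex^'n"] by simp
qed

text \<open>A function given near \<open>w\<close> by a convolution with a bump inherits smoothness from the bump, and its derivatives are
  integrals against derivatives of the bump.\<close>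

lemma convolution_evaluates_derivative:
  fixes h g :: "complex^'n \<Rightarrow> complex"
  assumes g: "integrable (lebesgue_on \<Omega>) g" and r: "r > 0"
    and eq: "\<And>w'. w' \<in> ball w r \<Longrightarrow> h w' = (LINT z|lebesgue_on \<Omega>. g z * bump 0 r (z - w')) / (LINT \<zeta>|lborel. bump 0 r (\<zeta> :: complex^'n))"
  shows "smooth_on (ball w r) h"
    and "bs \<in> lists Basis \<Longrightarrow> iter_partial bs h w = (LINT z|lebesgue_on \<Omega>. g z * eval_kernel bs w r z)"
proof -
  let ?m = "LINT \<zeta>|lborel. bump 0 r (\<zeta> :: complex^'n)"
  let ?u = "\<lambda>w. LINT z|lebesgue_on \<Omega>. g z * bump 0 r (z - w)"
  have t: "bump 0 r \<in> test_functions (UNIV :: (complex^'n) set)" by (rule bump_test_function[OF r]) simp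
  have sm: "smooth_on UNIV ?u" by (rule convolution_smooth[OF g t])
  have "smooth_on UNIV (\<lambda>w. ?u w / ?m)"
    using sm ksmooth_compose_linear[OF bounded_linear_divide open_UNIV] unfolding smooth_on_iff by blast
  then have "smooth_on (ball w r) (\<lambda>w. ?u w / ?m)" by (rule smooth_on_subset) auto
  then show "smooth_on (ball w r) h" using smooth_on_cong[of "ball w r" h "\<lambda>w. ?u w / ?m"] eq by blast
  assume bs: "bs \<in> lists Basis"
  have "iter_partial bs h w = iter_partial bs (\<lambda>w. ?u w / ?m) w"
    by (rule iter_partial_cong_open[of "ball w r"]) (use r eq in auto)
  also have "\<dots> = iter_partial bs ?u w / ?m"
    by (rule iter_partial_bounded_linear[OF bounded_linear_divide sm bs]) simp
  also have "\<dots> = (LINT z|lebesgue_on \<Omega>. g z * eval_kernel bs w r z)"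
  proof -
    have "(\<lambda>z. g z * eval_kernel bs w r z) = (\<lambda>z. ((-1) ^ length bs / ?m) * (g z * iter_partial bs (bump 0 r) (z - w)))"
      by (simp add: eval_kernel_def fun_eq_iff)
    then show ?thesis unfolding convolution_iter_partial[OF g t bs] by simp
  qed
  finally show "iter_partial bs h w = (LINT z|lebesgue_on \<Omega>. g z * eval_kernel bs w r z)" .
qed

lemma bergman_smooth_and_evaluation:
  fixes h :: "complex^'n \<Rightarrow> complex"
  assumes h: "h \<in> bergman_space \<Omega>" and \<Omega>: "open \<Omega>" "bounded \<Omega>"
  shows "smooth_on \<Omega> h"
    and "r > 0 \<Longrightarrow> ball w (2 * r) \<subseteq> \<Omega> \<Longrightarrow> bs \<in> lists Basis \<Longrightarrow> iter_partial bs h w = L2_inner \<Omega> h (eval_kernel bs w r)"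
proof -
  have hol: "holomorphic_several \<Omega> h" using h by (simp add: bergman_space_def)
  have int: "integrable (lebesgue_on \<Omega>) h"
    by (rule L2_integrable[OF bounded_open_lmeasurable[OF \<Omega>] bergman_space_L2[OF h]])
  have eq: "h w' = (LINT z|lebesgue_on \<Omega>. h z * bump 0 r (z - w')) / (LINT \<zeta>|lborel. bump 0 r (\<zeta> :: complex^'n))"
    if r: "r > 0" "ball w (2 * r) \<subseteq> \<Omega>" and w': "w' \<in> ball w r" for w w' r
  proof (rule bergman_convolution[OF hol \<Omega>(1) r(1)])
    have "ball w' r \<subseteq> ball w (2 * r)"
    proof
      fix y assume "y \<in> ball w' r"
      then show "y \<in> ball w (2 * r)" using w' dist_triangle[of w y w'] by simp
    qed
    then show "ball w' r \<subseteq> \<Omega>" using r(2) by blast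
  qed
  show "smooth_on \<Omega> h"
    unfolding smooth_on_iff
  proof (intro conjI allI \<Omega>(1) ksmooth_local)
    fix n w assume "w \<in> \<Omega>"
    then obtain e where e: "e > 0" "ball w e \<subseteq> \<Omega>" using \<Omega>(1) openE by blast
    have "smooth_on (ball w (e / 2)) h"
      by (rule convolution_evaluates_derivative(1)[OF int _ eq]) (use e in auto)
    then show "\<exists>U. open U \<and> w \<in> U \<and> ksmooth False U n h"
      using e(1) unfolding smooth_on_iff by (intro exI[of _ "ball w (e / 2)"]) auto
  qed
  assume r: "r > 0" "ball w (2 * r) \<subseteq> \<Omega>" and bs: "bs \<in> lists Basis"
  have "iter_partial bs h w = (LINT z|lebesgue_on \<Omega>. h z * eval_kernel bs w r z)"
    by (rule convolution_evaluates_derivative(2)[OF int r(1) eq[OF r] bs])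
  then show "iter_partial bs h w = L2_inner \<Omega> h (eval_kernel bs w r)"
    by (simp add: L2_inner_def cnj_eval_kernel[OF bs])
qed

lemma bergman_space_lin:
  assumes "g \<in> bergman_space \<Omega>" "h \<in> bergman_space \<Omega>"
  shows "(\<lambda>x. g x + c * h x) \<in> bergman_space \<Omega>"
proof -
  have "holomorphic_several \<Omega> (\<lambda>x. g x + c * h x)"
    unfolding holomorphic_several_def
  proof
    fix z assume z: "z \<in> \<Omega>"
    obtain D E where D: "(g has_derivative D) (at z)" "\<forall>c v. D (c *s v) = c * D v"
      and E: "(h has_derivative E) (at z)" "\<forall>c v. E (c *s v) = c * E v"
      using assms z unfolding bergman_space_def holomorphic_several_def by blast
    have "((\<lambda>x. g x + c * h x) has_derivative (\<lambda>v. D v + c * E v)) (at z)"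
      by (intro has_derivative_add has_derivative_mult_right D(1) E(1))
    then show "\<exists>D. ((\<lambda>x. g x + c * h x) has_derivative D) (at z) \<and> (\<forall>c v. D (c *s v) = c * D v)"
      using D(2) E(2) by (intro exI[of _ "\<lambda>v. D v + c * E v"]) (auto simp: algebra_simps)
  qed
  then show ?thesis using assms L2_add[OF _ L2_cmult] by (auto simp: bergman_space_def)
qed

lemma bergman_space_zero: "(\<lambda>x. 0) \<in> bergman_space \<Omega>"
  by (auto simp: bergman_space_def L2_zero holomorphic_several_def intro!: exI[of _ "\<lambda>_. 0"])

lemma bergman_space_cong:
  assumes "open \<Omega>" "\<And>z. z \<in> \<Omega> \<Longrightarrow> f z = g z" "f \<in> bergman_space \<Omega>"
  shows "g \<in> bergman_space \<Omega>"
proof -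
  have "holomorphic_several \<Omega> g"
    unfolding holomorphic_several_def
  proof
    fix z assume z: "z \<in> \<Omega>"
    obtain D where D: "(f has_derivative D) (at z)" "\<forall>c v. D (c *s v) = c * D v"
      using assms(3) z unfolding bergman_space_def holomorphic_several_def by blast
    have "(g has_derivative D) (at z)"
      by (rule has_derivative_transform_within_open[OF D(1) assms(1) z]) (use assms(2) in auto)
    then show "\<exists>D. (g has_derivative D) (at z) \<and> (\<forall>c v. D (c *s v) = c * D v)" using D(2) by blast
  qed
  then show ?thesis using assms(3) L2_cong[of \<Omega> f g] assms(2) by (simp add: bergman_space_def)
qed

text \<open>Completeness: evaluation functionals are \<open>L\<^sup>2\<close> continuous, so a Cauchy sequence converges pointwise;
  the limit is in \<open>L\<^sup>2\<close> by Fatou's lemma, and it inherits the convolution formula, hence is holomorphic.\<close>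

lemma bergman_complete:
  fixes h :: "nat \<Rightarrow> complex^'n \<Rightarrow> complex"
  assumes \<Omega>: "open \<Omega>" "bounded \<Omega>" and h: "\<And>n. h n \<in> bergman_space \<Omega>"
    and cauchy: "\<And>e. e > 0 \<Longrightarrow> \<exists>N. \<forall>m\<ge>N. \<forall>n\<ge>N. (L2_norm \<Omega> (\<lambda>x. h m x - h n x))\<^sup>2 < e"
  shows "\<exists>g\<in>bergman_space \<Omega>. (\<lambda>n. L2_norm \<Omega> (\<lambda>x. h n x - g x)) \<longlonglongrightarrow> 0"
proof -
  let ?M = "lebesgue_on \<Omega>"
  have lm: "\<Omega> \<in> lmeasurable" by (rule bounded_open_lmeasurable[OF \<Omega>])
  have hL: "h n \<in> L2 \<Omega>" for n by (rule bergman_space_L2[OF h])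
  have hdL: "(\<lambda>x. h n x - h m x) \<in> L2 \<Omega>" for m n by (rule L2_diff[OF hL hL])
  have cauchy': "\<exists>N. \<forall>m\<ge>N. \<forall>n\<ge>N. L2_norm \<Omega> (\<lambda>x. h m x - h n x) < e" if e: "e > 0" for e
  proof -
    obtain N where "\<forall>m\<ge>N. \<forall>n\<ge>N. (L2_norm \<Omega> (\<lambda>x. h m x - h n x))\<^sup>2 < e\<^sup>2" 
      using cauchy[OF zero_less_power[OF e, of 2]] by blast
    then show ?thesis using power2_less_imp_less[of _ e] e by (intro exI[of _ N]) auto
  qed
  have "Cauchy (\<lambda>n. h n w)" if w: "w \<in> \<Omega>" for w
  proof (rule metric_CauchyI)
    fix e :: real assume e: "e > 0"
    obtain r where r: "r > 0" "ball w (2 * r) \<subseteq> \<Omega>"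
      using \<Omega>(1) w openE[of \<Omega> w] by (metis half_gt_zero mult.commute nonzero_eq_divide_eq zero_neq_numeral)
    let ?k = "eval_kernel [] w r"
    have kL: "?k \<in> L2 \<Omega>"
      using eval_kernel_test_function[of r w \<Omega> "[]"] r test_function_L2[OF _ \<Omega>] by (auto simp: subset_iff)
    obtain N where N: "\<And>m n. m \<ge> N \<Longrightarrow> n \<ge> N \<Longrightarrow> L2_norm \<Omega> (\<lambda>x. h m x - h n x) < e / (L2_norm \<Omega> ?k + 1)"
      using cauchy'[of "e / (L2_norm \<Omega> ?k + 1)"] e L2_norm_nonneg[of \<Omega> ?k] by (metis add_nonneg_pos divide_pos_pos zero_less_one)
    show "\<exists>M. \<forall>m\<ge>M. \<forall>n\<ge>M. dist (h m w) (h n w) < e"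
    proof (intro exI[of _ N] allI impI)
      fix m n assume mn: "m \<ge> N" "n \<ge> N"
      have "h m w - h n w = L2_inner \<Omega> (\<lambda>x. h m x - h n x) ?k"
        using bergman_smooth_and_evaluation(2)[OF h \<Omega> r, of "[]"] by (simp add: L2_inner_diff_left[OF hL hL kL])
      then have "norm (h m w - h n w) \<le> L2_norm \<Omega> (\<lambda>x. h m x - h n x) * L2_norm \<Omega> ?k"
        using L2_Cauchy_Schwarz[OF hdL kL] by simp
      also have "\<dots> \<le> e / (L2_norm \<Omega> ?k + 1) * L2_norm \<Omega> ?k"
        using N[OF mn] by (intro mult_right_mono L2_norm_nonneg) auto
      also have "\<dots> < e" using e L2_norm_nonneg[of \<Omega> ?k] by (simp add: divide_simps)
      finally show "dist (h m w) (h n w) < e" by (simp add: dist_norm)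
    qed
  qed
  then have conv: "convergent (\<lambda>n. h n w)" if "w \<in> \<Omega>" for w using that Cauchy_convergent_iff by blast
  define g where "g w = lim (\<lambda>n. h n w)" for w
  have lim: "(\<lambda>n. h n w) \<longlonglongrightarrow> g w" if "w \<in> \<Omega>" for w
    using conv[OF that] by (simp add: g_def convergent_LIMSEQ_iff)
  have gm: "g \<in> borel_measurable ?M"
    by (rule borel_measurable_LIMSEQ_metric[of h]) (use lim L2_measurable[OF hL] in auto)
  have fatou: "(\<integral>\<^sup>+x. ennreal ((norm (h n x - g x))\<^sup>2) \<partial>?M) \<le> ennreal e"
    if N: "\<forall>m\<ge>N. (L2_norm \<Omega> (\<lambda>x. h n x - h m x))\<^sup>2 \<le> e" for n N e
  proof -
    have meas: "(\<lambda>x. ennreal ((norm (h n x - h m x))\<^sup>2)) \<in> borel_measurable ?M" for m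
      using L2_measurable[OF hdL[of n m]] by measurable
    have "(\<integral>\<^sup>+x. ennreal ((norm (h n x - g x))\<^sup>2) \<partial>?M) = (\<integral>\<^sup>+x. liminf (\<lambda>m. ennreal ((norm (h n x - h m x))\<^sup>2)) \<partial>?M)"
    proof (rule nn_integral_cong)
      fix x assume "x \<in> space ?M"
      then have "x \<in> \<Omega>" by simp
      then have "(\<lambda>m. ennreal ((norm (h n x - h m x))\<^sup>2)) \<longlonglongrightarrow> ennreal ((norm (h n x - g x))\<^sup>2)"
        by (intro tendsto_ennrealI tendsto_intros lim)
      then show "ennreal ((norm (h n x - g x))\<^sup>2) = liminf (\<lambda>m. ennreal ((norm (h n x - h m x))\<^sup>2))"
        using lim_imp_Liminf[OF sequentially_bot] by metis
    qed
    also have "\<dots> \<le> liminf (\<lambda>m. \<integral>\<^sup>+x. ennreal ((norm (h n x - h m x))\<^sup>2) \<partial>?M)"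
      by (rule nn_integral_liminf[OF meas])
    also have "\<dots> \<le> ennreal e"
    proof (rule Liminf_le[OF sequentially_bot])
      have "(\<integral>\<^sup>+x. ennreal ((norm (h n x - h m x))\<^sup>2) \<partial>?M) = ennreal ((L2_norm \<Omega> (\<lambda>x. h n x - h m x))\<^sup>2)" for m
        unfolding L2_norm_square by (rule nn_integral_eq_integral[OF L2_integrable_square[OF hdL]]) auto
      then show "\<forall>\<^sub>F m in sequentially. (\<integral>\<^sup>+x. ennreal ((norm (h n x - h m x))\<^sup>2) \<partial>?M) \<le> ennreal e"
        using N by (auto simp: eventually_sequentially intro!: exI[of _ N] ennreal_leI)
    qed
    finally show ?thesis .
  qed
  have hgL: "(\<lambda>x. h n x - g x) \<in> L2 \<Omega>" and hgN: "(L2_norm \<Omega> (\<lambda>x. h n x - g x))\<^sup>2 \<le> e"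
    if N: "\<forall>m\<ge>N. (L2_norm \<Omega> (\<lambda>x. h n x - h m x))\<^sup>2 \<le> e" and e: "e \<ge> 0" for n N e
  proof -
    have m: "(\<lambda>x. h n x - g x) \<in> borel_measurable ?M" using gm L2_measurable[OF hL] by (intro borel_measurable_diff) auto
    have i: "integrable ?M (\<lambda>x. (norm (h n x - g x))\<^sup>2)"
    proof (rule integrableI_nonneg)
      show "(\<lambda>x. (norm (h n x - g x))\<^sup>2) \<in> borel_measurable ?M" using m by measurable
      show "(\<integral>\<^sup>+x. ennreal ((norm (h n x - g x))\<^sup>2) \<partial>?M) < \<infinity>"
        using fatou[OF N] by (metis ennreal_less_top infinity_ennreal_def le_less_trans)
    qed simp
    show "(\<lambda>x. h n x - g x) \<in> L2 \<Omega>" using m i by (simp add: L2_def)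
    have "ennreal ((L2_norm \<Omega> (\<lambda>x. h n x - g x))\<^sup>2) = (\<integral>\<^sup>+x. ennreal ((norm (h n x - g x))\<^sup>2) \<partial>?M)"
      unfolding L2_norm_square by (rule nn_integral_eq_integral[OF i, symmetric]) auto
    then have "ennreal ((L2_norm \<Omega> (\<lambda>x. h n x - g x))\<^sup>2) \<le> ennreal e" using fatou[OF N] by simp
    then show "(L2_norm \<Omega> (\<lambda>x. h n x - g x))\<^sup>2 \<le> e" using e by simp
  qed
  have gL: "g \<in> L2 \<Omega>"
  proof -
    obtain N where "\<forall>m\<ge>N. \<forall>n\<ge>N. (L2_norm \<Omega> (\<lambda>x. h m x - h n x))\<^sup>2 < 1" using cauchy[of 1] by auto
    then have "\<forall>m\<ge>N. (L2_norm \<Omega> (\<lambda>x. h N x - h m x))\<^sup>2 \<le> 1" by (simp add: less_imp_le)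
    from hgL[OF this] have "(\<lambda>x. h N x - g x) \<in> L2 \<Omega>" by simp
    from L2_diff[OF hL[of N] this] show ?thesis by simp
  qed
  have conv0: "(\<lambda>n. L2_norm \<Omega> (\<lambda>x. h n x - g x)) \<longlonglongrightarrow> 0"
  proof (rule LIMSEQ_I)
    fix e :: real assume e: "e > 0"
    then obtain N where N: "\<forall>m\<ge>N. \<forall>n\<ge>N. (L2_norm \<Omega> (\<lambda>x. h m x - h n x))\<^sup>2 < (e / 2)\<^sup>2" 
      using cauchy[OF zero_less_power[OF half_gt_zero[OF e], of 2]] by blast
    have "L2_norm \<Omega> (\<lambda>x. h n x - g x) < e" if "n \<ge> N" for n
    proof -
      have "\<forall>m\<ge>N. (L2_norm \<Omega> (\<lambda>x. h n x - h m x))\<^sup>2 \<le> (e / 2)\<^sup>2" using N that by (simp add: less_imp_le)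
      then have "(L2_norm \<Omega> (\<lambda>x. h n x - g x))\<^sup>2 \<le> (e / 2)\<^sup>2" by (rule hgN) simp
      then have "L2_norm \<Omega> (\<lambda>x. h n x - g x) \<le> e / 2" by (rule power2_le_imp_le) (use e in simp)
      then show ?thesis using e by simp
    qed
    then show "\<exists>no. \<forall>n\<ge>no. norm (L2_norm \<Omega> (\<lambda>x. h n x - g x) - 0) < e"
      by (intro exI[of _ N]) (simp add: abs_of_nonneg[OF L2_norm_nonneg])
  qed
  have inner_lim: "(\<lambda>n. LINT z|?M. h n z * k z) \<longlonglongrightarrow> (LINT z|?M. g z * k z)" if kL: "k \<in> L2 \<Omega>" for k
  proof -
    have "(\<lambda>n. (LINT z|?M. h n z * k z) - (LINT z|?M. g z * k z)) \<longlonglongrightarrow> 0"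
    proof (rule Lim_null_comparison)
      show "(\<lambda>n. L2_norm \<Omega> (\<lambda>x. h n x - g x) * L2_norm \<Omega> k) \<longlonglongrightarrow> 0" by (rule tendsto_mult_left_zero[OF conv0])
      have "norm ((LINT z|?M. h n z * k z) - (LINT z|?M. g z * k z)) \<le> L2_norm \<Omega> (\<lambda>x. h n x - g x) * L2_norm \<Omega> k" for n
        using L2_Cauchy_Schwarz_mult[OF L2_diff[OF hL gL] kL, of n]
        by (simp add: left_diff_distrib L2_integrable_mult hL gL kL)
      then show "\<forall>\<^sub>F n in sequentially. norm ((LINT z|?M. h n z * k z) - (LINT z|?M. g z * k z)) \<le> L2_norm \<Omega> (\<lambda>x. h n x - g x) * L2_norm \<Omega> k"
        by simp
    qed
    then show ?thesis by (simp add: LIM_zero_iff)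
  qed
  have "holomorphic_several \<Omega> g"
    unfolding holomorphic_several_def
  proof
    fix w assume w: "w \<in> \<Omega>"
    obtain e where e: "e > 0" "ball w e \<subseteq> \<Omega>" using \<Omega>(1) w openE by blast
    define r where "r = e / 2"
    have r: "r > 0" "ball w (2 * r) \<subseteq> \<Omega>" using e by (auto simp: r_def)
    let ?m = "LINT \<zeta>|lborel. bump 0 r (\<zeta> :: complex^'n)"
    have t: "bump 0 r \<in> test_functions (UNIV :: (complex^'n) set)" by (rule bump_test_function[OF r(1)]) simp
    have sub: "ball w' r \<subseteq> \<Omega>" if "w' \<in> ball w r" for w'
    proof
      fix y assume "y \<in> ball w' r"
      then have "y \<in> ball w (2 * r)" using that dist_triangle[of w y w'] by simp
      then show "y \<in> \<Omega>" using r(2) by blast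
    qed
    have eqn: "h n w' = (LINT z|?M. h n z * bump 0 r (z - w')) / ?m" if "w' \<in> ball w r" for w' n
      using h by (intro bergman_convolution \<Omega> r(1) sub[OF that]) (simp add: bergman_space_def)
    have shiftL: "(\<lambda>z. f (z - w')) \<in> L2 \<Omega>" if f: "f \<in> test_functions UNIV" for f :: "complex^'n \<Rightarrow> complex" and w'
    proof -
      have "smooth_on UNIV (\<lambda>z. 1 * f (z - w'))"
      proof -
        obtain K where K: "compact K" "\<And>x. x \<notin> K \<Longrightarrow> f x = 0" using test_functionsE[OF f] by metis
        obtain R where R: "K \<subseteq> ball 0 R" using bounded_subset_ballD[OF compact_imp_bounded[OF K(1)]] by blast
        have "f \<in> test_functions (ball 0 R)"
          by (rule test_functionsI[OF _ K(1) R K(2)]) (use f in \<open>auto simp: test_functions_def\<close>)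
        from test_function_shift[OF this, where c=1 and w=w'] show ?thesis by (simp add: test_functions_def)
      qed
      then have "(\<lambda>z. f (z - w')) \<in> smooth_closure \<Omega>" using smooth_on_UNIV_smooth_closure[OF _ \<Omega>(1)] by simp
      then show ?thesis by (rule smooth_closure_L2[OF _ \<Omega>])
    qed
    have eqg: "g w' = (LINT z|?M. g z * bump 0 r (z - w')) / ?m" if w': "w' \<in> ball w r" for w'
    proof (rule LIMSEQ_unique)
      show "(\<lambda>n. h n w') \<longlonglongrightarrow> g w'" using sub[OF w'] r(1) by (intro lim) auto
      show "(\<lambda>n. h n w') \<longlonglongrightarrow> (LINT z|?M. g z * bump 0 r (z - w')) / ?m"
        unfolding eqn[OF w'] by (intro tendsto_divide inner_lim tendsto_const shiftL t bump_mass_nonzero r(1))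
    qed
    let ?D = "\<lambda>f v. - (LINT z|?M. f z * frechet_derivative (bump 0 r) (at (z - w)) v) / ?m"
    have der: "(f has_derivative ?D f) (at w)"
      if f: "f \<in> L2 \<Omega>" and eq: "\<And>w'. w' \<in> ball w r \<Longrightarrow> f w' = (LINT z|?M. f z * bump 0 r (z - w')) / ?m" for f
    proof -
      have "((\<lambda>w. (LINT z|?M. f z * bump 0 r (z - w)) / ?m) has_derivative ?D f) (at w)"
        by (rule bounded_linear.has_derivative[OF bounded_linear_divide convolution_has_derivative[OF L2_integrable[OF lm f] t]])
      then show ?thesis
        by (rule has_derivative_transform_within_open[OF _ open_ball[of w r]]) (use r eq in auto)
    qed
    have dern: "(h n has_derivative ?D (h n)) (at w)" for n by (rule der[OF hL eqn])
    have Dn: "?D (h n) (c *s v) = c * ?D (h n) v" for n c v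
    proof -
      have "holomorphic_several \<Omega> (h n)" using h by (simp add: bergman_space_def)
      from holomorphic_several_derivative(2)[OF this w] show ?thesis unfolding frechet_derivative_eqI[OF dern] .
    qed
    have Dlim: "(\<lambda>n. ?D (h n) v) \<longlonglongrightarrow> ?D g v" for v
    proof -
      have lin: "linear (frechet_derivative (bump 0 r) (at x))" for x :: "complex^'n"
        by (rule linear_frechet_derivative[OF smooth_on_differentiable[OF smooth_on_bump UNIV_I]])
      have "(\<lambda>z. \<Sum>b\<in>Basis. frechet_derivative (bump 0 r) (at (z - w)) b * of_real (v \<bullet> b)) \<in> L2 \<Omega>"
      proof -
        have "(\<lambda>z. frechet_derivative (bump 0 r) (at (z - w)) b * of_real (v \<bullet> b)) \<in> L2 \<Omega>" if "b \<in> Basis" for b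
          using L2_cmult[OF shiftL[OF test_function_iter_partial[OF t, of "[b]"]], of "of_real (v \<bullet> b)"] that by (simp add: mult.commute)
        then show ?thesis by (rule L2_sum)
      qed
      then have "(\<lambda>z. frechet_derivative (bump 0 r) (at (z - w)) v) \<in> L2 \<Omega>" by (simp add: linear_sum_Basis[OF lin])
      then show ?thesis by (intro tendsto_divide tendsto_minus inner_lim tendsto_const bump_mass_nonzero r(1))
    qed
    have "?D g (c *s v) = c * ?D g v" for c v
      using LIMSEQ_unique[OF Dlim[of "c *s v"]] tendsto_mult[OF tendsto_const Dlim[of v], of c] unfolding Dn by blast
    then show "\<exists>D. (g has_derivative D) (at w) \<and> (\<forall>c v. D (c *s v) = c * D v)"
      using der[OF gL eqg] by blast
  qed
  then have "g \<in> bergman_space \<Omega>" using gL by (simp add: bergman_space_def)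
  then show ?thesis using conv0 by blast
qed

section \<open>The Bergman projection\<close>

text \<open>Point evaluations are continuous in the \<open>L\<^sup>2\<close> norm, so a holomorphic function that vanishes almost everywhere is 0 at
  every point of \<open>\<Omega>\<close>.\<close>

lemma bergman_inner_self_zero:
  assumes \<Omega>: "open \<Omega>" "bounded \<Omega>" and g: "g \<in> bergman_space \<Omega>" "L2_inner \<Omega> g g = 0" and w: "w \<in> \<Omega>"
  shows "g w = 0"
proof -
  obtain e where e: "e > 0" "ball w e \<subseteq> \<Omega>" using \<Omega>(1) w openE by blast
  have r: "e / 2 > 0" "ball w (2 * (e / 2)) \<subseteq> \<Omega>" using e by auto
  have k: "eval_kernel [] w (e / 2) \<in> L2 \<Omega>"
    by (rule test_function_L2[OF eval_kernel_test_function \<Omega>]) (use e in auto)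
  have "L2_norm \<Omega> g = 0" using g(2) unfolding L2_inner_self by simp
  then show ?thesis
    using bergman_smooth_and_evaluation(2)[OF g(1) \<Omega> r, of "[]"] L2_Cauchy_Schwarz[OF bergman_space_L2[OF g(1)] k] by simp
qed

text \<open>Existence is the projection theorem for the complete space of holomorphic functions. Uniqueness holds pointwise, not
  only almost everywhere, which justifies the definite description.\<close>

lemma bergman_projection:
  assumes \<Omega>: "open \<Omega>" "bounded \<Omega>" and f: "f \<in> L2 \<Omega>"
  shows "bergman_projection \<Omega> f \<in> bergman_space \<Omega>"
    and "\<And>h. h \<in> bergman_space \<Omega> \<Longrightarrow> L2_inner \<Omega> (bergman_projection \<Omega> f) h = L2_inner \<Omega> f h"
    and "\<And>g. g \<in> bergman_space \<Omega> \<Longrightarrow> (\<And>z. z \<notin> \<Omega> \<Longrightarrow> g z = 0) \<Longrightarrow>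
      (\<And>h. h \<in> bergman_space \<Omega> \<Longrightarrow> L2_inner \<Omega> g h = L2_inner \<Omega> f h) \<Longrightarrow> bergman_projection \<Omega> f = g"
    and "\<And>z. z \<notin> \<Omega> \<Longrightarrow> bergman_projection \<Omega> f z = 0"
proof -
  let ?P = "\<lambda>g. g \<in> bergman_space \<Omega> \<and> (\<forall>z. z \<notin> \<Omega> \<longrightarrow> g z = 0) \<and>
     (\<forall>h\<in>bergman_space \<Omega>. L2_inner \<Omega> (\<lambda>z. f z - g z) h = 0)"
  have eq: "L2_inner \<Omega> (\<lambda>z. f z - g z) h = L2_inner \<Omega> f h - L2_inner \<Omega> g h"
    if "g \<in> bergman_space \<Omega>" "h \<in> bergman_space \<Omega>" for g h
    by (rule L2_inner_diff_left[OF f bergman_space_L2[OF that(1)] bergman_space_L2[OF that(2)]])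
  have "\<exists>g\<in>bergman_space \<Omega>. \<forall>h\<in>bergman_space \<Omega>. L2_inner \<Omega> (\<lambda>x. f x - g x) h = 0"
  proof (rule L2_projection_exists[OF _ _ _ _ f])
    show "bergman_space \<Omega> \<subseteq> L2 \<Omega>" using bergman_space_L2 by blast
    show "bergman_space \<Omega> \<noteq> {}" using bergman_space_zero by blast
  qed (use bergman_space_lin bergman_complete[OF \<Omega>] in blast)+
  then obtain g0 where g0: "g0 \<in> bergman_space \<Omega>" "\<And>h. h \<in> bergman_space \<Omega> \<Longrightarrow> L2_inner \<Omega> (\<lambda>x. f x - g0 x) h = 0"
    by blast
  define g where "g z = (if z \<in> \<Omega> then g0 z else 0)" for z
  have gA: "g \<in> bergman_space \<Omega>" by (rule bergman_space_cong[OF \<Omega>(1) _ g0(1)]) (simp add: g_def)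
  have "L2_inner \<Omega> (\<lambda>x. f x - g x) h = L2_inner \<Omega> (\<lambda>x. f x - g0 x) h" for h
    unfolding L2_inner_def by (rule Bochner_Integration.integral_cong) (auto simp: g_def)
  then have Pg: "?P g" using gA g0(2) by (auto simp: g_def)
  have uniq: "g1 = g2" if "?P g1" "?P g2" for g1 g2
  proof
    fix z
    show "g1 z = g2 z"
    proof (cases "z \<in> \<Omega>")
      case True
      have d: "(\<lambda>x. g1 x - g2 x) \<in> bergman_space \<Omega>" using bergman_space_lin[of g1 \<Omega> g2 "-1"] that by simp
      have "L2_inner \<Omega> (\<lambda>x. g1 x - g2 x) (\<lambda>x. g1 x - g2 x) = 0"
        using that eq[OF _ d, of g1] eq[OF _ d, of g2] d L2_inner_diff_left[OF bergman_space_L2 bergman_space_L2 bergman_space_L2, of g1 \<Omega> g2 "\<lambda>x. g1 x - g2 x"]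
        by simp
      from bergman_inner_self_zero[OF \<Omega> d this True] show ?thesis by simp
    qed (use that in auto)
  qed
  have "?P (bergman_projection \<Omega> f)" unfolding bergman_projection_def by (rule theI[of ?P, OF Pg]) (use uniq Pg in blast)
  then show "bergman_projection \<Omega> f \<in> bergman_space \<Omega>"
    and "\<And>h. h \<in> bergman_space \<Omega> \<Longrightarrow> L2_inner \<Omega> (bergman_projection \<Omega> f) h = L2_inner \<Omega> f h"
    and "\<And>z. z \<notin> \<Omega> \<Longrightarrow> bergman_projection \<Omega> f z = 0"
    using eq by auto
  show "bergman_projection \<Omega> f = g" if "g \<in> bergman_space \<Omega>" "\<And>z. z \<notin> \<Omega> \<Longrightarrow> g z = 0"
      "\<And>h. h \<in> bergman_space \<Omega> \<Longrightarrow> L2_inner \<Omega> g h = L2_inner \<Omega> f h" for g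
  proof -
    have "?P g" using that eq by auto
    then show ?thesis using \<open>?P (bergman_projection \<Omega> f)\<close> uniq by blast
  qed
qed

lemma bergman_projection_selfadjoint:
  assumes \<Omega>: "open \<Omega>" "bounded \<Omega>" and f: "f \<in> L2 \<Omega>" and g: "g \<in> L2 \<Omega>"
  shows "L2_inner \<Omega> (bergman_projection \<Omega> f) g = L2_inner \<Omega> f (bergman_projection \<Omega> g)"
proof -
  note Bf = bergman_projection[OF \<Omega> f] and Bg = bergman_projection[OF \<Omega> g]
  have "L2_inner \<Omega> (bergman_projection \<Omega> f) g = cnj (L2_inner \<Omega> g (bergman_projection \<Omega> f))"
    by (rule L2_inner_commute)
  also have "L2_inner \<Omega> g (bergman_projection \<Omega> f) = L2_inner \<Omega> (bergman_projection \<Omega> g) (bergman_projection \<Omega> f)"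
    using Bg(2)[OF Bf(1)] by simp
  also have "cnj \<dots> = L2_inner \<Omega> (bergman_projection \<Omega> f) (bergman_projection \<Omega> g)"
    by (rule L2_inner_commute[symmetric])
  also have "\<dots> = L2_inner \<Omega> f (bergman_projection \<Omega> g)" by (rule Bf(2)[OF Bg(1)])
  finally show ?thesis .
qed

lemma bergman_projection_diff:
  assumes \<Omega>: "open \<Omega>" "bounded \<Omega>" and f: "f \<in> L2 \<Omega>" and g: "g \<in> L2 \<Omega>"
  shows "bergman_projection \<Omega> (\<lambda>x. f x - g x) = (\<lambda>x. bergman_projection \<Omega> f x - bergman_projection \<Omega> g x)"
proof (rule bergman_projection(3)[OF \<Omega> L2_diff[OF f g]])
  note Bf = bergman_projection[OF \<Omega> f] and Bg = bergman_projection[OF \<Omega> g]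
  show "(\<lambda>x. bergman_projection \<Omega> f x - bergman_projection \<Omega> g x) \<in> bergman_space \<Omega>"
    using bergman_space_lin[OF Bf(1) Bg(1), of "-1"] by simp
  fix h assume h: "h \<in> bergman_space \<Omega>"
  show "L2_inner \<Omega> (\<lambda>x. bergman_projection \<Omega> f x - bergman_projection \<Omega> g x) h = L2_inner \<Omega> (\<lambda>x. f x - g x) h"
    using L2_inner_diff_left[OF bergman_space_L2[OF Bf(1)] bergman_space_L2[OF Bg(1)] bergman_space_L2[OF h]]
      L2_inner_diff_left[OF f g bergman_space_L2[OF h]] Bf(2)[OF h] Bg(2)[OF h] by simp
qed (use bergman_projection(4)[OF \<Omega>] f g in auto)

text \<open>By self-adjointness the projection moves from \<open>f\<close> to the kernel. The dependence on \<open>w\<close> is now carried by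
  holomorphic functions \<open>B k\<^sub>w\<close> alone, and bounds uniform in \<open>w\<close> become statements about these.\<close>

lemma bergman_projection_evaluation:
  assumes \<Omega>: "open \<Omega>" "bounded \<Omega>" and f: "f \<in> L2 \<Omega>" and r: "r > 0" "ball w (2 * r) \<subseteq> \<Omega>" and bs: "bs \<in> lists Basis"
  shows "iter_partial bs (bergman_projection \<Omega> f) w = L2_inner \<Omega> f (bergman_projection \<Omega> (eval_kernel bs w r))"
proof -
  have "ball w r \<subseteq> \<Omega>" using r by (auto simp: subset_iff)
  then have k: "eval_kernel bs w r \<in> L2 \<Omega>"
    by (intro test_function_L2[OF eval_kernel_test_function \<Omega>] r bs)
  show ?thesis
    using bergman_smooth_and_evaluation(2)[OF bergman_projection(1)[OF \<Omega> f] \<Omega> r bs]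
      bergman_projection_selfadjoint[OF \<Omega> f k] by simp
qed

section \<open>Condition R gives polynomial growth of the kernel\<close>

lemma suminf_has_derivative:
  fixes f :: "nat \<Rightarrow> 'a::euclidean_space \<Rightarrow> complex"
  assumes der: "\<And>j x. (f j has_derivative f' j x) (at x)"
    and M: "summable M" "\<And>j x. norm (f j x) \<le> M j"
    and M': "\<And>b. b \<in> Basis \<Longrightarrow> summable (M' b)" "\<And>b j x. b \<in> Basis \<Longrightarrow> norm (f' j x b) \<le> M' b j"
  shows "((\<lambda>x. \<Sum>j. f j x) has_derivative (\<lambda>v. \<Sum>j. f' j x v)) (at x)"
proof -
  define N where "N j = (\<Sum>b\<in>Basis. M' b j)" for j
  have N: "summable N" unfolding N_def by (intro summable_sum M')
  have lin: "linear (f' j x)" for j x using der has_derivative_linear by blast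
  have bd: "norm (f' j x v) \<le> N j * norm v" for j x v
    unfolding N_def by (rule order_trans[OF norm_linear_le_sum_Basis[OF lin]]) (intro mult_right_mono sum_mono M', auto)
  have sN: "summable (\<lambda>j. N j * norm v)" for v :: 'a using N by (rule summable_mult2)
  have s': "summable (\<lambda>j. f' j x v)" for x v
    by (rule summable_comparison_test'[OF sN[of v]]) (use bd in auto)
  have sf: "summable (\<lambda>j. f j x)" for x by (rule summable_comparison_test'[OF M(1)]) (use M(2) in auto)
  have "\<exists>g. \<forall>x\<in>UNIV. (\<lambda>j. f j x) sums g x \<and> (g has_derivative (\<lambda>v. \<Sum>j. f' j x v)) (at x within UNIV)"
  proof (rule has_derivative_series[where f'=f'])
    fix e :: real assume e: "e > 0"
    obtain n0 where n0: "\<And>n. n \<ge> n0 \<Longrightarrow> norm (\<Sum>i. N (i + n)) < e"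
      using suminf_exist_split[OF e N] by blast
    show "\<forall>\<^sub>F n in sequentially. \<forall>x\<in>UNIV. \<forall>h. norm ((\<Sum>i<n. f' i x h) - (\<Sum>j. f' j x h)) \<le> e * norm h"
      unfolding eventually_sequentially
    proof (intro exI[of _ n0] allI impI ballI)
      fix n x and h :: 'a assume n: "n \<ge> n0"
      have "(\<Sum>i<n. f' i x h) - (\<Sum>j. f' j x h) = - (\<Sum>i. f' (i + n) x h)"
        using suminf_minus_initial_segment[OF s'[of x h], of n] by simp
      then have "norm ((\<Sum>i<n. f' i x h) - (\<Sum>j. f' j x h)) = norm (\<Sum>i. f' (i + n) x h)" by simp
      also have "\<dots> \<le> (\<Sum>i. N (i + n) * norm h)"
        by (rule norm_suminf_le[OF bd summable_ignore_initial_segment[OF sN]])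
      also have "\<dots> = (\<Sum>i. N (i + n)) * norm h"
        by (rule suminf_mult2[OF summable_ignore_initial_segment[OF N], symmetric])
      also have "\<dots> \<le> e * norm h" using n0[OF n] by (intro mult_right_mono) auto
      finally show "norm ((\<Sum>i<n. f' i x h) - (\<Sum>j. f' j x h)) \<le> e * norm h" .
    qed
  qed (use der sf summable_sums in \<open>auto\<close>)
  then obtain g where g: "\<And>x. (\<lambda>j. f j x) sums g x" "\<And>x. (g has_derivative (\<lambda>v. \<Sum>j. f' j x v)) (at x)" by auto
  have "g = (\<lambda>x. \<Sum>j. f j x)" using g(1) sums_unique by blast
  then show ?thesis using g(2) by simp
qed

lemma smooth_on_suminf:
  fixes f :: "nat \<Rightarrow> 'a::euclidean_space \<Rightarrow> complex"
  assumes sm: "\<And>j. smooth_on UNIV (f j)"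
    and M: "\<And>bs. bs \<in> lists Basis \<Longrightarrow> \<exists>M. summable M \<and> (\<forall>j x. norm (iter_partial bs (f j) x) \<le> M j)"
  shows "smooth_on UNIV (\<lambda>x. \<Sum>j. f j x)"
proof -
  have der: "((\<lambda>x. \<Sum>j. iter_partial bs (f j) x) has_derivative
      (\<lambda>v. \<Sum>j. frechet_derivative (iter_partial bs (f j)) (at x) v)) (at x)" if bs: "bs \<in> lists Basis" for bs x
  proof -
    obtain M0 where M0: "summable M0" "\<And>j x. norm (iter_partial bs (f j) x) \<le> M0 j" using M[OF bs] by blast
    have "\<exists>M. summable M \<and> (\<forall>j x. norm (frechet_derivative (iter_partial bs (f j)) (at x) b) \<le> M j)" if "b \<in> Basis" for b
      using M[of "b # bs"] bs that by simp
    then obtain M' where M': "\<And>b. b \<in> Basis \<Longrightarrow> summable (M' b)"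
      "\<And>b j x. b \<in> Basis \<Longrightarrow> norm (frechet_derivative (iter_partial bs (f j)) (at x) b) \<le> M' b j" by metis
    show ?thesis
      by (rule suminf_has_derivative[OF iter_partial_has_derivative[OF sm bs UNIV_I] M0 M'])
  qed
  have eq: "iter_partial bs (\<lambda>x. \<Sum>j. f j x) = (\<lambda>x. \<Sum>j. iter_partial bs (f j) x)" if "bs \<in> lists Basis" for bs
    using that
  proof (induction bs)
    case (Cons b bs)
    show ?case using frechet_derivative_eqI[OF der[OF Cons.hyps(2)]] by (simp add: Cons.IH)
  qed simp
  show ?thesis unfolding smooth_on_def
    using eq der differentiableI by (metis open_UNIV)
qed

text \<open>A uniform boundedness principle for bounds that may deteriorate like a negative power of a parameter \<open>\<rho>\<close>. If
  no power suffices, choose inductively indices \<open>l\<^sub>i\<close>, points \<open>w\<^sub>i\<close> and weights \<open>e\<^sub>i\<close> such that \<open>e\<^sub>i a(l\<^sub>i, w\<^sub>i)\<close> beats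
  everything chosen before (bounded through \<open>S\<close>), while \<open>e\<^sub>i\<close> is so small that the later terms do not disturb the values at the
  earlier points (bounded through \<open>K\<close>). The factor \<open>\<rho>\<^sup>i\<close> in the weights makes them decay faster than every fixed power of
  \<open>\<rho>\<close>.\<close>

lemma gliding_hump:
  fixes a :: "'l \<Rightarrow> 'w \<Rightarrow> complex" and \<rho> :: "'l \<Rightarrow> real"
  assumes \<rho>: "\<And>l. l \<in> \<Lambda> \<Longrightarrow> 0 < \<rho> l" "\<And>l. l \<in> \<Lambda> \<Longrightarrow> \<rho> l \<le> 1"
    and S: "\<And>l w. l \<in> \<Lambda> \<Longrightarrow> w \<in> W \<Longrightarrow> norm (a l w) \<le> S l"
    and K: "\<And>l w. l \<in> \<Lambda> \<Longrightarrow> w \<in> W \<Longrightarrow> norm (a l w) \<le> K w"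
    and unb: "\<And>C m. \<exists>l\<in>\<Lambda>. \<exists>w\<in>W. norm (a l w) > C / \<rho> l ^ m"
  shows "\<exists>l e w. \<forall>i. l i \<in> \<Lambda> \<and> 0 \<le> e i \<and> e i \<le> (1/2) ^ i * \<rho> (l i) ^ i \<and> w i \<in> W \<and>
    real i \<le> norm (\<Sum>j. of_real (e j) * a (l j) (w i))"
proof -
  define P where "P i s = (case s of (l, w, e, \<kappa>, \<sigma>) \<Rightarrow> l \<in> \<Lambda> \<and> w \<in> W \<and> 0 \<le> e \<and> e \<le> (1/2) ^ i * \<rho> l ^ i \<and>
     \<bar>K w\<bar> \<le> \<kappa> \<and> e * \<bar>S l\<bar> \<le> \<sigma>)" for i :: nat and s :: "'l \<times> 'w \<times> real \<times> real \<times> real"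
  define Q where "Q i s s' = (case s of (l, w, e, \<kappa>, \<sigma>) \<Rightarrow> case s' of (l', w', e', \<kappa>', \<sigma>') \<Rightarrow>
     \<kappa>' = \<kappa> + \<bar>K w'\<bar> \<and> \<sigma>' = \<sigma> + e' * \<bar>S l'\<bar> \<and> e' * (1 + \<kappa>) \<le> (1/2) ^ Suc i \<and>
     real (Suc i) + 2 + \<sigma> \<le> e' * norm (a l' w'))" for i :: nat and s s' :: "'l \<times> 'w \<times> real \<times> real \<times> real"
  have "\<exists>f. \<forall>i. P i (f i) \<and> Q i (f i) (f (Suc i))"
  proof (rule dependent_nat_choice)
    obtain l w where "l \<in> \<Lambda>" "w \<in> W" using unb[of 0 0] by blast
    then have "P 0 (l, w, 0, \<bar>K w\<bar>, 0)" by (simp add: P_def)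
    then show "\<exists>s. P 0 s" by blast
  next
    fix s and i :: nat assume Ps: "P i s"
    obtain l w e \<kappa> \<sigma> where s: "s = (l, w, e, \<kappa>, \<sigma>)" by (metis prod_cases5)
    have b: "0 \<le> e" "\<bar>K w\<bar> \<le> \<kappa>" "e * \<bar>S l\<bar> \<le> \<sigma>" using Ps by (auto simp: P_def s)
    have pos: "\<kappa> \<ge> 0" "\<sigma> \<ge> 0"
      using order_trans[OF abs_ge_zero b(2)] order_trans[OF mult_nonneg_nonneg[OF b(1) abs_ge_zero] b(3)] by auto
    obtain l' w' where lw: "l' \<in> \<Lambda>" "w' \<in> W"
      and big: "norm (a l' w') > (2 ^ Suc i * (1 + \<kappa>) * (real (Suc i) + 2 + \<sigma>)) / \<rho> l' ^ Suc i"
      using unb[of "2 ^ Suc i * (1 + \<kappa>) * (real (Suc i) + 2 + \<sigma>)" "Suc i"] by blast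
    define e' where "e' = (1/2) ^ Suc i * \<rho> l' ^ Suc i / (1 + \<kappa>)"
    have r: "0 < \<rho> l'" "\<rho> l' \<le> 1" using \<rho> lw by auto
    have rp: "0 < \<rho> l' ^ Suc i" "\<rho> l' ^ Suc i \<le> 1" using r power_le_one[of "\<rho> l'" "Suc i"] by auto
    have e': "e' > 0" unfolding e'_def using rp pos by (intro divide_pos_pos mult_pos_pos) auto
    have e'1: "e' * (1 + \<kappa>) = (1/2) ^ Suc i * \<rho> l' ^ Suc i" 
      using pos unfolding e'_def by (simp del: power_Suc)
    have e'2: "e' \<le> (1/2) ^ Suc i * \<rho> l' ^ Suc i"
      unfolding e'1[symmetric] using e' pos by (simp add: mult_le_cancel_left1)
    have "real (Suc i) + 2 + \<sigma> = e' * ((2 ^ Suc i * (1 + \<kappa>) * (real (Suc i) + 2 + \<sigma>)) / \<rho> l' ^ Suc i)"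
    proof -
      have c: "(p * X / y) * ((q * y * u) / X) = (p * q) * u" if "X \<noteq> 0" "y \<noteq> 0" for p q X y u :: real
        using that by simp
      have h: "(1/2) ^ Suc i * 2 ^ Suc i = (1::real)" by (simp add: power_one_over del: power_Suc)
      have n: "\<rho> l' ^ Suc i \<noteq> 0" "1 + \<kappa> \<noteq> 0" using rp(1) pos by (auto simp del: power_Suc)
      show ?thesis using c[OF n, of "(1/2) ^ Suc i" "2 ^ Suc i" "real (Suc i) + 2 + \<sigma>"]
        unfolding e'_def h mult_1_left by (rule sym)
    qed
    also have "\<dots> \<le> e' * norm (a l' w')" using big e' by (intro mult_left_mono) auto
    finally have q: "real (Suc i) + 2 + \<sigma> \<le> e' * norm (a l' w')" .
    have "e' * (1 + \<kappa>) \<le> (1/2) ^ Suc i"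
      unfolding e'1 using rp by (simp add: mult_le_cancel_left2)
    then have "P (Suc i) (l', w', e', \<kappa> + \<bar>K w'\<bar>, \<sigma> + e' * \<bar>S l'\<bar>) \<and> Q i s (l', w', e', \<kappa> + \<bar>K w'\<bar>, \<sigma> + e' * \<bar>S l'\<bar>)"
      unfolding P_def Q_def s using lw e' e'2 pos q by simp
    then show "\<exists>s'. P (Suc i) s' \<and> Q i s s'" by blast
  qed
  then obtain f where f: "\<And>i. P i (f i)" "\<And>i. Q i (f i) (f (Suc i))" by blast
  define l where "l i = fst (f i)" for i
  define w where "w i = fst (snd (f i))" for i
  define e where "e i = fst (snd (snd (f i)))" for i
  define \<kappa> where "\<kappa> i = fst (snd (snd (snd (f i))))" for i
  define \<sigma> where "\<sigma> i = snd (snd (snd (snd (f i))))" for i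
  have fi: "f i = (l i, w i, e i, \<kappa> i, \<sigma> i)" for i by (simp add: l_def w_def e_def \<kappa>_def \<sigma>_def)
  have p: "l i \<in> \<Lambda>" "w i \<in> W" "0 \<le> e i" "e i \<le> (1/2) ^ i * \<rho> (l i) ^ i" "\<bar>K (w i)\<bar> \<le> \<kappa> i" "e i * \<bar>S (l i)\<bar> \<le> \<sigma> i" for i
    using f(1)[of i] by (auto simp: P_def fi)
  have q: "\<kappa> (Suc i) = \<kappa> i + \<bar>K (w (Suc i))\<bar>" "\<sigma> (Suc i) = \<sigma> i + e (Suc i) * \<bar>S (l (Suc i))\<bar>"
     "e (Suc i) * (1 + \<kappa> i) \<le> (1/2) ^ Suc i" "real (Suc i) + 2 + \<sigma> i \<le> e (Suc i) * norm (a (l (Suc i)) (w (Suc i)))" for i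
    using f(2)[of i] by (auto simp: Q_def fi)
  have \<kappa>mono: "\<kappa> i \<le> \<kappa> j" if "i \<le> j" for i j using that by (induction rule: dec_induct) (auto simp: q)
  have \<sigma>sum: "(\<Sum>j\<le>i. e j * \<bar>S (l j)\<bar>) \<le> \<sigma> i" for i
    by (induction i) (use p(6)[of 0] q(2) in auto)
  have tail: "e j * norm (a (l j) (w i)) \<le> (1/2) ^ j" if ij: "i < j" for i j
  proof -
    obtain j' where j': "j = Suc j'" "i \<le> j'" using ij by (cases j) auto
    have "norm (a (l j) (w i)) \<le> \<bar>K (w i)\<bar>" using K[OF p(1)[of j] p(2)[of i]] by linarith
    also have "\<dots> \<le> 1 + \<kappa> j'" using p(5)[of i] \<kappa>mono[OF j'(2)] by linarith
    finally have "e j * norm (a (l j) (w i)) \<le> e j * (1 + \<kappa> j')" using p(3) by (rule mult_left_mono)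
    then show ?thesis using q(3)[of j'] j'(1) by simp
  qed
  have big: "real i \<le> norm (\<Sum>j. of_real (e j) * a (l j) (w i))" for i
  proof (cases i)
    case (Suc i')
    let ?t = "\<lambda>j. of_real (e j) * a (l j) (w i)"
    have nt: "norm (?t j) = e j * norm (a (l j) (w i))" for j using p(3)[of j] by (simp add: norm_mult)
    have geo: "summable (\<lambda>j. (1/2::real) ^ j)" by (simp add: summable_geometric)
    have sm: "summable ?t"
    proof (rule summable_comparison_test[OF _ geo])
      show "\<exists>N. \<forall>j\<ge>N. norm (?t j) \<le> (1/2) ^ j" using tail[of i] nt by (intro exI[of _ "Suc i"]) auto
    qed
    have "suminf ?t = (\<Sum>j. ?t (j + Suc i)) + (\<Sum>j<Suc i. ?t j)"
      by (rule suminf_split_initial_segment[OF sm])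
    then have split: "?t i = suminf ?t - (\<Sum>j. ?t (j + Suc i)) - (\<Sum>j<i. ?t j)" by simp
    have a1: "norm (\<Sum>j. ?t (j + Suc i)) \<le> 2"
    proof -
      have "norm (\<Sum>j. ?t (j + Suc i)) \<le> (\<Sum>j. (1/2::real) ^ j)"
      proof (rule norm_suminf_le)
        show "norm (?t (j + Suc i)) \<le> (1/2) ^ j" for j
        proof -
          have "norm (?t (j + Suc i)) \<le> (1/2) ^ (j + Suc i)" unfolding nt by (rule tail) simp
          also have "\<dots> \<le> (1/2) ^ j" by (rule power_decreasing) auto
          finally show ?thesis .
        qed
      qed (rule geo)
      also have "\<dots> = 2" by (simp add: suminf_geometric)
      finally show ?thesis .
    qed
    have a2: "norm (\<Sum>j<i. ?t j) \<le> \<sigma> i'"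
    proof -
      have "norm (\<Sum>j<i. ?t j) \<le> (\<Sum>j<i. e j * \<bar>S (l j)\<bar>)"
      proof (rule order_trans[OF norm_sum sum_mono])
        fix j
        have "norm (a (l j) (w i)) \<le> \<bar>S (l j)\<bar>" using S[OF p(1)[of j] p(2)[of i]] by linarith
        then show "norm (?t j) \<le> e j * \<bar>S (l j)\<bar>" unfolding nt using p(3) by (rule mult_left_mono)
      qed
      also have "\<dots> \<le> \<sigma> i'" using \<sigma>sum[of i'] unfolding Suc lessThan_Suc_atMost .
      finally show ?thesis .
    qed
    have "real i + 2 + \<sigma> i' \<le> norm (?t i)" 
      using q(4)[of i'] nt[of i] unfolding Suc by linarith
    also have "\<dots> \<le> norm (suminf ?t) + norm (\<Sum>j. ?t (j + Suc i)) + norm (\<Sum>j<i. ?t j)"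
      unfolding split by (meson add_right_mono norm_triangle_ineq4 order_trans)
    finally show ?thesis using a1 a2 by linarith
  qed simp
  show ?thesis by (rule exI[of _ l], rule exI[of _ e], rule exI[of _ w]) (use p big in simp)
qed

lemma bump_derivative_bounds:
  fixes bs :: "'a::euclidean_space list"
  assumes bs: "bs \<in> lists Basis"
  obtains C where "C \<ge> 0" "\<And>z r x. r > 0 \<Longrightarrow> norm (iter_partial bs (bump z r) (x :: 'a)) \<le> C / r ^ length bs"
proof -
  have "bump 0 1 \<in> test_functions (UNIV :: 'a set)" by (rule bump_test_function) auto
  from test_function_bounded[OF test_function_iter_partial[OF this bs]]
  obtain C where C: "\<And>x. norm (iter_partial bs (bump 0 1) (x :: 'a)) \<le> C" by (auto simp: bounded_iff)
  show thesis
  proof (rule that[of C])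
    show "C \<ge> 0" using C[of 0] by (rule order_trans[OF norm_ge_zero])
    fix z x :: 'a and r :: real assume r: "r > 0"
    have "norm (iter_partial bs (bump z r) x) = \<bar>(1 / r) ^ length bs\<bar> * norm (iter_partial bs (bump 0 1) ((1 / r) *\<^sub>R (x - z)))"
      unfolding bump_affine[OF r] iter_partial_affine[OF smooth_on_bump bs] by simp
    also have "\<dots> \<le> (1 / r) ^ length bs * C" using r C by (simp add: power_one_over divide_right_mono)
    finally show "norm (iter_partial bs (bump z r) x) \<le> C / r ^ length bs" by (simp add: power_one_over)
  qed
qed

text \<open>Otherwise the gliding hump principle yields a series \<open>\<Phi> = \<Sum> e\<^sub>j \<psi>\<^sub>j\<close> of bumps such that the derivative of \<open>B \<Phi>\<close> along \<open>bs\<close> is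
  unbounded. A derivative of order \<open>k\<close> of a bump of radius \<open>r\<close> has size \<open>r\<^sup>-\<^sup>k\<close>, and \<open>e\<^sub>j \<le> 2\<^sup>-\<^sup>j r\<^sub>j\<^sup>j\<close>, so the series
  converges with all its derivatives: \<open>\<Phi>\<close> is smooth, and Condition R makes every derivative of \<open>B \<Phi>\<close> bounded. The two
  hypotheses of the principle are Condition R for a single bump, and continuity of the point evaluation in \<open>L\<^sup>2\<close>.\<close>

lemma bergman_projection_bump_bound:
  fixes \<Omega> :: "(complex^'n) set"
  assumes \<Omega>: "open \<Omega>" "bounded \<Omega>" and R: "condition_R \<Omega>" and bs: "bs \<in> lists Basis"
  shows "\<exists>C m. \<forall>z r w. ball z r \<subseteq> \<Omega> \<longrightarrow> 0 < r \<longrightarrow> r \<le> 1 \<longrightarrow> w \<in> \<Omega> \<longrightarrow>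
     norm (iter_partial bs (bergman_projection \<Omega> (bump z r)) w) \<le> C / r ^ m"
proof (rule ccontr)
  assume neg: "\<not> ?thesis"
  let ?B = "bergman_projection \<Omega>"
  define \<Lambda> where "\<Lambda> = {(z, r). ball z r \<subseteq> \<Omega> \<and> 0 < r \<and> r \<le> (1::real)}"
  define \<phi> where "\<phi> l = bump (fst l) (snd l)" for l :: "(complex^'n) \<times> real"
  define a where "a l w = iter_partial bs (?B (\<phi> l)) w" for l w
  have lm: "\<Omega> \<in> lmeasurable" by (rule bounded_open_lmeasurable[OF \<Omega>])
  have \<phi>t: "\<phi> l \<in> test_functions \<Omega>" if "l \<in> \<Lambda>" for l
    unfolding \<phi>_def by (rule bump_test_function) (use that in \<open>auto simp: \<Lambda>_def\<close>)
  have sup: "\<exists>S. \<forall>w\<in>\<Omega>. norm (iter_partial bs (?B f) w) \<le> S" if "f \<in> smooth_closure \<Omega>" for f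
  proof -
    have "?B f \<in> smooth_closure \<Omega>" using R that unfolding condition_R_def by blast
    then have "ksmooth True \<Omega> (length bs) (?B f)" by (rule smooth_closure_ksmooth_True[OF _ \<Omega>(2)])
    then have "bounded (iter_partial bs (?B f) ` \<Omega>)" unfolding ksmooth_iter_partial using bs by blast
    then show ?thesis by (auto simp: bounded_iff)
  qed
  have "\<exists>r>0. ball w (2 * r) \<subseteq> \<Omega>" if "w \<in> \<Omega>" for w
  proof -
    obtain e where "e > 0" "ball w e \<subseteq> \<Omega>" using \<Omega>(1) \<open>w \<in> \<Omega>\<close> openE by blast
    then show ?thesis by (intro exI[of _ "e / 2"]) auto
  qed
  then obtain r0 where r0: "\<And>w. w \<in> \<Omega> \<Longrightarrow> r0 w > 0" "\<And>w. w \<in> \<Omega> \<Longrightarrow> ball w (2 * r0 w) \<subseteq> \<Omega>" by metis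
  define k where "k w = ?B (eval_kernel bs w (r0 w))" for w
  have ev: "iter_partial bs (?B f) w = L2_inner \<Omega> f (k w)" if "f \<in> L2 \<Omega>" "w \<in> \<Omega>" for f w
    unfolding k_def by (rule bergman_projection_evaluation[OF \<Omega> that(1) r0(1)[OF that(2)] r0(2)[OF that(2)] bs])
  have kL: "k w \<in> L2 \<Omega>" if "w \<in> \<Omega>" for w
  proof -
    have "ball w (r0 w) \<subseteq> \<Omega>" using r0[OF that] by (auto simp: subset_iff)
    then show ?thesis unfolding k_def
      by (intro bergman_space_L2 bergman_projection(1) \<Omega> test_function_L2[OF eval_kernel_test_function] r0(1) that bs)
  qed
  have small: "L2_norm \<Omega> f \<le> C * sqrt (measure lebesgue \<Omega>)" if "f \<in> L2 \<Omega>" "\<And>x. norm (f x) \<le> C" for f C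
    by (rule bounded_measurable_L2(2)[OF lm]) (use that L2_measurable in auto)
  have "\<forall>l\<in>\<Lambda>. \<exists>S. \<forall>w\<in>\<Omega>. norm (a l w) \<le> S"
    unfolding a_def using sup[OF test_function_smooth_closure[OF \<phi>t \<Omega>(1)]] by blast
  then obtain S where S: "\<And>l w. l \<in> \<Lambda> \<Longrightarrow> w \<in> \<Omega> \<Longrightarrow> norm (a l w) \<le> S l" by metis
  have K: "norm (a l w) \<le> sqrt (measure lebesgue \<Omega>) * L2_norm \<Omega> (k w)" if lw: "l \<in> \<Lambda>" "w \<in> \<Omega>" for l w
  proof -
    have L: "\<phi> l \<in> L2 \<Omega>" by (rule test_function_L2[OF \<phi>t[OF lw(1)] \<Omega>])
    have "norm (a l w) \<le> L2_norm \<Omega> (\<phi> l) * L2_norm \<Omega> (k w)"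
      unfolding a_def ev[OF L lw(2)] by (rule L2_Cauchy_Schwarz[OF L kL[OF lw(2)]])
    also have "\<dots> \<le> (1 * sqrt (measure lebesgue \<Omega>)) * L2_norm \<Omega> (k w)"
      by (intro mult_right_mono small L L2_norm_nonneg) (simp add: \<phi>_def norm_bump_le)
    finally show ?thesis by simp
  qed
  have unb: "\<exists>l\<in>\<Lambda>. \<exists>w\<in>\<Omega>. norm (a l w) > C / snd l ^ m" for C m
  proof -
    obtain z r w where "ball z r \<subseteq> \<Omega>" "0 < r" "r \<le> 1" "w \<in> \<Omega>"
      "\<not> norm (iter_partial bs (?B (bump z r)) w) \<le> C / r ^ m" using neg by blast
    then show ?thesis by (intro bexI[of _ "(z, r)"] bexI[of _ w]) (auto simp: \<Lambda>_def a_def \<phi>_def)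
  qed
  have sndpos: "0 < snd l" "snd l \<le> 1" if "l \<in> \<Lambda>" for l using that by (auto simp: \<Lambda>_def)
  obtain l e w where l: "\<And>i. l i \<in> \<Lambda>" and e: "\<And>i. 0 \<le> e i" "\<And>i. e i \<le> (1/2) ^ i * snd (l i) ^ i"
    and w: "\<And>i. w i \<in> \<Omega>" and big: "\<And>i. real i \<le> norm (\<Sum>j. of_real (e j) * a (l j) (w i))"
    using gliding_hump[of \<Lambda> snd \<Omega> a S "\<lambda>w. sqrt (measure lebesgue \<Omega>) * L2_norm \<Omega> (k w)", OF sndpos S K unb] by blast
  define f where "f j x = of_real (e j) * \<phi> (l j) x" for j x
  have fsm: "smooth_on UNIV (f j)" for j
    unfolding f_def[abs_def] smooth_on_iff \<phi>_def
    using smooth_on_bump ksmooth_compose_linear[OF bounded_linear_mult_right open_UNIV] unfolding smooth_on_iff by blast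
  have e1: "e j \<le> (1/2) ^ j" for j
  proof -
    have "(1/2) ^ j * snd (l j) ^ j \<le> (1/2::real) ^ j * 1"
      using sndpos[OF l[of j]] by (intro mult_left_mono power_le_one) auto
    then show ?thesis using e(2)[of j] by linarith
  qed
  have geo: "summable (\<lambda>j. (1/2::real) ^ j)" by (simp add: summable_geometric)
  have phi_sm: "smooth_on UNIV (\<lambda>x. \<Sum>j. f j x)"
  proof (rule smooth_on_suminf[OF fsm])
    fix cs :: "(complex^'n) list" assume cs: "cs \<in> lists Basis"
    obtain C where C: "C \<ge> 0" "\<And>z r x. r > 0 \<Longrightarrow> norm (iter_partial cs (bump z r) (x :: complex^'n)) \<le> C / r ^ length cs"
      using bump_derivative_bounds[OF cs] by metis
    have fb: "norm (iter_partial cs (f j) x) \<le> e j * (C / snd (l j) ^ length cs)" for j x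
    proof -
      have "iter_partial cs (f j) x = of_real (e j) * iter_partial cs (\<phi> (l j)) x"
        unfolding f_def[abs_def] \<phi>_def by (rule iter_partial_bounded_linear[OF bounded_linear_mult_right smooth_on_bump cs]) simp
      then have "norm (iter_partial cs (f j) x) = e j * norm (iter_partial cs (bump (fst (l j)) (snd (l j))) x)"
        using e(1)[of j] by (simp add: norm_mult \<phi>_def)
      then show ?thesis
        using mult_left_mono[OF C(2)[OF sndpos(1)[OF l[of j]]] e(1)[of j]] by simp
    qed
    have fb2: "e j * (C / snd (l j) ^ length cs) \<le> C * (1/2) ^ j" if j: "j \<ge> length cs" for j
    proof -
      have r: "0 < snd (l j)" "snd (l j) \<le> 1" using sndpos[OF l] by auto
      have "snd (l j) ^ j \<le> snd (l j) ^ length cs" using r j by (intro power_decreasing) auto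
      then have "(1/2) ^ j * snd (l j) ^ j \<le> (1/2) ^ j * snd (l j) ^ length cs" by (intro mult_left_mono) auto
      then have "e j \<le> (1/2) ^ j * snd (l j) ^ length cs" using e(2)[of j] by linarith
      then have "e j * (C / snd (l j) ^ length cs) \<le> ((1/2) ^ j * snd (l j) ^ length cs) * (C / snd (l j) ^ length cs)"
        using C(1) r by (intro mult_right_mono) auto
      then show ?thesis using r by (simp add: mult.commute[of C])
    qed
    have "summable (\<lambda>j. e j * (C / snd (l j) ^ length cs))"
    proof (rule summable_comparison_test[of _ "\<lambda>j. C * (1/2) ^ j"])
      show "\<exists>N. \<forall>n\<ge>N. norm (e n * (C / snd (l n) ^ length cs)) \<le> C * (1/2) ^ n"
      proof (intro exI[of _ "length cs"] allI impI)
        fix n assume "n \<ge> length cs"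
        then show "norm (e n * (C / snd (l n) ^ length cs)) \<le> C * (1/2) ^ n"
          using fb2[of n] e(1)[of n] C(1) sndpos[OF l[of n]] by simp
      qed
    qed (intro summable_mult geo)
    then show "\<exists>M. summable M \<and> (\<forall>j x. norm (iter_partial cs (f j) x) \<le> M j)" using fb by blast
  qed
  define \<Phi> where "\<Phi> x = (\<Sum>j. f j x)" for x
  have \<Phi>sc: "\<Phi> \<in> smooth_closure \<Omega>" unfolding \<Phi>_def[abs_def] by (rule smooth_on_UNIV_smooth_closure[OF phi_sm \<Omega>(1)])
  have \<Phi>L: "\<Phi> \<in> L2 \<Omega>" by (rule smooth_closure_L2[OF \<Phi>sc \<Omega>])
  have fL: "f j \<in> L2 \<Omega>" for j
    by (rule smooth_closure_L2[OF smooth_on_UNIV_smooth_closure[OF fsm \<Omega>(1)] \<Omega>])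
  have fb: "norm (f j x) \<le> (1/2) ^ j" for j x
  proof -
    have "norm (f j x) = e j * norm (bump (fst (l j)) (snd (l j)) x)"
      unfolding f_def norm_mult \<phi>_def using e(1)[of j] by simp
    also have "\<dots> \<le> e j * 1" by (rule mult_left_mono[OF norm_bump_le e(1)])
    finally have "norm (f j x) \<le> e j * 1" .
    then show ?thesis using e1[of j] by simp
  qed
  have fs: "summable (\<lambda>j. f j x)" for x by (rule summable_comparison_test'[OF geo]) (use fb in auto)
  have expand: "iter_partial bs (?B \<Phi>) v = (\<Sum>j. of_real (e j) * a (l j) v)" if v: "v \<in> \<Omega>" for v
  proof -
    have rem: "norm (\<Phi> x - (\<Sum>j<n. f j x)) \<le> 2 * (1/2) ^ n" for n x
    proof -
      have "\<Phi> x - (\<Sum>j<n. f j x) = (\<Sum>j. f (j + n) x)"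
        unfolding \<Phi>_def using suminf_minus_initial_segment[OF fs] by metis
      also have "norm \<dots> \<le> (\<Sum>j. (1/2) ^ n * (1/2::real) ^ j)"
      proof (rule norm_suminf_le[OF _ summable_mult[OF geo]])
        show "norm (f (j + n) x) \<le> (1/2) ^ n * (1/2) ^ j" for j
          using fb[of "j + n" x] by (simp add: power_add mult.commute)
      qed
      also have "\<dots> = (1/2) ^ n * (\<Sum>j. (1/2::real) ^ j)" by (rule suminf_mult[OF geo])
      also have "\<dots> = 2 * (1/2) ^ n" by (simp add: suminf_geometric)
      finally show ?thesis .
    qed
    have sL: "(\<lambda>x. \<Sum>j<n. f j x) \<in> L2 \<Omega>" for n by (rule L2_sum[OF fL])
    have part: "L2_inner \<Omega> (\<lambda>x. \<Sum>j<n. f j x) (k v) = (\<Sum>j<n. of_real (e j) * a (l j) v)" for n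
    proof (induction n)
      case 0 then show ?case by (simp add: L2_inner_def)
    next
      case (Suc n)
      have "L2_inner \<Omega> (f n) (k v) = of_real (e n) * a (l n) v"
        unfolding f_def[abs_def] L2_inner_cmult_left a_def ev[OF test_function_L2[OF \<phi>t[OF l] \<Omega>] v] ..
      then show ?case using Suc L2_inner_add_left[OF sL[of n] fL[of n] kL[OF v]] by simp
    qed
    have "(\<lambda>n. \<Sum>j<n. of_real (e j) * a (l j) v) \<longlonglongrightarrow> L2_inner \<Omega> \<Phi> (k v)"
    proof (rule LIM_zero_cancel, rule Lim_null_comparison)
      show "(\<lambda>n. (2 * (1/2) ^ n * sqrt (measure lebesgue \<Omega>)) * L2_norm \<Omega> (k v)) \<longlonglongrightarrow> 0"
        by (intro tendsto_mult_left_zero tendsto_mult_right_zero LIMSEQ_power_zero) auto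
      have "norm ((\<Sum>j<n. of_real (e j) * a (l j) v) - L2_inner \<Omega> \<Phi> (k v))
          \<le> (2 * (1/2) ^ n * sqrt (measure lebesgue \<Omega>)) * L2_norm \<Omega> (k v)" for n
      proof -
        have "norm ((\<Sum>j<n. of_real (e j) * a (l j) v) - L2_inner \<Omega> \<Phi> (k v)) = norm (L2_inner \<Omega> (\<lambda>x. \<Phi> x - (\<Sum>j<n. f j x)) (k v))"
          unfolding L2_inner_diff_left[OF \<Phi>L sL kL[OF v]] part by (rule norm_minus_commute)
        also have "\<dots> \<le> L2_norm \<Omega> (\<lambda>x. \<Phi> x - (\<Sum>j<n. f j x)) * L2_norm \<Omega> (k v)"
          by (rule L2_Cauchy_Schwarz[OF L2_diff[OF \<Phi>L sL] kL[OF v]])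
        also have "\<dots> \<le> (2 * (1/2) ^ n * sqrt (measure lebesgue \<Omega>)) * L2_norm \<Omega> (k v)"
          by (intro mult_right_mono small L2_diff \<Phi>L sL rem L2_norm_nonneg)
        finally show ?thesis .
      qed
      then show "\<forall>\<^sub>F n in sequentially. norm ((\<Sum>j<n. of_real (e j) * a (l j) v) - L2_inner \<Omega> \<Phi> (k v))
          \<le> (2 * (1/2) ^ n * sqrt (measure lebesgue \<Omega>)) * L2_norm \<Omega> (k v)" by simp
    qed
    then have "(\<lambda>j. of_real (e j) * a (l j) v) sums L2_inner \<Omega> \<Phi> (k v)" by (simp add: sums_def)
    then show ?thesis using ev[OF \<Phi>L v] sums_unique by metis
  qed
  obtain S0 where S0: "\<forall>w\<in>\<Omega>. norm (iter_partial bs (?B \<Phi>) w) \<le> S0" using sup[OF \<Phi>sc] by blast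
  obtain i where i: "real i > S0" using reals_Archimedean2 by blast
  have "real i \<le> norm (iter_partial bs (?B \<Phi>) (w i))" using big[of i] expand[OF w[of i]] by simp
  then show False using S0 w[of i] i by force
qed

text \<open>Symmetry of the kernel turns the bound on derivatives of projected bumps into a growth bound for the
  projected evaluation kernels, uniform in the evaluation point: the value at \<open>z\<close> of the projected kernel at \<open>w\<close> is, up to
  conjugation and normalisation, the derivative at \<open>w\<close> of the projected bump at \<open>z\<close>.\<close>

lemma projected_kernel_growth:
  fixes \<Omega> :: "(complex^'n) set"
  assumes \<Omega>: "open \<Omega>" "bounded \<Omega>" and R: "condition_R \<Omega>" and bs: "bs \<in> lists Basis"
  shows "\<exists>A m. A > 0 \<and> (\<forall>w s z r. s > 0 \<longrightarrow> ball w (2 * s) \<subseteq> \<Omega> \<longrightarrow> ball z r \<subseteq> \<Omega> \<longrightarrow> 0 < r \<longrightarrow> r \<le> 1 \<longrightarrow>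
     norm (bergman_projection \<Omega> (eval_kernel bs w s) z) \<le> A / r ^ m)"
proof -
  let ?B = "bergman_projection \<Omega>"
  obtain C m where C: "\<And>z r w. ball z r \<subseteq> \<Omega> \<Longrightarrow> 0 < r \<Longrightarrow> r \<le> 1 \<Longrightarrow> w \<in> \<Omega> \<Longrightarrow>
     norm (iter_partial bs (?B (bump z r)) w) \<le> C / r ^ m"
    using bergman_projection_bump_bound[OF assms] by blast
  obtain c where c: "c > 0" "\<And>r. r > 0 \<Longrightarrow> c * r ^ DIM(complex^'n) \<le> norm (LINT \<zeta>|lborel. bump 0 r (\<zeta> :: complex^'n))"
    using bump_mass_lower_bound by blast
  let ?d = "DIM(complex^'n)"
  define A where "A = (\<bar>C\<bar> + 1) * 2 ^ (m + ?d) / c"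
  have "norm (?B (eval_kernel bs w s) z) \<le> A / r ^ (m + ?d)"
    if s: "s > 0" "ball w (2 * s) \<subseteq> \<Omega>" and r: "ball z r \<subseteq> \<Omega>" "0 < r" "r \<le> 1" for w s z r
  proof -
    let ?m = "LINT \<zeta>|lborel. bump 0 (r / 2) (\<zeta> :: complex^'n)"
    have ws: "ball w s \<subseteq> \<Omega>" "w \<in> \<Omega>" using s by (auto simp: subset_iff)
    have kL: "eval_kernel bs w s \<in> L2 \<Omega>" by (rule test_function_L2[OF eval_kernel_test_function[OF s(1) ws(1) bs] \<Omega>])
    have zs: "ball z (r / 2) \<subseteq> \<Omega>" using r by (auto simp: subset_iff)
    have bL: "bump z (r / 2) \<in> L2 \<Omega>" by (rule test_function_L2[OF bump_test_function \<Omega>]) (use r zs in auto)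
    have m: "norm ?m \<ge> c * (r / 2) ^ ?d" using c(2)[of "r / 2"] r by simp
    have mp: "c * (r / 2) ^ ?d > 0" using c(1) r by simp
    have e: "eval_kernel [] z (r / 2) = (\<lambda>x. (1 / ?m) * bump z (r / 2) x)"
      by (simp add: eval_kernel_def fun_eq_iff bump_def)
    have "?B (eval_kernel bs w s) z = L2_inner \<Omega> (?B (eval_kernel bs w s)) (eval_kernel [] z (r / 2))"
      using bergman_smooth_and_evaluation(2)[OF bergman_projection(1)[OF \<Omega> kL] \<Omega>, of "r / 2" z "[]"] r by simp
    also have "\<dots> = L2_inner \<Omega> (eval_kernel bs w s) (?B (eval_kernel [] z (r / 2)))"
      by (rule bergman_projection_selfadjoint[OF \<Omega> kL]) (unfold e, rule L2_cmult[OF bL])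
    also have "\<dots> = cnj (L2_inner \<Omega> (?B (eval_kernel [] z (r / 2))) (eval_kernel bs w s))"
      by (rule L2_inner_commute)
    also have "L2_inner \<Omega> (?B (eval_kernel [] z (r / 2))) (eval_kernel bs w s)
        = L2_inner \<Omega> (eval_kernel [] z (r / 2)) (?B (eval_kernel bs w s))"
      by (rule bergman_projection_selfadjoint[OF \<Omega> _ kL]) (unfold e, rule L2_cmult[OF bL])
    also have "\<dots> = (1 / ?m) * L2_inner \<Omega> (bump z (r / 2)) (?B (eval_kernel bs w s))"
      unfolding e by (rule L2_inner_cmult_left)
    also have "L2_inner \<Omega> (bump z (r / 2)) (?B (eval_kernel bs w s)) = iter_partial bs (?B (bump z (r / 2))) w"
      by (rule bergman_projection_evaluation[OF \<Omega> bL s bs, symmetric])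
    finally have "norm (?B (eval_kernel bs w s) z) = norm (iter_partial bs (?B (bump z (r / 2))) w) / norm ?m"
      by (simp add: norm_mult norm_divide)
    also have "\<dots> \<le> ((\<bar>C\<bar> + 1) / (r / 2) ^ m) / (c * (r / 2) ^ ?d)"
    proof (rule frac_le[OF _ _ mp m])
      have "C / (r / 2) ^ m \<le> (\<bar>C\<bar> + 1) / (r / 2) ^ m" using r by (intro divide_right_mono) auto
      then show "norm (iter_partial bs (?B (bump z (r / 2))) w) \<le> (\<bar>C\<bar> + 1) / (r / 2) ^ m"
        using C[OF zs _ _ ws(2)] r by linarith
    qed (use r in simp)
    also have "\<dots> = A / r ^ (m + ?d)"
      using r c(1) by (simp add: A_def power_divide power_add field_simps)
    finally show ?thesis .
  qed
  moreover have "A > 0" using c(1) by (simp add: A_def)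
  ultimately show ?thesis by blast
qed

section \<open>Vector fields as differential operators\<close>

definition vf_apply :: "('a::euclidean_space \<Rightarrow> 'a \<times> 'a) \<Rightarrow> ('a \<Rightarrow> complex) \<Rightarrow> 'a \<Rightarrow> complex" where
  "vf_apply T \<phi> x = (\<Sum>b\<in>Basis. vf_coeff T b x * frechet_derivative \<phi> (at x) b)"

lemma vf_coeff_ksmooth:
  assumes "smooth_vector_field \<Omega> T" "bounded \<Omega>" "b \<in> Basis"
  shows "ksmooth B \<Omega> n (vf_coeff T b)"
proof -
  have "ksmooth True \<Omega> n (vf_coeff T b)"
    using assms by (intro smooth_closure_ksmooth_True) (auto simp: smooth_vector_field_def)
  then show ?thesis using ksmooth_unbounded by (cases B) auto
qed

lemma vf_coeff_differentiable:
  assumes "smooth_vector_field \<Omega> T" "bounded \<Omega>" "b \<in> Basis" "x \<in> \<Omega>"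
  shows "vf_coeff T b differentiable at x"
  using vf_coeff_ksmooth[OF assms(1-3), of False "Suc 0"] assms(4) by simp

lemma vf_apply_ksmooth:
  assumes T: "smooth_vector_field \<Omega> T" "bounded \<Omega>" "open S" "S \<subseteq> \<Omega>" and "ksmooth B S (Suc n) \<phi>"
  shows "ksmooth B S n (vf_apply T \<phi>)"
  unfolding vf_apply_def[abs_def] using assms
  by (intro ksmooth_sum ksmooth_mult ksmooth_subset[OF vf_coeff_ksmooth[OF T(1,2)] T(4)] ksmooth_partial) auto

lemma vf_transpose_ksmooth:
  assumes T: "smooth_vector_field \<Omega> T" "bounded \<Omega>" "open S" "S \<subseteq> \<Omega>" and "ksmooth B S (Suc n) \<phi>"
  shows "ksmooth B S n (vf_transpose T \<phi>)"
  unfolding vf_transpose_def[abs_def]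
proof (intro ksmooth_minus ksmooth_sum T)
  fix b :: 'a assume b: "b \<in> Basis"
  have "ksmooth B S (Suc n) (\<lambda>y. vf_coeff T b y * \<phi> y)"
    by (intro ksmooth_mult assms ksmooth_subset[OF vf_coeff_ksmooth[OF T(1,2) b] T(4)])
  then show "ksmooth B S n (\<lambda>x. frechet_derivative (\<lambda>y. vf_coeff T b y * \<phi> y) (at x) b)" using b by simp
qed

lemma frechet_derivative_mult:
  fixes f g :: "'a::real_normed_vector \<Rightarrow> complex"
  assumes "f differentiable at x" "g differentiable at x"
  shows "frechet_derivative (\<lambda>y. f y * g y) (at x) v = f x * frechet_derivative g (at x) v + frechet_derivative f (at x) v * g x"
  by (subst frechet_derivative_eqI[OF has_derivative_mult]) (use assms in \<open>auto simp: frechet_derivative_works\<close>)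

text \<open>The transpose is \<open>-T\<close> plus multiplication by a function, so it satisfies the Leibniz rule with one factor differentiated by
  \<open>-T\<close> alone.\<close>

lemma vf_transpose_mult:
  assumes T: "smooth_vector_field \<Omega> T" "bounded \<Omega>" and x: "x \<in> \<Omega>" and d: "\<phi> differentiable at x" "\<psi> differentiable at x"
  shows "vf_transpose T (\<lambda>y. \<phi> y * \<psi> y) x = \<phi> x * vf_transpose T \<psi> x - \<psi> x * vf_apply T \<phi> x"
proof -
  have "frechet_derivative (\<lambda>y. vf_coeff T b y * (\<phi> y * \<psi> y)) (at x) b =
    \<phi> x * frechet_derivative (\<lambda>y. vf_coeff T b y * \<psi> y) (at x) b + vf_coeff T b x * frechet_derivative \<phi> (at x) b * \<psi> x"
    if b: "b \<in> Basis" for b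
  proof -
    have c: "vf_coeff T b differentiable at x" by (rule vf_coeff_differentiable[OF T b x])
    show ?thesis using c d
      by (simp add: frechet_derivative_mult differentiable_mult algebra_simps)
  qed
  then show ?thesis
    by (simp add: vf_transpose_def vf_apply_def sum.distrib sum_distrib_left sum_negf algebra_simps)
qed

lemma vf_transpose_cong_open:
  assumes "open S" "x \<in> S" "\<And>y. y \<in> S \<Longrightarrow> \<phi> y = \<psi> y"
  shows "vf_transpose T \<phi> x = vf_transpose T \<psi> x"
  unfolding vf_transpose_def
  by (intro arg_cong[where f=uminus] sum.cong refl fun_cong[OF frechet_derivative_cong_open[OF assms(1,2)]]) (simp add: assms(3))

lemma vf_transpose_zero: "vf_transpose T (\<lambda>y. 0) x = 0"
  by (simp add: vf_transpose_def)

lemma vf_transpose_test_function: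
  assumes T: "smooth_vector_field \<Omega> T" "bounded \<Omega>" "open \<Omega>" and \<phi>: "\<phi> \<in> test_functions \<Omega>"
  shows "vf_transpose T \<phi> \<in> test_functions \<Omega>"
proof -
  obtain K where K: "smooth_on UNIV \<phi>" "compact K" "K \<subseteq> \<Omega>" "\<And>x. x \<notin> K \<Longrightarrow> \<phi> x = 0"
    using test_functionsE[OF \<phi>] by metis
  have z: "vf_transpose T \<phi> x = 0" if "x \<notin> K" for x
    using vf_transpose_cong_open[of "- K" x \<phi> "\<lambda>_. 0" T] compact_imp_closed[OF K(2)] that K(4)
    by (simp add: vf_transpose_zero open_Compl)
  have "ksmooth False \<Omega> n (vf_transpose T \<phi>)" for n
    by (rule vf_transpose_ksmooth[OF T order_refl ksmooth_subset[OF K(1)[unfolded smooth_on_iff, THEN conjunct2, rule_format] subset_UNIV]])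
  then have "smooth_on \<Omega> (vf_transpose T \<phi>)" using T by (simp add: smooth_on_iff)
  from smooth_on_extend_zero[OF this compact_imp_closed[OF K(2)] K(3)]
  have "smooth_on UNIV (\<lambda>x. if x \<in> \<Omega> then vf_transpose T \<phi> x else 0)" using z by blast
  moreover have "(\<lambda>x. if x \<in> \<Omega> then vf_transpose T \<phi> x else 0) = vf_transpose T \<phi>"
    by (rule ext) (use z K(3) in auto)
  ultimately show ?thesis using test_functionsI[OF _ K(2,3) z] by simp
qed

lemma vf_coeff_sum_Basis:
  fixes L :: "'a::euclidean_space \<Rightarrow> complex"
  assumes "linear L"
  shows "(\<Sum>b\<in>Basis. vf_coeff T b x * L b) = L (fst (T x)) + \<i> * L (snd (T x))"
proof -
  have "vf_coeff T b x * L b = L b * of_real (fst (T x) \<bullet> b) + \<i> * (L b * of_real (snd (T x) \<bullet> b))" for b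
    by (simp add: vf_coeff_def Complex_eq algebra_simps)
  then show ?thesis by (simp add: sum.distrib sum_distrib_left[symmetric] linear_sum_Basis[OF assms])
qed

section \<open>Geometry near a boundary point\<close>

lemma defining_function_at_frontier:
  assumes \<rho>: "open U" "frontier \<Omega> \<subseteq> U" "smooth_on U \<rho>" "\<Omega> \<inter> U = {x \<in> U. \<rho> x < 0}" and \<Omega>: "open \<Omega>" and p: "p \<in> frontier \<Omega>"
  shows "\<rho> p = (0::real)"
proof -
  have pU: "p \<in> U" using \<rho>(2) p by blast
  have "p \<notin> \<Omega>" using p \<Omega> by (simp add: frontier_def interior_open)
  then have "\<rho> p \<ge> 0" using \<rho>(4) pU by (metis (mono_tags, lifting) Int_iff mem_Collect_eq not_le_imp_less)
  moreover have "\<not> \<rho> p > 0"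
  proof
    assume pos: "\<rho> p > 0"
    have "open (U \<inter> \<rho> -` {0<..})"
      using smooth_on_continuous[OF \<rho>(3)] \<rho>(1) by (simp add: continuous_open_preimage)
    moreover have "p \<in> U \<inter> \<rho> -` {0<..}" using pU pos by simp
    moreover have "p \<in> closure \<Omega>" using p by (simp add: frontier_def)
    ultimately have "\<Omega> \<inter> (U \<inter> \<rho> -` {0<..}) \<noteq> {}"
      using open_Int_closure_eq_empty[of "U \<inter> \<rho> -` {0<..}" \<Omega>] by blast
    then obtain x where "x \<in> \<Omega> \<inter> U" "\<rho> x > 0" by auto
    then show False using \<rho>(4) by force
  qed
  ultimately show ?thesis by simp
qed

lemma derivative_pos_imp_increase:
  fixes \<rho> :: "'a::euclidean_space \<Rightarrow> real"
  assumes "(\<rho> has_derivative D) (at p)" "\<rho> p = 0" "D u > 0"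
  shows "\<forall>\<^sub>F s in at_right (0::real). \<rho> (p + s *\<^sub>R u) > 0"
proof -
  have "((\<lambda>s. p + s *\<^sub>R u) has_derivative (\<lambda>d. d *\<^sub>R u)) (at 0)" by (auto intro!: derivative_eq_intros)
  moreover have "(\<rho> has_derivative D) (at (p + 0 *\<^sub>R u))" using assms(1) by simp
  ultimately have "((\<lambda>s. \<rho> (p + s *\<^sub>R u)) has_derivative (\<lambda>d. D (d *\<^sub>R u))) (at 0)"
    by (rule has_derivative_compose)
  then have "((\<lambda>s. \<rho> (p + s *\<^sub>R u)) has_field_derivative D u) (at 0)"
    unfolding has_field_derivative_def
    by (rule has_derivative_eq_rhs) (simp add: linear_cmul[OF has_derivative_linear[OF assms(1)]] fun_eq_iff)
  from has_real_derivative_pos_inc_right[OF this assms(3)]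
  obtain d where "d > 0" "\<forall>h>0. 0 + h \<in> UNIV \<longrightarrow> h < d \<longrightarrow> \<rho> (p + 0 *\<^sub>R u) < \<rho> (p + (0 + h) *\<^sub>R u)" by blast
  then show ?thesis using assms(2) unfolding eventually_at_right_field by (intro exI[of _ d]) auto
qed

text \<open>If the kernels of the differentials of two defining functions differed, some direction would lead into
  \<open>\<Omega>\<close> according to one of them and out of \<open>\<Omega>\<close> according to the other.\<close>

lemma defining_functions_same_kernel:
  assumes \<Omega>: "open \<Omega>" and p: "p \<in> frontier \<Omega>"
    and \<rho>1: "defining_function \<Omega> \<rho>1" and \<rho>2: "defining_function \<Omega> \<rho>2"
    and v: "frechet_derivative \<rho>1 (at p) v = 0"
  shows "frechet_derivative \<rho>2 (at p) v = 0"
proof (rule ccontr)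
  assume n0: "frechet_derivative \<rho>2 (at p) v \<noteq> 0"
  let ?D1 = "frechet_derivative \<rho>1 (at p)" and ?D2 = "frechet_derivative \<rho>2 (at p)"
  obtain U1 where U1: "open U1" "frontier \<Omega> \<subseteq> U1" "smooth_on U1 \<rho>1" "\<Omega> \<inter> U1 = {x \<in> U1. \<rho>1 x < 0}" "?D1 \<noteq> (\<lambda>v. 0)"
    using \<rho>1 p unfolding defining_function_def by blast
  obtain U2 where U2: "open U2" "frontier \<Omega> \<subseteq> U2" "smooth_on U2 \<rho>2" "\<Omega> \<inter> U2 = {x \<in> U2. \<rho>2 x < 0}"
    using \<rho>2 p unfolding defining_function_def by blast
  have pU: "p \<in> U1" "p \<in> U2" using U1 U2 p by auto
  have d1: "(\<rho>1 has_derivative ?D1) (at p)" and d2: "(\<rho>2 has_derivative ?D2) (at p)"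
    using smooth_on_differentiable[OF U1(3) pU(1)] smooth_on_differentiable[OF U2(3) pU(2)] by (simp_all add: frechet_derivative_works)
  note l1 = has_derivative_linear[OF d1] and l2 = has_derivative_linear[OF d2]
  obtain n where n: "?D1 n \<noteq> 0" using U1(5) by auto
  define n' where "n' = (if ?D1 n > 0 then n else - n)"
  have n': "?D1 n' > 0" using n linear_neg[OF l1] by (auto simp: n'_def)
  define v' where "v' = (if ?D2 v < 0 then v else - v)"
  have v': "?D2 v' < 0" "?D1 v' = 0" using n0 v linear_neg[OF l1] linear_neg[OF l2] by (auto simp: v'_def)
  define e where "e = - ?D2 v' / (2 * (\<bar>?D2 n'\<bar> + 1))"
  have e: "e > 0" unfolding e_def using v' by (intro divide_pos_pos) auto
  define u where "u = v' + e *\<^sub>R n'"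
  have u1: "?D1 u > 0" using linear_add[OF l1] linear_cmul[OF l1] v' n' e by (simp add: u_def)
  have "e * ?D2 n' \<le> e * (\<bar>?D2 n'\<bar> + 1)" using e by (intro mult_left_mono) auto
  also have "\<dots> = - ?D2 v' / 2"
  proof -
    have h: "(- a / (2 * m)) * m = - a / 2" if "m \<noteq> 0" for a m :: real using that by simp
    show ?thesis unfolding e_def by (rule h) linarith
  qed
  finally have u2: "?D2 u < 0" using linear_add[OF l2] linear_cmul[OF l2] v' by (simp add: u_def)
  have r1: "\<rho>1 p = 0" by (rule defining_function_at_frontier[OF U1(1-4) \<Omega> p])
  have r2: "\<rho>2 p = 0" by (rule defining_function_at_frontier[OF U2 \<Omega> p])
  have ev1: "\<forall>\<^sub>F s in at_right (0::real). \<rho>1 (p + s *\<^sub>R u) > 0"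
    by (rule derivative_pos_imp_increase[OF d1 r1 u1])
  have "\<forall>\<^sub>F s in at_right (0::real). - \<rho>2 (p + s *\<^sub>R u) > 0"
    by (rule derivative_pos_imp_increase[OF has_derivative_minus[OF d2]]) (use r2 u2 in auto)
  moreover have "((\<lambda>s. p + s *\<^sub>R u) \<longlongrightarrow> p) (at_right (0::real))" by (auto intro!: tendsto_eq_intros)
  then have "\<forall>\<^sub>F s in at_right (0::real). p + s *\<^sub>R u \<in> U1 \<inter> U2"
    by (rule topological_tendstoD[OF _ open_Int[OF U1(1) U2(1)]]) (use pU in simp)
  ultimately have "\<forall>\<^sub>F s in at_right (0::real). False"
    using ev1 by eventually_elim (use U1(4) U2(4) in \<open>auto simp: set_eq_iff; force\<close>)
  then show False by simp
qed

lemma boundary_tangentI: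
  assumes "open \<Omega>" "p \<in> frontier \<Omega>" "defining_function \<Omega> \<rho>" "frechet_derivative \<rho> (at p) v = 0"
  shows "v \<in> boundary_tangent \<Omega> p"
  unfolding boundary_tangent_def using defining_functions_same_kernel[OF assms(1,2,3) _ assms(4)] by blast

text \<open>The direction \<open>X - \<i> Y\<close> for \<open>T = X + \<i> Y\<close>: it carries the \<open>(0,1)\<close> part of \<open>T\<close>, the part that acts on
  conjugates of holomorphic functions.\<close>

definition vf_direction :: "(complex^'n \<Rightarrow> (complex^'n) \<times> (complex^'n)) \<Rightarrow> complex^'n \<Rightarrow> complex^'n" where
  "vf_direction T x = fst (T x) - \<i> *s snd (T x)"

text \<open>If no complex multiple of \<open>X - \<i> Y\<close> points inward, then all of them are tangential. Since \<open>X\<close> and \<open>Y\<close> are tangential,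
  so are \<open>\<i> X\<close> and \<open>\<i> Y\<close>, and \<open>T = X + \<i> Y\<close> splits into tangential vectors of type \<open>(1,0)\<close> and \<open>(0,1)\<close>, against complex
  transversality. This is the only place where transversality enters.\<close>

lemma inward_direction_exists:
  fixes \<Omega> :: "(complex^'n) set"
  assumes \<Omega>: "open \<Omega>" and p: "p \<in> frontier \<Omega>" and \<rho>: "defining_function \<Omega> \<rho>"
    and T: "tangential \<Omega> T" "complex_transversal \<Omega> T"
  shows "\<exists>c. c \<noteq> 0 \<and> frechet_derivative \<rho> (at p) (c *s vf_direction T p) < 0"
proof (rule ccontr)
  assume neg: "\<not> ?thesis"
  let ?D = "frechet_derivative \<rho> (at p)"
  define X Y where "X = fst (T p)" and "Y = snd (T p)"
  obtain U where U: "open U" "frontier \<Omega> \<subseteq> U" "smooth_on U \<rho>"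
    using \<rho> p unfolding defining_function_def by blast
  have lin: "linear ?D"
    by (rule linear_frechet_derivative[OF smooth_on_differentiable[OF U(3)]]) (use U p in auto)
  have "T p \<in> complex_tangent \<Omega> p" using T(1) p by (simp add: tangential_def)
  then have XYt: "X \<in> boundary_tangent \<Omega> p" "Y \<in> boundary_tangent \<Omega> p"
    by (auto simp: complex_tangent_def X_def Y_def mem_Times_iff)
  then have XY: "?D X = 0" "?D Y = 0" using \<rho> by (auto simp: boundary_tangent_def)
  have z: "?D (c *s vf_direction T p) = 0" if "c \<noteq> 0" for c
  proof -
    have "\<not> ?D (c *s vf_direction T p) < 0" using neg that by blast
    moreover have "- c \<noteq> 0" using that by simp
    then have "\<not> ?D ((- c) *s vf_direction T p) < 0" using neg by blast
    moreover have "(- c) *s vf_direction T p = - (c *s vf_direction T p)" by (simp add: vec_eq_iff)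
    ultimately show ?thesis using linear_neg[OF lin] by simp
  qed
  have "1 *s vf_direction T p = X - \<i> *s Y" by (simp add: vf_direction_def X_def Y_def)
  then have iY: "?D (\<i> *s Y) = 0" using z[of 1] linear_diff[OF lin, of X "\<i> *s Y"] XY by simp
  have "\<i> *s vf_direction T p = \<i> *s X + Y" by (simp add: vf_direction_def X_def Y_def vec_eq_iff algebra_simps)
  then have iX: "?D (\<i> *s X) = 0" using z[of \<i>] linear_add[OF lin, of "\<i> *s X" Y] XY by simp
  have tan: "v \<in> boundary_tangent \<Omega> p" if "?D v = 0" for v by (rule boundary_tangentI[OF \<Omega> p \<rho> that])
  have half: "?D ((1/2) *\<^sub>R (a + b)) = 0" "?D ((1/2) *\<^sub>R (a - b)) = 0" if "?D a = 0" "?D b = 0" for a b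
    using that linear_cmul[OF lin] linear_add[OF lin] linear_diff[OF lin] by auto
  \<comment> \<open>the \<open>(1,0)\<close> and \<open>(0,1)\<close> parts \<open>(T - \<i> J T)/2\<close> and \<open>(T + \<i> J T)/2\<close> of \<open>T\<close>, written as pairs\<close>
  let ?u = "((1/2) *\<^sub>R (X + \<i> *s Y), (1/2) *\<^sub>R (Y - \<i> *s X))" and ?v = "((1/2) *\<^sub>R (X - \<i> *s Y), (1/2) *\<^sub>R (Y + \<i> *s X))"
  have "?u \<in> tangent10 \<Omega> p" unfolding tangent10_def complex_tangent_def
    using half XY iX iY by (auto intro!: tan simp: vec_eq_iff scaleR_conv_of_real algebra_simps)
  moreover have "?v \<in> tangent01 \<Omega> p" unfolding tangent01_def complex_tangent_def
    using half XY iX iY by (auto intro!: tan simp: vec_eq_iff scaleR_conv_of_real algebra_simps)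
  moreover have "T p = ?u + ?v"
    by (simp add: prod_eq_iff X_def[symmetric] Y_def[symmetric] scaleR_add_right[symmetric] scaleR_2[symmetric])
  ultimately show False using T(2) p unfolding complex_transversal_def by blast
qed

text \<open>The differential of \<open>\<rho>\<close> is continuous, so near \<open>p\<close> the decrease along \<open>n\<close> persists with half the rate, even for
  displacements that deviate from \<open>s n\<close> by at most \<open>\<sigma> s\<close>. The formal flow, the bound
  on \<open>T \<rho>\<close> and the extension of functions to the closure all rest on this estimate.\<close>

lemma defining_function_decrease:
  fixes \<rho> :: "'a::euclidean_space \<Rightarrow> real"
  assumes U: "open U" "smooth_on U \<rho>" "p \<in> U" and n: "frechet_derivative \<rho> (at p) n < 0"
  obtains r c \<sigma> where "r > 0" "c > 0" "\<sigma> > 0" "cball p r \<subseteq> U"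
    "\<And>x y s. x \<in> ball p r \<Longrightarrow> y \<in> ball p r \<Longrightarrow> s \<ge> 0 \<Longrightarrow> norm (y - x - s *\<^sub>R n) \<le> \<sigma> * s \<Longrightarrow> \<rho> y \<le> \<rho> x - c * s"
proof -
  let ?D = "\<lambda>x. frechet_derivative \<rho> (at x)"
  define \<kappa> where "\<kappa> = - ?D p n"
  have \<kappa>: "\<kappa> > 0" using n by (simp add: \<kappa>_def)
  have der: "(\<rho> has_derivative ?D x) (at x)" if "x \<in> U" for x
    using smooth_on_differentiable[OF U(2) that] by (simp add: frechet_derivative_works)
  have lin: "linear (?D x)" if "x \<in> U" for x using der[OF that] has_derivative_linear by blast
  define K where "K = (\<Sum>b\<in>Basis. norm (?D p b)) + 1"
  have K: "\<bar>?D p v\<bar> \<le> K * norm v" for v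
    using norm_linear_le_sum_Basis[OF lin[OF U(3)], of v] mult_right_mono[of "\<Sum>b\<in>Basis. norm (?D p b)" K "norm v"]
    by (simp add: K_def)
  have Kpos: "K > 0" unfolding K_def by (intro add_nonneg_pos sum_nonneg) auto
  define \<sigma> where "\<sigma> = min 1 (\<kappa> / (4 * K))"
  have \<sigma>: "\<sigma> > 0" "\<sigma> \<le> 1" "K * \<sigma> \<le> \<kappa> / 4"
  proof -
    show "\<sigma> > 0" "\<sigma> \<le> 1" using \<kappa> Kpos by (auto simp: \<sigma>_def)
    have "K * \<sigma> \<le> K * (\<kappa> / (4 * K))" using Kpos by (intro mult_left_mono) (auto simp: \<sigma>_def)
    then show "K * \<sigma> \<le> \<kappa> / 4" using Kpos by simp
  qed
  define \<epsilon> where "\<epsilon> = \<kappa> / (4 * (norm n + 1))"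
  have \<epsilon>: "\<epsilon> > 0" "\<epsilon> * (norm n + 1) = \<kappa> / 4"
  proof -
    have "norm n + 1 > 0" using norm_ge_zero[of n] by linarith
    then show "\<epsilon> > 0" "\<epsilon> * (norm n + 1) = \<kappa> / 4" using \<kappa> by (simp_all add: \<epsilon>_def divide_simps)
  qed
  define d where "d = real DIM('a)"
  have "\<forall>b\<in>Basis. \<forall>\<^sub>F x in nhds p. norm (?D x b - ?D p b) < \<epsilon> / DIM('a)"
  proof
    fix b :: 'a assume b: "b \<in> Basis"
    have "continuous_on U (\<lambda>x. ?D x b)" by (rule smooth_on_continuous[OF smooth_on_partial[OF U(2) b]])
    then have "isCont (\<lambda>x. ?D x b) p" using continuous_on_eq_continuous_at[OF U(1)] U(3) by blast
    then have t: "((\<lambda>x. ?D x b) \<longlongrightarrow> ?D p b) (nhds p)" 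
      using tendsto_at_iff_tendsto_nhds[of "\<lambda>x. ?D x b" p] by (simp add: isCont_def)
    have "\<epsilon> / DIM('a) > 0" using \<epsilon> by simp
    from tendstoD[OF t this] show "\<forall>\<^sub>F x in nhds p. norm (?D x b - ?D p b) < \<epsilon> / DIM('a)"
      by (simp only: dist_norm)
  qed
  then have "\<forall>\<^sub>F x in nhds p. \<forall>b\<in>Basis. norm (?D x b - ?D p b) < \<epsilon> / DIM('a)" by (intro eventually_ball_finite) auto
  then obtain r1 where r1: "r1 > 0" "\<And>x. dist x p < r1 \<Longrightarrow> \<forall>b\<in>Basis. norm (?D x b - ?D p b) < \<epsilon> / DIM('a)"
    unfolding eventually_nhds_metric by blast
  obtain r2 where r2: "r2 > 0" "cball p r2 \<subseteq> U" using U open_contains_cball by blast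
  define r where "r = min r1 r2"
  have r: "r > 0" "cball p r \<subseteq> U" using r1 r2 by (auto simp: r_def)
  have on: "onorm (?D x - ?D p) \<le> \<epsilon>" if x: "x \<in> ball p r" for x
  proof (rule onorm_le)
    fix v
    have xU: "x \<in> U" using r x by (auto simp: subset_iff)
    have "norm (?D x v - ?D p v) \<le> (\<Sum>b\<in>Basis. norm (?D x b - ?D p b)) * norm v"
      by (rule norm_linear_le_sum_Basis) (intro linear_compose_sub lin xU U)
    also have "(\<Sum>b\<in>Basis. norm (?D x b - ?D p b)) \<le> (\<Sum>b\<in>(Basis::'a set). \<epsilon> / DIM('a))"
      using r1(2)[of x] x by (intro sum_mono) (auto simp: r_def dist_commute intro: less_imp_le)
    also have "\<dots> = \<epsilon>" by simp
    finally show "norm ((?D x - ?D p) v) \<le> \<epsilon> * norm v" by (simp add: mult_right_mono)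
  qed
  show thesis
  proof (rule that[of r "\<kappa> / 2" \<sigma>])
    fix x y s assume x: "x \<in> ball p r" and y: "y \<in> ball p r" and s: "s \<ge> 0" and d: "norm (y - x - s *\<^sub>R n) \<le> \<sigma> * s"
    have "norm (\<rho> y - \<rho> x - ?D p (y - x)) \<le> norm (y - x) * \<epsilon>"
    proof (rule differentiable_bound_linearization[where S="ball p r"])
      show "x + t *\<^sub>R (y - x) \<in> ball p r" if "t \<in> {0..1}" for t
        using convexD_alt[OF convex_ball x y, of t] that by (simp add: algebra_simps)
      show "(\<rho> has_derivative ?D z) (at z within ball p r)" if "z \<in> ball p r" for z
      proof -
        have "z \<in> U" using that r(2) ball_subset_cball by blast
        from has_derivative_at_withinI[OF der[OF this]] show ?thesis .
      qed
    qed (use on r in auto)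
    then have 1: "\<rho> y - \<rho> x \<le> ?D p (y - x) + norm (y - x) * \<epsilon>" by (simp add: abs_le_iff)
    have "?D p (y - x) = s * ?D p n + ?D p (y - x - s *\<^sub>R n)"
      using linear_diff[OF lin[OF U(3)], of "y - x" "s *\<^sub>R n"] linear_cmul[OF lin[OF U(3)], of s n] by simp
    moreover have "?D p (y - x - s *\<^sub>R n) \<le> K * norm (y - x - s *\<^sub>R n)" using K[of "y - x - s *\<^sub>R n"] by linarith
    moreover have "K * norm (y - x - s *\<^sub>R n) \<le> K * (\<sigma> * s)" using d Kpos by (intro mult_left_mono) auto
    moreover have "K * (\<sigma> * s) \<le> \<kappa> / 4 * s" using mult_right_mono[OF \<sigma>(3) s] by (simp add: mult.assoc)
    ultimately have 2: "?D p (y - x) \<le> - (\<kappa> * s) + \<kappa> / 4 * s" by (simp add: \<kappa>_def mult.commute)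
    have "norm (y - x) \<le> norm (y - x - s *\<^sub>R n) + norm (s *\<^sub>R n)" using norm_triangle_ineq[of "y - x - s *\<^sub>R n" "s *\<^sub>R n"] by simp
    also have "\<dots> \<le> \<sigma> * s + s * norm n" using d s by simp
    also have "\<dots> \<le> s * (norm n + 1)" using mult_right_mono[OF \<sigma>(2) s] by (simp add: algebra_simps)
    finally have "norm (y - x) * \<epsilon> \<le> s * (norm n + 1) * \<epsilon>" using \<epsilon>(1) by (intro mult_right_mono) auto
    moreover have "s * (norm n + 1) * \<epsilon> = s * (\<epsilon> * (norm n + 1))" by (simp only: mult.assoc mult.commute[of \<epsilon>])
    ultimately have "norm (y - x) * \<epsilon> \<le> s * (\<kappa> / 4)" unfolding \<epsilon>(2) by simp
    then show "\<rho> y \<le> \<rho> x - \<kappa> / 2 * s" using 1 2 by (simp add: field_simps)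
  qed (use r \<kappa> \<sigma> in auto)
qed

lemma frechet_derivative_of_real:
  "f differentiable at x \<Longrightarrow> frechet_derivative (\<lambda>x. complex_of_real (f x)) (at x) v = of_real (frechet_derivative f (at x) v)"
  by (subst frechet_derivative_eqI[OF has_derivative_of_real]) (auto simp: frechet_derivative_works)

text \<open>Tangency makes \<open>T \<rho>\<close> vanish on the boundary; since \<open>\<rho>\<close> grows at a definite rate in the outward direction, the mean
  value theorem along the segment from \<open>x\<close> to its exit point gives \<open>T \<rho> = O(\<rho>)\<close>.\<close>

lemma tangential_vf_defining_function:
  fixes \<Omega> :: "'a::euclidean_space set" and \<rho> :: "'a \<Rightarrow> real"
  assumes \<Omega>: "open \<Omega>" "bounded \<Omega>" and T: "smooth_vector_field \<Omega> T" "tangential \<Omega> T"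
    and \<rho>: "defining_function \<Omega> \<rho>" and p: "p \<in> frontier \<Omega>"
    and U: "open U" "frontier \<Omega> \<subseteq> U" "smooth_on U \<rho>" "\<Omega> \<inter> U = {x \<in> U. \<rho> x < 0}"
    and r: "r > 0" "c > 0" "\<sigma> > 0" "cball p r \<subseteq> U"
      "\<And>x y s. x \<in> ball p r \<Longrightarrow> y \<in> ball p r \<Longrightarrow> s \<ge> 0 \<Longrightarrow> norm (y - x - s *\<^sub>R n) \<le> \<sigma> * s \<Longrightarrow> \<rho> y \<le> \<rho> x - c * s"
  shows "\<exists>r1 C. 0 < r1 \<and> r1 \<le> r \<and> 0 \<le> C \<and>
    (\<forall>x\<in>\<Omega> \<inter> ball p r1. norm (vf_apply T (\<lambda>x. of_real (\<rho> x)) x) \<le> C * \<bar>\<rho> x\<bar>)"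
proof -
  define G where "G x = (\<Sum>b\<in>Basis. vf_coeff T b x * of_real (frechet_derivative \<rho> (at x) b))" for x
  have d\<rho>: "\<rho> differentiable at x" if "x \<in> U" for x by (rule smooth_on_differentiable[OF U(3) that])
  have GX: "vf_apply T (\<lambda>x. of_real (\<rho> x)) x = G x" if "x \<in> U" for x
    unfolding vf_apply_def G_def using frechet_derivative_of_real[OF d\<rho>[OF that]] by simp
  have Gcont: "continuous_on (closure \<Omega> \<inter> U) G"
    unfolding G_def[abs_def]
  proof (intro continuous_on_sum continuous_on_mult continuous_on_of_real)
    fix b :: 'a assume b: "b \<in> Basis"
    show "continuous_on (closure \<Omega> \<inter> U) (vf_coeff T b)"
      using T(1) b continuous_on_subset unfolding smooth_vector_field_def by blast
    show "continuous_on (closure \<Omega> \<inter> U) (\<lambda>x. frechet_derivative \<rho> (at x) b)"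
      using smooth_on_continuous[OF smooth_on_partial[OF U(3) b]] continuous_on_subset by blast
  qed
  have G0: "G q = 0" if q: "q \<in> frontier \<Omega>" for q
  proof -
    have "linear (\<lambda>v. complex_of_real (frechet_derivative \<rho> (at q) v))"
      using linear_frechet_derivative[OF d\<rho>] q U(2) by (intro linearI) (auto simp: linear_add linear_cmul scaleR_conv_of_real)
    from vf_coeff_sum_Basis[OF this, of T q]
    have "G q = of_real (frechet_derivative \<rho> (at q) (fst (T q))) + \<i> * of_real (frechet_derivative \<rho> (at q) (snd (T q)))"
      by (simp add: G_def)
    moreover have "fst (T q) \<in> boundary_tangent \<Omega> q" "snd (T q) \<in> boundary_tangent \<Omega> q"
      using T(2) q by (auto simp: tangential_def complex_tangent_def mem_Times_iff)
    ultimately show ?thesis using \<rho> by (auto simp: boundary_tangent_def)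
  qed
  let ?S = "\<Omega> \<inter> ball p r"
  have So: "open ?S" using \<Omega> by auto
  have SU: "?S \<subseteq> U" using r(4) ball_subset_cball by blast
  have "ksmooth False U (Suc n) \<rho>" for n using U(3) by (simp add: smooth_on_iff del: ksmooth.simps)
  then have "ksmooth False U (Suc n) (\<lambda>x. complex_of_real (\<rho> x))" for n
    by (rule ksmooth_compose_linear[OF bounded_linear_of_real U(1)])
  then have "ksmooth True ?S (Suc (Suc 0)) (\<lambda>x. complex_of_real (\<rho> x))"
    by (rule ksmooth_bounded_of_compact[OF _ compact_cball r(4)]) auto
  then have "ksmooth True ?S (Suc 0) (vf_apply T (\<lambda>x. of_real (\<rho> x)))"
    by (rule vf_apply_ksmooth[OF T(1) \<Omega>(2) So Int_lower1])
  then have kG: "ksmooth True ?S (Suc 0) G"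
    by (subst (asm) ksmooth_cong[OF So, where g=G]) (use GX SU in auto)
  obtain L where L: "L > 0" "\<And>x v. x \<in> ?S \<Longrightarrow> norm (frechet_derivative G (at x) v) \<le> L * norm v"
    using ksmooth_derivative_bounded[OF kG] by metis
  have Gd: "G differentiable at x" if "x \<in> ?S" for x using kG that by simp
  have \<rho>p: "\<rho> p = 0" by (rule defining_function_at_frontier[OF U \<Omega>(1) p])
  have "isCont \<rho> p" using smooth_on_continuous[OF U(3)] U(1,2) p continuous_on_eq_continuous_at by blast
  moreover have "c * r / (2 * (norm n + 1)) > 0" using r by (intro divide_pos_pos mult_pos_pos) (auto intro: add_nonneg_pos)
  ultimately obtain d where d: "d > 0" "\<And>x. dist x p < d \<Longrightarrow> dist (\<rho> x) (\<rho> p) < c * r / (2 * (norm n + 1))"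
    unfolding continuous_at_eps_delta by blast
  define r1 where "r1 = min d (r / 2)"
  have "norm (vf_apply T (\<lambda>x. of_real (\<rho> x)) x) \<le> (L * norm n / c) * \<bar>\<rho> x\<bar>" if x: "x \<in> \<Omega> \<inter> ball p r1" for x
  proof -
    have xr: "dist p x < r / 2" using x by (simp add: r1_def)
    have x\<rho>: "\<bar>\<rho> x\<bar> < c * r / (2 * (norm n + 1))" using d(2)[of x] x \<rho>p by (simp add: r1_def dist_commute)
    have xS: "x \<in> ?S" using x xr r(1) by auto
    have xneg: "\<rho> x < 0" using x SU xS U(4) by blast
    define s1 where "s1 = \<bar>\<rho> x\<bar> / c"
    have s1: "s1 > 0" using xneg r(2) by (simp add: s1_def divide_neg_pos)
    have np: "norm n + 1 > 0" using norm_ge_zero[of n] by linarith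
    have s1n: "s1 * norm n < r / 2"
    proof -
      have "\<bar>\<rho> x\<bar> / c < r / (2 * (norm n + 1))"
        using divide_strict_right_mono[OF x\<rho> r(2)] r(2) by simp
      then have "s1 * (norm n + 1) < r / (2 * (norm n + 1)) * (norm n + 1)"
        unfolding s1_def using np by (rule mult_strict_right_mono)
      also have "\<dots> = r / 2"
      proof -
        have "r / (2 * m) * m = r / 2" if "m \<noteq> 0" for m using that by simp
        then show ?thesis using np less_imp_neq by metis
      qed
      finally show ?thesis using s1 by (simp add: algebra_simps)
    qed
    have inb: "x - s *\<^sub>R n \<in> ball p r" if "0 \<le> s" "s \<le> s1" for s
    proof -
      have "dist p (x - s *\<^sub>R n) \<le> dist p x + norm (s *\<^sub>R n)"
        using dist_triangle[of p "x - s *\<^sub>R n" x] by (simp add: dist_norm)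
      also have "norm (s *\<^sub>R n) \<le> s1 * norm n" using that by (simp add: mult_right_mono)
      finally show ?thesis using xr s1n by simp
    qed
    have inU: "x - s *\<^sub>R n \<in> U" if "0 \<le> s" "s \<le> s1" for s using inb[OF that] r(4) ball_subset_cball by blast
    define h where "h s = \<rho> (x - s *\<^sub>R n)" for s
    have hc: "continuous_on {0..s1} h" unfolding h_def[abs_def]
      by (rule continuous_on_compose2[OF smooth_on_continuous[OF U(3)]]) (use inU in \<open>auto intro!: continuous_intros\<close>)
    have "\<rho> x \<le> \<rho> (x - s1 *\<^sub>R n) - c * s1"
      by (rule r(5)) (use inb[of 0] inb[of s1] s1 r(3) in auto)
    then have "h s1 \<ge> 0" using r(2) xneg by (simp add: h_def s1_def)
    moreover have "h 0 \<le> 0" using xneg by (simp add: h_def)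
    ultimately obtain t where t: "0 \<le> t" "t \<le> s1" "h t = 0" using IVT'[OF _ _ _ hc, of 0] s1 by auto
    have t0: "t > 0" using t xneg by (cases "t = 0") (auto simp: h_def)
    define q where "q = x - t *\<^sub>R n"
    have in\<Omega>: "x - s *\<^sub>R n \<in> \<Omega>" if s: "0 \<le> s" "s < t" for s
    proof -
      have "\<rho> (x - s *\<^sub>R n) \<le> \<rho> q - c * (t - s)"
      proof (rule r(5))
        show "q \<in> ball p r" unfolding q_def by (rule inb) (use t in auto)
        show "x - s *\<^sub>R n \<in> ball p r" by (rule inb) (use t s in auto)
        have "x - s *\<^sub>R n - q - (t - s) *\<^sub>R n = 0" by (simp add: q_def algebra_simps)
        then show "norm (x - s *\<^sub>R n - q - (t - s) *\<^sub>R n) \<le> \<sigma> * (t - s)" using s r(3) by simp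
      qed (use s in simp)
      then have "\<rho> (x - s *\<^sub>R n) < 0" using t(3) s r(2) by (simp add: h_def q_def) (smt (verit) mult_pos_pos)
      then show ?thesis using U(4) inU[of s] s t by auto
    qed
    define sq where "sq k = t * (1 - inverse (real (Suc k)))" for k
    have sqr: "0 \<le> sq k" "sq k < t" for k
    proof -
      have "0 < inverse (real (Suc k))" "inverse (real (Suc k)) \<le> 1" by (auto simp: divide_simps)
      then show "0 \<le> sq k" "sq k < t" using t0 unfolding sq_def by (auto simp: mult_less_cancel_left1)
    qed
    have "(\<lambda>k. t * (1 - inverse (real (Suc k)))) \<longlonglongrightarrow> t * (1 - 0)"
      by (intro tendsto_intros LIMSEQ_inverse_real_of_nat)
    then have sql: "sq \<longlonglongrightarrow> t" by (simp add: sq_def[abs_def])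
    have ql: "(\<lambda>k. x - sq k *\<^sub>R n) \<longlonglongrightarrow> q" unfolding q_def by (intro tendsto_intros sql)
    have qcl: "q \<in> closure \<Omega>" unfolding closure_sequential
      by (rule exI[of _ "\<lambda>k. x - sq k *\<^sub>R n"]) (use ql in\<Omega>[OF sqr] in simp)
    have qU: "q \<in> U" unfolding q_def by (rule inU) (use t in auto)
    have "q \<notin> \<Omega>"
    proof
      assume "q \<in> \<Omega>"
      then have "\<rho> q < 0" using U(4) qU by blast
      then show False using t(3) by (simp add: h_def q_def)
    qed
    then have qf: "q \<in> frontier \<Omega>" using qcl \<Omega>(1) by (simp add: frontier_def interior_open)
    have lip: "norm (G x - G (x - sq k *\<^sub>R n)) \<le> L * t * norm n" for k
    proof -
      have seg: "closed_segment x (x - sq k *\<^sub>R n) \<subseteq> ?S"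
      proof
        fix y assume "y \<in> closed_segment x (x - sq k *\<^sub>R n)"
        then obtain a where a: "0 \<le> a" "a \<le> 1" "y = (1 - a) *\<^sub>R x + a *\<^sub>R (x - sq k *\<^sub>R n)" unfolding closed_segment_def by blast
        then have y: "y = x - (a * sq k) *\<^sub>R n" by (simp add: algebra_simps)
        have "a * sq k \<le> sq k" using a sqr[of k] by (simp add: mult_left_le_one_le)
        then have "0 \<le> a * sq k" "a * sq k < t" using a sqr[of k] by auto
        then show "y \<in> ?S" unfolding y using in\<Omega> inb t by auto
      qed
      have "norm (G x - G (x - sq k *\<^sub>R n)) \<le> L * norm (x - (x - sq k *\<^sub>R n))"
        by (rule lipschitz_of_derivative_bound[OF convex_closed_segment Gd[OF subsetD[OF seg]] L(2)[OF subsetD[OF seg]]]) auto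
      also have "\<dots> = L * sq k * norm n" using sqr[of k] by simp
      also have "\<dots> \<le> L * t * norm n" using sqr[of k] L by (intro mult_right_mono mult_left_mono) auto
      finally show ?thesis .
    qed
    have "(\<lambda>k. G (x - sq k *\<^sub>R n)) \<longlonglongrightarrow> G q"
    proof (rule continuous_on_tendsto_compose[OF Gcont ql])
      show "q \<in> closure \<Omega> \<inter> U" using qcl qU by simp
      show "\<forall>\<^sub>F k in sequentially. x - sq k *\<^sub>R n \<in> closure \<Omega> \<inter> U"
      proof (intro always_eventually allI)
        fix k
        have "x - sq k *\<^sub>R n \<in> U" by (rule inU) (use sqr[of k] t in auto)
        then show "x - sq k *\<^sub>R n \<in> closure \<Omega> \<inter> U" using in\<Omega>[OF sqr[of k]] closure_subset by auto
      qed
    qed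
    then have "(\<lambda>k. norm (G x - G (x - sq k *\<^sub>R n))) \<longlonglongrightarrow> norm (G x - G q)" by (intro tendsto_intros)
    then have "norm (G x - G q) \<le> L * t * norm n" by (rule LIMSEQ_le_const2) (use lip in auto)
    also have "\<dots> \<le> L * s1 * norm n" using t L by (intro mult_right_mono mult_left_mono) auto
    also have "\<dots> = (L * norm n / c) * \<bar>\<rho> x\<bar>" by (simp add: s1_def)
    finally show ?thesis using G0[OF qf] GX[of x] xS SU by auto
  qed
  moreover have "0 < r1" "r1 \<le> r" using d r by (auto simp: r1_def)
  moreover have "0 \<le> L * norm n / c" using L r by simp
  ultimately show ?thesis by blast
qed

lemma smooth_step_derivative_0:
  assumes "y < 0 \<or> y > 1"
  shows "frechet_derivative smooth_step (at y) v = 0"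
proof -
  have "frechet_derivative smooth_step (at y) = (\<lambda>v. 0)"
  proof (cases "y < 0")
    case True
    then show ?thesis
      using frechet_derivative_cong_open[of "{..<0}" y smooth_step "\<lambda>_. 0"] smooth_step_0 by auto
  next
    case False
    then show ?thesis
      using assms frechet_derivative_cong_open[of "{1<..}" y smooth_step "\<lambda>_. 1"] smooth_step_1 by auto
  qed
  then show ?thesis by simp
qed

lemma smooth_step_derivative_bound: "\<exists>C\<ge>0. \<forall>y. \<bar>frechet_derivative smooth_step (at y) 1\<bar> \<le> C"
proof -
  let ?D = "\<lambda>y. frechet_derivative smooth_step (at y) (1::real)"
  have "continuous_on {0..1} ?D"
    by (rule continuous_on_subset[OF smooth_on_continuous[OF smooth_on_partial[OF smooth_on_smooth_step]]]) auto
  then have "bounded (?D ` {0..1})" by (intro compact_imp_bounded compact_continuous_image) auto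
  then obtain C where C: "\<forall>y\<in>{0..1}. \<bar>?D y\<bar> \<le> C" by (auto simp: bounded_iff)
  have "\<bar>?D y\<bar> \<le> \<bar>C\<bar>" for y
  proof (cases "y \<in> {0..1}")
    case False
    then show ?thesis using smooth_step_derivative_0[of y] by auto
  next
    case True
    then show ?thesis using bspec[OF C, of y] by linarith
  qed
  then show ?thesis by (intro exI[of _ "\<bar>C\<bar>"]) auto
qed

text \<open>The weak relation between \<open>f\<close> and \<open>g\<close> extends from test functions to functions \<open>v\<close> that need not vanish at the
  boundary: multiply \<open>v\<close> by a cutoff in \<open>\<rho>\<close> at scale \<open>1/k\<close>. Its gradient is of size \<open>k\<close>, but its \<open>T\<close> derivative stays
  bounded because \<open>T \<rho> = O(\<rho>)\<close>, so dominated convergence applies.\<close>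

lemma tangential_integration_by_parts:
  fixes \<Omega> :: "'a::euclidean_space set" and \<rho> :: "'a \<Rightarrow> real"
  assumes \<Omega>: "open \<Omega>" "bounded \<Omega>" and T: "smooth_vector_field \<Omega> T"
    and U: "open U" "smooth_on U \<rho>" "\<Omega> \<inter> U = {x \<in> U. \<rho> x < 0}" and r: "ball p r \<subseteq> U"
    and C: "C \<ge> 0" "\<And>x. x \<in> \<Omega> \<inter> ball p r \<Longrightarrow> norm (vf_apply T (\<lambda>x. of_real (\<rho> x)) x) \<le> C * \<bar>\<rho> x\<bar>"
    and K: "compact K" "K \<subseteq> ball p r"
    and v: "\<And>n. ksmooth False \<Omega> n v" "\<And>x. x \<in> \<Omega> - K \<Longrightarrow> v x = 0"
      "\<And>x. x \<in> \<Omega> \<Longrightarrow> norm (v x) \<le> B" "\<And>x. x \<in> \<Omega> \<Longrightarrow> norm (vf_transpose T v x) \<le> B"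
    and f: "f \<in> L2 \<Omega>" and g: "g \<in> L2 \<Omega>"
    and weak: "\<And>\<phi>. \<phi> \<in> test_functions \<Omega> \<Longrightarrow> (LINT x|lebesgue_on \<Omega>. g x * \<phi> x) = (LINT x|lebesgue_on \<Omega>. f x * vf_transpose T \<phi> x)"
  shows "(LINT x|lebesgue_on \<Omega>. g x * v x) = (LINT x|lebesgue_on \<Omega>. f x * vf_transpose T v x)"
proof -
  let ?M = "lebesgue_on \<Omega>"
  let ?W = "\<Omega> \<inter> ball p r"
  have lm: "\<Omega> \<in> lmeasurable" by (rule bounded_open_lmeasurable[OF \<Omega>])
  have Wo: "open ?W" using \<Omega> by auto
  have WU: "?W \<subseteq> U" using r by auto
  have neg: "\<rho> x < 0" if "x \<in> ?W" for x using that WU U(3) by blast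
  obtain Cs where Cs: "Cs \<ge> 0" "\<And>y. \<bar>frechet_derivative smooth_step (at y) 1\<bar> \<le> Cs" using smooth_step_derivative_bound by blast
  \<comment> \<open>the cutoff vanishes where \<open>\<rho> \<ge> -1/(k+1)\<close> and is 1 where \<open>\<rho> \<le> -2/(k+1)\<close>\<close>
  define y where "y k x = - real (Suc k) * \<rho> x - 1" for k x
  define \<theta> where "\<theta> k x = complex_of_real (smooth_step (y k x))" for k x
  define \<phi> where "\<phi> k x = (if x \<in> ?W then \<theta> k x * v x else 0)" for k x
  have closedK: "closed K" by (rule compact_imp_closed[OF K(1)])
  have ky: "ksmooth False U n (y k)" for n k
    unfolding y_def[abs_def] using U(2) by (intro ksmooth_diff ksmooth_const ksmooth_mult U(1)) (simp add: smooth_on_iff)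
  have k\<theta>: "ksmooth False U n (\<theta> k)" for n k
    unfolding \<theta>_def[abs_def]
    by (rule ksmooth_compose_linear[OF bounded_linear_of_real U(1)],
        rule ksmooth_compose[OF U(1) open_UNIV subset_UNIV ky smooth_on_smooth_step[unfolded smooth_on_iff, THEN conjunct2, rule_format]])
  have test: "\<phi> k \<in> test_functions \<Omega>" for k
  proof -
    define Kk where "Kk = {x \<in> K. \<rho> x \<le> - (1 / real (Suc k))}"
    have "closedin (top_of_set K) (K \<inter> \<rho> -` {..- (1 / real (Suc k))})"
      by (rule continuous_closedin_preimage) (use smooth_on_continuous[OF U(2)] continuous_on_subset K r in \<open>blast, simp\<close>)
    then have "compact (K \<inter> \<rho> -` {..- (1 / real (Suc k))})" by (rule closedin_compact[OF K(1)])
    moreover have "Kk = K \<inter> \<rho> -` {..- (1 / real (Suc k))}" unfolding Kk_def by blast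
    ultimately have cK: "compact Kk" by simp
    have KW: "Kk \<subseteq> ?W"
    proof
      fix x assume x: "x \<in> Kk"
      then have "x \<in> ball p r" "\<rho> x < 0" using K(2) by (auto simp: Kk_def intro: le_less_trans)
      then show "x \<in> ?W" using U(3) r by auto
    qed
    have z: "\<theta> k x * v x = 0" if x: "x \<in> ?W - Kk" for x
    proof (cases "x \<in> K")
      case True
      then have "\<rho> x > - (1 / real (Suc k))" using x by (auto simp: Kk_def)
      then have "real (Suc k) * (- (1 / real (Suc k))) < real (Suc k) * \<rho> x"
        by (rule mult_strict_left_mono) simp
      then have "real (Suc k) * \<rho> x > - 1" by (simp del: of_nat_Suc)
      then have "y k x \<le> 0" unfolding y_def by (simp only: mult_minus_left)
      then show ?thesis by (simp add: \<theta>_def smooth_step_0)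
    qed (use v(2) x in auto)
    have "ksmooth False ?W n (\<lambda>x. \<theta> k x * v x)" for n
      by (intro ksmooth_mult Wo ksmooth_subset[OF k\<theta> WU] ksmooth_subset[OF v(1) Int_lower1])
    then have "smooth_on ?W (\<lambda>x. \<theta> k x * v x)" using Wo by (simp add: smooth_on_iff)
    from smooth_on_extend_zero[OF this compact_imp_closed[OF cK] KW z]
    have "smooth_on UNIV (\<phi> k)" unfolding \<phi>_def[abs_def] by blast
    then show ?thesis by (rule test_functionsI[OF _ cK]) (use KW z in \<open>auto simp: \<phi>_def\<close>)
  qed
  have lim\<theta>: "\<forall>\<^sub>F k in sequentially. y k x > 1" if x: "x \<in> ?W" for x
  proof -
    obtain N where N: "real N * (- \<rho> x) > 2" using ex_less_of_nat_mult[of "- \<rho> x" 2] neg[OF x] by auto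
    show ?thesis unfolding eventually_sequentially
    proof (intro exI[of _ N] allI impI)
      fix k assume "k \<ge> N"
      then have "real N * (- \<rho> x) \<le> real (Suc k) * (- \<rho> x)" using neg[OF x] by (intro mult_right_mono) auto
      then show "y k x > 1" using N unfolding y_def mult_minus_left mult_minus_right by linarith
    qed
  qed
  have out: "v x = 0 \<and> vf_transpose T v x = 0 \<and> \<phi> k x = 0 \<and> vf_transpose T (\<phi> k) x = 0" if x: "x \<in> \<Omega> - ?W" for x k
  proof -
    have o: "open (\<Omega> - K)" using \<Omega>(1) closedK by (rule open_Diff)
    have xK: "x \<in> \<Omega> - K" using x K(2) by auto
    have "\<phi> k z = 0" if "z \<in> \<Omega> - K" for z using v(2)[OF that] by (simp add: \<phi>_def)
    then show ?thesis
      using vf_transpose_cong_open[OF o xK, of "\<phi> k" "\<lambda>_. 0" T] vf_transpose_cong_open[OF o xK, of v "\<lambda>_. 0" T] v(2) xK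
      by (simp add: vf_transpose_zero)
  qed
  have P\<phi>: "vf_transpose T (\<phi> k) x = \<theta> k x * vf_transpose T v x - v x * vf_apply T (\<theta> k) x" if x: "x \<in> ?W" for x k
  proof -
    have "vf_transpose T (\<phi> k) x = vf_transpose T (\<lambda>x. \<theta> k x * v x) x"
      by (rule vf_transpose_cong_open[OF Wo x]) (simp add: \<phi>_def)
    also have "\<dots> = \<theta> k x * vf_transpose T v x - v x * vf_apply T (\<theta> k) x"
    proof (rule vf_transpose_mult[OF T \<Omega>(2)])
      show "\<theta> k differentiable at x" using ksmooth_differentiable[OF k\<theta>] WU x by blast
      show "v differentiable at x" using ksmooth_differentiable[OF v(1)] x by blast
    qed (use x in simp)
    finally show ?thesis .
  qed
  have X\<theta>: "vf_apply T (\<theta> k) x = of_real (frechet_derivative smooth_step (at (y k x)) 1 * (- real (Suc k))) * vf_apply T (\<lambda>x. of_real (\<rho> x)) x"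
    if x: "x \<in> ?W" for x k
  proof -
    have d\<rho>: "\<rho> differentiable at x" using smooth_on_differentiable[OF U(2)] WU x by blast
    have dy: "(y k has_derivative (\<lambda>u. - real (Suc k) * frechet_derivative \<rho> (at x) u)) (at x)"
      unfolding y_def[abs_def] using d\<rho> unfolding frechet_derivative_works by (auto intro!: derivative_eq_intros)
    have ds: "(smooth_step has_derivative frechet_derivative smooth_step (at z)) (at z)" for z
      using smooth_on_differentiable[OF smooth_on_smooth_step] by (simp add: frechet_derivative_works)
    have sl: "frechet_derivative smooth_step (at z) u = u * frechet_derivative smooth_step (at z) 1" for z u
      using linear_cmul[OF has_derivative_linear[OF ds[of z]], of u 1] by simp
    have e: "frechet_derivative (\<theta> k) (at x) b = of_real (frechet_derivative smooth_step (at (y k x)) (- real (Suc k) * frechet_derivative \<rho> (at x) b))" for b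
      unfolding \<theta>_def[abs_def] using frechet_derivative_eqI[OF has_derivative_of_real[OF has_derivative_compose[OF dy ds]]] by metis
    have "frechet_derivative (\<theta> k) (at x) b =
        of_real (frechet_derivative smooth_step (at (y k x)) 1 * (- real (Suc k))) * frechet_derivative (\<lambda>x. complex_of_real (\<rho> x)) (at x) b" for b
      unfolding frechet_derivative_of_real[OF d\<rho>] e sl[of _ "- real (Suc k) * frechet_derivative \<rho> (at x) b"]
      by (simp only: of_real_mult mult_ac)
    then show ?thesis by (simp only: vf_apply_def sum_distrib_left mult.left_commute)
  qed
  define D where "D = B + B * (Cs * C * 2)"
  have Bnn: "B \<ge> 0" if "x \<in> \<Omega>" for x using v(3)[OF that] by (rule order_trans[OF norm_ge_zero])
  have n\<theta>: "norm (\<theta> k x) \<le> 1" for k x using smooth_step_bounds by (simp add: \<theta>_def)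
  have bd1: "norm (\<phi> k x) \<le> B" if "x \<in> \<Omega>" for k x
    using mult_mono[OF n\<theta>[of k x] v(3)[OF that]] Bnn[OF that] by (auto simp: \<phi>_def norm_mult)
  have bd2: "norm (vf_transpose T (\<phi> k) x) \<le> D" if x: "x \<in> \<Omega>" for k x
  proof (cases "x \<in> ?W")
    case False
    then show ?thesis using out[of x k] x Bnn[OF x] Cs(1) C(1) by (simp add: D_def)
  next
    case True
    have 1: "norm (\<theta> k x * vf_transpose T v x) \<le> B"
      using mult_mono[OF n\<theta>[of k x] v(4)[OF x]] Bnn[OF x] by (simp add: norm_mult)
    have "norm (vf_apply T (\<theta> k) x) \<le> Cs * C * 2"
    proof (cases "y k x \<in> {0..1}")
      case False
      then have "frechet_derivative smooth_step (at (y k x)) 1 = 0" using smooth_step_derivative_0[of "y k x"] by auto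
      then show ?thesis using X\<theta>[OF True] Cs(1) C(1) by simp
    next
      case y: True
      have "norm (vf_apply T (\<theta> k) x) = \<bar>frechet_derivative smooth_step (at (y k x)) 1\<bar> * real (Suc k) * norm (vf_apply T (\<lambda>x. of_real (\<rho> x)) x)"
        unfolding X\<theta>[OF True] by (simp add: norm_mult abs_mult del: of_nat_Suc)
      also have "\<dots> \<le> Cs * real (Suc k) * (C * \<bar>\<rho> x\<bar>)"
        using Cs C(2)[OF True] by (intro mult_mono) auto
      also have "\<dots> = Cs * C * (real (Suc k) * \<bar>\<rho> x\<bar>)" by (simp only: mult_ac)
      also have "\<dots> \<le> Cs * C * 2"
      proof (rule mult_left_mono)
        show "real (Suc k) * \<bar>\<rho> x\<bar> \<le> 2" using y neg[OF True] unfolding y_def by (auto simp del: of_nat_Suc)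
      qed (use Cs C in simp)
      finally show ?thesis .
    qed
    then have 2: "norm (v x * vf_apply T (\<theta> k) x) \<le> B * (Cs * C * 2)"
      unfolding norm_mult using v(3)[OF x] Bnn[OF x] by (intro mult_mono) auto
    show ?thesis unfolding P\<phi>[OF True] D_def using norm_triangle_ineq4 1 2 by (meson add_mono order_trans)
  qed
  have l1: "(\<lambda>k. \<phi> k x) \<longlonglongrightarrow> v x" if x: "x \<in> \<Omega>" for x
  proof (cases "x \<in> ?W")
    case False then show ?thesis using out x by simp
  next
    case True
    have "\<forall>\<^sub>F k in sequentially. \<phi> k x = v x"
      using lim\<theta>[OF True] by eventually_elim (use True in \<open>simp add: \<phi>_def \<theta>_def smooth_step_1\<close>)
    then show ?thesis by (rule tendsto_eventually)
  qed
  have l2: "(\<lambda>k. vf_transpose T (\<phi> k) x) \<longlonglongrightarrow> vf_transpose T v x" if x: "x \<in> \<Omega>" for x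
  proof (cases "x \<in> ?W")
    case False then show ?thesis using out x by simp
  next
    case True
    have "\<forall>\<^sub>F k in sequentially. vf_transpose T (\<phi> k) x = vf_transpose T v x"
      using lim\<theta>[OF True]
    proof eventually_elim
      case (elim k)
      then have "frechet_derivative smooth_step (at (y k x)) 1 = 0" by (intro smooth_step_derivative_0) auto
      then show ?case using elim by (simp add: P\<phi>[OF True] X\<theta>[OF True]) (simp add: \<theta>_def smooth_step_1)
    qed
    then show ?thesis by (rule tendsto_eventually)
  qed
  have contv: "continuous_on \<Omega> v" using ksmooth_continuous[OF v(1)] .
  have contPv: "continuous_on \<Omega> (vf_transpose T v)"
    using ksmooth_continuous[OF vf_transpose_ksmooth[OF T \<Omega>(2,1) order_refl v(1)]] .
  have dom: "(\<lambda>k. LINT x|?M. h x * u k x) \<longlonglongrightarrow> (LINT x|?M. h x * w x)"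
    if h: "h \<in> L2 \<Omega>" and u: "\<And>k. u k \<in> test_functions \<Omega>" "\<And>k x. x \<in> \<Omega> \<Longrightarrow> norm (u k x) \<le> E"
      "\<And>x. x \<in> \<Omega> \<Longrightarrow> (\<lambda>k. u k x) \<longlonglongrightarrow> w x" and w: "continuous_on \<Omega> w" for h u w E
  proof (rule integral_dominated_convergence[where w="\<lambda>x. E * norm (h x)"])
    show "(\<lambda>x. h x * w x) \<in> borel_measurable ?M"
      by (intro borel_measurable_times L2_measurable h continuous_measurable_lebesgue_on w \<Omega>)
    show "(\<lambda>x. h x * u k x) \<in> borel_measurable ?M" for k
      by (intro borel_measurable_times L2_measurable h test_function_L2[OF u(1) \<Omega>])
    show "integrable ?M (\<lambda>x. E * norm (h x))" using L2_integrable[OF lm h] by auto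
    show "AE x in ?M. (\<lambda>k. h x * u k x) \<longlonglongrightarrow> h x * w x" by (rule AE_I2) (use u(3) in \<open>auto intro!: tendsto_intros\<close>)
    show "AE x in ?M. norm (h x * u k x) \<le> E * norm (h x)" for k
      by (rule AE_I2) (use u(2) in \<open>auto simp: norm_mult mult.commute[of E] intro!: mult_left_mono\<close>)
  qed
  have P\<phi>t: "vf_transpose T (\<phi> k) \<in> test_functions \<Omega>" for k by (rule vf_transpose_test_function[OF T \<Omega>(2,1) test])
  have lg: "(\<lambda>k. LINT x|?M. g x * \<phi> k x) \<longlonglongrightarrow> (LINT x|?M. g x * v x)"
    by (rule dom[OF g test bd1 l1 contv])
  have "(\<lambda>k. LINT x|?M. f x * vf_transpose T (\<phi> k) x) \<longlonglongrightarrow> (LINT x|?M. f x * vf_transpose T v x)"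
    by (rule dom[OF f P\<phi>t bd2 l2 contPv])
  with lg show ?thesis unfolding weak[OF test] by (rule LIMSEQ_unique)
qed

unbundle no fps_syntax

section \<open>The formal flow of a complex vector field\<close>

definition taylor_sum :: "nat \<Rightarrow> real \<Rightarrow> (nat \<Rightarrow> 'b::real_normed_vector) \<Rightarrow> 'b" where
  "taylor_sum N t a = (\<Sum>i<Suc N. (t ^ i / fact i) *\<^sub>R a i)"

text \<open>The coefficients of the conjugate of \<open>e\<^sup>t\<^sup>S\<close> applied to the conjugate coordinate functions, \<open>S = c T\<close>. As \<open>S\<close> is complex,
  there is no actual flow, but the Taylor polynomial is a map into \<open>\<complex>\<^sup>n\<close> all the same. Conjugate coordinates are used
  because \<open>S\<close> is to be applied to the conjugate of a holomorphic function.\<close>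

definition flow_coeff :: "(complex^'n \<Rightarrow> (complex^'n) \<times> (complex^'n)) \<Rightarrow> complex \<Rightarrow> nat \<Rightarrow> complex^'n \<Rightarrow> complex^'n" where
  "flow_coeff T c i x = (\<chi> j. cnj (((\<lambda>\<phi> x. c * vf_apply T \<phi> x) ^^ i) (\<lambda>x. cnj (x $ j)) x))"

text \<open>The Taylor coefficients of \<open>e\<^sup>-\<^sup>t\<^sup>c\<^sup>P \<eta>\<close> for the transpose \<open>P\<close> of \<open>T\<close>.\<close>

definition weight_coeff :: "('a::euclidean_space \<Rightarrow> 'a \<times> 'a) \<Rightarrow> complex \<Rightarrow> ('a \<Rightarrow> complex) \<Rightarrow> nat \<Rightarrow> 'a \<Rightarrow> complex" where
  "weight_coeff T c \<eta> i = ((\<lambda>\<phi> x. - c * vf_transpose T \<phi> x) ^^ i) \<eta>"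

lemma taylor_sum_0: "taylor_sum N 0 a = a 0"
  unfolding taylor_sum_def sum.lessThan_Suc_shift by simp

lemma taylor_sum_has_vector_derivative:
  "((\<lambda>t. taylor_sum (Suc N) t a) has_vector_derivative taylor_sum N t (\<lambda>i. a (Suc i))) (at t)"
proof -
  have d: "((\<lambda>t. (t ^ Suc i / fact (Suc i)) *\<^sub>R a (Suc i)) has_vector_derivative (t ^ i / fact i) *\<^sub>R a (Suc i)) (at t)" for i
  proof -
    have "((\<lambda>t. t ^ Suc i / fact (Suc i)) has_real_derivative (t ^ i / fact i)) (at t)"
      by (rule derivative_eq_intros refl | simp add: field_simps del: of_nat_Suc)+
    then have "((\<lambda>t. t ^ Suc i / fact (Suc i)) has_vector_derivative (t ^ i / fact i)) (at t)"
      by (simp add: has_real_derivative_iff_has_vector_derivative)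
    from has_vector_derivative_scaleR[OF _ has_vector_derivative_const] this show ?thesis
      unfolding has_real_derivative_iff_has_vector_derivative[symmetric] by fastforce
  qed
  have "((\<lambda>t. a 0 + (\<Sum>i<Suc N. (t ^ Suc i / fact (Suc i)) *\<^sub>R a (Suc i))) has_vector_derivative
      (0 + (\<Sum>i<Suc N. (t ^ i / fact i) *\<^sub>R a (Suc i)))) (at t)"
    by (intro has_vector_derivative_add has_vector_derivative_const has_vector_derivative_sum d)
  then show ?thesis
    unfolding taylor_sum_def by (subst sum.lessThan_Suc_shift) simp
qed

lemma taylor_sum_split: "taylor_sum (Suc N) t a = taylor_sum N t a + (t ^ Suc N / fact (Suc N)) *\<^sub>R a (Suc N)"
  by (simp add: taylor_sum_def)

lemma taylor_coeff_le_1: "0 \<le> t \<Longrightarrow> t \<le> 1 \<Longrightarrow> \<bar>t ^ i / fact i\<bar> \<le> (1::real)"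
proof -
  assume t: "0 \<le> t" "t \<le> 1"
  have "t ^ i \<le> 1" using t by (rule power_le_one)
  moreover have "(1::real) \<le> fact i" by simp
  ultimately have "t ^ i \<le> fact i" by linarith
  then show ?thesis using t by (simp add: divide_le_eq_1)
qed

lemma norm_taylor_sum_le:
  assumes t: "0 \<le> t" "t \<le> 1" and a: "\<And>i. i \<le> N \<Longrightarrow> norm (a i) \<le> C"
  shows "norm (taylor_sum N t a) \<le> real (Suc N) * C"
proof -
  have "norm (taylor_sum N t a) \<le> (\<Sum>i<Suc N. C)"
    unfolding taylor_sum_def
  proof (rule order_trans[OF norm_sum sum_mono])
    fix i assume i: "i \<in> {..<Suc N}"
    then have "norm (a i) \<le> C" using a by simp
    then have "\<bar>t ^ i / fact i\<bar> * norm (a i) \<le> 1 * C"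
      using taylor_coeff_le_1[OF t] by (intro mult_mono) auto
    then show "norm ((t ^ i / fact i) *\<^sub>R a i) \<le> C" by simp
  qed
  then show ?thesis by simp
qed

lemma taylor_sum_second_order:
  assumes t: "0 \<le> t" "t \<le> 1" and a: "\<And>i. i \<le> Suc N \<Longrightarrow> norm (a i) \<le> C"
  shows "norm (taylor_sum (Suc N) t a - a 0 - t *\<^sub>R a 1) \<le> real N * C * t\<^sup>2"
proof -
  have "taylor_sum (Suc N) t a - a 0 - t *\<^sub>R a 1 = (\<Sum>i<N. (t ^ Suc (Suc i) / fact (Suc (Suc i))) *\<^sub>R a (Suc (Suc i)))"
    unfolding taylor_sum_def sum.lessThan_Suc_shift by simp
  also have "norm \<dots> \<le> (\<Sum>i<N. t\<^sup>2 * C)"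
  proof (rule order_trans[OF norm_sum sum_mono])
    fix i assume i: "i \<in> {..<N}"
    have "norm (a (Suc (Suc i))) \<le> C" using a i by simp
    moreover have "\<bar>t ^ Suc (Suc i) / fact (Suc (Suc i))\<bar> \<le> t\<^sup>2"
    proof -
      have "t ^ Suc (Suc i) \<le> t ^ 2" using t by (intro power_decreasing) auto
      moreover have "t ^ Suc (Suc i) / fact (Suc (Suc i)) \<le> t ^ Suc (Suc i) / 1"
        using t by (intro divide_left_mono) (auto simp del: fact_Suc)
      ultimately show ?thesis using t by (simp del: fact_Suc power_Suc)
    qed
    ultimately show "norm ((t ^ Suc (Suc i) / fact (Suc (Suc i))) *\<^sub>R a (Suc (Suc i))) \<le> t\<^sup>2 * C"
      unfolding norm_scaleR by (intro mult_mono) auto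
  qed
  finally show ?thesis by (simp add: mult_ac)
qed

lemma ksmooth_taylor_sum:
  assumes "open S" "\<And>i. ksmooth B S n (\<lambda>x. a i x)"
  shows "ksmooth B S n (\<lambda>x. taylor_sum N t (\<lambda>i. a i x))"
  unfolding taylor_sum_def
  by (intro ksmooth_sum assms(1) ksmooth_compose_linear[OF bounded_linear_scaleR_right] assms(2))

lemma bounded_linear_axis: "bounded_linear (axis j :: complex \<Rightarrow> complex^'n)"
  unfolding linear_conv_bounded_linear[symmetric] by (rule linearI) (auto simp: axis_def vec_eq_iff)

lemma vec_eq_sum_axis: "(\<chi> j. g j) = (\<Sum>j\<in>UNIV. axis j (g j :: complex))"
  by (simp add: vec_eq_iff axis_def sum.delta)

lemma coord_iter_ksmooth:
  fixes T :: "complex^'n \<Rightarrow> (complex^'n) \<times> (complex^'n)"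
  assumes T: "smooth_vector_field \<Omega> T" "bounded \<Omega>" "open \<Omega>"
  shows "ksmooth True \<Omega> n (((\<lambda>\<phi> x. c * vf_apply T \<phi> x) ^^ i) (\<lambda>x. cnj (x $ j)))"
proof (induction i arbitrary: n)
  case 0
  have "bounded_linear (\<lambda>x::complex^'n. cnj (x $ j))"
    by (rule bounded_linear_compose[OF bounded_linear_cnj bounded_linear_vec_nth])
  then show ?case using ksmooth_linear[OF _ T(3)] T(2) by simp
next
  case (Suc i)
  show ?case
    by (simp, rule ksmooth_compose_linear[OF bounded_linear_mult_right T(3) vf_apply_ksmooth[OF T order_refl Suc.IH]])
qed

lemma flow_coeff_ksmooth:
  fixes T :: "complex^'n \<Rightarrow> (complex^'n) \<times> (complex^'n)"
  assumes T: "smooth_vector_field \<Omega> T" "bounded \<Omega>" "open \<Omega>"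
  shows "ksmooth True \<Omega> n (flow_coeff T c i)"
  unfolding flow_coeff_def[abs_def] vec_eq_sum_axis
  by (intro ksmooth_sum T(3) ksmooth_compose_linear[OF bounded_linear_axis]
        ksmooth_compose_linear[OF bounded_linear_cnj] coord_iter_ksmooth T)

lemma weight_coeff_ksmooth:
  assumes T: "smooth_vector_field \<Omega> T" "bounded \<Omega>" "open \<Omega>" and \<eta>: "\<And>n. ksmooth True \<Omega> n \<eta>"
  shows "ksmooth True \<Omega> n (weight_coeff T c \<eta> i)"
proof (induction i arbitrary: n)
  case 0 then show ?case using \<eta> by (simp add: weight_coeff_def)
next
  case (Suc i)
  have "weight_coeff T c \<eta> (Suc i) = (\<lambda>x. (- c) * vf_transpose T (weight_coeff T c \<eta> i) x)"
    by (simp add: weight_coeff_def)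
  then show ?case
    using ksmooth_compose_linear[OF bounded_linear_mult_right T(3) vf_transpose_ksmooth[OF T order_refl Suc.IH], of n "- c"] by simp
qed

lemma weight_coeff_support:
  assumes "open S" "\<And>x. x \<in> S \<Longrightarrow> \<eta> x = 0" "x \<in> S"
  shows "weight_coeff T c \<eta> i x = 0"
  using assms(3)
proof (induction i arbitrary: x)
  case 0 then show ?case using assms(2) by (simp add: weight_coeff_def)
next
  case (Suc i)
  have "vf_transpose T (weight_coeff T c \<eta> i) x = vf_transpose T (\<lambda>_. 0) x"
    by (rule vf_transpose_cong_open[OF assms(1) Suc.prems Suc.IH])
  then show ?case by (simp add: weight_coeff_def vf_transpose_zero)
qed

lemma flow_coeff_0: "flow_coeff T c 0 x = (x :: complex^'n)"
  by (simp add: flow_coeff_def vec_eq_iff)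

lemma flow_coeff_1:
  fixes T :: "complex^'n \<Rightarrow> (complex^'n) \<times> (complex^'n)"
  shows "flow_coeff T c 1 x = cnj c *s vf_direction T x"
proof -
  have bl: "bounded_linear (\<lambda>x::complex^'n. cnj (x $ j))" for j
    by (rule bounded_linear_compose[OF bounded_linear_cnj bounded_linear_vec_nth])
  have "vf_apply T (\<lambda>x. cnj (x $ j)) x = cnj (vf_direction T x $ j)" for j
  proof -
    have "frechet_derivative (\<lambda>x::complex^'n. cnj (x $ j)) (at x) = (\<lambda>x. cnj (x $ j))"
      by (rule frechet_derivative_eqI[OF bounded_linear_imp_has_derivative[OF bl]])
    then show ?thesis
      unfolding vf_apply_def using vf_coeff_sum_Basis[OF bounded_linear.linear[OF bl[of j]], of T x]
      by (simp add: vf_direction_def)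
  qed
  then show ?thesis by (simp add: flow_coeff_def vec_eq_iff)
qed

lemma flow_coeff_Suc:
  fixes T :: "complex^'n \<Rightarrow> (complex^'n) \<times> (complex^'n)"
  assumes T: "smooth_vector_field \<Omega> T" "bounded \<Omega>" "open \<Omega>" and x: "x \<in> \<Omega>"
  shows "(\<Sum>b\<in>Basis. cnj (c * vf_coeff T b x) *s frechet_derivative (flow_coeff T c i) (at x) b) = flow_coeff T c (Suc i) x"
proof -
  let ?A = "\<lambda>j. ((\<lambda>\<phi> x. c * vf_apply T \<phi> x) ^^ i) (\<lambda>x. cnj (x $ j))"
  have dA: "(?A j has_derivative frechet_derivative (?A j) (at x)) (at x)" for j
    using ksmooth_differentiable[OF coord_iter_ksmooth[OF T] x] by (simp add: frechet_derivative_works)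
  have "(flow_coeff T c i has_derivative (\<lambda>v. \<Sum>j\<in>UNIV. axis j (cnj (frechet_derivative (?A j) (at x) v)))) (at x)"
    unfolding flow_coeff_def[abs_def] vec_eq_sum_axis
    by (intro has_derivative_sum bounded_linear.has_derivative[OF bounded_linear_axis]
        bounded_linear.has_derivative[OF bounded_linear_cnj] dA)
  note D = frechet_derivative_eqI[OF this]
  have "frechet_derivative (flow_coeff T c i) (at x) v = (\<chi> j. cnj (frechet_derivative (?A j) (at x) v))" for v
    unfolding vec_eq_sum_axis D ..
  then show ?thesis
    by (simp add: vec_eq_iff flow_coeff_def vf_apply_def sum_component cnj_sum sum_distrib_left mult.assoc)
qed

lemma vf_transpose_taylor_sum:
  assumes T: "smooth_vector_field \<Omega> T" "bounded \<Omega>" and x: "x \<in> \<Omega>" and a: "\<And>i. (\<lambda>x. a i x) differentiable at x"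
  shows "vf_transpose T (\<lambda>x. taylor_sum N t (\<lambda>i. a i x)) x = taylor_sum N t (\<lambda>i. vf_transpose T (a i) x)"
proof -
  have "frechet_derivative (\<lambda>y. vf_coeff T b y * taylor_sum N t (\<lambda>i. a i y)) (at x) v
      = (\<Sum>i<Suc N. (t ^ i / fact i) *\<^sub>R frechet_derivative (\<lambda>y. vf_coeff T b y * a i y) (at x) v)" if b: "b \<in> Basis" for b v
  proof -
    have "(\<lambda>y. vf_coeff T b y * a i y) differentiable at x" for i
      using vf_coeff_differentiable[OF T b x] a by (rule differentiable_mult)
    then have D: "((\<lambda>y. \<Sum>i<Suc N. (t ^ i / fact i) *\<^sub>R (vf_coeff T b y * a i y)) has_derivative
       (\<lambda>v. \<Sum>i<Suc N. (t ^ i / fact i) *\<^sub>R frechet_derivative (\<lambda>y. vf_coeff T b y * a i y) (at x) v)) (at x)"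
      by (intro has_derivative_sum has_derivative_scaleR_right) (simp add: frechet_derivative_works)
    have "(\<lambda>y. vf_coeff T b y * taylor_sum N t (\<lambda>i. a i y)) = (\<lambda>y. \<Sum>i<Suc N. (t ^ i / fact i) *\<^sub>R (vf_coeff T b y * a i y))"
      by (simp add: taylor_sum_def sum_distrib_left distrib_left)
    then show ?thesis using frechet_derivative_eqI[OF D] by simp
  qed
  then have "vf_transpose T (\<lambda>x. taylor_sum N t (\<lambda>i. a i x)) x
      = - (\<Sum>b\<in>Basis. \<Sum>i<Suc N. (t ^ i / fact i) *\<^sub>R frechet_derivative (\<lambda>y. vf_coeff T b y * a i y) (at x) b)"
    by (simp add: vf_transpose_def)
  also have "\<dots> = taylor_sum N t (\<lambda>i. vf_transpose T (a i) x)"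
    unfolding taylor_sum_def vf_transpose_def scaleR_minus_right sum_negf
    by (subst sum.swap) (simp add: scaleR_sum_right)
  finally show ?thesis .
qed

text \<open>Let \<open>V\<close> and \<open>w\<close> be the Taylor sums of the flow and weight coefficients, \<open>F = w \<cdot> cnj (H \<circ> V)\<close>, and \<open>P\<close> the transpose
  of \<open>T\<close>. By the Leibniz rule, \<open>-c P F\<close> is the sum of \<open>(-c P w) cnj (H \<circ> V)\<close> and \<open>w (c T (cnj (H \<circ> V)))\<close>. As \<open>H\<close> is
  holomorphic, \<open>c T\<close> acts on \<open>cnj (H \<circ> V)\<close> by applying the complex linear derivative of \<open>H\<close> to the coefficients of \<open>V\<close>, each
  shifted to the next; and \<open>-c P\<close> shifts the coefficients of \<open>w\<close>. Shifting the coefficients of a Taylor sum is differentiation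
  in \<open>t\<close> except in the last term, so \<open>F\<close> solves \<open>\<partial>\<^sub>t F = -c P F\<close> up to an error with a factor \<open>t\<^sup>N\<close>.\<close>

lemma transport_equation:
  fixes \<Omega> :: "(complex^'n) set"
  assumes T: "smooth_vector_field \<Omega> T" "bounded \<Omega>" "open \<Omega>" and x: "x \<in> \<Omega>" and \<eta>: "\<And>n. ksmooth True \<Omega> n \<eta>"
    and H: "holomorphic_several \<Omega> H" and V: "taylor_sum N t (\<lambda>i. flow_coeff T c i x) \<in> \<Omega>"
  shows "- c * vf_transpose T (\<lambda>x. taylor_sum N t (\<lambda>i. weight_coeff T c \<eta> i x) * cnj (H (taylor_sum N t (\<lambda>i. flow_coeff T c i x)))) x
    = taylor_sum N t (\<lambda>i. weight_coeff T c \<eta> (Suc i) x) * cnj (H (taylor_sum N t (\<lambda>i. flow_coeff T c i x)))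
      + taylor_sum N t (\<lambda>i. weight_coeff T c \<eta> i x) *
        cnj (frechet_derivative H (at (taylor_sum N t (\<lambda>i. flow_coeff T c i x))) (taylor_sum N t (\<lambda>i. flow_coeff T c (Suc i) x)))"
proof -
  let ?w = "\<lambda>x. taylor_sum N t (\<lambda>i. weight_coeff T c \<eta> i x)"
  let ?V = "\<lambda>x. taylor_sum N t (\<lambda>i. flow_coeff T c i x)"
  let ?D = "frechet_derivative H (at (?V x))"
  have dw: "weight_coeff T c \<eta> i differentiable at x" for i
    using ksmooth_differentiable[OF weight_coeff_ksmooth[OF T \<eta>] x] .
  have dws: "?w differentiable at x"
    using ksmooth_differentiable[OF ksmooth_taylor_sum[OF T(3) weight_coeff_ksmooth[OF T \<eta>]] x] .
  have dfl: "(flow_coeff T c i has_derivative frechet_derivative (flow_coeff T c i) (at x)) (at x)" for i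
    using ksmooth_differentiable[OF flow_coeff_ksmooth[OF T] x] by (simp add: frechet_derivative_works)
  have dV: "(?V has_derivative (\<lambda>v. taylor_sum N t (\<lambda>i. frechet_derivative (flow_coeff T c i) (at x) v))) (at x)"
    unfolding taylor_sum_def by (intro has_derivative_sum has_derivative_scaleR_right dfl)
  have dH: "(H has_derivative ?D) (at (?V x))" and Dc: "?D (k *s v) = k * ?D v" for k v
    using holomorphic_several_derivative[OF H V] by auto
  have dHV: "((\<lambda>x. cnj (H (?V x))) has_derivative (\<lambda>v. cnj (?D (taylor_sum N t (\<lambda>i. frechet_derivative (flow_coeff T c i) (at x) v))))) (at x)"
    by (rule bounded_linear.has_derivative[OF bounded_linear_cnj has_derivative_compose[OF dV dH]])
  have lin: "linear ?D" by (rule has_derivative_linear[OF dH])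
  have "c * vf_apply T (\<lambda>x. cnj (H (?V x))) x =
      cnj (\<Sum>b\<in>Basis. cnj (c * vf_coeff T b x) * ?D (taylor_sum N t (\<lambda>i. frechet_derivative (flow_coeff T c i) (at x) b)))"
    by (simp add: vf_apply_def frechet_derivative_eqI[OF dHV] sum_distrib_left mult.assoc cnj_sum)
  also have "(\<Sum>b\<in>Basis. cnj (c * vf_coeff T b x) * ?D (taylor_sum N t (\<lambda>i. frechet_derivative (flow_coeff T c i) (at x) b)))
     = ?D (\<Sum>b\<in>Basis. cnj (c * vf_coeff T b x) *s taylor_sum N t (\<lambda>i. frechet_derivative (flow_coeff T c i) (at x) b))"
    unfolding Dc[symmetric] by (rule linear_sum[OF lin, symmetric])
  also have "(\<Sum>b\<in>Basis. cnj (c * vf_coeff T b x) *s taylor_sum N t (\<lambda>i. frechet_derivative (flow_coeff T c i) (at x) b))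
     = taylor_sum N t (\<lambda>i. flow_coeff T c (Suc i) x)"
  proof -
    have s: "k *s (\<Sum>i<Suc N. (t ^ i / fact i) *\<^sub>R a i) = (\<Sum>i<Suc N. (t ^ i / fact i) *\<^sub>R (k *s a i))" for k and a :: "nat \<Rightarrow> complex^'n"
      by (simp only: linear_sum[OF bounded_linear.linear[OF bounded_linear_scalar_mult_right]]
          linear_cmul[OF bounded_linear.linear[OF bounded_linear_scalar_mult_right]])
    show ?thesis unfolding taylor_sum_def s
      by (subst sum.swap) (simp only: scaleR_sum_right[symmetric] flow_coeff_Suc[OF T x])
  qed
  finally have X: "c * vf_apply T (\<lambda>x. cnj (H (?V x))) x = cnj (?D (taylor_sum N t (\<lambda>i. flow_coeff T c (Suc i) x)))" .
  have P: "- c * vf_transpose T ?w x = taylor_sum N t (\<lambda>i. weight_coeff T c \<eta> (Suc i) x)"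
  proof -
    have "- c * vf_transpose T ?w x = - c * taylor_sum N t (\<lambda>i. vf_transpose T (weight_coeff T c \<eta> i) x)"
      by (subst vf_transpose_taylor_sum[OF T(1,2) x dw]) simp
    also have "\<dots> = taylor_sum N t (\<lambda>i. - c * vf_transpose T (weight_coeff T c \<eta> i) x)"
      unfolding taylor_sum_def by (simp only: sum_distrib_left mult_scaleR_right)
    finally show ?thesis by (simp add: weight_coeff_def)
  qed
  have "vf_transpose T (\<lambda>x. ?w x * cnj (H (?V x))) x = vf_transpose T (\<lambda>x. cnj (H (?V x)) * ?w x) x"
    by (simp add: mult.commute)
  also have "\<dots> = cnj (H (?V x)) * vf_transpose T ?w x - ?w x * vf_apply T (\<lambda>x. cnj (H (?V x))) x"
    by (rule vf_transpose_mult[OF T(1,2) x differentiableI[OF dHV] dws])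
  finally have e: "vf_transpose T (\<lambda>x. ?w x * cnj (H (?V x))) x =
    cnj (H (?V x)) * vf_transpose T ?w x - ?w x * vf_apply T (\<lambda>x. cnj (H (?V x))) x" .
  have "- c * vf_transpose T (\<lambda>x. ?w x * cnj (H (?V x))) x
     = (- c * vf_transpose T ?w x) * cnj (H (?V x)) + ?w x * (c * vf_apply T (\<lambda>x. cnj (H (?V x))) x)"
    unfolding e by (simp add: algebra_simps)
  then show ?thesis unfolding P X .
qed

section \<open>Gaining powers by integrating a chain of differential relations\<close>

lemma singular_integration:
  fixes f :: "real \<Rightarrow> complex"
  assumes t: "0 < t" "t < \<tau>" and der: "\<And>s. t \<le> s \<Longrightarrow> s \<le> \<tau> \<Longrightarrow> (f has_vector_derivative f' s) (at s)"
    and bd: "\<And>s. t \<le> s \<Longrightarrow> s \<le> \<tau> \<Longrightarrow> norm (f' s) \<le> K * s powr (- a)" and a: "a \<noteq> 1"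
  shows "norm (f t) \<le> norm (f \<tau>) + K * (\<tau> powr (1 - a) - t powr (1 - a)) / (1 - a)"
proof -
  let ?\<phi> = "\<lambda>s. K * s powr (1 - a) / (1 - a)"
  have d\<phi>: "(?\<phi> has_vector_derivative K * s powr (- a)) (at s)" if "s > 0" for s
  proof -
    have "(?\<phi> has_real_derivative K * s powr (- a)) (at s)"
      using that a by (auto intro!: derivative_eq_intros)
    then show ?thesis by (simp add: has_real_derivative_iff_has_vector_derivative)
  qed
  have "norm (f \<tau> - f t) \<le> ?\<phi> \<tau> - ?\<phi> t"
  proof (rule differentiable_bound_general[OF t(2), where f'=f' and \<phi>'="\<lambda>s. K * s powr (- a)"])
    show "continuous_on {t..\<tau>} f"
      by (intro continuous_at_imp_continuous_on ballI has_vector_derivative_continuous[OF der]) auto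
    show "continuous_on {t..\<tau>} ?\<phi>"
      by (intro continuous_at_imp_continuous_on ballI has_vector_derivative_continuous[OF d\<phi>]) (use t in auto)
  qed (use der d\<phi> bd t in auto)
  moreover have "norm (f t) \<le> norm (f \<tau>) + norm (f \<tau> - f t)" using norm_triangle_ineq4[of "f \<tau>" "f \<tau> - f t"] by simp
  ultimately show ?thesis by (simp add: diff_divide_distrib right_diff_distrib)
qed

text \<open>If all \<open>g\<^sub>j\<close> with \<open>j \<le> J\<close> are \<open>O(t\<^sup>-\<^sup>a)\<close> and \<open>g\<^sub>j' = -c g\<^sub>j\<^sub>+\<^sub>1 + O(1)\<close>, then integration from a fixed time down to \<open>t\<close> shows
  that the \<open>g\<^sub>j\<close> with \<open>j < J\<close> are \<open>O(t\<^sup>1\<^sup>-\<^sup>a)\<close>. Starting from exponent \<open>M\<close>, each step costs one index and gains one power,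
  and \<open>M + 1\<close> steps bound \<open>g\<^sub>0\<close>. The constant depends on \<open>c\<close>, \<open>M\<close> and \<open>\<delta>\<close> only.\<close>

lemma chain_of_relations_bound:
  fixes c :: complex
  assumes \<delta>: "0 < \<delta>" "\<delta> \<le> 1"
  shows "\<exists>C\<ge>0. \<forall>(g :: nat \<Rightarrow> real \<Rightarrow> complex) g' E. E \<ge> 0 \<longrightarrow>
    (\<forall>j\<le>Suc M. \<forall>t. 0 < t \<longrightarrow> t < \<delta> \<longrightarrow> norm (g j t) \<le> E / t ^ M) \<longrightarrow>
    (\<forall>j\<le>M. \<forall>t. 0 < t \<longrightarrow> t < \<delta> \<longrightarrow> (g j has_vector_derivative g' j t) (at t) \<and> norm (g' j t + c * g (Suc j) t) \<le> E) \<longrightarrow>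
    (\<forall>t. 0 < t \<longrightarrow> t < \<delta> / 2 \<longrightarrow> norm (g 0 t) \<le> C * E)"
proof -
  define hyp where "hyp g g' E \<longleftrightarrow> E \<ge> 0 \<and> (\<forall>j\<le>Suc M. \<forall>t. 0 < t \<longrightarrow> t < \<delta> \<longrightarrow> norm (g j t) \<le> E / t ^ M) \<and>
    (\<forall>j\<le>M. \<forall>t. 0 < t \<longrightarrow> t < \<delta> \<longrightarrow> (g j has_vector_derivative g' j t) (at t) \<and> norm (g' j t + c * g (Suc j) t) \<le> E)"
    for g g' :: "nat \<Rightarrow> real \<Rightarrow> complex" and E :: real
  define \<tau> where "\<tau> = \<delta> / 2"
  have \<tau>: "0 < \<tau>" "\<tau> < \<delta>" "\<tau> \<le> 1" using \<delta> by (auto simp: \<tau>_def)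
  have der: "norm (g' j s) \<le> (1 + norm c * C) * E * s powr (- a)"
    if h: "hyp g g' E" and j: "j \<le> M" and s: "0 < s" "s < \<delta>" and a: "a \<ge> 0" and b: "norm (g (Suc j) s) \<le> C * E * s powr (- a)"
    for g g' :: "nat \<Rightarrow> real \<Rightarrow> complex" and E j s a C
  proof -
    have E: "E \<ge> 0" and e: "norm (g' j s + c * g (Suc j) s) \<le> E" using h j s by (auto simp: hyp_def)
    have p1: "1 \<le> s powr (- a)"
    proof -
      have "s powr a \<le> 1 powr a" using s \<delta> a by (intro powr_mono2) auto
      then have "s powr a \<le> 1" by simp
      then show ?thesis using s by (simp add: powr_minus one_le_inverse_iff)
    qed
    have "norm (g' j s) \<le> norm (g' j s + c * g (Suc j) s) + norm (c * g (Suc j) s)"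
      using norm_triangle_ineq4[of "g' j s + c * g (Suc j) s" "c * g (Suc j) s"] by simp
    also have "\<dots> \<le> E * s powr (- a) + norm c * (C * E * s powr (- a))"
      unfolding norm_mult using e b mult_left_mono[OF p1 E] by (intro add_mono mult_left_mono) auto
    finally show ?thesis by (simp add: algebra_simps)
  qed
  have at\<tau>: "norm (g j \<tau>) \<le> E / \<tau> ^ M" if "hyp g g' E" "j \<le> Suc M" for g g' E j
    using that \<tau> by (auto simp: hyp_def)
  \<comment> \<open>the exponents are kept in \<open>\<nat> + 1/2\<close>, so that no integration produces a logarithm\<close>
  have claim: "\<exists>C\<ge>0. \<forall>g g' E. hyp g g' E \<longrightarrow> (\<forall>j\<le>Suc M - i. \<forall>t. 0 < t \<longrightarrow> t < \<tau> \<longrightarrow> norm (g j t) \<le> C * E * t powr (- (real M + 1/2 - real i)))"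
    if "i \<le> M" for i
    using that
  proof (induction i)
    case 0
    show ?case
    proof (intro exI[of _ 1] conjI allI impI)
      fix g g' E j and t :: real
      assume h: "hyp g g' E" and j: "j \<le> Suc M - 0" and t: "0 < t" "t < \<tau>"
      have E: "E \<ge> 0" using h by (simp add: hyp_def)
      have "t powr (real M + 1/2) \<le> t powr (real M)" using t \<tau> by (intro powr_mono') auto
      then have "1 / t ^ M \<le> t powr (- (real M + 1/2))"
        using t by (simp add: powr_minus powr_realpow divide_simps inverse_eq_divide)
      then have "E * (1 / t ^ M) \<le> E * t powr (- (real M + 1/2))" using E by (rule mult_left_mono)
      moreover have "norm (g j t) \<le> E / t ^ M" using h j t \<tau> by (auto simp: hyp_def)
      ultimately show "norm (g j t) \<le> 1 * E * t powr (- (real M + 1/2 - real 0))" by simp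
    qed simp
  next
    case (Suc i)
    then obtain C where C: "C \<ge> 0" "\<And>g g' E j t. hyp g g' E \<Longrightarrow> j \<le> Suc M - i \<Longrightarrow> 0 < t \<Longrightarrow> t < \<tau> \<Longrightarrow>
        norm (g j t) \<le> C * E * t powr (- (real M + 1/2 - real i))" by (metis Suc_leD)
    define a where "a = real M + 1/2 - real i"
    have a: "a \<ge> 3/2" "- (real M + 1/2 - real (Suc i)) = 1 - a" using Suc.prems by (auto simp: a_def)
    define D where "D = 1 + norm c * C"
    have D: "D \<ge> 0" using C(1) by (simp add: D_def)
    show ?case
    proof (intro exI[of _ "2 ^ M / \<tau> ^ M + 2 * D"] conjI allI impI)
      fix g g' E j and t :: real
      assume h: "hyp g g' E" and j: "j \<le> Suc M - Suc i" and t: "0 < t" "t < \<tau>"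
      have E: "E \<ge> 0" using h by (simp add: hyp_def)
      have jM: "j \<le> M" "Suc j \<le> Suc M - i" using j Suc.prems by auto
      define \<tau>' where "\<tau>' = (t + \<tau>) / 2"
      have \<tau>': "t < \<tau>'" "\<tau>' < \<tau>" "\<tau> / 2 \<le> \<tau>'" using t by (auto simp: \<tau>'_def)
      have "norm (g j t) \<le> norm (g j \<tau>') + (D * E) * (\<tau>' powr (1 - a) - t powr (1 - a)) / (1 - a)"
      proof (rule singular_integration[OF t(1) \<tau>'(1)])
        fix s assume s: "t \<le> s" "s \<le> \<tau>'"
        then have s': "0 < s" "s < \<tau>" "s < \<delta>" using t \<tau> \<tau>' by auto
        show "(g j has_vector_derivative g' j s) (at s)" using h jM s' by (auto simp: hyp_def)
        show "norm (g' j s) \<le> D * E * s powr (- a)"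
          unfolding D_def by (rule der[OF h jM(1) s'(1,3)]) (use a C(2)[OF h jM(2) s'(1,2)] in \<open>auto simp: a_def\<close>)
      qed (use a in auto)
      also have "norm (g j \<tau>') \<le> E * (2 ^ M / \<tau> ^ M)"
      proof -
        have "norm (g j \<tau>') \<le> E / \<tau>' ^ M" using h jM t \<tau> \<tau>' by (auto simp: hyp_def)
        also have "\<dots> \<le> E / (\<tau> / 2) ^ M"
          using E \<tau> \<tau>' t by (intro divide_left_mono power_mono) auto
        finally show ?thesis by (simp add: power_divide)
      qed
      also have "(D * E) * (\<tau>' powr (1 - a) - t powr (1 - a)) / (1 - a) \<le> 2 * D * E * t powr (1 - a)"
      proof -
        have "(D * E) * (\<tau>' powr (1 - a) - t powr (1 - a)) / (1 - a) = (D * E) * (t powr (1 - a) - \<tau>' powr (1 - a)) / (a - 1)"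
          using a by (simp add: divide_simps) (simp add: algebra_simps)
        also have "\<dots> \<le> (D * E) * t powr (1 - a) / (a - 1)"
          using a D E by (intro divide_right_mono mult_left_mono) auto
        also have "\<dots> \<le> (D * E) * t powr (1 - a) / (1/2)"
          using a D E by (intro divide_left_mono) auto
        finally show ?thesis by simp
      qed
      finally have 1: "norm (g j t) \<le> E * (2 ^ M / \<tau> ^ M) + 2 * D * E * t powr (1 - a)" by simp
      have "1 \<le> t powr (1 - a)"
      proof -
        have "t powr (a - 1) \<le> 1 powr (a - 1)" using t \<tau> a by (intro powr_mono2) auto
        then have "inverse (t powr (a - 1)) \<ge> 1" using t by (simp add: one_le_inverse_iff)
        then show ?thesis by (simp add: powr_minus[symmetric])
      qed
      then have "E * (2 ^ M / \<tau> ^ M) * 1 \<le> E * (2 ^ M / \<tau> ^ M) * t powr (1 - a)"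
        using E \<tau> by (intro mult_left_mono) auto
      with 1 show "norm (g j t) \<le> (2 ^ M / \<tau> ^ M + 2 * D) * E * t powr (- (real M + 1/2 - real (Suc i)))"
        unfolding a(2) by (simp add: algebra_simps)
    qed (use D \<tau> in auto)
  qed
  obtain C where C: "C \<ge> 0" "\<And>g g' E j t. hyp g g' E \<Longrightarrow> j \<le> 1 \<Longrightarrow> 0 < t \<Longrightarrow> t < \<tau> \<Longrightarrow> norm (g j t) \<le> C * E * t powr (- (1/2))"
  proof -
    from claim[OF order_refl] show thesis using that by (simp add: Suc_diff_le) blast
  qed
  define D where "D = 1 + norm c * C"
  have D: "D \<ge> 0" using C(1) by (simp add: D_def)
  have fin: "norm (g 0 t) \<le> (2 ^ M / \<tau> ^ M + 2 * D) * E" if h: "hyp g g' E" and t: "0 < t" "t < \<tau>" for g g' E t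
  proof -
    have E: "E \<ge> 0" using h by (simp add: hyp_def)
    \<comment> \<open>the last step integrates \<open>s\<^sup>-\<^sup>1\<^sup>/\<^sup>2\<close>, which is integrable at 0\<close>
    define \<tau>' where "\<tau>' = (t + \<tau>) / 2"
    have \<tau>': "t < \<tau>'" "\<tau>' < \<tau>" "\<tau> / 2 \<le> \<tau>'" using t by (auto simp: \<tau>'_def)
    have "norm (g 0 t) \<le> norm (g 0 \<tau>') + (D * E) * (\<tau>' powr (1 - 1/2) - t powr (1 - 1/2)) / (1 - 1/2)"
    proof (rule singular_integration[OF t(1) \<tau>'(1)])
      fix s assume s: "t \<le> s" "s \<le> \<tau>'"
      then have s': "0 < s" "s < \<tau>" "s < \<delta>" using t \<tau> \<tau>' by auto
      show "(g 0 has_vector_derivative g' 0 s) (at s)" using h s' by (auto simp: hyp_def)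
      show "norm (g' 0 s) \<le> D * E * s powr (- (1/2))"
        unfolding D_def by (rule der[OF h le0 s'(1,3)]) (use C(2)[OF h _ s'(1,2), of "Suc 0"] in auto)
    qed auto
    also have "norm (g 0 \<tau>') \<le> E * (2 ^ M / \<tau> ^ M)"
    proof -
      have "norm (g 0 \<tau>') \<le> E / \<tau>' ^ M" using h t \<tau> \<tau>' by (auto simp: hyp_def)
      also have "\<dots> \<le> E / (\<tau> / 2) ^ M"
        using E \<tau> \<tau>' t by (intro divide_left_mono power_mono) auto
      finally show ?thesis by (simp add: power_divide)
    qed
    also have "(D * E) * (\<tau>' powr (1 - 1/2) - t powr (1 - 1/2)) / (1 - 1/2) \<le> (D * E) * 1 / (1/2)"
    proof -
      have "\<tau>' powr (1 - 1/2) \<le> 1 powr (1 - 1/2)" using t \<tau> \<tau>' by (intro powr_mono2) auto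
      then have "\<tau>' powr (1 - 1/2) - t powr (1 - 1/2) \<le> 1"
        using powr_ge_zero[of t "1 - 1/2"] powr_one_eq_one[of "1 - 1/2 :: real"] by linarith
      then have "(D * E) * (\<tau>' powr (1 - 1/2) - t powr (1 - 1/2)) / (1/2) \<le> (D * E) * 1 / (1/2)"
        using D E by (intro divide_right_mono mult_left_mono) auto
      then show ?thesis by simp
    qed
    finally show ?thesis by (simp add: algebra_simps)
  qed
  show ?thesis
    by (rule exI[of _ "2 ^ M / \<tau> ^ M + 2 * D"], intro conjI) (use fin D \<tau> in \<open>auto simp: hyp_def \<tau>_def\<close>)
qed

section \<open>The local pairing estimate\<close>

text \<open>The relation \<open>g = T f\<close> may be tested against functions supported in \<open>S\<close> that do not vanish at the boundary. Only bounds on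
  \<open>v\<close> and its transpose derivative are asked for, no regularity at the boundary.\<close>

definition integrates_by_parts :: "'a::euclidean_space set \<Rightarrow> ('a \<Rightarrow> 'a \<times> 'a) \<Rightarrow> 'a set \<Rightarrow> bool" where
  "integrates_by_parts \<Omega> T S \<longleftrightarrow> (\<forall>K v B f g. compact K \<longrightarrow> K \<subseteq> S \<longrightarrow> (\<forall>n. ksmooth False \<Omega> n v) \<longrightarrow>
     (\<forall>x\<in>\<Omega> - K. v x = 0) \<longrightarrow> (\<forall>x\<in>\<Omega>. norm (v x) \<le> B \<and> norm (vf_transpose T v x) \<le> B) \<longrightarrow> f \<in> L2 \<Omega> \<longrightarrow> g \<in> L2 \<Omega> \<longrightarrow>
     (\<forall>\<phi>\<in>test_functions \<Omega>. (LINT x|lebesgue_on \<Omega>. g x * \<phi> x) = (LINT x|lebesgue_on \<Omega>. f x * vf_transpose T \<phi> x)) \<longrightarrow>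
     (LINT x|lebesgue_on \<Omega>. g x * v x) = (LINT x|lebesgue_on \<Omega>. f x * vf_transpose T v x))"

lemma vf_direction_continuous:
  assumes "smooth_vector_field \<Omega> T"
  shows "continuous_on (closure \<Omega>) (\<lambda>x. c *s vf_direction T x)"
proof -
  have b: "continuous_on (closure \<Omega>) (vf_coeff T b)" if "b \<in> Basis" for b
    using assms that by (simp add: smooth_vector_field_def)
  have "fst (T x) = (\<Sum>b\<in>Basis. Re (vf_coeff T b x) *\<^sub>R b)" "snd (T x) = (\<Sum>b\<in>Basis. Im (vf_coeff T b x) *\<^sub>R b)" for x
    by (simp_all add: vf_coeff_def euclidean_representation)
  then have "(\<lambda>x. c *s vf_direction T x) =
      (\<lambda>x. c *s ((\<Sum>b\<in>Basis. Re (vf_coeff T b x) *\<^sub>R b) - \<i> *s (\<Sum>b\<in>Basis. Im (vf_coeff T b x) *\<^sub>R b)))"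
    by (simp only: vf_direction_def)
  moreover have "continuous_on (closure \<Omega>) \<dots>"
    by (intro bounded_linear.continuous_on[OF bounded_linear_scalar_mult_right] continuous_on_diff continuous_on_sum
          continuous_on_scaleR continuous_on_Re continuous_on_Im continuous_on_const b)
  ultimately show ?thesis by (simp only:)
qed

text \<open>To first order the formal flow of \<open>c T\<close> moves \<open>x\<close> by \<open>t n(x)\<close> with \<open>n = cnj c (X - \<i> Y)\<close>. Choosing \<open>c\<close> such that \<open>n\<close>
  points inward at \<open>p\<close>, the formal flow enters \<open>\<Omega>\<close> at a linear rate, whatever the order of the Taylor polynomial; \<open>r\<close> and
  \<open>c\<close> do not depend on that order.\<close>

lemma boundary_point_flow:
  fixes \<Omega> :: "(complex^'n) set"
  assumes \<Omega>: "open \<Omega>" "bounded \<Omega>" and T: "smooth_vector_field \<Omega> T" "tangential \<Omega> T" "complex_transversal \<Omega> T"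
    and \<rho>: "defining_function \<Omega> \<rho>" and p: "p \<in> frontier \<Omega>"
  shows "\<exists>r c. 0 < r \<and> c \<noteq> 0 \<and> integrates_by_parts \<Omega> T (ball p r) \<and>
    (\<forall>N. \<exists>\<delta> \<kappa>. 0 < \<delta> \<and> \<delta> \<le> 1 \<and> 0 < \<kappa> \<and> \<kappa> \<le> 1 \<and> (\<forall>x\<in>\<Omega> \<inter> ball p r. \<forall>t. 0 < t \<longrightarrow> t \<le> \<delta> \<longrightarrow>
       ball (taylor_sum (Suc N) t (\<lambda>i. flow_coeff T c i x)) (\<kappa> * t) \<subseteq> \<Omega>))"
proof -
  obtain U where U: "open U" "frontier \<Omega> \<subseteq> U" "smooth_on U \<rho>" "\<Omega> \<inter> U = {x \<in> U. \<rho> x < 0}"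
    using \<rho> unfolding defining_function_def by blast
  have pU: "p \<in> U" using U p by blast
  obtain c0 where c0: "c0 \<noteq> 0" "frechet_derivative \<rho> (at p) (c0 *s vf_direction T p) < 0"
    using inward_direction_exists[OF \<Omega>(1) p \<rho> T(2,3)] by blast
  define n where "n = c0 *s vf_direction T p"
  define c where "c = cnj c0"
  obtain r0 c1 \<sigma> where r0: "r0 > 0" "c1 > 0" "\<sigma> > 0" "cball p r0 \<subseteq> U"
    and dec: "\<And>x y s. x \<in> ball p r0 \<Longrightarrow> y \<in> ball p r0 \<Longrightarrow> s \<ge> 0 \<Longrightarrow> norm (y - x - s *\<^sub>R n) \<le> \<sigma> * s \<Longrightarrow> \<rho> y \<le> \<rho> x - c1 * s"
    using defining_function_decrease[OF U(1,3) pU c0(2)] unfolding n_def by metis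
  obtain r1 C1 where r1: "0 < r1" "r1 \<le> r0" "0 \<le> C1"
    and C1: "\<forall>x\<in>\<Omega> \<inter> ball p r1. norm (vf_apply T (\<lambda>x. of_real (\<rho> x)) x) \<le> C1 * \<bar>\<rho> x\<bar>"
    using tangential_vf_defining_function[OF \<Omega> T(1,2) \<rho> p U r0 dec] by blast
  have "p \<in> closure \<Omega>" using p by (simp add: frontier_def)
  then obtain r2 where r2: "r2 > 0" "\<And>x. x \<in> closure \<Omega> \<Longrightarrow> dist x p < r2 \<Longrightarrow> dist (c0 *s vf_direction T x) n < \<sigma> / 4"
    using vf_direction_continuous[OF T(1), of c0] r0(3) unfolding continuous_on_iff n_def
    by (metis divide_pos_pos zero_less_numeral)
  define r where "r = Min {r0 / 2, r1, r2}"
  have r: "0 < r" "r \<le> r0 / 2" "r \<le> r1" "r \<le> r2" using r0 r1 r2 by (auto simp: r_def)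
  have ibp: "integrates_by_parts \<Omega> T (ball p r)"
    unfolding integrates_by_parts_def
  proof (intro allI impI)
    fix K v B f g
    assume K: "compact K" "K \<subseteq> ball p r" and v: "\<forall>n. ksmooth False \<Omega> n v" "\<forall>x\<in>\<Omega> - K. v x = 0"
      "\<forall>x\<in>\<Omega>. norm (v x) \<le> B \<and> norm (vf_transpose T v x) \<le> B"
      and fg: "f \<in> L2 \<Omega>" "g \<in> L2 \<Omega>"
      and w: "\<forall>\<phi>\<in>test_functions \<Omega>. (LINT x|lebesgue_on \<Omega>. g x * \<phi> x) = (LINT x|lebesgue_on \<Omega>. f x * vf_transpose T \<phi> x)"
    have "ball p r \<subseteq> U" using r r0 by (auto simp: subset_iff)
    moreover have "norm (vf_apply T (\<lambda>x. of_real (\<rho> x)) x) \<le> C1 * \<bar>\<rho> x\<bar>" if "x \<in> \<Omega> \<inter> ball p r" for x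
      using C1 that r by auto
    ultimately show "(LINT x|lebesgue_on \<Omega>. g x * v x) = (LINT x|lebesgue_on \<Omega>. f x * vf_transpose T v x)"
      using tangential_integration_by_parts[OF \<Omega> T(1) U(1,3,4) _ r1(3) _ K, of v B f g] v fg w by blast
  qed
  have flow: "\<exists>\<delta> \<kappa>. 0 < \<delta> \<and> \<delta> \<le> 1 \<and> 0 < \<kappa> \<and> \<kappa> \<le> 1 \<and> (\<forall>x\<in>\<Omega> \<inter> ball p r. \<forall>t. 0 < t \<longrightarrow> t \<le> \<delta> \<longrightarrow>
       ball (taylor_sum (Suc N) t (\<lambda>i. flow_coeff T c i x)) (\<kappa> * t) \<subseteq> \<Omega>)" for N
  proof -
    have "\<exists>b. \<forall>x\<in>\<Omega>. norm (flow_coeff T c i x) \<le> b" for i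
      using ksmooth_bounded[OF flow_coeff_ksmooth[OF T(1) \<Omega>(2,1), of 0]] by (auto simp: bounded_iff)
    then obtain b where b: "\<And>i x. x \<in> \<Omega> \<Longrightarrow> norm (flow_coeff T c i x) \<le> b i" by metis
    define B where "B = (\<Sum>i\<le>Suc N. \<bar>b i\<bar>)"
    have B: "norm (flow_coeff T c i x) \<le> B" if "x \<in> \<Omega>" "i \<le> Suc N" for i x
    proof -
      have "\<bar>b i\<bar> \<le> B" unfolding B_def using that(2) by (intro member_le_sum) auto
      then show ?thesis using b[OF that(1), of i] by linarith
    qed
    have B0: "B \<ge> 0" unfolding B_def by (intro sum_nonneg) auto
    define C where "C = real N * B"
    have C: "C \<ge> 0" using B0 by (simp add: C_def)
    define \<kappa> where "\<kappa> = min 1 (\<sigma> / 2)"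
    define \<delta> where "\<delta> = Min {1, \<sigma> / (4 * (C + 1)), r0 / (2 * (norm n + \<sigma>))}"
    have ns: "norm n + \<sigma> > 0" using r0 by (simp add: add_nonneg_pos)
    have \<delta>: "0 < \<delta>" "\<delta> \<le> 1" "\<delta> \<le> \<sigma> / (4 * (C + 1))" "\<delta> \<le> r0 / (2 * (norm n + \<sigma>))"
      using r0 C ns by (auto simp: \<delta>_def)
    have "ball (taylor_sum (Suc N) t (\<lambda>i. flow_coeff T c i x)) (\<kappa> * t) \<subseteq> \<Omega>"
      if x: "x \<in> \<Omega> \<inter> ball p r" and t: "0 < t" "t \<le> \<delta>" for x t
    proof
      let ?V = "taylor_sum (Suc N) t (\<lambda>i. flow_coeff T c i x)"
      fix y assume "y \<in> ball ?V (\<kappa> * t)"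
      then have y: "norm (y - ?V) < \<kappa> * t" by (simp add: dist_norm norm_minus_commute)
      have y': "norm (y - ?V) \<le> \<sigma> / 2 * t"
      proof -
        have "\<kappa> * t \<le> \<sigma> / 2 * t" using t by (intro mult_right_mono) (auto simp: \<kappa>_def)
        then show ?thesis using y by linarith
      qed
      have v1: "norm (?V - x - t *\<^sub>R (c0 *s vf_direction T x)) \<le> \<sigma> / 4 * t"
      proof -
        have "norm (?V - flow_coeff T c 0 x - t *\<^sub>R flow_coeff T c 1 x) \<le> real N * B * t\<^sup>2"
          by (rule taylor_sum_second_order) (use t \<delta> B x in auto)
        then have "norm (?V - x - t *\<^sub>R (c0 *s vf_direction T x)) \<le> C * t\<^sup>2"
          unfolding flow_coeff_0 flow_coeff_1 by (simp add: c_def C_def)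
        also have "\<dots> = C * t * t" by (simp add: power2_eq_square)
        also have "\<dots> \<le> \<sigma> / 4 * t"
        proof (rule mult_right_mono)
          have "C * t \<le> (C + 1) * (\<sigma> / (4 * (C + 1)))" using C t \<delta> by (intro mult_mono) auto
          also have "\<dots> = \<sigma> / 4" using C by (simp add: field_simps)
          finally show "C * t \<le> \<sigma> / 4" .
        qed (use t in simp)
        finally show ?thesis .
      qed
      have "x \<in> closure \<Omega>" "dist x p < r2" using x closure_subset r by (auto simp: dist_commute)
      then have "norm (c0 *s vf_direction T x - n) \<le> \<sigma> / 4" using r2(2)[of x] by (simp add: dist_norm)
      then have v2: "norm (t *\<^sub>R (c0 *s vf_direction T x - n)) \<le> \<sigma> / 4 * t" using t by (simp add: mult.commute mult_left_mono)
      have "y - x - t *\<^sub>R n = (y - ?V) + ((?V - x - t *\<^sub>R (c0 *s vf_direction T x)) + t *\<^sub>R (c0 *s vf_direction T x - n))"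
        by (simp add: scaleR_diff_right)
      also have "norm \<dots> \<le> \<sigma> / 2 * t + (\<sigma> / 4 * t + \<sigma> / 4 * t)"
        by (intro norm_triangle_mono y' v1 v2)
      finally have yx: "norm (y - x - t *\<^sub>R n) \<le> \<sigma> * t" by simp
      have "norm (y - x) \<le> norm (y - x - t *\<^sub>R n) + norm (t *\<^sub>R n)" using norm_triangle_ineq[of "y - x - t *\<^sub>R n" "t *\<^sub>R n"] by simp
      also have "\<dots> \<le> \<delta> * (norm n + \<sigma>)"
      proof -
        have "norm (y - x - t *\<^sub>R n) + norm (t *\<^sub>R n) \<le> t * (norm n + \<sigma>)" using yx t by (simp add: algebra_simps)
        also have "\<dots> \<le> \<delta> * (norm n + \<sigma>)" using t ns by (intro mult_right_mono) auto
        finally show ?thesis .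
      qed
      also have "\<dots> \<le> r0 / (2 * (norm n + \<sigma>)) * (norm n + \<sigma>)" using \<delta> ns by (intro mult_right_mono) auto
      also have "\<dots> = r0 / 2"
      proof -
        have "r0 / (2 * m) * m = r0 / 2" if "m \<noteq> 0" for m using that by simp
        then show ?thesis using ns by (metis less_irrefl)
      qed
      finally have "norm (y - x) \<le> r0 / 2" .
      then have "dist p y < r0" using x r dist_triangle[of p y x] by (simp add: dist_norm norm_minus_commute)
      then have yb: "y \<in> ball p r0" by simp
      have xb: "x \<in> ball p r0" using x r r0 by auto
      have inU: "x \<in> U" "y \<in> U" using xb yb r0(4) ball_subset_cball by blast+
      have "\<rho> y \<le> \<rho> x - c1 * t" by (rule dec[OF xb yb _ yx]) (use t in simp)
      moreover have "\<rho> x < 0" using x inU U(4) by blast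
      moreover have "c1 * t > 0" using r0 t by simp
      ultimately have "\<rho> y < 0" by linarith
      then show "y \<in> \<Omega>" using inU U(4) by blast
    qed
    moreover have "0 < \<kappa>" "\<kappa> \<le> 1" using r0 by (auto simp: \<kappa>_def)
    ultimately show ?thesis using \<delta> by blast
  qed
  show ?thesis using r(1) c0(1) ibp flow by (intro exI[of _ r] exI[of _ c]) (auto simp: c_def)
qed

text \<open>The sequence \<open>f\<close> stands for \<open>f, T f, T\<^sup>2 f, \<dots>\<close>, related weakly. The function \<open>H\<close> is required to be smooth up to the
  boundary, but the bounds below involve only its growth rate.\<close>

definition admissible_pairing ::
    "(complex^'n) set \<Rightarrow> (complex^'n \<Rightarrow> (complex^'n) \<times> (complex^'n)) \<Rightarrow> nat \<Rightarrow>
      (complex^'n \<Rightarrow> complex) \<Rightarrow> real \<Rightarrow> (nat \<Rightarrow> complex^'n \<Rightarrow> complex) \<Rightarrow> bool" where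
  "admissible_pairing \<Omega> T M H A f \<longleftrightarrow>
     H \<in> smooth_closure \<Omega> \<and> holomorphic_several \<Omega> H \<and> A > 0 \<and>
     (\<forall>z s. ball z s \<subseteq> \<Omega> \<longrightarrow> 0 < s \<longrightarrow> s \<le> 1 \<longrightarrow> norm (H z) \<le> A / s ^ M) \<and> (\<forall>j. f j \<in> L2 \<Omega>) \<and>
     (\<forall>j. \<forall>\<phi>\<in>test_functions \<Omega>. (LINT x|lebesgue_on \<Omega>. f (Suc j) x * \<phi> x) =
        (LINT x|lebesgue_on \<Omega>. f j x * vf_transpose T \<phi> x))"

text \<open>The constant depends on \<open>\<zeta>\<close> and on the order \<open>M\<close> of growth, not on \<open>H\<close>, its size \<open>A\<close>, or \<open>f\<close>. The cutoff \<open>\<zeta>\<close>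
  serves to localise the estimate.\<close>

definition pairing_bounded ::
    "(complex^'n) set \<Rightarrow> (complex^'n \<Rightarrow> (complex^'n) \<times> (complex^'n)) \<Rightarrow> nat \<Rightarrow> (complex^'n \<Rightarrow> complex) \<Rightarrow> bool" where
  "pairing_bounded \<Omega> T M \<zeta> \<longleftrightarrow> (\<exists>C\<ge>0. \<forall>H A f. admissible_pairing \<Omega> T M H A f \<longrightarrow>
     norm (LINT x|lebesgue_on \<Omega>. f 0 x * (\<zeta> x * cnj (H x))) \<le> C * A * (\<Sum>j\<le>Suc M. L2_norm \<Omega> (f j)))"

text \<open>Put \<open>I\<^sub>j(t) = \<integral> (T\<^sup>j f) F(t,\<cdot>)\<close> with \<open>F\<close> the transported version of
  \<open>\<eta> \<cdot> cnj H\<close>. For \<open>t > 0\<close> the argument of \<open>H\<close> stays at distance at least \<open>\<kappa> t\<close> from the boundary, so \<open>I\<^sub>j = O(t\<^sup>-\<^sup>M)\<close>; the transport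
  equation and integration by parts give \<open>I\<^sub>j' = -c I\<^sub>j\<^sub>+\<^sub>1 + O(1)\<close>, which bounds \<open>I\<^sub>0\<close> up to \<open>t = 0\<close>. The Taylor sums
  have order \<open>M + 1\<close>, so that the factor \<open>t\<^sup>M\<^sup>+\<^sup>1\<close> in the error absorbs the growth \<open>t\<^sup>-\<^sup>M\<^sup>-\<^sup>1\<close> of the derivative of \<open>H\<close>.\<close>

lemma local_pairing_estimate:
  fixes \<Omega> :: "(complex^'n) set"
  assumes \<Omega>: "open \<Omega>" "bounded \<Omega>" and T: "smooth_vector_field \<Omega> T" and c: "c \<noteq> 0"
    and ibp: "integrates_by_parts \<Omega> T (ball p r)"
    and \<delta>: "0 < \<delta>" "\<delta> \<le> 1" and \<kappa>: "0 < \<kappa>" "\<kappa> \<le> 1"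
    and flow: "\<And>x t. x \<in> \<Omega> \<inter> ball p r \<Longrightarrow> 0 < t \<Longrightarrow> t \<le> \<delta> \<Longrightarrow>
       ball (taylor_sum (Suc M) t (\<lambda>i. flow_coeff T c i x)) (\<kappa> * t) \<subseteq> \<Omega>"
    and \<eta>: "\<And>n. ksmooth True \<Omega> n \<eta>" and K: "compact K" "K \<subseteq> ball p r" "\<And>x. x \<in> \<Omega> - K \<Longrightarrow> \<eta> x = 0"
  shows "pairing_bounded \<Omega> T M \<eta>"
proof -
  let ?M = "lebesgue_on \<Omega>"
  have lm: "\<Omega> \<in> lmeasurable" by (rule bounded_open_lmeasurable[OF \<Omega>])
  note T' = T \<Omega>(2,1)
  define wc where "wc i x = weight_coeff T c \<eta> i x" for i x
  define fc where "fc i x = flow_coeff T c i x" for i x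
  have kwc: "ksmooth True \<Omega> n (wc i)" for n i unfolding wc_def[abs_def] by (rule weight_coeff_ksmooth[OF T' \<eta>])
  have kfc: "ksmooth True \<Omega> n (fc i)" for n i unfolding fc_def[abs_def] by (rule flow_coeff_ksmooth[OF T'])
  have closedK: "closed K" by (rule compact_imp_closed[OF K(1)])
  have oK: "open (\<Omega> - K)" using \<Omega>(1) closedK by (rule open_Diff)
  have wc0: "wc i x = 0" if "x \<in> \<Omega> - K" for i x unfolding wc_def by (rule weight_coeff_support[OF oK K(3) that])
  have "\<exists>b. \<forall>x\<in>\<Omega>. norm (wc i x) \<le> b \<and> norm (fc i x) \<le> b" for i
  proof -
    obtain b1 b2 where "\<forall>x\<in>\<Omega>. norm (wc i x) \<le> b1" "\<forall>x\<in>\<Omega>. norm (fc i x) \<le> b2"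
      using ksmooth_bounded[OF kwc[of 0 i]] ksmooth_bounded[OF kfc[of 0 i]] by (auto simp: bounded_iff)
    then show ?thesis by (intro exI[of _ "max b1 b2"]) (auto simp: le_max_iff_disj)
  qed
  then obtain b where b: "\<And>i x. x \<in> \<Omega> \<Longrightarrow> norm (wc i x) \<le> b i" "\<And>i x. x \<in> \<Omega> \<Longrightarrow> norm (fc i x) \<le> b i" by metis
  define Q0 where "Q0 = 1 + (\<Sum>i\<le>Suc (Suc M). \<bar>b i\<bar>)"
  have Q0: "Q0 \<ge> 1" unfolding Q0_def by (simp add: sum_nonneg)
  have bQ: "b i \<le> Q0" if "i \<le> Suc (Suc M)" for i
  proof -
    have "\<bar>b i\<bar> \<le> (\<Sum>i\<le>Suc (Suc M). \<bar>b i\<bar>)" using that by (intro member_le_sum) auto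
    then show ?thesis by (simp add: Q0_def)
  qed
  define Q where "Q = real (Suc (Suc M)) * Q0"
  have QQ: "Q0 \<le> Q" "real (Suc M) * Q0 \<le> Q" using Q0 by (auto simp: Q_def algebra_simps)
  have Q: "Q \<ge> 1" using QQ Q0 by linarith
  define w where "w t x = taylor_sum (Suc M) t (\<lambda>i. wc i x)" for t x
  define V where "V t x = taylor_sum (Suc M) t (\<lambda>i. fc i x)" for t x
  define w1 where "w1 t x = taylor_sum M t (\<lambda>i. wc (Suc i) x)" for t x
  define V1 where "V1 t x = taylor_sum M t (\<lambda>i. fc (Suc i) x)" for t x
  have wb: "norm (w t x) \<le> Q" if "x \<in> \<Omega>" "0 \<le> t" "t \<le> 1" for t x
    unfolding w_def Q_def by (rule norm_taylor_sum_le) (use that b bQ order_trans in \<open>auto intro: order_trans[OF b(1)]\<close>)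
  have w1b: "norm (w1 t x) \<le> Q" if "x \<in> \<Omega>" "0 \<le> t" "t \<le> 1" for t x
  proof -
    have "norm (w1 t x) \<le> real (Suc M) * Q0"
      unfolding w1_def by (rule norm_taylor_sum_le) (use that b bQ in \<open>auto intro: order_trans[OF b(1)]\<close>)
    then show ?thesis using QQ by linarith
  qed
  have V1b: "norm (V1 t x) \<le> Q" if "x \<in> \<Omega>" "0 \<le> t" "t \<le> 1" for t x
  proof -
    have "norm (V1 t x) \<le> real (Suc M) * Q0"
      unfolding V1_def by (rule norm_taylor_sum_le) (use that b bQ in \<open>auto intro: order_trans[OF b(2)]\<close>)
    then show ?thesis using QQ by linarith
  qed
  have wcb: "norm (wc (Suc (Suc M)) x) \<le> Q" "norm (fc (Suc (Suc M)) x) \<le> Q" if "x \<in> \<Omega>" for x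
    using order_trans[OF b(1)[OF that] bQ[OF order_refl]] order_trans[OF b(2)[OF that] bQ[OF order_refl]] QQ by linarith+
  have w0: "w t x = 0" "w1 t x = 0" if "x \<in> \<Omega> - K" for t x
    using wc0[OF that] by (simp_all add: w_def w1_def taylor_sum_def)
  have dw: "((\<lambda>t. w t x) has_vector_derivative w1 t x) (at t)" for t x
    unfolding w_def w1_def by (rule taylor_sum_has_vector_derivative)
  have dV: "((\<lambda>t. V t x) has_vector_derivative V1 t x) (at t)" for t x
    unfolding V_def V1_def by (rule taylor_sum_has_vector_derivative)
  have Vin: "ball (V t x) (\<kappa> * t) \<subseteq> \<Omega>" if "x \<in> \<Omega> \<inter> ball p r" "0 < t" "t \<le> \<delta>" for x t
    unfolding V_def fc_def by (rule flow[OF that])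
  have V\<Omega>: "V t x \<in> \<Omega>" if "x \<in> \<Omega> \<inter> ball p r" "0 < t" "t \<le> \<delta>" for x t
    using Vin[OF that] \<kappa> that by (auto simp: subset_iff)
  define L where "L = Q / \<kappa> ^ Suc M + Q * Q * 2 ^ (M + 3) / \<kappa> ^ Suc M"
  have L: "L \<ge> 0" using Q \<kappa> by (simp add: L_def)
  obtain C0 where C0: "C0 \<ge> 0" and chain: "\<And>g g' E. E \<ge> 0 \<Longrightarrow>
    (\<forall>j\<le>Suc M. \<forall>t. 0 < t \<longrightarrow> t < \<delta> \<longrightarrow> norm (g j t) \<le> E / t ^ M) \<Longrightarrow>
    (\<forall>j\<le>M. \<forall>t. 0 < t \<longrightarrow> t < \<delta> \<longrightarrow> ((g j :: real \<Rightarrow> complex) has_vector_derivative g' j t) (at t) \<and> norm (g' j t + c * g (Suc j) t) \<le> E) \<Longrightarrow>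
    (\<forall>t. 0 < t \<longrightarrow> t < \<delta> / 2 \<longrightarrow> norm (g 0 t) \<le> C0 * E)"
    using chain_of_relations_bound[OF \<delta>, of M c] by blast
  define vol where "vol = sqrt (measure lebesgue \<Omega>)"
  have vol: "vol \<ge> 0" by (simp add: vol_def)
  have main: "norm (LINT x|?M. f 0 x * (\<eta> x * cnj (H x))) \<le> C0 * L * vol * A * (\<Sum>j\<le>Suc M. L2_norm \<Omega> (f j))"
    if Hs: "H \<in> smooth_closure \<Omega>" and H: "holomorphic_several \<Omega> H" and A: "A > 0"
      and growth: "\<forall>z s. ball z s \<subseteq> \<Omega> \<longrightarrow> 0 < s \<longrightarrow> s \<le> 1 \<longrightarrow> norm (H z) \<le> A / s ^ M"
      and f: "\<forall>j. f j \<in> L2 \<Omega>"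
      and weak: "\<forall>j. \<forall>\<phi>\<in>test_functions \<Omega>. (LINT x|?M. f (Suc j) x * \<phi> x) = (LINT x|?M. f j x * vf_transpose T \<phi> x)"
    for H A f
  proof -
    have fL: "f j \<in> L2 \<Omega>" for j using f by blast
    have kH: "ksmooth False \<Omega> n H" for n using Hs by (simp add: smooth_closure_def smooth_on_iff)
    define DH where "DH z = frechet_derivative H (at z)" for z
    have dH: "(H has_derivative DH z) (at z)" and DHc: "DH z (k *s v) = k * DH z v" if "z \<in> \<Omega>" for z k v
      using holomorphic_several_derivative[OF H that] by (auto simp: DH_def)
    define F where "F t x = w t x * cnj (H (V t x))" for t x
    define F' where "F' t x = w1 t x * cnj (H (V t x)) + w t x * cnj (DH (V t x) (V1 t x))" for t x
    define \<tau> where "\<tau> t = t ^ Suc M / fact (Suc M)" for t :: real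
    \<comment> \<open>\<open>F'\<close> is the time derivative of \<open>F\<close>, and \<open>R\<close> the error in the transport equation\<close>
    define R where "R t x = \<tau> t *\<^sub>R (wc (Suc (Suc M)) x * cnj (H (V t x)) + w t x * cnj (DH (V t x) (fc (Suc (Suc M)) x)))" for t x
    have out: "F t x = 0" "F' t x = 0" "R t x = 0" if "x \<in> \<Omega> - K" for t x
      using w0[OF that] wc0[OF that] by (simp_all add: F_def F'_def R_def)
    have Hb: "norm (H (V t x)) \<le> A / (\<kappa> * t) ^ M" and DHb: "norm (DH (V t x) u) \<le> A * 2 ^ (M + 3) * norm u / (\<kappa> * t) ^ Suc M"
      if x: "x \<in> \<Omega> \<inter> ball p r" and t: "0 < t" "t \<le> \<delta>" for t x u
    proof -
      have s: "0 < \<kappa> * t" "\<kappa> * t \<le> 1" using \<kappa> \<delta> t by (auto intro: mult_le_one)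
      show "norm (H (V t x)) \<le> A / (\<kappa> * t) ^ M" using growth Vin[OF x t] s by blast
      have "norm (DH (V t x) u) \<le> 4 * (A / (\<kappa> * t / 2) ^ M) * norm u / (\<kappa> * t / 2)"
        unfolding DH_def
      proof (rule holomorphic_derivative_bound[OF H])
        show "ball (V t x) (\<kappa> * t / 2) \<subseteq> \<Omega>" using Vin[OF x t] s by (auto simp: subset_iff)
        fix y assume y: "y \<in> ball (V t x) (\<kappa> * t / 2)"
        have "ball y (\<kappa> * t / 2) \<subseteq> ball (V t x) (\<kappa> * t)"
        proof
          fix z assume "z \<in> ball y (\<kappa> * t / 2)"
          then show "z \<in> ball (V t x) (\<kappa> * t)" using y dist_triangle[of "V t x" z y] by simp
        qed
        then have "ball y (\<kappa> * t / 2) \<subseteq> \<Omega>" using Vin[OF x t] by blast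
        then show "norm (H y) \<le> A / (\<kappa> * t / 2) ^ M" using growth s by simp
      qed (use s A in auto)
      also have "\<dots> = A * 2 ^ (M + 3) * norm u / (\<kappa> * t) ^ Suc M"
        by (simp add: power_divide power_add field_simps)
      finally show "norm (DH (V t x) u) \<le> A * 2 ^ (M + 3) * norm u / (\<kappa> * t) ^ Suc M" .
    qed
    have comb: "norm (a * cnj (H (V t x)) + w t x * cnj (DH (V t x) u)) \<le> L * A / t ^ Suc M"
      if x: "x \<in> \<Omega> \<inter> ball p r" and t: "0 < t" "t \<le> \<delta>" and a: "norm a \<le> Q" and u: "norm u \<le> Q" for t x a u
    proof -
      have s: "0 < \<kappa> * t" "\<kappa> * t \<le> 1" using \<kappa> \<delta> t by (auto intro: mult_le_one)
      have "norm (a * cnj (H (V t x))) \<le> Q * (A / (\<kappa> * t) ^ Suc M)"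
      proof -
        have "(\<kappa> * t) ^ Suc M \<le> (\<kappa> * t) ^ M" using s by (intro power_decreasing) auto
        then have "A / (\<kappa> * t) ^ M \<le> A / (\<kappa> * t) ^ Suc M" using A s by (intro divide_left_mono) auto
        then have "norm (H (V t x)) \<le> A / (\<kappa> * t) ^ Suc M" using Hb[OF x t] by linarith
        then show ?thesis unfolding norm_mult complex_mod_cnj using a Q by (intro mult_mono) auto
      qed
      moreover have "norm (w t x * cnj (DH (V t x) u)) \<le> Q * (A * 2 ^ (M + 3) * Q / (\<kappa> * t) ^ Suc M)"
      proof -
        have "A * 2 ^ (M + 3) * norm u / (\<kappa> * t) ^ Suc M \<le> A * 2 ^ (M + 3) * Q / (\<kappa> * t) ^ Suc M"
          using A u s by (intro divide_right_mono mult_left_mono) auto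
        then have "norm (DH (V t x) u) \<le> A * 2 ^ (M + 3) * Q / (\<kappa> * t) ^ Suc M" using DHb[OF x t, of u] by linarith
        then show ?thesis unfolding norm_mult complex_mod_cnj using wb[of x t] x t \<delta> Q by (intro mult_mono) auto
      qed
      ultimately have "norm (a * cnj (H (V t x)) + w t x * cnj (DH (V t x) u))
          \<le> Q * (A / (\<kappa> * t) ^ Suc M) + Q * (A * 2 ^ (M + 3) * Q / (\<kappa> * t) ^ Suc M)" by (rule norm_triangle_mono)
      also have "\<dots> = L * A / t ^ Suc M"
      proof -
        have "Q * (A / (k * u)) + Q * (A * q * Q / (k * u)) = (Q / k + Q * Q * q / k) * A / u" if "k \<noteq> 0" "u \<noteq> 0" for k u q :: real
          using that by (simp add: field_simps)
        from this[of "\<kappa> ^ Suc M" "t ^ Suc M" "2 ^ (M + 3)"] show ?thesis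
          unfolding L_def power_mult_distrib using \<kappa> t by (simp del: power_Suc)
      qed
      finally show ?thesis .
    qed
    have Fb: "norm (F t x) \<le> L * A / t ^ M" if x: "x \<in> \<Omega>" and t: "0 < t" "t \<le> \<delta>" for t x
    proof (cases "x \<in> K")
      case True
      then have xb: "x \<in> \<Omega> \<inter> ball p r" using x K(2) by auto
      have "norm (F t x) \<le> Q * (A / (\<kappa> * t) ^ M)"
        unfolding F_def norm_mult complex_mod_cnj using wb[of x t] x t \<delta> Q Hb[OF xb t] by (intro mult_mono) auto
      also have "\<dots> = (Q / \<kappa> ^ M) * (A / t ^ M)" by (simp add: power_mult_distrib)
      also have "\<dots> \<le> L * (A / t ^ M)"
      proof (rule mult_right_mono)
        have "\<kappa> ^ Suc M \<le> \<kappa> ^ M" using \<kappa> by (intro power_decreasing) auto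
        then have "Q / \<kappa> ^ M \<le> Q / \<kappa> ^ Suc M" using Q \<kappa> by (intro divide_left_mono) auto
        also have "\<dots> \<le> L" unfolding L_def using Q \<kappa> by simp
        finally show "Q / \<kappa> ^ M \<le> L" .
      qed (use A t in simp)
      finally show ?thesis by simp
    qed (use out[of x t] x L A t in simp)
    have F'b: "norm (F' t x) \<le> L * A / t ^ Suc M" if x: "x \<in> \<Omega>" and t: "0 < t" "t \<le> \<delta>" for t x
    proof (cases "x \<in> K")
      case True
      then have xb: "x \<in> \<Omega> \<inter> ball p r" using x K(2) by auto
      show ?thesis unfolding F'_def by (rule comb[OF xb t]) (use w1b V1b x t \<delta> in auto)
    qed (use out[of x t] x L A t in simp)
    have Rb: "norm (R t x) \<le> L * A" if x: "x \<in> \<Omega>" and t: "0 < t" "t \<le> \<delta>" for t x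
    proof (cases "x \<in> K")
      case True
      then have xb: "x \<in> \<Omega> \<inter> ball p r" using x K(2) by auto
      have "\<bar>\<tau> t\<bar> \<le> t ^ Suc M"
      proof -
        have "t ^ Suc M / fact (Suc M) \<le> t ^ Suc M / 1" using t by (intro divide_left_mono) (auto simp del: fact_Suc)
        then show ?thesis using t by (simp add: \<tau>_def del: fact_Suc power_Suc)
      qed
      then have "norm (R t x) \<le> t ^ Suc M * (L * A / t ^ Suc M)"
        unfolding R_def norm_scaleR using comb[OF xb t wcb[OF x]] t by (intro mult_mono) auto
      then show ?thesis using t by simp
    qed (use out[of x t] x L A t in simp)
    have kF: "ksmooth False \<Omega> n (F t)" if t: "0 < t" "t \<le> \<delta>" for n t
    proof (rule ksmooth_local[OF \<Omega>(1)])
      fix x assume x: "x \<in> \<Omega>"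
      show "\<exists>U. open U \<and> x \<in> U \<and> ksmooth False U n (F t)"
      proof (cases "x \<in> K")
        case True
        let ?W = "\<Omega> \<inter> ball p r"
        have Wo: "open ?W" using \<Omega> by auto
        have kw: "ksmooth False ?W n (w t)"
          unfolding w_def[abs_def] by (rule ksmooth_taylor_sum[OF Wo ksmooth_unbounded[OF ksmooth_subset[OF kwc Int_lower1]]])
        have kV: "ksmooth False ?W n (V t)"
          unfolding V_def[abs_def] by (rule ksmooth_taylor_sum[OF Wo ksmooth_unbounded[OF ksmooth_subset[OF kfc Int_lower1]]])
        have "ksmooth False ?W n (\<lambda>x. H (V t x))"
          by (rule ksmooth_compose[OF Wo \<Omega>(1) _ kV kH]) (use V\<Omega> t in auto)
        then have "ksmooth False ?W n (F t)"
          unfolding F_def[abs_def] by (intro ksmooth_mult Wo kw ksmooth_compose_linear[OF bounded_linear_cnj])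
        then show ?thesis using Wo True x K(2) by blast
      next
        case False
        have "ksmooth False (\<Omega> - K) n (F t) \<longleftrightarrow> ksmooth False (\<Omega> - K) n (\<lambda>x. 0::complex)"
          by (rule ksmooth_cong[OF oK]) (use out in auto)
        then show ?thesis using oK x False ksmooth_const by blast
      qed
    qed
    have Fcont: "continuous_on \<Omega> (F t)" if "0 < t" "t \<le> \<delta>" for t using ksmooth_continuous[OF kF[OF that]] .
    have PFcont: "continuous_on \<Omega> (vf_transpose T (F t))" if "0 < t" "t \<le> \<delta>" for t
      using ksmooth_continuous[OF vf_transpose_ksmooth[OF T' order_refl kF[OF that]]] .
    have FL: "F t \<in> L2 \<Omega>" "L2_norm \<Omega> (F t) \<le> L * A / t ^ M * vol" if "0 < t" "t \<le> \<delta>" for t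
      using bounded_measurable_L2[OF lm continuous_measurable_lebesgue_on[OF Fcont[OF that] \<Omega>(1)] Fb[OF _ that]] by (auto simp: vol_def)
    have transport: "- c * vf_transpose T (F t) x = F' t x + R t x" if x: "x \<in> \<Omega>" and t: "0 < t" "t \<le> \<delta>" for x t
    proof (cases "x \<in> K")
      case True
      then have xb: "x \<in> \<Omega> \<inter> ball p r" using x K(2) by auto
      have lin: "linear (DH (V t x))" by (rule has_derivative_linear[OF dH[OF V\<Omega>[OF xb t]]])
      have "- c * vf_transpose T (F t) x = taylor_sum (Suc M) t (\<lambda>i. wc (Suc i) x) * cnj (H (V t x))
          + w t x * cnj (DH (V t x) (taylor_sum (Suc M) t (\<lambda>i. fc (Suc i) x)))"
        unfolding F_def[abs_def] w_def V_def DH_def wc_def fc_def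
        by (rule transport_equation[OF T' x \<eta> H]) (use V\<Omega>[OF xb t] in \<open>simp add: V_def fc_def\<close>)
      also have "taylor_sum (Suc M) t (\<lambda>i. wc (Suc i) x) = w1 t x + \<tau> t *\<^sub>R wc (Suc (Suc M)) x"
        unfolding w1_def \<tau>_def by (rule taylor_sum_split)
      also have "taylor_sum (Suc M) t (\<lambda>i. fc (Suc i) x) = V1 t x + \<tau> t *\<^sub>R fc (Suc (Suc M)) x"
        unfolding V1_def \<tau>_def by (rule taylor_sum_split)
      finally show ?thesis
        unfolding F'_def R_def linear_add[OF lin] linear_cmul[OF lin] by (simp add: scaleR_conv_of_real algebra_simps)
    next
      case False
      have xK: "x \<in> \<Omega> - K" using x False by simp
      have "vf_transpose T (F t) x = vf_transpose T (\<lambda>_. 0) x"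
        by (rule vf_transpose_cong_open[OF oK xK]) (use out in auto)
      then show ?thesis using out[OF xK] by (simp add: vf_transpose_zero)
    qed
    \<comment> \<open>times within \<open>e\<close> of \<open>t\<close> are at least \<open>t/2\<close>, so the growth bound at \<open>t/2\<close> provides an integrable majorant\<close>
    have dF: "((\<lambda>t. F t x) has_vector_derivative F' t x) (at t)" if x: "x \<in> \<Omega>" and t: "0 < t" "t \<le> \<delta>" for x t
    proof (cases "x \<in> K")
      case True
      then have xb: "x \<in> \<Omega> \<inter> ball p r" using x K(2) by auto
      have z: "V t x \<in> \<Omega>" by (rule V\<Omega>[OF xb t])
      have "((\<lambda>t. H (V t x)) has_derivative (\<lambda>d. DH (V t x) (d *\<^sub>R V1 t x))) (at t)"
        using has_derivative_compose[OF dV[unfolded has_vector_derivative_def] dH[OF z]] .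
      then have "((\<lambda>t. H (V t x)) has_vector_derivative DH (V t x) (V1 t x)) (at t)"
        unfolding has_vector_derivative_def linear_cmul[OF has_derivative_linear[OF dH[OF z]]] .
      then have "((\<lambda>t. cnj (H (V t x))) has_vector_derivative cnj (DH (V t x) (V1 t x))) (at t)"
        by (rule bounded_linear.has_vector_derivative[OF bounded_linear_cnj])
      from has_vector_derivative_mult[OF dw this] show ?thesis
        unfolding F_def F'_def by (simp add: add.commute)
    next
      case False
      then show ?thesis using out[of x] x by simp
    qed
    have dI: "((\<lambda>t. LINT x|?M. h x * F t x) has_vector_derivative (LINT x|?M. h x * F' t x)) (at t)
        \<and> integrable ?M (\<lambda>x. h x * F' t x)" if h: "h \<in> L2 \<Omega>" and t: "0 < t" "t < \<delta>" for h t
    proof -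
      define e where "e = min (t / 2) (\<delta> - t)"
      have e: "e > 0" using t by (simp add: e_def)
      have s: "t / 2 \<le> s" "0 < s" "s \<le> \<delta>" if "\<bar>s - t\<bar> < e" for s
      proof -
        have "e \<le> t / 2" "e \<le> \<delta> - t" unfolding e_def by (rule min.cobounded1, rule min.cobounded2)
        then show "t / 2 \<le> s" "0 < s" "s \<le> \<delta>" using that[unfolded abs_less_iff] t by linarith+
      qed
      note d = integral_has_vector_derivative[where F="\<lambda>t x. h x * F t x" and F'="\<lambda>t x. h x * F' t x" and M="?M" and s=t
        and G="\<lambda>x. (L * A / (t / 2) ^ Suc M) * norm (h x)", OF e]
      have d1: "integrable ?M (\<lambda>x. h x * F s x)" if "\<bar>s - t\<bar> < e" for s
        by (rule L2_integrable_mult[OF h FL(1)]) (use s[OF that] in auto)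
      have d2: "((\<lambda>s. h x * F s x) has_vector_derivative h x * F' s x) (at s)" if "\<bar>s - t\<bar> < e" "x \<in> space ?M" for s x
        by (rule has_vector_derivative_mult_right[OF dF]) (use s[OF that(1)] that(2) in auto)
      have d3: "norm (h x * F' s x) \<le> (L * A / (t / 2) ^ Suc M) * norm (h x)" if st: "\<bar>s - t\<bar> < e" "x \<in> space ?M" for s x
      proof -
        have "(t / 2) ^ Suc M \<le> s ^ Suc M" using s[OF st(1)] t by (intro power_mono) auto
        then have "L * A / s ^ Suc M \<le> L * A / (t / 2) ^ Suc M"
          using L A s[OF st(1)] t by (intro divide_left_mono mult_nonneg_nonneg mult_pos_pos zero_less_power) auto
        then have "norm (F' s x) \<le> L * A / (t / 2) ^ Suc M"
          using F'b[of x s] s[OF st(1)] st(2) by auto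
        then show ?thesis unfolding norm_mult by (subst mult.commute) (rule mult_right_mono, auto)
      qed
      have d4: "integrable ?M (\<lambda>x. (L * A / (t / 2) ^ Suc M) * norm (h x))" using L2_integrable[OF lm h] by auto
      show ?thesis using d[OF d1 d2 d3 d4] by blast
    qed
    define E where "E = L * A * vol * (\<Sum>j\<le>Suc M. L2_norm \<Omega> (f j))"
    have E0: "E \<ge> 0" unfolding E_def using L A vol by (intro mult_nonneg_nonneg sum_nonneg L2_norm_nonneg) auto
    have fE: "L * A * vol * L2_norm \<Omega> (f j) \<le> E" if "j \<le> Suc M" for j
      unfolding E_def using that L A vol by (intro mult_left_mono member_le_sum L2_norm_nonneg mult_nonneg_nonneg) auto
    define I where "I j t = (LINT x|?M. f j x * F t x)" for j t
    define I' where "I' j t = (LINT x|?M. f j x * F' t x)" for j t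
    have b1: "norm (I j t) \<le> E / t ^ M" if "j \<le> Suc M" "0 < t" "t < \<delta>" for j t
    proof -
      have "norm (I j t) \<le> L2_norm \<Omega> (f j) * L2_norm \<Omega> (F t)"
        unfolding I_def by (rule L2_Cauchy_Schwarz_mult[OF fL FL(1)]) (use that in auto)
      also have "\<dots> \<le> L2_norm \<Omega> (f j) * (L * A / t ^ M * vol)"
        using FL(2)[of t] that by (intro mult_left_mono L2_norm_nonneg) auto
      also have "\<dots> = (L * A * vol * L2_norm \<Omega> (f j)) / t ^ M" by simp
      also have "\<dots> \<le> E / t ^ M" using fE[OF that(1)] that by (intro divide_right_mono) auto
      finally show ?thesis .
    qed
    have b2: "norm (I' j t + c * I (Suc j) t) \<le> E" if j: "j \<le> M" and t: "0 < t" "t < \<delta>" for j t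
    proof -
      have t': "0 < t" "t \<le> \<delta>" using t by auto
      have mF': "F' t \<in> borel_measurable ?M"
        using dI[OF L2_const[OF lm, of 1] t] borel_measurable_integrable by fastforce
      have mPF: "vf_transpose T (F t) \<in> borel_measurable ?M"
        by (rule continuous_measurable_lebesgue_on[OF PFcont[OF t'] \<Omega>(1)])
      have "(\<lambda>x. - c * vf_transpose T (F t) x - F' t x) \<in> borel_measurable ?M"
        using mF' mPF by (intro borel_measurable_diff borel_measurable_times) auto
      then have mR: "R t \<in> borel_measurable ?M"
        by (subst measurable_cong[of _ _ "\<lambda>x. - c * vf_transpose T (F t) x - F' t x"]) (use transport[OF _ t'] in auto)
      note RL = bounded_measurable_L2[OF lm mR Rb[OF _ t']]
      have PFb: "norm (vf_transpose T (F t) x) \<le> (L * A / t ^ Suc M + L * A) / norm c" if x: "x \<in> \<Omega>" for x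
      proof -
        have "norm c * norm (vf_transpose T (F t) x) = norm (F' t x + R t x)"
          unfolding transport[OF x t', symmetric] by (simp add: norm_mult)
        also have "\<dots> \<le> L * A / t ^ Suc M + L * A" by (rule norm_triangle_mono[OF F'b[OF x t'] Rb[OF x t']])
        finally show ?thesis using c by (simp add: pos_le_divide_eq mult.commute)
      qed
      define B where "B = max (L * A / t ^ M) ((L * A / t ^ Suc M + L * A) / norm c)"
      have "\<forall>x\<in>\<Omega>. norm (F t x) \<le> B \<and> norm (vf_transpose T (F t) x) \<le> B"
        using Fb[OF _ t'] PFb by (auto simp: B_def le_max_iff_disj)
      then have "(LINT x|?M. f (Suc j) x * F t x) = (LINT x|?M. f j x * vf_transpose T (F t) x)"
        using ibp[unfolded integrates_by_parts_def, rule_format, of K "F t" B "f j" "f (Suc j)"] K(1,2) kF[OF t'] out(1) fL weak by blast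
      then have "c * I (Suc j) t = - (LINT x|?M. f j x * (- c * vf_transpose T (F t) x))"
        unfolding I_def by (simp flip: integral_mult_right_zero Bochner_Integration.integral_minus add: mult.left_commute)
      also have "(LINT x|?M. f j x * (- c * vf_transpose T (F t) x)) = (LINT x|?M. f j x * (F' t x + R t x))"
        by (rule Bochner_Integration.integral_cong) (use transport[OF _ t'] in auto)
      also have "\<dots> = I' j t + (LINT x|?M. f j x * R t x)"
      proof -
        show ?thesis unfolding I'_def distrib_left
          using dI[OF fL t] L2_integrable_mult[OF fL RL(1)] by (intro Bochner_Integration.integral_add) auto
      qed
      finally have "I' j t + c * I (Suc j) t = - (LINT x|?M. f j x * R t x)" by simp
      moreover have "norm (LINT x|?M. f j x * R t x) \<le> L2_norm \<Omega> (f j) * (L * A * vol)"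
      proof -
        have "norm (LINT x|?M. f j x * R t x) \<le> L2_norm \<Omega> (f j) * L2_norm \<Omega> (R t)"
          by (rule L2_Cauchy_Schwarz_mult[OF fL RL(1)])
        also have "\<dots> \<le> L2_norm \<Omega> (f j) * (L * A * vol)"
          using RL(2) by (intro mult_left_mono L2_norm_nonneg) (auto simp: vol_def)
        finally show ?thesis .
      qed
      ultimately show ?thesis using fE[of j] j by (simp add: mult_ac)
    qed
    have bound: "norm (I 0 t) \<le> C0 * E" if "0 < t" "t < \<delta> / 2" for t
    proof -
      have "\<forall>t. 0 < t \<longrightarrow> t < \<delta> / 2 \<longrightarrow> norm (I 0 t) \<le> C0 * E"
        by (rule chain[OF E0, of I I']) (use b1 b2 dI[OF fL] in \<open>auto simp: I_def[abs_def] I'_def\<close>)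
      then show ?thesis using that by blast
    qed
    \<comment> \<open>In the limit \<open>t \<rightarrow> 0\<close>, the bound \<open>S\<close> of \<open>H\<close> provides the majorant; it does not enter the constant.\<close>
    obtain S where S: "\<And>x. x \<in> \<Omega> \<Longrightarrow> norm (H x) \<le> S" using smooth_closure_bounded[OF Hs \<Omega>(2)] unfolding bounded_iff by blast
    \<comment> \<open>any sequence in \<open>(0, \<delta>/2)\<close> tending to 0 will do\<close>
    define tn where "tn k = \<delta> / real (k + 3)" for k :: nat
    have tn: "0 < tn k" "tn k < \<delta> / 2" "tn k \<le> \<delta>" for k
    proof -
      show "0 < tn k" using \<delta> by (simp add: tn_def)
      show 2: "tn k < \<delta> / 2" unfolding tn_def using \<delta> by (intro divide_strict_left_mono) auto
      then show "tn k \<le> \<delta>" using \<delta> by linarith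
    qed
    have "(\<lambda>k. \<delta> * (1 / real (k + 3))) \<longlonglongrightarrow> \<delta> * 0"
      by (intro tendsto_mult tendsto_const) (use LIMSEQ_ignore_initial_segment[OF lim_1_over_n, of 3] in simp)
    then have tl: "tn \<longlonglongrightarrow> 0" by (simp add: tn_def[abs_def])
    have "(\<lambda>k. I 0 (tn k)) \<longlonglongrightarrow> (LINT x|?M. f 0 x * (\<eta> x * cnj (H x)))"
      unfolding I_def
    proof (rule integral_dominated_convergence[where w="\<lambda>x. (Q * \<bar>S\<bar>) * norm (f 0 x)"])
      have "continuous_on \<Omega> (\<lambda>x. \<eta> x * cnj (H x))"
        by (intro continuous_on_mult continuous_on_cnj ksmooth_continuous[OF \<eta>] ksmooth_continuous[OF kH])
      then show "(\<lambda>x. f 0 x * (\<eta> x * cnj (H x))) \<in> borel_measurable ?M"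
        by (intro borel_measurable_times L2_measurable[OF fL] continuous_measurable_lebesgue_on[OF _ \<Omega>(1)])
      show "(\<lambda>x. f 0 x * F (tn k) x) \<in> borel_measurable ?M" for k
        by (intro borel_measurable_times L2_measurable fL FL(1) tn)
      show "integrable ?M (\<lambda>x. (Q * \<bar>S\<bar>) * norm (f 0 x))" using L2_integrable[OF lm fL] by auto
      show "AE x in ?M. (\<lambda>k. f 0 x * F (tn k) x) \<longlonglongrightarrow> f 0 x * (\<eta> x * cnj (H x))"
      proof (rule AE_I2)
        fix x assume "x \<in> space ?M"
        then have x: "x \<in> \<Omega>" by simp
        have "((\<lambda>t. w t x) \<longlongrightarrow> w 0 x) (at 0)" "((\<lambda>t. V t x) \<longlongrightarrow> V 0 x) (at 0)"
          using has_vector_derivative_continuous[OF dw[of x 0]] has_vector_derivative_continuous[OF dV[of x 0]]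
          by (auto simp: continuous_at)
        moreover have "filterlim tn (at 0) sequentially" using tl tn(1) by (auto simp: filterlim_at less_imp_neq[symmetric])
        ultimately have lw: "(\<lambda>k. w (tn k) x) \<longlonglongrightarrow> w 0 x" and lV: "(\<lambda>k. V (tn k) x) \<longlonglongrightarrow> V 0 x"
          by (auto intro: filterlim_compose)
        have w00: "w 0 x = \<eta> x" by (simp add: w_def taylor_sum_0 wc_def weight_coeff_def)
        have V00: "V 0 x = x" by (simp add: V_def taylor_sum_0 fc_def flow_coeff_0)
        have "isCont H x" using has_derivative_continuous[OF dH[OF x]] .
        then have "(\<lambda>k. H (V (tn k) x)) \<longlonglongrightarrow> H x" using isCont_tendsto_compose lV unfolding V00 by blast
        then show "(\<lambda>k. f 0 x * F (tn k) x) \<longlonglongrightarrow> f 0 x * (\<eta> x * cnj (H x))"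
          unfolding F_def using lw unfolding w00 by (intro tendsto_intros)
      qed
      show "AE x in ?M. norm (f 0 x * F (tn k) x) \<le> (Q * \<bar>S\<bar>) * norm (f 0 x)" for k
      proof (rule AE_I2)
        fix x assume "x \<in> space ?M"
        then have x: "x \<in> \<Omega>" by simp
        have "norm (F (tn k) x) \<le> Q * \<bar>S\<bar>"
        proof (cases "x \<in> K")
          case True
          then have xb: "x \<in> \<Omega> \<inter> ball p r" using x K(2) by auto
          have "norm (H (V (tn k) x)) \<le> \<bar>S\<bar>" using S[OF V\<Omega>[OF xb tn(1,3)]] by (meson abs_ge_self order_trans)
          moreover have "norm (w (tn k) x) \<le> Q" by (rule wb[OF x]) (use tn[of k] \<delta> in auto)
          ultimately show ?thesis unfolding F_def norm_mult complex_mod_cnj using Q by (intro mult_mono) auto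
        next
          case False
          then show ?thesis using out[of x] x Q by simp
        qed
        then show "norm (f 0 x * F (tn k) x) \<le> (Q * \<bar>S\<bar>) * norm (f 0 x)"
          unfolding norm_mult by (subst mult.commute) (rule mult_right_mono, auto)
      qed
    qed
    then have "norm (LINT x|?M. f 0 x * (\<eta> x * cnj (H x))) \<le> C0 * E"
      by (rule LIMSEQ_le_const2[OF tendsto_norm]) (use bound[OF tn(1,2)] in auto)
    then show ?thesis by (simp add: E_def mult_ac)
  qed
  show ?thesis unfolding pairing_bounded_def admissible_pairing_def
    by (rule exI[of _ "C0 * L * vol"]) (use main C0 L vol in auto)
qed

section \<open>From local to global pairings\<close>

lemma ksmooth_True_pairing_L2:
  assumes \<Omega>: "open \<Omega>" "bounded \<Omega>" and \<zeta>: "\<And>n. ksmooth True \<Omega> n (\<zeta> :: _ \<Rightarrow> complex)" and H: "H \<in> smooth_closure \<Omega>"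
  shows "(\<lambda>x. \<zeta> x * cnj (H x)) \<in> L2 \<Omega>"
proof -
  have "bounded (\<zeta> ` \<Omega>)" by (rule ksmooth_bounded[OF \<zeta>])
  then obtain Z where Z: "\<And>x. x \<in> \<Omega> \<Longrightarrow> norm (\<zeta> x) \<le> Z" unfolding bounded_iff by auto
  have "bounded (H ` \<Omega>)" by (rule smooth_closure_bounded[OF H \<Omega>(2)])
  then obtain S where S: "\<And>x. x \<in> \<Omega> \<Longrightarrow> norm (H x) \<le> S" unfolding bounded_iff by auto
  have "continuous_on \<Omega> \<zeta>" by (rule ksmooth_continuous[OF \<zeta>])
  moreover have "continuous_on \<Omega> H" using H by (auto simp: smooth_closure_def intro: smooth_on_continuous)
  ultimately have c: "continuous_on \<Omega> (\<lambda>x. \<zeta> x * cnj (H x))" by (intro continuous_intros)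
  show ?thesis
  proof (rule bounded_measurable_L2(1)[OF bounded_open_lmeasurable[OF \<Omega>] continuous_measurable_lebesgue_on[OF c \<Omega>(1)]])
    fix x assume x: "x \<in> \<Omega>"
    show "norm (\<zeta> x * cnj (H x)) \<le> Z * S" unfolding norm_mult complex_mod_cnj
      by (rule mult_mono[OF Z[OF x] S[OF x] order_trans[OF norm_ge_zero Z[OF x]] norm_ge_zero])
  qed
qed

lemma pairing_bounded_add:
  fixes \<Omega> :: "(complex^'n) set"
  assumes \<Omega>: "open \<Omega>" "bounded \<Omega>" and \<zeta>: "\<And>n. ksmooth True \<Omega> n \<zeta>1" "\<And>n. ksmooth True \<Omega> n \<zeta>2"
    and b: "pairing_bounded \<Omega> T M \<zeta>1" "pairing_bounded \<Omega> T M \<zeta>2"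
  shows "pairing_bounded \<Omega> T M (\<lambda>x. \<zeta>1 x + \<zeta>2 x)"
proof -
  obtain C1 where C1: "C1 \<ge> 0" "\<And>H A f. admissible_pairing \<Omega> T M H A f \<Longrightarrow>
     norm (LINT x|lebesgue_on \<Omega>. f 0 x * (\<zeta>1 x * cnj (H x))) \<le> C1 * A * (\<Sum>j\<le>Suc M. L2_norm \<Omega> (f j))"
    using b(1) unfolding pairing_bounded_def by blast
  obtain C2 where C2: "C2 \<ge> 0" "\<And>H A f. admissible_pairing \<Omega> T M H A f \<Longrightarrow>
     norm (LINT x|lebesgue_on \<Omega>. f 0 x * (\<zeta>2 x * cnj (H x))) \<le> C2 * A * (\<Sum>j\<le>Suc M. L2_norm \<Omega> (f j))"
    using b(2) unfolding pairing_bounded_def by blast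
  show ?thesis
    unfolding pairing_bounded_def
  proof (intro exI[of _ "C1 + C2"] conjI allI impI)
    show "0 \<le> C1 + C2" using C1(1) C2(1) by simp
    fix H A f assume adm: "admissible_pairing \<Omega> T M H A f"
    then have H: "H \<in> smooth_closure \<Omega>" and f0: "f 0 \<in> L2 \<Omega>" by (auto simp: admissible_pairing_def)
    have i: "integrable (lebesgue_on \<Omega>) (\<lambda>x. f 0 x * (\<zeta>1 x * cnj (H x)))" "integrable (lebesgue_on \<Omega>) (\<lambda>x. f 0 x * (\<zeta>2 x * cnj (H x)))"
      by (rule L2_integrable_mult[OF f0 ksmooth_True_pairing_L2[OF \<Omega> _ H]], rule \<zeta>)+
    have e: "(LINT x|lebesgue_on \<Omega>. f 0 x * ((\<zeta>1 x + \<zeta>2 x) * cnj (H x))) =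
      (LINT x|lebesgue_on \<Omega>. f 0 x * (\<zeta>1 x * cnj (H x))) + (LINT x|lebesgue_on \<Omega>. f 0 x * (\<zeta>2 x * cnj (H x)))"
      by (subst Bochner_Integration.integral_add[OF i, symmetric]) (simp add: algebra_simps)
    have "norm (LINT x|lebesgue_on \<Omega>. f 0 x * (\<zeta>1 x * cnj (H x))) \<le> C1 * A * (\<Sum>j\<le>Suc M. L2_norm \<Omega> (f j))"
      by (rule C1(2)[OF adm])
    moreover have "norm (LINT x|lebesgue_on \<Omega>. f 0 x * (\<zeta>2 x * cnj (H x))) \<le> C2 * A * (\<Sum>j\<le>Suc M. L2_norm \<Omega> (f j))"
      by (rule C2(2)[OF adm])
    ultimately show "norm (LINT x|lebesgue_on \<Omega>. f 0 x * ((\<zeta>1 x + \<zeta>2 x) * cnj (H x))) \<le> (C1 + C2) * A * (\<Sum>j\<le>Suc M. L2_norm \<Omega> (f j))"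
      unfolding e distrib_right[of C1 C2] distrib_right[of "C1 * A"] by (meson add_mono norm_triangle_ineq order_trans)
  qed
qed

text \<open>On a compact part of \<open>\<Omega>\<close> the function \<open>H\<close> is bounded by a multiple of \<open>A\<close>, and the Cauchy-Schwarz inequality suffices.\<close>

lemma pairing_bounded_interior:
  fixes \<Omega> :: "(complex^'n) set"
  assumes \<Omega>: "open \<Omega>" "bounded \<Omega>" and \<zeta>: "\<And>n. ksmooth True \<Omega> n \<zeta>"
    and K: "compact K" "K \<subseteq> \<Omega>" "\<And>x. x \<in> \<Omega> - K \<Longrightarrow> \<zeta> x = 0"
  shows "pairing_bounded \<Omega> T M \<zeta>"
proof -
  obtain d where d: "d > 0" "\<And>x. x \<in> K \<Longrightarrow> ball x d \<subseteq> \<Omega>"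
    using Heine_Borel_lemma[OF K(1), of "{\<Omega>}"] K(2) \<Omega>(1) by (metis Union_insert Union_empty sup_bot_right singletonD singletonI)
  define s where "s = min d 1"
  have s: "0 < s" "s \<le> 1" "s \<le> d" using d by (auto simp: s_def)
  have "bounded (\<zeta> ` \<Omega>)" by (rule ksmooth_bounded[OF \<zeta>])
  then obtain Z where Z: "Z > 0" "\<And>x. x \<in> \<Omega> \<Longrightarrow> norm (\<zeta> x) \<le> Z" unfolding bounded_pos by auto
  define V where "V = sqrt (measure lebesgue \<Omega>)"
  have V: "V \<ge> 0" by (simp add: V_def)
  show ?thesis
    unfolding pairing_bounded_def
  proof (intro exI[of _ "Z / s ^ M * V"] conjI allI impI)
    show "0 \<le> Z / s ^ M * V" using Z s V by simp
    fix H A f assume "admissible_pairing \<Omega> T M H A f"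
    then have H: "H \<in> smooth_closure \<Omega>" "holomorphic_several \<Omega> H" "A > 0"
      "\<forall>z s. ball z s \<subseteq> \<Omega> \<longrightarrow> 0 < s \<longrightarrow> s \<le> 1 \<longrightarrow> norm (H z) \<le> A / s ^ M" and f: "\<forall>j. f j \<in> L2 \<Omega>"
      by (auto simp: admissible_pairing_def)
    have m: "(\<lambda>x. \<zeta> x * cnj (H x)) \<in> L2 \<Omega>" by (rule ksmooth_True_pairing_L2[OF \<Omega> \<zeta> H(1)])
    have f0: "f 0 \<in> L2 \<Omega>" using f by blast
    have "L2_norm \<Omega> (\<lambda>x. \<zeta> x * cnj (H x)) \<le> (Z * (A / s ^ M)) * V"
      unfolding V_def
    proof (rule bounded_measurable_L2(2)[OF bounded_open_lmeasurable[OF \<Omega>] L2_measurable[OF m]])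
      fix x assume x: "x \<in> \<Omega>"
      show "norm (\<zeta> x * cnj (H x)) \<le> Z * (A / s ^ M)"
      proof (cases "x \<in> K")
        case True
        then have "ball x s \<subseteq> \<Omega>" using d(2) s(3) by (meson order_trans subset_ball)
        then have "norm (H x) \<le> A / s ^ M" using H(4) s by blast
        then show ?thesis unfolding norm_mult complex_mod_cnj using Z x by (intro mult_mono) auto
      qed (use K(3) x Z H(3) s in simp)
    qed
    then have "L2_norm \<Omega> (f 0) * L2_norm \<Omega> (\<lambda>x. \<zeta> x * cnj (H x)) \<le> L2_norm \<Omega> (f 0) * ((Z * (A / s ^ M)) * V)"
      by (rule mult_left_mono[OF _ L2_norm_nonneg])
    then have 1: "norm (LINT x|lebesgue_on \<Omega>. f 0 x * (\<zeta> x * cnj (H x))) \<le> (Z / s ^ M * V * A) * L2_norm \<Omega> (f 0)"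
      using L2_Cauchy_Schwarz_mult[OF f0 m] by (simp add: mult_ac)
    have "L2_norm \<Omega> (f 0) \<le> (\<Sum>j\<le>Suc M. L2_norm \<Omega> (f j))"
      by (rule member_le_sum[of 0 "{..Suc M}" "\<lambda>j. L2_norm \<Omega> (f j)"]) (auto simp: L2_norm_nonneg)
    then have "(Z / s ^ M * V * A) * L2_norm \<Omega> (f 0) \<le> (Z / s ^ M * V * A) * (\<Sum>j\<le>Suc M. L2_norm \<Omega> (f j))"
      by (rule mult_left_mono) (use Z V H(3) s in simp)
    with 1 show "norm (LINT x|lebesgue_on \<Omega>. f 0 x * (\<zeta> x * cnj (H x))) \<le> Z / s ^ M * V * A * (\<Sum>j\<le>Suc M. L2_norm \<Omega> (f j))"
      by linarith
  qed
qed

lemma ksmooth_bump: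
  assumes "open S" "bounded S"
  shows "ksmooth True S n (bump p r)"
proof (rule ksmooth_bounded_of_compact)
  show "ksmooth False UNIV (Suc n) (bump p r)" using smooth_on_bump[of p r] unfolding smooth_on_iff by blast
  show "compact (closure S)" "closure S \<subseteq> UNIV" "S \<subseteq> closure S" using assms(2) closure_subset by auto
qed

text \<open>Split off one bump after the other: \<open>\<zeta> = \<zeta> \<psi> + \<zeta> (1 - \<psi>)\<close>.\<close>

lemma pairing_bounded_partition:
  fixes \<Omega> :: "(complex^'n) set"
  assumes \<Omega>: "open \<Omega>" "bounded \<Omega>" and P: "finite P"
    and b: "\<And>p \<zeta>. p \<in> P \<Longrightarrow> (\<And>n. ksmooth True \<Omega> n \<zeta>) \<Longrightarrow> pairing_bounded \<Omega> T M (\<lambda>x. \<zeta> x * bump p (r p) x)"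
    and \<zeta>: "\<And>n. ksmooth True \<Omega> n \<zeta>" and rest: "pairing_bounded \<Omega> T M (\<lambda>x. \<zeta> x * (\<Prod>p\<in>P. 1 - bump p (r p) x))"
  shows "pairing_bounded \<Omega> T M \<zeta>"
  using P b \<zeta> rest
proof (induction P arbitrary: \<zeta> rule: finite_induct)
  case empty
  then show ?case by simp
next
  case (insert p P)
  have s: "ksmooth True \<Omega> n (\<lambda>x. \<zeta> x * (1 - bump p (r p) x))" for n
    by (rule ksmooth_mult[OF \<Omega>(1) insert.prems(2) ksmooth_diff[OF \<Omega>(1) ksmooth_const ksmooth_bump[OF \<Omega>]]])
  have s2: "ksmooth True \<Omega> n (\<lambda>x. \<zeta> x * bump p (r p) x)" for n
    by (rule ksmooth_mult[OF \<Omega>(1) insert.prems(2) ksmooth_bump[OF \<Omega>]])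
  have "pairing_bounded \<Omega> T M (\<lambda>x. \<zeta> x * (1 - bump p (r p) x))"
  proof (rule insert.IH)
    show "pairing_bounded \<Omega> T M (\<lambda>x. \<zeta> x * (1 - bump p (r p) x) * (\<Prod>p\<in>P. 1 - bump p (r p) x))"
      using insert.prems(3) insert.hyps by (simp add: mult.assoc)
  qed (use insert.prems(1) s in auto)
  then have "pairing_bounded \<Omega> T M (\<lambda>x. \<zeta> x * (1 - bump p (r p) x) + \<zeta> x * bump p (r p) x)"
    by (rule pairing_bounded_add[OF \<Omega> s s2]) (use insert.prems(1,2) in auto)
  then show ?case by (simp add: algebra_simps)
qed

text \<open>Cover the boundary by finitely many balls in which the local estimate holds; what remains after splitting off the
  bumps is supported in a compact subset of \<open>\<Omega>\<close>.\<close>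

lemma pairing_bounded_one:
  fixes \<Omega> :: "(complex^'n) set"
  assumes \<Omega>: "open \<Omega>" "bounded \<Omega>" and T: "smooth_vector_field \<Omega> T" "tangential \<Omega> T" "complex_transversal \<Omega> T"
    and \<rho>: "defining_function \<Omega> \<rho>"
  shows "pairing_bounded \<Omega> T M (\<lambda>x. 1)"
proof -
  have "\<exists>r>0. \<forall>\<zeta>. (\<forall>n. ksmooth True \<Omega> n \<zeta>) \<longrightarrow> pairing_bounded \<Omega> T M (\<lambda>x. \<zeta> x * bump p r x)" if p: "p \<in> frontier \<Omega>" for p
  proof -
    obtain r c where r: "0 < r" "c \<noteq> 0" "integrates_by_parts \<Omega> T (ball p r)"
      and fl: "\<And>N. \<exists>\<delta> \<kappa>. 0 < \<delta> \<and> \<delta> \<le> 1 \<and> 0 < \<kappa> \<and> \<kappa> \<le> 1 \<and> (\<forall>x\<in>\<Omega> \<inter> ball p r. \<forall>t. 0 < t \<longrightarrow> t \<le> \<delta> \<longrightarrow>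
       ball (taylor_sum (Suc N) t (\<lambda>i. flow_coeff T c i x)) (\<kappa> * t) \<subseteq> \<Omega>)"
      using boundary_point_flow[OF \<Omega> T \<rho> p] by blast
    obtain \<delta> \<kappa> where \<delta>: "0 < \<delta>" "\<delta> \<le> 1" "0 < \<kappa>" "\<kappa> \<le> 1" "\<And>x t. x \<in> \<Omega> \<inter> ball p r \<Longrightarrow> 0 < t \<Longrightarrow> t \<le> \<delta> \<Longrightarrow>
       ball (taylor_sum (Suc M) t (\<lambda>i. flow_coeff T c i x)) (\<kappa> * t) \<subseteq> \<Omega>" using fl[of M] by blast
    have "pairing_bounded \<Omega> T M (\<lambda>x. \<zeta> x * bump p r x)" if \<zeta>: "\<And>n. ksmooth True \<Omega> n \<zeta>" for \<zeta>
    proof (rule local_pairing_estimate[OF \<Omega> T(1) r(2,3) \<delta>(1-4)])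
      show "ball (taylor_sum (Suc M) t (\<lambda>i. flow_coeff T c i x)) (\<kappa> * t) \<subseteq> \<Omega>" if "x \<in> \<Omega> \<inter> ball p r" "0 < t" "t \<le> \<delta>" for x t
        by (rule \<delta>(5)[OF that])
      show "ksmooth True \<Omega> n (\<lambda>x. \<zeta> x * bump p r x)" for n
        by (rule ksmooth_mult[OF \<Omega>(1) \<zeta> ksmooth_bump[OF \<Omega>]])
      show "compact (cball p (3 * r / 4))" "cball p (3 * r / 4) \<subseteq> ball p r" using r(1) by auto
      show "\<zeta> x * bump p r x = 0" if "x \<in> \<Omega> - cball p (3 * r / 4)" for x
        using bump_eq_0[OF r(1), of x p] that by (simp add: dist_norm norm_minus_commute)
    qed
    then show ?thesis using r(1) by blast
  qed
  then obtain r where r: "\<And>p. p \<in> frontier \<Omega> \<Longrightarrow> r p > 0"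
    "\<And>p \<zeta>. p \<in> frontier \<Omega> \<Longrightarrow> (\<And>n. ksmooth True \<Omega> n \<zeta>) \<Longrightarrow> pairing_bounded \<Omega> T M (\<lambda>x. \<zeta> x * bump p (r p) x)" by metis
  have "compact (frontier \<Omega>)" by (rule compact_frontier_bounded[OF \<Omega>(2)])
  then obtain P where P: "P \<subseteq> frontier \<Omega>" "finite P" "frontier \<Omega> \<subseteq> (\<Union>p\<in>P. ball p (r p / 2))"
    by (rule compactE_image[where C = "frontier \<Omega>" and f = "\<lambda>p. ball p (r p / 2)"]) (use r(1) in force)+
  define K where "K = closure \<Omega> - (\<Union>p\<in>P. ball p (r p / 2))"
  have K: "compact K" "K \<subseteq> \<Omega>"
    using compact_diff[of "closure \<Omega>" "\<Union>p\<in>P. ball p (r p / 2)"] \<Omega> P(3) by (auto simp: K_def compact_closure frontier_def interior_open)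
  show ?thesis
  proof (rule pairing_bounded_partition[OF \<Omega> P(2)])
    have pr: "ksmooth True \<Omega> n (\<lambda>x. \<Prod>p\<in>Q. 1 - bump p (r p) x)" if "finite Q" for n Q
      using that
    proof induction
      case (insert p Q)
      then show ?case
        using ksmooth_mult[OF \<Omega>(1) ksmooth_diff[OF \<Omega>(1) ksmooth_const ksmooth_bump[OF \<Omega>, of n p "r p"]] insert.IH] by simp
    qed (simp add: ksmooth_const)
    show "pairing_bounded \<Omega> T M (\<lambda>x. 1 * (\<Prod>p\<in>P. 1 - bump p (r p) x))"
    proof (rule pairing_bounded_interior[OF \<Omega> _ K])
      show "ksmooth True \<Omega> n (\<lambda>x. 1 * (\<Prod>p\<in>P. 1 - bump p (r p) x))" for n using pr[OF P(2)] by simp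
      fix x assume "x \<in> \<Omega> - K"
      then obtain p where p: "p \<in> P" "x \<in> ball p (r p / 2)" unfolding K_def using closure_subset by blast
      then have "1 - bump p (r p) x = 0" using bump_eq_1[of "r p" x p] r(1) P(1) by (auto simp: dist_norm norm_minus_commute)
      then show "1 * (\<Prod>p\<in>P. 1 - bump p (r p) x) = 0" using P(2) p(1) prod_zero by fastforce
    qed
  qed (use r(2) P(1) in \<open>auto simp: ksmooth_const\<close>)
qed

section \<open>Test functions separate square-integrable functions\<close>

lemma test_function_cutoff:
  fixes K :: "'a::euclidean_space set"
  assumes K: "compact K" "K \<subseteq> \<Omega>" and \<Omega>: "open \<Omega>"
  obtains \<theta> where "\<theta> \<in> test_functions \<Omega>" "\<And>x. x \<in> K \<Longrightarrow> \<theta> x = 1" "\<And>x. norm (\<theta> x) \<le> 2"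
proof -
  have "\<exists>r>0. ball p r \<subseteq> \<Omega>" if "p \<in> K" for p using that K(2) \<Omega> open_contains_ball by blast
  then obtain r where r: "\<And>p. p \<in> K \<Longrightarrow> r p > 0" "\<And>p. p \<in> K \<Longrightarrow> ball p (r p) \<subseteq> \<Omega>" by metis
  obtain P where P: "P \<subseteq> K" "finite P" "K \<subseteq> (\<Union>p\<in>P. ball p (r p / 2))"
    by (rule compactE_image[OF K(1), where C = K and f = "\<lambda>p. ball p (r p / 2)"]) (use r(1) in force)+
  let ?\<Pi> = "\<lambda>x. \<Prod>p\<in>P. 1 - bump p (r p) x"
  have n1: "norm (1 - bump p (r p) x) \<le> 1" for p x
  proof -
    have "1 - bump p (r p) x = of_real (1 - smooth_step (2 - 4 * ((x - p) \<bullet> (x - p)) / (r p)\<^sup>2))" by (simp add: bump_def)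
    then show ?thesis using smooth_step_bounds by (metis norm_of_real abs_le_iff diff_ge_0_iff_ge diff_le_eq le_add_same_cancel1 abs_of_nonneg)
  qed
  have sm: "ksmooth False UNIV n (\<lambda>x. \<Prod>p\<in>Q. 1 - bump p (r p) x)" if "finite Q" for n Q
    using that
  proof induction
    case (insert p Q)
    have "ksmooth False UNIV n (bump p (r p))" using smooth_on_bump[of p "r p"] unfolding smooth_on_iff by blast
    then show ?case
      using ksmooth_mult[OF open_UNIV ksmooth_diff[OF open_UNIV ksmooth_const] insert.IH] insert.hyps by simp
  qed (simp add: ksmooth_const)
  show ?thesis
  proof (rule that[of "\<lambda>x. 1 - ?\<Pi> x"])
    show "(\<lambda>x. 1 - ?\<Pi> x) \<in> test_functions \<Omega>"
    proof (rule test_functionsI[of _ "\<Union>p\<in>P. cball p (3 * r p / 4)"])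
      show "smooth_on UNIV (\<lambda>x. 1 - ?\<Pi> x)"
        unfolding smooth_on_iff using ksmooth_diff[OF open_UNIV ksmooth_const sm[OF P(2)]] by simp
      show "compact (\<Union>p\<in>P. cball p (3 * r p / 4))" using P(2) by (intro compact_UN) auto
      show "(\<Union>p\<in>P. cball p (3 * r p / 4)) \<subseteq> \<Omega>"
      proof (rule UN_least)
        fix p assume "p \<in> P"
        then have "p \<in> K" using P(1) by blast
        then have "cball p (3 * r p / 4) \<subseteq> ball p (r p)" using r(1) by force
        then show "cball p (3 * r p / 4) \<subseteq> \<Omega>" using r(2)[OF \<open>p \<in> K\<close>] by blast
      qed
      fix x assume x: "x \<notin> (\<Union>p\<in>P. cball p (3 * r p / 4))"
      have "1 - bump p (r p) x = 1" if "p \<in> P" for p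
        using bump_eq_0[of "r p" x p] r(1) x that P(1) by (force simp: dist_norm norm_minus_commute)
      then show "1 - ?\<Pi> x = 0" by simp
    qed
    show "1 - ?\<Pi> x = 1" if x: "x \<in> K" for x
    proof -
      obtain p where p: "p \<in> P" "x \<in> ball p (r p / 2)" using x P(3) by blast
      then have "1 - bump p (r p) x = 0" using bump_eq_1[of "r p" x p] r(1) P(1) by (auto simp: dist_norm norm_minus_commute)
      then have "?\<Pi> x = 0" using P(2) p(1) prod_zero by fastforce
      then show ?thesis by simp
    qed
    show "norm (1 - ?\<Pi> x) \<le> 2" for x
    proof -
      have "norm (?\<Pi> x) \<le> 1" unfolding prod_norm[symmetric] using n1 by (intro prod_le_1) auto
      then show ?thesis using norm_triangle_ineq4[of 1 "?\<Pi> x"] by simp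
    qed
  qed
qed

lemma smooth_on_polynomial_function:
  fixes q :: "'a::euclidean_space \<Rightarrow> complex"
  assumes "polynomial_function q"
  shows "smooth_on UNIV q"
proof -
  have real: "ksmooth False UNIV n u" if "real_polynomial_function u" for n and u :: "'a \<Rightarrow> real"
    using that
  proof induction
    case (linear f)
    then show ?case by (simp add: ksmooth_linear)
  next
    case (const c)
    then show ?case by (rule ksmooth_const)
  next
    case (add f g)
    then show ?case by (simp add: ksmooth_add)
  next
    case (mult f g)
    then show ?case by (simp add: ksmooth_mult)
  qed
  have "real_polynomial_function (\<lambda>x. Re (q x))" "real_polynomial_function (\<lambda>x. Im (q x))"
    using assms bounded_linear_Re bounded_linear_Im by (auto simp: polynomial_function_def o_def)
  then have "ksmooth False UNIV n (\<lambda>x. of_real (Re (q x)) + \<i> * of_real (Im (q x)))" for n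
    by (intro ksmooth_add ksmooth_mult ksmooth_const open_UNIV ksmooth_compose_linear[OF bounded_linear_of_real] real)
  then show ?thesis by (simp add: smooth_on_iff complex_eq[symmetric])
qed

text \<open>Test functions of the form cutoff times polynomial, bounded by a common constant, approximate
  \<open>cnj g / (1 + \<bar>g\<bar>)\<close> almost everywhere: \<open>g\<close> is an almost everywhere limit of continuous functions, and the
  Weierstrass theorem replaces these by polynomials. Dominated convergence gives \<open>\<integral> \<bar>g\<bar>\<^sup>2 / (1 + \<bar>g\<bar>) = 0\<close>.\<close>

lemma test_functions_separate_L2:
  fixes g :: "'a::euclidean_space \<Rightarrow> complex"
  assumes \<Omega>: "open \<Omega>" "bounded \<Omega>" and g: "g \<in> L2 \<Omega>"
    and orth: "\<And>\<phi>. \<phi> \<in> test_functions \<Omega> \<Longrightarrow> (LINT x|lebesgue_on \<Omega>. g x * \<phi> x) = 0"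
  shows "AE x in lebesgue_on \<Omega>. g x = 0"
proof -
  let ?M = "lebesgue_on \<Omega>"
  have lm: "\<Omega> \<in> lmeasurable" by (rule bounded_open_lmeasurable[OF \<Omega>])
  then have \<Omega>s: "\<Omega> \<in> sets lebesgue" by blast
  have gm: "g \<in> borel_measurable ?M" by (rule L2_measurable[OF g])
  have "g measurable_on \<Omega>" using measurable_on_iff_borel_measurable[OF \<Omega>s] gm by blast
  then obtain N a where N: "negligible N" and a: "\<And>n. continuous_on UNIV (a n)"
    "\<And>x. x \<notin> N \<Longrightarrow> (\<lambda>n. a n x) \<longlonglongrightarrow> (if x \<in> \<Omega> then g x else 0)"
    unfolding measurable_on_def by metis
  \<comment> \<open>a bounded continuous substitute for \<open>cnj\<close> whose product with the argument is nonnegative\<close>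
  define \<Phi> where "\<Phi> c = cnj c / of_real (1 + norm c)" for c :: complex
  have \<Phi>n: "norm (\<Phi> c) \<le> 1" for c 
  proof -
    have "norm (\<Phi> c) = norm c / (1 + norm c)"
      unfolding \<Phi>_def norm_divide norm_of_real complex_mod_cnj by simp
    also have "\<dots> \<le> 1" by (simp add: divide_le_eq_1 add_pos_nonneg)
    finally show ?thesis .
  qed
  have \<Phi>c: "continuous_on UNIV \<Phi>" unfolding \<Phi>_def
    by (intro continuous_intros) (metis add_pos_nonneg norm_ge_zero of_real_eq_0_iff order_less_irrefl zero_less_one)
  obtain C where C: "\<And>n. compact (C n)" "\<And>n. C n \<subseteq> \<Omega>" "\<And>n. C n \<subseteq> interior (C (Suc n))" "\<Union>(range C) = \<Omega>"
      "\<And>K. compact K \<Longrightarrow> K \<subseteq> \<Omega> \<Longrightarrow> \<exists>N. \<forall>n\<ge>N. K \<subseteq> C n"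
    by (rule open_Union_compact_subsets[OF \<Omega>(1)]) (rule that)
  have "\<exists>\<theta>. \<theta> \<in> test_functions \<Omega> \<and> (\<forall>x\<in>C n. \<theta> x = 1) \<and> (\<forall>x. norm (\<theta> x) \<le> 2)" for n
    using test_function_cutoff[OF C(1)[of n] C(2)[of n] \<Omega>(1)] by metis
  then obtain \<theta> where \<theta>: "\<And>n. \<theta> n \<in> test_functions \<Omega>" "\<And>n x. x \<in> C n \<Longrightarrow> \<theta> n x = 1" "\<And>n x. norm (\<theta> n x) \<le> 2"
    by metis
  have "\<exists>q. polynomial_function q \<and> (\<forall>x\<in>closure \<Omega>. norm (\<Phi> (a n x) - q x) < inverse (real (Suc n)))" for n
  proof (rule Stone_Weierstrass_polynomial_function)
    show "compact (closure \<Omega>)" using \<Omega>(2) by simp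
    show "continuous_on (closure \<Omega>) (\<lambda>x. \<Phi> (a n x))"
      by (rule continuous_on_compose2[OF \<Phi>c continuous_on_subset[OF a(1)]]) auto
  qed simp
  then obtain q where q: "\<And>n. polynomial_function (q n)"
    "\<And>n x. x \<in> closure \<Omega> \<Longrightarrow> norm (\<Phi> (a n x) - q n x) < inverse (real (Suc n))" by metis
  define \<phi> where "\<phi> n x = \<theta> n x * q n x" for n x
  have \<phi>: "\<phi> n \<in> test_functions \<Omega>" for n
  proof -
    obtain K where K: "smooth_on UNIV (\<theta> n)" "compact K" "K \<subseteq> \<Omega>" "\<And>x. x \<notin> K \<Longrightarrow> \<theta> n x = 0"
      using test_functionsE[OF \<theta>(1)[of n]] by metis
    show ?thesis unfolding \<phi>_def
      by (rule test_functionsI[OF smooth_on_mult[OF K(1) smooth_on_polynomial_function[OF q(1)]] K(2,3)]) (simp add: K(4))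
  qed
  have q2: "norm (q n x) \<le> 2" if "x \<in> \<Omega>" for n x
  proof -
    have "norm (\<Phi> (a n x) - q n x) < inverse (real (Suc n))" using q(2) that closure_subset by blast
    also have "\<dots> \<le> 1" using le_imp_inverse_le[of 1 "real (Suc n)"] by simp
    finally show ?thesis using \<Phi>n[of "a n x"] norm_triangle_ineq4[of "\<Phi> (a n x)" "\<Phi> (a n x) - q n x"] by simp
  qed
  have \<phi>n: "norm (\<phi> n x) \<le> 4" if "x \<in> \<Omega>" for n x
    unfolding \<phi>_def norm_mult using mult_mono[OF \<theta>(3)[of n x] q2[OF that, of n]] by simp
  have lim: "(\<lambda>n. g x * \<phi> n x) \<longlonglongrightarrow> g x * \<Phi> (g x)" if x: "x \<in> \<Omega>" "x \<notin> N" for x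
  proof -
    have "(\<lambda>n. a n x) \<longlonglongrightarrow> g x" using a(2)[OF x(2)] x(1) by simp
    then have l1: "(\<lambda>n. \<Phi> (a n x)) \<longlonglongrightarrow> \<Phi> (g x)"
      using continuous_on_tendsto_compose[OF \<Phi>c] by simp
    have "(\<lambda>n. \<Phi> (a n x) - q n x) \<longlonglongrightarrow> 0"
      by (rule Lim_null_comparison[OF _ LIMSEQ_inverse_real_of_nat])
        (use q(2)[of x] x(1) closure_subset in \<open>auto intro!: always_eventually less_imp_le\<close>)
    from tendsto_diff[OF l1 this] have l2: "(\<lambda>n. q n x) \<longlonglongrightarrow> \<Phi> (g x)" by simp
    obtain m where m: "\<forall>n\<ge>m. {x} \<subseteq> C n" using C(5)[of "{x}"] x(1) by auto
    have "\<forall>\<^sub>F n in sequentially. q n x = \<phi> n x"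
      unfolding eventually_sequentially \<phi>_def using m \<theta>(2) by auto
    with l2 have "(\<lambda>n. \<phi> n x) \<longlonglongrightarrow> \<Phi> (g x)" by (rule Lim_transform_eventually)
    then show ?thesis by (rule tendsto_mult_left)
  qed
  have AEN: "AE x in ?M. x \<notin> N"
  proof -
    have "N \<in> null_sets lebesgue" using N negligible_iff_null_sets by blast
    then have "AE x in lebesgue. x \<notin> N" by (rule AE_not_in)
    then show ?thesis using \<Omega>s by (subst AE_restrict_space_iff) auto
  qed
  have gi: "integrable ?M (\<lambda>x. 4 * norm (g x))" using L2_integrable[OF lm g] by simp
  have m1: "(\<lambda>x. g x * \<Phi> (g x)) \<in> borel_measurable ?M"
    using gm borel_measurable_continuous_onI[OF \<Phi>c] by measurable
  have m2: "(\<lambda>x. g x * \<phi> n x) \<in> borel_measurable ?M" for n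
    using gm L2_measurable[OF test_function_L2[OF \<phi> \<Omega>]] by measurable
  have dom: "(\<lambda>n. LINT x|?M. g x * \<phi> n x) \<longlonglongrightarrow> (LINT x|?M. g x * \<Phi> (g x))" "integrable ?M (\<lambda>x. g x * \<Phi> (g x))"
  proof -
    have A: "AE x in ?M. (\<lambda>n. g x * \<phi> n x) \<longlonglongrightarrow> g x * \<Phi> (g x)" 
      using AEN AE_space[of ?M] by eventually_elim (rule lim, auto)
    have B: "AE x in ?M. norm (g x * \<phi> n x) \<le> 4 * norm (g x)" for n
      by (rule AE_I2) (use \<phi>n in \<open>simp add: norm_mult mult.commute mult_left_mono\<close>)
    show "(\<lambda>n. LINT x|?M. g x * \<phi> n x) \<longlonglongrightarrow> (LINT x|?M. g x * \<Phi> (g x))"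
      by (rule integral_dominated_convergence[OF m1 m2 gi A B])
    show "integrable ?M (\<lambda>x. g x * \<Phi> (g x))"
      by (rule integrable_dominated_convergence[OF m1 m2 gi A B])
  qed
  have "(LINT x|?M. g x * \<Phi> (g x)) = 0"
    using dom(1) orth[OF \<phi>] by (simp add: LIMSEQ_const_iff)
  moreover have pos: "g x * \<Phi> (g x) = of_real ((norm (g x))\<^sup>2 / (1 + norm (g x)))" for x
    by (simp only: \<Phi>_def of_real_divide complex_norm_square times_divide_eq_right)
  ultimately have z: "(LINT x|?M. (norm (g x))\<^sup>2 / (1 + norm (g x))) = 0"
    using integral_complex_of_real[of ?M "\<lambda>x. (norm (g x))\<^sup>2 / (1 + norm (g x))"] by simp
  have "integrable ?M (\<lambda>x. (norm (g x))\<^sup>2 / (1 + norm (g x)))"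
    using integrable_Re[OF dom(2)] unfolding pos by simp
  then have "AE x in ?M. (norm (g x))\<^sup>2 / (1 + norm (g x)) = 0"
    using z by (subst (asm) integral_nonneg_eq_0_iff_AE) auto
  then show ?thesis
  proof eventually_elim
    case (elim x)
    then show ?case using norm_ge_zero[of "g x"] by (auto simp: divide_eq_0_iff)
  qed
qed

section \<open>Functions with bounded derivatives are smooth up to the boundary\<close>

text \<open>Two points \<open>x, y\<close> near \<open>p\<close> are joined inside \<open>\<Omega>\<close> by going inward along \<open>s n\<close>, across, and back out. The middle segment stays
  in \<open>\<Omega>\<close> if \<open>s\<close> is large compared with the distance, \<open>s = \<bar>x - y\<bar> / \<sigma>\<close>, so the path has length comparable to
  \<open>\<bar>x - y\<bar>\<close>.\<close>

lemma locally_lipschitz_at_frontier: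
  fixes f :: "'a::euclidean_space \<Rightarrow> 'b::real_normed_vector"
  assumes \<Omega>: "open \<Omega>" and \<rho>: "defining_function \<Omega> \<rho>" and p: "p \<in> frontier \<Omega>"
    and d: "\<And>z. z \<in> \<Omega> \<Longrightarrow> f differentiable (at z)"
    and C: "C > 0" "\<And>z v. z \<in> \<Omega> \<Longrightarrow> norm (frechet_derivative f (at z) v) \<le> C * norm v"
  obtains r L where "r > 0" "L > 0" "\<And>x y. x \<in> \<Omega> \<Longrightarrow> y \<in> \<Omega> \<Longrightarrow> x \<in> ball p r \<Longrightarrow> y \<in> ball p r \<Longrightarrow> norm (f x - f y) \<le> L * norm (x - y)"
proof -
  obtain U where U: "open U" "frontier \<Omega> \<subseteq> U" "smooth_on U \<rho>" "\<Omega> \<inter> U = {x \<in> U. \<rho> x < 0}"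
    "\<forall>x\<in>frontier \<Omega>. frechet_derivative \<rho> (at x) \<noteq> (\<lambda>v. 0)" using \<rho> unfolding defining_function_def by blast
  have pU: "p \<in> U" using U(2) p by blast
  let ?D = "frechet_derivative \<rho> (at p)"
  have lin: "linear ?D" using smooth_on_differentiable[OF U(3) pU] linear_frechet_derivative by blast
  obtain v where v: "?D v \<noteq> 0" using U(5) p by fastforce
  obtain n where n: "?D n < 0"
  proof (cases "?D v < 0")
    case False
    then have "?D (- v) < 0" using v linear_neg[OF lin, of v] by simp
    then show thesis by (rule that)
  qed (rule that)
  obtain R c \<sigma> where R: "R > 0" "c > 0" "\<sigma> > 0" "cball p R \<subseteq> U"
    "\<And>x y s. x \<in> ball p R \<Longrightarrow> y \<in> ball p R \<Longrightarrow> s \<ge> 0 \<Longrightarrow> norm (y - x - s *\<^sub>R n) \<le> \<sigma> * s \<Longrightarrow> \<rho> y \<le> \<rho> x - c * s"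
    by (rule defining_function_decrease[OF U(1,3) pU n]) (rule that)
  define m where "m = 2 * norm n / \<sigma> + 3"
  have m: "m \<ge> 3" using R by (simp add: m_def)
  define r where "r = R / m"
  have r: "r > 0" "r * m = R" "r \<le> R" using R(1) m by (auto simp: r_def field_simps mult_left_le_one_le)
  have inside: "z \<in> \<Omega>" if "x \<in> \<Omega>" "x \<in> ball p R" "z \<in> ball p R" "s \<ge> 0" "norm (z - x - s *\<^sub>R n) \<le> \<sigma> * s" for x z s
  proof -
    have "x \<in> U" "z \<in> U" using that(2,3) R(4) by auto
    then have "\<rho> x < 0" using that(1) U(4) by blast
    moreover have "c * s \<ge> 0" using R(2) that(4) by simp
    ultimately have "\<rho> z < 0" using R(5)[OF that(2-5)] by linarith
    then show ?thesis using U(4) \<open>z \<in> U\<close> by blast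
  qed
  define L where "L = C * (2 * norm n / \<sigma> + 1)"
  show ?thesis
  proof (rule that[of r L])
    show "r > 0" by (rule r(1))
    show "L > 0" unfolding L_def using C R(3) by (intro mult_pos_pos add_nonneg_pos) auto
    fix x y assume x: "x \<in> \<Omega>" "x \<in> ball p r" and y: "y \<in> \<Omega>" "y \<in> ball p r"
    define s where "s = norm (x - y) / \<sigma>"
    have s: "s \<ge> 0" "\<sigma> * s = norm (x - y)" using R(3) by (auto simp: s_def)
    have xp: "norm (x - p) < r" "norm (y - p) < r" using x(2) y(2) by (auto simp: dist_norm norm_minus_commute)
    have xy: "norm (x - y) < 2 * r" using norm_triangle_ineq4[of "x - p" "y - p"] xp by simp
    have bR: "x \<in> ball p R" "y \<in> ball p R" using x(2) y(2) r(3) by auto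
    have sn: "s * norm n + norm (x - y) \<le> r * (m - 1)"
    proof -
      have "s * norm n + norm (x - y) = norm (x - y) * (norm n / \<sigma> + 1)" by (simp add: s_def field_simps)
      also have "\<dots> \<le> (2 * r) * (norm n / \<sigma> + 1)" using xy R(3) by (intro mult_right_mono) auto
      also have "\<dots> = r * (m - 1)" by (simp add: m_def algebra_simps)
      finally show ?thesis .
    qed
    have near: "z \<in> ball p R" if "norm (z - p) < r + (s * norm n + norm (x - y))" for z
    proof -
      have "norm (z - p) < R" using that sn r(2) by (simp add: algebra_simps)
      then show ?thesis by (simp add: dist_norm norm_minus_commute)
    qed
    have vert: "closed_segment w (w + s *\<^sub>R n) \<subseteq> \<Omega>" if w: "w \<in> \<Omega>" "w \<in> ball p R" "norm (w - p) < r" for w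
    proof
      fix z assume "z \<in> closed_segment w (w + s *\<^sub>R n)"
      then obtain u where u: "0 \<le> u" "u \<le> 1" "z = (1 - u) *\<^sub>R w + u *\<^sub>R (w + s *\<^sub>R n)" by (auto simp: closed_segment_def)
      then have z: "z = w + (u * s) *\<^sub>R n" by (simp add: algebra_simps)
      have us: "0 \<le> u * s" "u * s \<le> s" using u s by (auto simp: mult_left_le_one_le)
      have "norm (z - p) \<le> norm (w - p) + (u * s) * norm n" using norm_triangle_ineq[of "w - p" "(u * s) *\<^sub>R n"] us z
        by (simp add: algebra_simps)
      moreover have "(u * s) * norm n \<le> s * norm n" using us by (intro mult_right_mono) auto
      ultimately have "norm (z - p) < r + (s * norm n + norm (x - y))" using w(3) norm_ge_zero[of "x - y"] by linarith
      then show "z \<in> \<Omega>" using inside[OF w(1,2) near us(1)] us R(3) by (simp add: z)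
    qed
    have horiz: "closed_segment (x + s *\<^sub>R n) (y + s *\<^sub>R n) \<subseteq> \<Omega>"
    proof
      fix z assume "z \<in> closed_segment (x + s *\<^sub>R n) (y + s *\<^sub>R n)"
      then obtain u where u: "0 \<le> u" "u \<le> 1" "z = (1 - u) *\<^sub>R (x + s *\<^sub>R n) + u *\<^sub>R (y + s *\<^sub>R n)" by (auto simp: closed_segment_def)
      then have z: "z = x + s *\<^sub>R n + u *\<^sub>R (y - x)" by (simp add: algebra_simps)
      have uy: "norm (u *\<^sub>R (y - x)) \<le> norm (x - y)" using u by (simp add: norm_minus_commute mult_left_le_one_le)
      have "norm (z - p) \<le> norm (x - p) + norm (s *\<^sub>R n) + norm (u *\<^sub>R (y - x))"
        using norm_triangle_ineq[of "x - p + s *\<^sub>R n" "u *\<^sub>R (y - x)"] norm_triangle_ineq[of "x - p" "s *\<^sub>R n"]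
        by (simp add: z algebra_simps)
      then have "norm (z - p) < r + (s * norm n + norm (x - y))" using xp uy s(1) by simp
      then show "z \<in> \<Omega>" using inside[OF x(1) bR(1) near s(1)] uy s(2) by (simp add: z)
    qed
    have seg: "norm (f u - f w) \<le> C * norm (u - w)" if "closed_segment u w \<subseteq> \<Omega>" for u w
      by (rule lipschitz_of_derivative_bound[of "closed_segment u w"]) (use that d C(2) in auto)
    have "norm (f x - f (x + s *\<^sub>R n)) \<le> C * (s * norm n)" using seg[OF vert[OF x(1) bR(1) xp(1)]] s(1) by simp
    moreover have "norm (f (x + s *\<^sub>R n) - f (y + s *\<^sub>R n)) \<le> C * norm (x - y)" using seg[OF horiz] by simp
    moreover have "norm (f y - f (y + s *\<^sub>R n)) \<le> C * (s * norm n)" using seg[OF vert[OF y(1) bR(2) xp(2)]] s(1) by simp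
    moreover have "f x - f y = (f x - f (x + s *\<^sub>R n)) + (f (x + s *\<^sub>R n) - f (y + s *\<^sub>R n)) - (f y - f (y + s *\<^sub>R n))" by simp
    ultimately have "norm (f x - f y) \<le> C * (s * norm n) + C * norm (x - y) + C * (s * norm n)"
      by (smt (verit) norm_triangle_ineq norm_triangle_ineq4)
    also have "\<dots> = L * norm (x - y)" by (simp add: L_def s_def algebra_simps)
    finally show "norm (f x - f y) \<le> L * norm (x - y)" .
  qed
qed

text \<open>The function is locally Lipschitz at every point of the compact closure; a Lebesgue number of a suitable cover makes the
  continuity uniform.\<close>

lemma uniformly_continuous_of_bounded_derivative:
  fixes f :: "'a::euclidean_space \<Rightarrow> 'b::real_normed_vector"
  assumes \<Omega>: "open \<Omega>" "bounded \<Omega>" and \<rho>: "defining_function \<Omega> \<rho>" and f: "ksmooth True \<Omega> (Suc 0) f"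
  shows "uniformly_continuous_on \<Omega> f"
proof -
  obtain C where C: "C > 0" "\<And>x v. x \<in> \<Omega> \<Longrightarrow> norm (frechet_derivative f (at x) v) \<le> C * norm v"
    using ksmooth_derivative_bounded[OF f] by metis
  have d: "f differentiable (at z)" if "z \<in> \<Omega>" for z by (rule ksmooth_differentiable[OF f that])
  have loc: "\<exists>r>0. \<exists>L>0. \<forall>x\<in>\<Omega>. \<forall>y\<in>\<Omega>. x \<in> ball p r \<longrightarrow> y \<in> ball p r \<longrightarrow> norm (f x - f y) \<le> L * norm (x - y)"
    if p: "p \<in> closure \<Omega>" for p
  proof (cases "p \<in> \<Omega>")
    case True
    then obtain r where r: "r > 0" "ball p r \<subseteq> \<Omega>" using \<Omega>(1) open_contains_ball by blast
    have "norm (f x - f y) \<le> C * norm (x - y)" if "x \<in> ball p r" "y \<in> ball p r" for x y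
      by (rule lipschitz_of_derivative_bound[of "ball p r"]) (use r that d C(2) in auto)
    then show ?thesis using r(1) C(1) by blast
  next
    case False
    then have "p \<in> frontier \<Omega>" using p \<Omega>(1) by (simp add: frontier_def interior_open)
    then show ?thesis using locally_lipschitz_at_frontier[OF \<Omega>(1) \<rho> _ d C] by metis
  qed
  show ?thesis
    unfolding uniformly_continuous_on_def
  proof (intro allI impI)
    fix e :: real assume e: "0 < e"
    have "\<exists>r>0. \<forall>x\<in>\<Omega>. \<forall>y\<in>\<Omega>. x \<in> ball p r \<longrightarrow> y \<in> ball p r \<longrightarrow> dist (f y) (f x) < e" if p: "p \<in> closure \<Omega>" for p
    proof -
      obtain r L where r: "r > 0" "L > 0" "\<And>x y. x \<in> \<Omega> \<Longrightarrow> y \<in> \<Omega> \<Longrightarrow> x \<in> ball p r \<Longrightarrow> y \<in> ball p r \<Longrightarrow> norm (f x - f y) \<le> L * norm (x - y)"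
        using loc[OF p] by metis
      define r' where "r' = min r (e / (2 * L))"
      have "dist (f y) (f x) < e" if xy: "x \<in> \<Omega>" "y \<in> \<Omega>" "x \<in> ball p r'" "y \<in> ball p r'" for x y
      proof -
        have "norm (x - y) < 2 * r'" using norm_triangle_ineq4[of "x - p" "y - p"] xy(3,4) by (simp add: dist_norm norm_minus_commute)
        also have "\<dots> \<le> e / L" by (simp add: r'_def)
        finally have "L * norm (x - y) < e" using r(2) by (simp add: field_simps)
        moreover have "norm (f x - f y) \<le> L * norm (x - y)" using r(3)[OF xy(1,2)] xy(3,4) by (simp add: r'_def)
        ultimately show ?thesis by (simp add: dist_norm norm_minus_commute)
      qed
      moreover have "r' > 0" using r(1,2) e by (simp add: r'_def)
      ultimately show ?thesis by blast
    qed
    then obtain r where r: "\<And>p. p \<in> closure \<Omega> \<Longrightarrow> r p > 0"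
      "\<And>p x y. p \<in> closure \<Omega> \<Longrightarrow> x \<in> \<Omega> \<Longrightarrow> y \<in> \<Omega> \<Longrightarrow> x \<in> ball p (r p) \<Longrightarrow> y \<in> ball p (r p) \<Longrightarrow> dist (f y) (f x) < e" by metis
    obtain \<epsilon> where \<epsilon>: "0 < \<epsilon>" "\<And>x. x \<in> closure \<Omega> \<Longrightarrow> \<exists>G\<in>(\<lambda>p. ball p (r p)) ` closure \<Omega>. ball x \<epsilon> \<subseteq> G"
    proof (rule Heine_Borel_lemma[of "closure \<Omega>" "(\<lambda>p. ball p (r p)) ` closure \<Omega>"])
      show "compact (closure \<Omega>)" using \<Omega>(2) by simp
      show "closure \<Omega> \<subseteq> \<Union> ((\<lambda>p. ball p (r p)) ` closure \<Omega>)" using r(1) by force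
    qed (use that in auto)
    show "\<exists>d>0. \<forall>x\<in>\<Omega>. \<forall>x'\<in>\<Omega>. dist x' x < d \<longrightarrow> dist (f x') (f x) < e"
    proof (intro exI[of _ \<epsilon>] conjI ballI impI)
      fix x x' assume x: "x \<in> \<Omega>" "x' \<in> \<Omega>" "dist x' x < \<epsilon>"
      then obtain p where "p \<in> closure \<Omega>" "ball x \<epsilon> \<subseteq> ball p (r p)" using \<epsilon>(2)[of x] closure_subset by blast
      moreover have "x \<in> ball x \<epsilon>" "x' \<in> ball x \<epsilon>" using x(3) \<epsilon>(1) by (auto simp: dist_commute)
      ultimately show "dist (f x') (f x) < e" using r(2) x(1,2) by blast
    qed (rule \<epsilon>(1))
  qed
qed

text \<open>Every derivative has bounded gradient, hence is uniformly continuous and extends continuously to the closure.\<close>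

lemma smooth_closure_of_bounded_derivatives:
  assumes \<Omega>: "open \<Omega>" "bounded \<Omega>" and \<rho>: "defining_function \<Omega> \<rho>" and h: "smooth_on \<Omega> h"
    and bd: "\<And>bs. bs \<in> lists Basis \<Longrightarrow> bounded (iter_partial bs h ` \<Omega>)"
  shows "h \<in> smooth_closure \<Omega>"
proof -
  have "\<exists>g. continuous_on (closure \<Omega>) g \<and> (\<forall>x\<in>\<Omega>. g x = iter_partial bs h x)" if bs: "bs \<in> lists Basis" for bs
  proof -
    have "ksmooth True \<Omega> (Suc 0) (iter_partial bs h)"
    proof -
      have "iter_partial bs h differentiable at x" if "x \<in> \<Omega>" for x
        using h bs that by (simp add: smooth_on_def)
      moreover have "bounded ((\<lambda>x. frechet_derivative (iter_partial bs h) (at x) b) ` \<Omega>)" if "b \<in> Basis" for b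
        using bd[of "b # bs"] bs that by simp
      ultimately show ?thesis using bd[OF bs] by simp
    qed
    then have "uniformly_continuous_on \<Omega> (iter_partial bs h)"
      by (rule uniformly_continuous_of_bounded_derivative[OF \<Omega> \<rho>])
    then obtain g where "uniformly_continuous_on (closure \<Omega>) g" "\<And>x. x \<in> \<Omega> \<Longrightarrow> iter_partial bs h x = g x"
      by (rule uniformly_continuous_on_extension_on_closure) (rule that)
    then show ?thesis using uniformly_continuous_imp_continuous by metis
  qed
  then show ?thesis using h by (simp add: smooth_closure_def)
qed

section \<open>The spaces \<open>H\<^sup>k\<^sub>T\<close>\<close>

lemma vf_transpose_funpow_test_function:
  assumes T: "smooth_vector_field \<Omega> T" "bounded \<Omega>" "open \<Omega>" and \<phi>: "\<phi> \<in> test_functions \<Omega>"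
  shows "(vf_transpose T ^^ j) \<phi> \<in> test_functions \<Omega>"
  by (induction j) (use \<phi> vf_transpose_test_function[OF T] in auto)

lemma T_power_H_T_infty:
  assumes "f \<in> H_T_infty \<Omega> T"
  shows "T_power \<Omega> T j f \<in> L2 \<Omega>" and "dist_power \<Omega> T j f (T_power \<Omega> T j f)"
proof -
  have "f \<in> H_T \<Omega> T j" using assms by (auto simp: H_T_infty_def)
  then have "\<exists>g. g \<in> L2 \<Omega> \<and> dist_power \<Omega> T j f g"
  proof (cases "j = 0")
    case True
    then show ?thesis using \<open>f \<in> H_T \<Omega> T j\<close> by (auto simp: H_T_def dist_power_def)
  next
    case False
    then have "j \<in> {1..j}" by simp
    then show ?thesis using \<open>f \<in> H_T \<Omega> T j\<close> unfolding H_T_def by blast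
  qed
  from someI_ex[OF this] show "T_power \<Omega> T j f \<in> L2 \<Omega>" "dist_power \<Omega> T j f (T_power \<Omega> T j f)"
    unfolding T_power_def by auto
qed

text \<open>Although the representatives are chosen independently for different powers, each one is the weak \<open>T\<close> derivative of the one
  before, because all of them are tested against the same iterated transposes.\<close>

lemma T_power_weak_derivative:
  assumes T: "smooth_vector_field \<Omega> T" "bounded \<Omega>" "open \<Omega>" and f: "f \<in> H_T_infty \<Omega> T" and \<phi>: "\<phi> \<in> test_functions \<Omega>"
  shows "(LINT x|lebesgue_on \<Omega>. T_power \<Omega> T (Suc j) f x * \<phi> x) = (LINT x|lebesgue_on \<Omega>. T_power \<Omega> T j f x * vf_transpose T \<phi> x)"
proof -
  have "(LINT x|lebesgue_on \<Omega>. T_power \<Omega> T (Suc j) f x * \<phi> x) = (LINT x|lebesgue_on \<Omega>. f x * (vf_transpose T ^^ j) (vf_transpose T \<phi>) x)"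
    using T_power_H_T_infty(2)[OF f, of "Suc j"] \<phi> by (simp add: dist_power_def funpow_swap1)
  also have "\<dots> = (LINT x|lebesgue_on \<Omega>. T_power \<Omega> T j f x * vf_transpose T \<phi> x)"
    using T_power_H_T_infty(2)[OF f, of j] vf_transpose_test_function[OF T \<phi>] by (simp add: dist_power_def)
  finally show ?thesis .
qed

text \<open>The representative chosen for \<open>T\<^sup>0 f\<close> need not be \<open>f\<close> itself.\<close>

lemma T_power_0_AE:
  assumes \<Omega>: "open \<Omega>" "bounded \<Omega>" and f: "f \<in> H_T_infty \<Omega> T"
  shows "AE x in lebesgue_on \<Omega>. T_power \<Omega> T 0 f x = f x"
proof -
  have fL: "f \<in> L2 \<Omega>" using f by (auto simp: H_T_infty_def H_T_def)
  have gL: "T_power \<Omega> T 0 f \<in> L2 \<Omega>" by (rule T_power_H_T_infty(1)[OF f])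
  have "AE x in lebesgue_on \<Omega>. T_power \<Omega> T 0 f x - f x = 0"
  proof (rule test_functions_separate_L2[OF \<Omega> L2_diff[OF gL fL]])
    fix \<phi> assume \<phi>: "\<phi> \<in> test_functions \<Omega>"
    have \<phi>L: "\<phi> \<in> L2 \<Omega>" by (rule test_function_L2[OF \<phi> \<Omega>])
    have "(LINT x|lebesgue_on \<Omega>. T_power \<Omega> T 0 f x * \<phi> x) = (LINT x|lebesgue_on \<Omega>. f x * \<phi> x)"
      using T_power_H_T_infty(2)[OF f, of 0] \<phi> by (simp add: dist_power_def)
    then show "(LINT x|lebesgue_on \<Omega>. (T_power \<Omega> T 0 f x - f x) * \<phi> x) = 0"
      using Bochner_Integration.integral_diff[OF L2_integrable_mult[OF gL \<phi>L] L2_integrable_mult[OF fL \<phi>L]]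
      by (simp add: left_diff_distrib)
  qed
  then show ?thesis by eventually_elim simp
qed

lemma H_T_infty_diff:
  assumes T: "smooth_vector_field \<Omega> T" "bounded \<Omega>" "open \<Omega>" and f: "f \<in> H_T_infty \<Omega> T" and g: "g \<in> H_T_infty \<Omega> T"
  shows "(\<lambda>x. f x - g x) \<in> H_T_infty \<Omega> T"
proof -
  have L: "f \<in> L2 \<Omega>" "g \<in> L2 \<Omega>" using f g by (auto simp: H_T_infty_def H_T_def)
  have "dist_power \<Omega> T j (\<lambda>x. f x - g x) (\<lambda>x. T_power \<Omega> T j f x - T_power \<Omega> T j g x)" for j
    unfolding dist_power_def
  proof
    fix \<phi> assume \<phi>: "\<phi> \<in> test_functions \<Omega>"
    let ?\<psi> = "(vf_transpose T ^^ j) \<phi>"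
    have \<phi>L: "\<phi> \<in> L2 \<Omega>" "?\<psi> \<in> L2 \<Omega>"
      using test_function_L2 \<phi> vf_transpose_funpow_test_function[OF T \<phi>] T(2,3) by auto
    have "(LINT x|lebesgue_on \<Omega>. (T_power \<Omega> T j f x - T_power \<Omega> T j g x) * \<phi> x) =
        (LINT x|lebesgue_on \<Omega>. T_power \<Omega> T j f x * \<phi> x) - (LINT x|lebesgue_on \<Omega>. T_power \<Omega> T j g x * \<phi> x)"
      unfolding left_diff_distrib
      by (rule Bochner_Integration.integral_diff; rule L2_integrable_mult[OF T_power_H_T_infty(1) \<phi>L(1)]) (rule f g)+
    also have "\<dots> = (LINT x|lebesgue_on \<Omega>. f x * ?\<psi> x) - (LINT x|lebesgue_on \<Omega>. g x * ?\<psi> x)"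
      using T_power_H_T_infty(2)[OF f, of j] T_power_H_T_infty(2)[OF g, of j] \<phi> by (simp add: dist_power_def)
    also have "\<dots> = (LINT x|lebesgue_on \<Omega>. (f x - g x) * ?\<psi> x)"
      unfolding left_diff_distrib
      by (rule Bochner_Integration.integral_diff[symmetric]; rule L2_integrable_mult[OF _ \<phi>L(2)]) (rule L)+
    finally show "(LINT x|lebesgue_on \<Omega>. (T_power \<Omega> T j f x - T_power \<Omega> T j g x) * \<phi> x) = (LINT x|lebesgue_on \<Omega>. (f x - g x) * ?\<psi> x)" .
  qed
  moreover have "(\<lambda>x. T_power \<Omega> T j f x - T_power \<Omega> T j g x) \<in> L2 \<Omega>" for j
    by (rule L2_diff[OF T_power_H_T_infty(1)[OF f] T_power_H_T_infty(1)[OF g]])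
  ultimately show ?thesis using L2_diff[OF L] unfolding H_T_infty_def H_T_def by blast
qed

lemma L2_norm_T_power_le_H_T_norm:
  assumes "j \<le> k"
  shows "L2_norm \<Omega> (T_power \<Omega> T j f) \<le> H_T_norm \<Omega> T k f"
proof -
  have "(L2_norm \<Omega> (T_power \<Omega> T j f))\<^sup>2 \<le> (\<Sum>j=0..k. (L2_norm \<Omega> (T_power \<Omega> T j f))\<^sup>2)"
    by (rule member_le_sum) (use assms in auto)
  then show ?thesis unfolding H_T_norm_def by (rule real_le_rsqrt)
qed

text \<open>The chosen representatives of \<open>T\<^sup>j 0\<close> vanish almost everywhere. Consequently a seminorm ball contains its centre.\<close>

lemma H_T_norm_zero:
  assumes T: "smooth_vector_field \<Omega> T" "bounded \<Omega>" "open \<Omega>"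
  shows "H_T_norm \<Omega> T k (\<lambda>x. 0) = 0"
proof -
  have z: "(\<lambda>x. 0) \<in> H_T_infty \<Omega> T"
    unfolding H_T_infty_def H_T_def using L2_zero by (auto simp: dist_power_def intro!: bexI[of _ "\<lambda>x. 0"])
  have "L2_norm \<Omega> (T_power \<Omega> T j (\<lambda>x. 0)) = 0" for j
  proof -
    have "AE x in lebesgue_on \<Omega>. T_power \<Omega> T j (\<lambda>x. 0) x = 0"
      by (rule test_functions_separate_L2[OF T(3,2) T_power_H_T_infty(1)[OF z]])
        (use T_power_H_T_infty(2)[OF z, of j] in \<open>simp add: dist_power_def\<close>)
    then have "AE x in lebesgue_on \<Omega>. (norm (T_power \<Omega> T j (\<lambda>x. 0) x))\<^sup>2 = 0" by eventually_elim simp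
    then have "(LINT x|lebesgue_on \<Omega>. (norm (T_power \<Omega> T j (\<lambda>x. 0) x))\<^sup>2) = 0" by (rule integral_eq_zero_AE)
    then show ?thesis by (simp add: L2_norm_def)
  qed
  then show ?thesis by (simp add: H_T_norm_def)
qed

section \<open>The main estimate and continuity\<close>

text \<open>The derivative at \<open>w\<close> is the pairing of \<open>f\<close> with a projected kernel, whose growth does not depend on \<open>w\<close>; the pairing
  estimate for this order of growth \<open>m\<close> bounds it by \<open>T\<close> derivatives of \<open>f\<close> of order at most \<open>m + 1\<close>.\<close>

lemma bergman_projection_derivative_estimate:
  fixes \<Omega> :: "(complex^'n) set"
  assumes \<Omega>: "open \<Omega>" "bounded \<Omega>" and T: "smooth_vector_field \<Omega> T" "tangential \<Omega> T" "complex_transversal \<Omega> T"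
    and \<rho>: "defining_function \<Omega> \<rho>" and R: "condition_R \<Omega>" and bs: "bs \<in> lists Basis"
  shows "\<exists>C k. C \<ge> 0 \<and> k \<ge> 1 \<and> (\<forall>f\<in>H_T_infty \<Omega> T. \<forall>w\<in>\<Omega>. norm (iter_partial bs (bergman_projection \<Omega> f) w) \<le> C * H_T_norm \<Omega> T k f)"
proof -
  obtain A m where A: "A > 0" "\<And>w s z r. s > 0 \<Longrightarrow> ball w (2 * s) \<subseteq> \<Omega> \<Longrightarrow> ball z r \<subseteq> \<Omega> \<Longrightarrow> 0 < r \<Longrightarrow> r \<le> 1 \<Longrightarrow>
     norm (bergman_projection \<Omega> (eval_kernel bs w s) z) \<le> A / r ^ m"
    using projected_kernel_growth[OF \<Omega> R bs] by blast
  obtain C where C: "C \<ge> 0" "\<And>H A f. admissible_pairing \<Omega> T m H A f \<Longrightarrow>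
     norm (LINT x|lebesgue_on \<Omega>. f 0 x * (1 * cnj (H x))) \<le> C * A * (\<Sum>j\<le>Suc m. L2_norm \<Omega> (f j))"
    using pairing_bounded_one[OF \<Omega> T \<rho>, of m] unfolding pairing_bounded_def by blast
  define C' where "C' = C * A * (real m + 2)"
  have "norm (iter_partial bs (bergman_projection \<Omega> f) w) \<le> C' * H_T_norm \<Omega> T (Suc m) f"
    if f: "f \<in> H_T_infty \<Omega> T" and w: "w \<in> \<Omega>" for f w
  proof -
    obtain e where e: "e > 0" "ball w e \<subseteq> \<Omega>" using \<Omega>(1) w open_contains_ball by blast
    define s where "s = e / 2"
    have s: "s > 0" "ball w (2 * s) \<subseteq> \<Omega>" using e by (auto simp: s_def)
    have "ball w s \<subseteq> \<Omega>" using s subset_ball[of s "2 * s" w] by simp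
    then have k: "eval_kernel bs w s \<in> test_functions \<Omega>" by (rule eval_kernel_test_function[OF s(1) _ bs])
    define H where "H = bergman_projection \<Omega> (eval_kernel bs w s)"
    have HB: "H \<in> bergman_space \<Omega>" unfolding H_def by (rule bergman_projection(1)[OF \<Omega> test_function_L2[OF k \<Omega>]])
    have fL: "f \<in> L2 \<Omega>" using f by (auto simp: H_T_infty_def H_T_def)
    let ?g = "\<lambda>j. T_power \<Omega> T j f"
    have adm: "admissible_pairing \<Omega> T m H A ?g"
      unfolding admissible_pairing_def
    proof (intro conjI)
      show "H \<in> smooth_closure \<Omega>" using R test_function_smooth_closure[OF k \<Omega>(1)] by (auto simp: condition_R_def H_def)
      show "holomorphic_several \<Omega> H" using HB by (simp add: bergman_space_def)
      show "\<forall>z s. ball z s \<subseteq> \<Omega> \<longrightarrow> 0 < s \<longrightarrow> s \<le> 1 \<longrightarrow> norm (H z) \<le> A / s ^ m" unfolding H_def using A(2)[OF s] by blast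
    qed (use A(1) T_power_H_T_infty(1)[OF f] T_power_weak_derivative[OF T(1) \<Omega>(2,1) f] in auto)
    have "iter_partial bs (bergman_projection \<Omega> f) w = (LINT x|lebesgue_on \<Omega>. f x * cnj (H x))"
      using bergman_projection_evaluation[OF \<Omega> fL s bs] by (simp add: L2_inner_def H_def)
    also have "\<dots> = (LINT x|lebesgue_on \<Omega>. ?g 0 x * (1 * cnj (H x)))"
    proof (rule integral_cong_AE)
      show "(\<lambda>x. f x * cnj (H x)) \<in> borel_measurable (lebesgue_on \<Omega>)"
        using L2_integrable_inner[OF fL bergman_space_L2[OF HB]] by auto
      show "(\<lambda>x. ?g 0 x * (1 * cnj (H x))) \<in> borel_measurable (lebesgue_on \<Omega>)"
        using L2_integrable_inner[OF T_power_H_T_infty(1)[OF f] bergman_space_L2[OF HB]] by auto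
      show "AE x in lebesgue_on \<Omega>. f x * cnj (H x) = ?g 0 x * (1 * cnj (H x))"
        using T_power_0_AE[OF \<Omega> f] by eventually_elim simp
    qed
    finally have "norm (iter_partial bs (bergman_projection \<Omega> f) w) \<le> C * A * (\<Sum>j\<le>Suc m. L2_norm \<Omega> (?g j))"
      using C(2)[OF adm] by simp
    also have "(\<Sum>j\<le>Suc m. L2_norm \<Omega> (?g j)) \<le> (\<Sum>j\<le>Suc m. H_T_norm \<Omega> T (Suc m) f)"
      by (rule sum_mono) (rule L2_norm_T_power_le_H_T_norm, simp)
    also have "\<dots> = (real m + 2) * H_T_norm \<Omega> T (Suc m) f" by simp
    finally show ?thesis using C(1) A(1) by (simp add: C'_def mult.assoc mult_left_mono)
  qed
  moreover have "C' \<ge> 0" using C(1) A(1) by (simp add: C'_def)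
  ultimately show ?thesis by (intro exI[of _ C'] exI[of _ "Suc m"]) auto
qed

lemma bergman_projection_smooth_closure:
  fixes \<Omega> :: "(complex^'n) set"
  assumes \<Omega>: "open \<Omega>" "bounded \<Omega>" and T: "smooth_vector_field \<Omega> T" "tangential \<Omega> T" "complex_transversal \<Omega> T"
    and \<rho>: "defining_function \<Omega> \<rho>" and R: "condition_R \<Omega>" and f: "f \<in> H_T_infty \<Omega> T"
  shows "bergman_projection \<Omega> f \<in> smooth_closure \<Omega>"
proof (rule smooth_closure_of_bounded_derivatives[OF \<Omega> \<rho>])
  have fL: "f \<in> L2 \<Omega>" using f by (auto simp: H_T_infty_def H_T_def)
  show "smooth_on \<Omega> (bergman_projection \<Omega> f)"
    by (rule bergman_smooth_and_evaluation(1)[OF bergman_projection(1)[OF \<Omega> fL] \<Omega>])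
  show "bounded (iter_partial bs (bergman_projection \<Omega> f) ` \<Omega>)" if "bs \<in> lists Basis" for bs
    using bergman_projection_derivative_estimate[OF \<Omega> T \<rho> R that] f unfolding bounded_iff by blast
qed

lemma smooth_closure_diff_bounded:
  assumes \<Omega>: "open \<Omega>" "bounded \<Omega>" and f: "f \<in> smooth_closure \<Omega>" and g: "g \<in> smooth_closure \<Omega>" and bs: "bs \<in> lists Basis"
  shows "bdd_above ((\<lambda>x. norm (iter_partial bs (\<lambda>x. f x - g x) x)) ` \<Omega>)"
proof -
  have "ksmooth True \<Omega> (length bs) (\<lambda>x. f x - g x)"
    by (rule ksmooth_diff[OF \<Omega>(1) smooth_closure_ksmooth_True[OF f \<Omega>(2)] smooth_closure_ksmooth_True[OF g \<Omega>(2)]])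
  then have "bounded (iter_partial bs (\<lambda>x. f x - g x) ` \<Omega>)" using bs unfolding ksmooth_iter_partial by blast
  then show ?thesis unfolding bounded_iff by (auto intro: bdd_aboveI2)
qed

lemma openin_seminorm_topology:
  assumes "U \<subseteq> V" and "\<And>f. f \<in> U \<Longrightarrow> \<exists>p\<in>P. p (\<lambda>x. 0) = 0 \<and> (\<exists>\<delta>>0. \<forall>g\<in>V. p (\<lambda>x. g x - f x) < \<delta> \<longrightarrow> g \<in> U)"
  shows "openin (seminorm_topology V P) U"
proof (subst openin_subopen, intro ballI)
  fix f assume f: "f \<in> U"
  then obtain p \<delta> where p: "p \<in> P" "p (\<lambda>x. 0) = 0" "\<delta> > 0" "\<And>g. g \<in> V \<Longrightarrow> p (\<lambda>x. g x - f x) < \<delta> \<Longrightarrow> g \<in> U"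
    using assms(2) by metis
  let ?B = "{g \<in> V. p (\<lambda>x. g x - f x) < \<delta>}"
  have fV: "f \<in> V" using f assms(1) by blast
  have "openin (seminorm_topology V P) ?B"
    unfolding seminorm_topology_def by (rule topology_generated_by_Basis) (use p(1,3) fV in blast)
  moreover have "f \<in> ?B" using fV p(2,3) by simp
  moreover have "?B \<subseteq> U" using p(4) by blast
  ultimately show "\<exists>B. openin (seminorm_topology V P) B \<and> f \<in> B \<and> B \<subseteq> U" by blast
qed

text \<open>It suffices to treat subbasic sets. The seminorm that vanishes at 0 ensures that the subbasic sets cover \<open>V\<close>.\<close>

lemma continuous_map_seminorm_topology:
  assumes maps: "\<And>x. x \<in> topspace X \<Longrightarrow> h x \<in> V" and p0: "p0 \<in> P" "p0 (\<lambda>x. 0) = 0"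
    and op: "\<And>p F e. p \<in> P \<Longrightarrow> F \<in> V \<Longrightarrow> e > 0 \<Longrightarrow> openin X {x \<in> topspace X. p (\<lambda>y. h x y - F y) < e}"
  shows "continuous_map X (seminorm_topology V P) h"
  unfolding seminorm_topology_def continuous_on_generated_topo_iff
proof (intro conjI allI impI)
  fix U assume "U \<in> {{g \<in> V. p (\<lambda>x. g x - F x) < e} | p F e. p \<in> P \<and> F \<in> V \<and> e > 0}"
  then obtain p F e where U: "U = {g \<in> V. p (\<lambda>x. g x - F x) < e}" "p \<in> P" "F \<in> V" "e > 0" by blast
  have "h -` U \<inter> topspace X = {x \<in> topspace X. p (\<lambda>y. h x y - F y) < e}" using maps U(1) by auto
  then show "openin X (h -` U \<inter> topspace X)" using op[OF U(2-4)] by simp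
next
  show "h ` topspace X \<subseteq> \<Union> {{g \<in> V. p (\<lambda>x. g x - F x) < e} | p F e. p \<in> P \<and> F \<in> V \<and> e > 0}"
  proof
    fix F assume "F \<in> h ` topspace X"
    then have F: "F \<in> V" using maps by blast
    have "F \<in> {g \<in> V. p0 (\<lambda>x. g x - F x) < 1}" using F p0(2) by simp
    then show "F \<in> \<Union> {{g \<in> V. p (\<lambda>x. g x - F x) < e} | p F e. p \<in> P \<and> F \<in> V \<and> e > 0}"
      by (rule UnionI[rotated]) (use p0(1) F zero_less_one in blast)
  qed
qed

theorem corollary1p4:
  fixes \<Omega> :: "(complex^'n) set" and T :: "complex^'n \<Rightarrow> (complex^'n) \<times> (complex^'n)"
  assumes "smoothly_bounded_domain \<Omega>"
    and "smooth_vector_field \<Omega> T"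
    and "tangential \<Omega> T"
    and "complex_transversal \<Omega> T"
    and "condition_R \<Omega>"
  shows "bergman_projection \<Omega> ` H_T_infty \<Omega> T \<subseteq> smooth_closure \<Omega> \<and>
    continuous_map (H_T_infty_topology \<Omega> T) (smooth_closure_topology \<Omega>) (bergman_projection \<Omega>)"
proof -
  let ?B = "bergman_projection \<Omega>"
  obtain \<rho> where \<Omega>: "open \<Omega>" "bounded \<Omega>" and ne: "\<Omega> \<noteq> {}" and \<rho>: "defining_function \<Omega> \<rho>"
    using assms(1) by (auto simp: smoothly_bounded_domain_def)
  have smooth: "?B f \<in> smooth_closure \<Omega>" if "f \<in> H_T_infty \<Omega> T" for f
    by (rule bergman_projection_smooth_closure[OF \<Omega> assms(2-4) \<rho> assms(5) that])
  have source: "topspace (H_T_infty_topology \<Omega> T) \<subseteq> H_T_infty \<Omega> T"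
    by (auto simp: H_T_infty_topology_def seminorm_topology_def topology_generated_by_topspace)
  define sup_norm where "sup_norm bs f = (SUP x\<in>\<Omega>. norm (iter_partial bs f x))" for bs and f :: "complex^'n \<Rightarrow> complex"
  have "continuous_map (H_T_infty_topology \<Omega> T) (smooth_closure_topology \<Omega>) ?B"
    unfolding smooth_closure_topology_def
  proof (rule continuous_map_seminorm_topology)
    show "?B f \<in> smooth_closure \<Omega>" if "f \<in> topspace (H_T_infty_topology \<Omega> T)" for f using that source smooth by blast
    show "(\<lambda>f. SUP x\<in>\<Omega>. norm (iter_partial [] f x)) \<in> {(\<lambda>f. SUP x\<in>\<Omega>. norm (iter_partial bs f x)) | bs. bs \<in> lists Basis}"
      by blast
    show "(SUP x\<in>\<Omega>. norm (iter_partial [] (\<lambda>x. 0) x)) = 0" using ne by simp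
    fix p :: "(complex^'n \<Rightarrow> complex) \<Rightarrow> real" and F and e :: real
    assume "p \<in> {(\<lambda>f. SUP x\<in>\<Omega>. norm (iter_partial bs f x)) | bs. bs \<in> lists Basis}" and F: "F \<in> smooth_closure \<Omega>"
    then obtain bs where bs: "bs \<in> lists Basis" and "p = (\<lambda>f. SUP x\<in>\<Omega>. norm (iter_partial bs f x))" by blast
    then have p: "p = sup_norm bs" by (simp add: sup_norm_def fun_eq_iff)
    obtain C k where C: "C \<ge> 0" "k \<ge> 1"
      "\<And>f w. f \<in> H_T_infty \<Omega> T \<Longrightarrow> w \<in> \<Omega> \<Longrightarrow> norm (iter_partial bs (?B f) w) \<le> C * H_T_norm \<Omega> T k f"
      using bergman_projection_derivative_estimate[OF \<Omega> assms(2-4) \<rho> assms(5) bs] by blast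
    have near: "sup_norm bs (\<lambda>x. ?B g x - F x) \<le> C * H_T_norm \<Omega> T k (\<lambda>x. g x - f x) + sup_norm bs (\<lambda>x. ?B f x - F x)"
      if f: "f \<in> H_T_infty \<Omega> T" and g: "g \<in> H_T_infty \<Omega> T" for f g
      unfolding sup_norm_def[of bs "\<lambda>x. ?B g x - F x"]
    proof (rule cSUP_least[OF ne])
      fix x assume x: "x \<in> \<Omega>"
      have L: "f \<in> L2 \<Omega>" "g \<in> L2 \<Omega>" using f g by (auto simp: H_T_infty_def H_T_def)
      have d: "(\<lambda>x. g x - f x) \<in> H_T_infty \<Omega> T" by (rule H_T_infty_diff[OF assms(2) \<Omega>(2,1) g f])
      have s1: "smooth_on \<Omega> (?B (\<lambda>x. g x - f x))" using smooth[OF d] by (simp add: smooth_closure_def)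
      have "smooth_on \<Omega> (?B f)" "smooth_on \<Omega> F" using smooth[OF f] F by (auto simp: smooth_closure_def)
      then have s2: "smooth_on \<Omega> (\<lambda>x. ?B f x - F x)" using ksmooth_diff[OF \<Omega>(1)] unfolding smooth_on_iff by blast
      have "(\<lambda>x. ?B g x - F x) = (\<lambda>x. ?B (\<lambda>x. g x - f x) x + (?B f x - F x))"
        by (simp add: bergman_projection_diff[OF \<Omega> L(2,1)])
      then have "iter_partial bs (\<lambda>x. ?B g x - F x) x =
          iter_partial bs (?B (\<lambda>x. g x - f x)) x + iter_partial bs (\<lambda>x. ?B f x - F x) x"
        using iter_partial_add[OF s1 s2 bs x] by simp
      moreover have "norm (iter_partial bs (\<lambda>x. ?B f x - F x) x) \<le> sup_norm bs (\<lambda>x. ?B f x - F x)"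
        unfolding sup_norm_def by (rule cSUP_upper[OF x smooth_closure_diff_bounded[OF \<Omega> smooth[OF f] F bs]])
      ultimately show "norm (iter_partial bs (\<lambda>x. ?B g x - F x) x) \<le>
          C * H_T_norm \<Omega> T k (\<lambda>x. g x - f x) + sup_norm bs (\<lambda>x. ?B f x - F x)"
        using C(3)[OF d x] norm_triangle_ineq[of "iter_partial bs (?B (\<lambda>x. g x - f x)) x" "iter_partial bs (\<lambda>x. ?B f x - F x) x"]
        by simp
    qed
    let ?U = "{f \<in> H_T_infty \<Omega> T. sup_norm bs (\<lambda>x. ?B f x - F x) < e}"
    have "openin (H_T_infty_topology \<Omega> T) ?U"
      unfolding H_T_infty_topology_def
    proof (rule openin_seminorm_topology)
      fix f assume "f \<in> ?U"
      then have f: "f \<in> H_T_infty \<Omega> T" "sup_norm bs (\<lambda>x. ?B f x - F x) < e" by auto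
      \<comment> \<open>\<open>C + 1\<close> in place of \<open>C\<close>, which may be 0\<close>
      define \<delta> where "\<delta> = (e - sup_norm bs (\<lambda>x. ?B f x - F x)) / (C + 1)"
      have "g \<in> ?U" if g: "g \<in> H_T_infty \<Omega> T" "H_T_norm \<Omega> T k (\<lambda>x. g x - f x) < \<delta>" for g
      proof -
        have "0 \<le> H_T_norm \<Omega> T k (\<lambda>x. g x - f x)" by (simp add: H_T_norm_def sum_nonneg)
        then have "C * H_T_norm \<Omega> T k (\<lambda>x. g x - f x) \<le> (C + 1) * H_T_norm \<Omega> T k (\<lambda>x. g x - f x)"
          by (intro mult_right_mono) auto
        also have "\<dots> < (C + 1) * \<delta>" using g(2) C(1) by simp
        also have "\<dots> = e - sup_norm bs (\<lambda>x. ?B f x - F x)" using C(1) by (simp add: \<delta>_def)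
        finally have "sup_norm bs (\<lambda>x. ?B g x - F x) < e" using near[OF f(1) g(1)] by linarith
        then show ?thesis using g(1) by simp
      qed
      moreover have "\<delta> > 0" using f(2) C(1) by (simp add: \<delta>_def)
      ultimately show "\<exists>p\<in>{H_T_norm \<Omega> T k | k. k \<ge> 1}. p (\<lambda>x. 0) = 0 \<and>
          (\<exists>\<delta>>0. \<forall>g\<in>H_T_infty \<Omega> T. p (\<lambda>x. g x - f x) < \<delta> \<longrightarrow> g \<in> ?U)"
        using C(2) H_T_norm_zero[OF assms(2) \<Omega>(2,1)] by (intro bexI[of _ "H_T_norm \<Omega> T k"]) blast+
    qed blast
    then have "openin (H_T_infty_topology \<Omega> T) (?U \<inter> topspace (H_T_infty_topology \<Omega> T))"
      by (rule openin_Int) (rule openin_topspace)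
    moreover have "?U \<inter> topspace (H_T_infty_topology \<Omega> T) = {f \<in> topspace (H_T_infty_topology \<Omega> T). p (\<lambda>x. ?B f x - F x) < e}"
      using source p by blast
    ultimately show "openin (H_T_infty_topology \<Omega> T) {f \<in> topspace (H_T_infty_topology \<Omega> T). p (\<lambda>x. ?B f x - F x) < e}" by simp
  qed
  then show ?thesis using smooth by blast
qed

end
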